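(* Let $p$ be a prime number and let $f(x,y,z)\in\mathbf{Z}_p[x,y,z]$ be a nonzero polynomial in three variables with $f(0,0,0)=0$. Suppose that $f$ is non-degenerated over $\mathbf{F}_p$ with respect to all the compact faces of its Newton polyhedron $\Gamma_f$. Let $s_0$ be a candidate pole of $Z^0_f$ with $\Re(s_0)\neq-1$, and suppose that $s_0$ is only contributed by $B_1$-facets of $\Gamma_f$ (i.e. every facet of $\Gamma_f$ contributing to $s_0$ is a $B_1$-facet). Assume also that for any pair of contributing $B_1$-facets, either they are $B_1$-facets for a same variable, or they have at most one point in common. Then $s_0$ is not a pole of $Z^0_f$.
   Context: Newton polyhedron: for a nonzero polynomial $f=\sum_{\omega\in\mathbf{Z}_{\geqslant0}^n}a_\omega x^\omega$ over a ring with $f(0)=0$, put $\mathrm{supp}(f)=\{\omega\mid a_\omega\neq0\}$; the Newton polyhedron $\Gamma_f$ is the convex hull of $\bigcup_{\omega\in\mathrm{supp}(f)}(\omega+\mathbf{R}_{\geqslant0}^n)$. Faces of $\Gamma_f$ are $\Gamma_f$ itself and its intersections with supporting hyperplanes; facets are faces of codimension one. For a face $\tau$, $f_\tau(x)=\sum_{\omega\in\tau}a_\omega x^\omega$. Here $n=3$. Non-degeneracy over $\mathbf{F}_p$ with respect to all the compact faces of $\Gamma_f$: for every compact face $\tau$, the reduction $\overline{f_\tau}$ of $f_\tau$ modulo $p$ and all its partial derivatives have no common zero in $(\mathbf{F}_p^\times)^n$. Local Igusa zeta function: $Z^0_f(s)=\int_{(p\mathbf{Z}_p)^n}|f(x)|^s|dx|$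 for $\Re(s)>0$, with $|\cdot|$ the $p$-adic norm and $|dx|$ the Haar measure on $\mathbf{Q}_p^n$ giving $\mathbf{Z}_p^n$ measure one; $Z^0_f$ also denotes its meromorphic continuation to $\mathbf{C}$. For $k\in\mathbf{R}_{\geqslant0}^n$ put $m(k)=\inf_{x\in\Gamma_f}k\cdot x$ and $\sigma(k)=k_1+\cdots+k_n$. Let $\tau_1,\ldots,\tau_r$ be all facets of $\Gamma_f$ and $v_j\in\mathbf{Z}_{\geqslant0}^n\setminus\{0\}$ the unique primitive vector (integer components with greatest common divisor one) perpendicular to $\tau_j$. The candidate poles of $Z^0_f$ are the numbers $-1+\frac{2k\pi i}{\log p}$ $(k\in\mathbf{Z})$ and $-\frac{\sigma(v_j)}{m(v_j)}+\frac{2k\pi i}{m(v_j)\log p}$ ($j$ with $m(v_j)\neq0$, $k\in\mathbf{Z}$). The facet $\tau_j$ contributes to the candidate pole $s_0$ if $p^{\sigma(v_j)+m(v_j)s_0}=1$. $B_1$-facets (coordinates $x_1,x_2,x_3$): a facet $\tau$ of $\Gamma_f$ is a $B_1$-simplex for the variable $x_i$ if $\tau$ is a simplex with two vertices in the coordinate plane $\{x_i=0\}$ and one vertex in the plane $\{x_i=1\}$. A facet $\tau$ is non-compact for a variable $x_j$ if adding $1$ to the $x_j$-coordinate of any point of $\tau$ gives again a point of $\tau$. A facet $\tau$ is a non-compact $B_1$-facet for the variable $x_i$ if $\tau$ is non-compact for precisely one variable $x_j$, $x_j\neq x_i$, and the image $\pi_j(\tau)$ of $\tau$ under the projection $\pi_j:\mathbf{R}^3\to\mathbf{R}^2$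 forgetting the coordinate $x_j$ is a segment with one vertex in $\{x_i=0\}$ and one vertex in $\{x_i=1\}$. A facet is a $B_1$-facet for $x_i$ if it is a $B_1$-simplex for $x_i$ or a non-compact $B_1$-facet for $x_i$; it is a $B_1$-facet if it is one for some variable. *)

theory Defs
  imports "HOL-Complex_Analysis.Complex_Analysis" "HOL-Library.Poly_Mapping" "Berlekamp_Zassenhaus.Finite_Field"
begin

text \<open>
  The prime \<open>p\<close> is carried by a type \<open>'p\<close> of class \<open>prime_card\<close>, as \<open>p = CARD('p)\<close>; the field
  with \<open>p\<close> elements is \<open>'p mod_ring\<close>.  The field \<open>'p padic\<close> of \<open>p\<close>-adic numbers is built as the
  completion of the rationals for the \<open>p\<close>-adic norm: Cauchy sequences modulo null sequences.
\<close>

definition rat_padic_norm :: "nat \<Rightarrow> rat \<Rightarrow> real" where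
  "rat_padic_norm p r =
     (if r = 0 then 0
      else real p powi (int (multiplicity (int p) (snd (quotient_of r)))
                        - int (multiplicity (int p) (fst (quotient_of r)))))"

lemma rat_padic_norm_fraction:
  assumes p: "prime p" and "a \<noteq> 0" "b \<noteq> 0"
  shows "rat_padic_norm p (of_int a / of_int b) =
           real p powi (int (multiplicity (int p) b) - int (multiplicity (int p) a))"
proof -
  define r where "r = (of_int a / of_int b :: rat)"
  have r0: "r \<noteq> 0" using assms by (simp add: r_def)
  obtain c d where cd: "quotient_of r = (c, d)" by (cases "quotient_of r")
  have d: "d > 0" using quotient_of_denom_pos[OF cd] .
  have rcd: "r = of_int c / of_int d" using quotient_of_div[OF cd] .
  have c: "c \<noteq> 0" using rcd r0 by auto
  have "(of_int (a * d) :: rat) = of_int (c * b)"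
    using rcd d assms unfolding r_def by (simp add: field_simps)
  then have e: "a * d = c * b" by (simp only: of_int_eq_iff)
  have pe: "prime_elem (int p)" using p by simp
  have "multiplicity (int p) a + multiplicity (int p) d =
        multiplicity (int p) c + multiplicity (int p) b"
    using e prime_elem_multiplicity_mult_distrib[OF pe, of a d]
      prime_elem_multiplicity_mult_distrib[OF pe, of c b] assms c d by simp
  then have m: "int (multiplicity (int p) d) - int (multiplicity (int p) c)
    = int (multiplicity (int p) b) - int (multiplicity (int p) a)" by linarith
  have "rat_padic_norm p r = real p powi (int (multiplicity (int p) d) - int (multiplicity (int p) c))"
    using r0 cd by (simp add: rat_padic_norm_def)
  then show ?thesis unfolding m r_def .
qed

lemma rat_fraction: obtains a b where "(r::rat) = of_int a / of_int b" "b \<noteq> 0"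
  by (metis quotient_of_div quotient_of_denom_pos less_irrefl surj_pair)

lemma rat_padic_norm_0 [simp]: "rat_padic_norm p 0 = 0"
  by (simp add: rat_padic_norm_def)

lemma rat_padic_norm_pos: "prime p \<Longrightarrow> r \<noteq> 0 \<Longrightarrow> rat_padic_norm p r > 0"
  by (simp add: rat_padic_norm_def prime_gt_0_nat)

lemma rat_padic_norm_nonneg [simp]: "rat_padic_norm p r \<ge> 0"
  by (simp add: rat_padic_norm_def)

lemma rat_padic_norm_1 [simp]: "rat_padic_norm p 1 = 1"
  by (simp add: rat_padic_norm_def)

lemma rat_padic_norm_mult:
  assumes p: "prime p"
  shows "rat_padic_norm p (r * s) = rat_padic_norm p r * rat_padic_norm p s"
proof (cases "r = 0 \<or> s = 0")
  case False
  obtain a b where r: "r = of_int a / of_int b" "b \<noteq> 0" by (rule rat_fraction)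
  obtain c d where s: "s = of_int c / of_int d" "d \<noteq> 0" by (rule rat_fraction)
  have ac: "a \<noteq> 0" "c \<noteq> 0" using False r s by auto
  have rs: "r * s = of_int (a * c) / of_int (b * d)" using r s by simp
  have pe: "prime_elem (int p)" using p by simp
  have p0: "real p \<noteq> 0" using p prime_gt_0_nat[of p] by simp
  have "rat_padic_norm p (r * s) = real p powi (int (multiplicity (int p) (b * d)) - int (multiplicity (int p) (a * c)))"
    unfolding rs by (rule rat_padic_norm_fraction[OF p]) (use ac r s in auto)
  also have "\<dots> = real p powi ((int (multiplicity (int p) b) - int (multiplicity (int p) a)) + (int (multiplicity (int p) d) - int (multiplicity (int p) c)))"
    using ac r s by (simp add: prime_elem_multiplicity_mult_distrib[OF pe] algebra_simps)
  also have "\<dots> = rat_padic_norm p r * rat_padic_norm p s"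
    unfolding r(1) s(1) rat_padic_norm_fraction[OF p ac(1) r(2)] rat_padic_norm_fraction[OF p ac(2) s(2)]
    by (rule power_int_add) (use p0 in auto)
  finally show ?thesis .
qed auto

lemma rat_padic_norm_minus [simp]:
  assumes p: "prime p"
  shows "rat_padic_norm p (- r) = rat_padic_norm p r"
proof -
  have "rat_padic_norm p (of_int (-1) / of_int 1) = 1"
    by (subst rat_padic_norm_fraction[OF p]) (auto simp: multiplicity_unit_right)
  then show ?thesis using rat_padic_norm_mult[OF p, of "-1" r] by simp
qed

lemma rat_padic_norm_diff_commute:
  "prime p \<Longrightarrow> rat_padic_norm p (r - s) = rat_padic_norm p (s - r)"
  by (metis minus_diff_eq rat_padic_norm_minus)

lemma rat_padic_norm_inverse:
  assumes p: "prime p"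
  shows "rat_padic_norm p (inverse r) = inverse (rat_padic_norm p r)"
proof (cases "r = 0")
  case False
  then have "rat_padic_norm p (inverse r) * rat_padic_norm p r = 1"
    using rat_padic_norm_mult[OF p, of "inverse r" r] by simp
  then show ?thesis by (metis inverse_unique mult.commute)
qed auto

lemma rat_padic_norm_add:
  assumes p: "prime p"
  shows "rat_padic_norm p (r + s) \<le> max (rat_padic_norm p r) (rat_padic_norm p s)"
proof (cases "r = 0 \<or> s = 0 \<or> r + s = 0")
  case True
  then show ?thesis by (auto simp: le_max_iff_disj)
next
  case False
  obtain a b where r: "r = of_int a / of_int b" "b \<noteq> 0" by (rule rat_fraction)
  obtain c d where s: "s = of_int c / of_int d" "d \<noteq> 0" by (rule rat_fraction)
  define x y z where "x = a * d" and "y = c * b" and "z = b * d"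
  have z: "z \<noteq> 0" using r s by (simp add: z_def)
  have rx: "r = of_int x / of_int z" and sy: "s = of_int y / of_int z"
    and rs: "r + s = of_int (x + y) / of_int z"
    using r s by (auto simp: x_def y_def z_def field_simps)
  have nz: "x \<noteq> 0" "y \<noteq> 0" "x + y \<noteq> 0" using False rx sy rs by auto
  have p1: "real p \<ge> 1" using p prime_ge_1_nat by auto
  let ?v = "multiplicity (int p)"
  have "int p ^ min (?v x) (?v y) dvd x + y"
    by (intro dvd_add) (auto intro: multiplicity_dvd')
  then have v: "min (?v x) (?v y) \<le> ?v (x + y)"
    using nz p by (intro multiplicity_geI) auto
  have "rat_padic_norm p (r + s) = real p powi (int (?v z) - int (?v (x + y)))"
    unfolding rs by (rule rat_padic_norm_fraction[OF p nz(3) z])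
  also have "\<dots> \<le> real p powi (int (?v z) - int (min (?v x) (?v y)))"
    using v p1 by (intro power_int_increasing) auto
  also have "\<dots> \<le> max (real p powi (int (?v z) - int (?v x))) (real p powi (int (?v z) - int (?v y)))"
    by (auto simp: min_def)
  also have "\<dots> = max (rat_padic_norm p r) (rat_padic_norm p s)"
    unfolding rx sy rat_padic_norm_fraction[OF p nz(1) z] rat_padic_norm_fraction[OF p nz(2) z] ..
  finally show ?thesis .
qed

lemma rat_padic_norm_triangle:
  assumes p: "prime p"
  shows "\<bar>rat_padic_norm p r - rat_padic_norm p s\<bar> \<le> rat_padic_norm p (r - s)"
proof -
  have "rat_padic_norm p r \<le> rat_padic_norm p (r - s) + rat_padic_norm p s" for r s
  proof -
    have "rat_padic_norm p r \<le> max (rat_padic_norm p (r - s)) (rat_padic_norm p s)"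
      using rat_padic_norm_add[OF p, of "r - s" s] by simp
    then show ?thesis
      using rat_padic_norm_nonneg[of p "r - s"] rat_padic_norm_nonneg[of p s] by linarith
  qed
  from this[of r s] this[of s r] show ?thesis
    using rat_padic_norm_diff_commute[OF p, of r s] by linarith
qed

lemma rat_padic_norm_eq:
  assumes p: "prime p" and l: "rat_padic_norm p (r - s) < rat_padic_norm p s"
  shows "rat_padic_norm p r = rat_padic_norm p s"
proof -
  have 1: "rat_padic_norm p r \<le> max (rat_padic_norm p (r - s)) (rat_padic_norm p s)"
    using rat_padic_norm_add[OF p, of "r - s" s] by simp
  have 2: "rat_padic_norm p s \<le> max (rat_padic_norm p (r - s)) (rat_padic_norm p r)"
    using rat_padic_norm_add[OF p, of "s - r" r] rat_padic_norm_diff_commute[OF p, of r s] by simp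
  from 1 2 l show ?thesis by linarith
qed

definition rat_padic_cauchy :: "nat \<Rightarrow> (nat \<Rightarrow> rat) \<Rightarrow> bool" where
  "rat_padic_cauchy p X \<longleftrightarrow>
     (\<forall>e>0. \<exists>N. \<forall>m\<ge>N. \<forall>n\<ge>N. rat_padic_norm p (X m - X n) < e)"

definition rat_padic_null :: "nat \<Rightarrow> (nat \<Rightarrow> rat) \<Rightarrow> bool" where
  "rat_padic_null p X \<longleftrightarrow> (\<lambda>n. rat_padic_norm p (X n)) \<longlonglongrightarrow> 0"

lemma rat_padic_null_add:
  assumes "prime p" "rat_padic_null p X" "rat_padic_null p Y"
  shows "rat_padic_null p (\<lambda>n. X n + Y n)"
  unfolding rat_padic_null_def
proof (rule tendsto_sandwich[OF _ _ tendsto_const])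
  show "(\<lambda>n. max (rat_padic_norm p (X n)) (rat_padic_norm p (Y n))) \<longlonglongrightarrow> 0"
    using tendsto_max[OF assms(2,3)[unfolded rat_padic_null_def]] by simp
qed (use rat_padic_norm_add assms in auto)

lemma rat_padic_null_minus:
  "prime p \<Longrightarrow> rat_padic_null p X \<Longrightarrow> rat_padic_null p (\<lambda>n. - X n)"
  by (simp add: rat_padic_null_def)

lemma rat_padic_null_mult_bounded:
  assumes p: "prime p" and X: "rat_padic_null p X" and Y: "\<And>n. rat_padic_norm p (Y n) \<le> B"
  shows "rat_padic_null p (\<lambda>n. X n * Y n)"
  unfolding rat_padic_null_def
proof (rule tendsto_sandwich[OF _ _ tendsto_const])
  show "(\<lambda>n. rat_padic_norm p (X n) * B) \<longlonglongrightarrow> 0"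
    using X unfolding rat_padic_null_def by (rule tendsto_mult_left_zero)
qed (auto simp: rat_padic_norm_mult[OF p] Y intro!: always_eventually mult_left_mono)

lemma rat_padic_cauchy_const [simp]: "rat_padic_cauchy p (\<lambda>_. c)"
  by (simp add: rat_padic_cauchy_def)

lemma rat_padic_cauchy_add:
  assumes p: "prime p" and "rat_padic_cauchy p X" "rat_padic_cauchy p Y"
  shows "rat_padic_cauchy p (\<lambda>n. X n + Y n)"
  unfolding rat_padic_cauchy_def
proof (intro allI impI)
  fix e :: real assume "e > 0"
  then obtain M N where M: "\<And>m n. m \<ge> M \<Longrightarrow> n \<ge> M \<Longrightarrow> rat_padic_norm p (X m - X n) < e"
    and N: "\<And>m n. m \<ge> N \<Longrightarrow> n \<ge> N \<Longrightarrow> rat_padic_norm p (Y m - Y n) < e"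
    using assms unfolding rat_padic_cauchy_def by metis
  have "rat_padic_norm p ((X m + Y m) - (X n + Y n)) < e" if "m \<ge> max M N" "n \<ge> max M N" for m n
  proof -
    have "rat_padic_norm p ((X m - X n) + (Y m - Y n)) < e"
      using rat_padic_norm_add[OF p, of "X m - X n" "Y m - Y n"] M[of m n] N[of m n] that by simp
    then show ?thesis by (simp add: algebra_simps)
  qed
  then show "\<exists>N. \<forall>m\<ge>N. \<forall>n\<ge>N. rat_padic_norm p ((X m + Y m) - (X n + Y n)) < e" by blast
qed

lemma rat_padic_cauchy_minus:
  assumes p: "prime p" and "rat_padic_cauchy p X"
  shows "rat_padic_cauchy p (\<lambda>n. - X n)"
proof -
  have "rat_padic_norm p (- X m - - X n) = rat_padic_norm p (X m - X n)" for m n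
    using rat_padic_norm_minus[OF p, of "X m - X n"] by (simp add: algebra_simps)
  then show ?thesis using assms(2) unfolding rat_padic_cauchy_def by simp
qed

lemma rat_padic_cauchy_cases:
  assumes p: "prime p" and X: "rat_padic_cauchy p X" and nz: "\<not> rat_padic_null p X"
  obtains c N where "c > 0" "\<And>n. n \<ge> N \<Longrightarrow> rat_padic_norm p (X n) = c"
proof -
  obtain e where e: "e > 0" and ev: "\<And>N. \<exists>n\<ge>N. rat_padic_norm p (X n) \<ge> e"
    using nz unfolding rat_padic_null_def LIMSEQ_iff by (auto simp: not_less)
  obtain N where N: "\<And>m n. m \<ge> N \<Longrightarrow> n \<ge> N \<Longrightarrow> rat_padic_norm p (X m - X n) < e"
    using X e unfolding rat_padic_cauchy_def by metis
  obtain n0 where n0: "n0 \<ge> N" "rat_padic_norm p (X n0) \<ge> e" using ev by blast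
  have "rat_padic_norm p (X n) = rat_padic_norm p (X n0)" if "n \<ge> N" for n
    using rat_padic_norm_eq[OF p, of "X n" "X n0"] N[OF that n0(1)] n0(2) by simp
  then show ?thesis using that n0(2) e by (metis less_le_trans)
qed

lemma rat_padic_cauchy_convergent:
  assumes p: "prime p" and X: "rat_padic_cauchy p X"
  shows "convergent (\<lambda>n. rat_padic_norm p (X n))"
proof (cases "rat_padic_null p X")
  case True
  then show ?thesis by (auto simp: rat_padic_null_def convergent_def)
next
  case False
  obtain c N where "\<And>n. n \<ge> N \<Longrightarrow> rat_padic_norm p (X n) = c"
    using rat_padic_cauchy_cases[OF p X False] by metis
  then have "(\<lambda>n. rat_padic_norm p (X n)) \<longlonglongrightarrow> c"
    by (intro tendsto_eventually) (auto simp: eventually_sequentially)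
  then show ?thesis by (auto simp: convergent_def)
qed

lemma rat_padic_cauchy_bounded:
  assumes p: "prime p" and X: "rat_padic_cauchy p X"
  obtains B where "B > 0" "\<And>n. rat_padic_norm p (X n) \<le> B"
proof -
  have "Bseq (\<lambda>n. rat_padic_norm p (X n))"
    using rat_padic_cauchy_convergent[OF assms] by (rule convergent_imp_Bseq)
  then obtain B where "B > 0" "\<forall>n. norm (rat_padic_norm p (X n)) \<le> B" unfolding Bseq_def by blast
  then show ?thesis using that[of B] by simp
qed

lemma rat_padic_cauchy_mult:
  assumes p: "prime p" and X: "rat_padic_cauchy p X" and Y: "rat_padic_cauchy p Y"
  shows "rat_padic_cauchy p (\<lambda>n. X n * Y n)"
  unfolding rat_padic_cauchy_def
proof (intro allI impI)
  fix e :: real assume e: "e > 0"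
  obtain A where A: "A > 0" "\<And>n. rat_padic_norm p (X n) \<le> A" using rat_padic_cauchy_bounded[OF p X] by metis
  obtain B where B: "B > 0" "\<And>n. rat_padic_norm p (Y n) \<le> B" using rat_padic_cauchy_bounded[OF p Y] by metis
  have eA: "e / A > 0" and eB: "e / B > 0" using e A B by auto
  obtain M where M: "\<And>m n. m \<ge> M \<Longrightarrow> n \<ge> M \<Longrightarrow> rat_padic_norm p (X m - X n) < e / B"
    using X eB unfolding rat_padic_cauchy_def by metis
  obtain N where N: "\<And>m n. m \<ge> N \<Longrightarrow> n \<ge> N \<Longrightarrow> rat_padic_norm p (Y m - Y n) < e / A"
    using Y eA unfolding rat_padic_cauchy_def by metis
  have "rat_padic_norm p (X m * Y m - X n * Y n) < e" if mn: "m \<ge> max M N" "n \<ge> max M N" for m n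
  proof -
    have "rat_padic_norm p (X m * (Y m - Y n)) \<le> A * rat_padic_norm p (Y m - Y n)"
      unfolding rat_padic_norm_mult[OF p] by (intro mult_right_mono A) auto
    also have "\<dots> < e" using N[of m n] mn A(1) by (simp add: field_simps)
    finally have 1: "rat_padic_norm p (X m * (Y m - Y n)) < e" .
    have "rat_padic_norm p ((X m - X n) * Y n) \<le> rat_padic_norm p (X m - X n) * B"
      unfolding rat_padic_norm_mult[OF p] by (intro mult_left_mono B) auto
    also have "\<dots> < e" using M[of m n] mn B(1) by (simp add: field_simps)
    finally have 2: "rat_padic_norm p ((X m - X n) * Y n) < e" .
    have "X m * Y m - X n * Y n = X m * (Y m - Y n) + (X m - X n) * Y n" by (simp add: algebra_simps)
    then show ?thesis
      using rat_padic_norm_add[OF p, of "X m * (Y m - Y n)" "(X m - X n) * Y n"] 1 2 by simp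
  qed
  then show "\<exists>N. \<forall>m\<ge>N. \<forall>n\<ge>N. rat_padic_norm p (X m * Y m - X n * Y n) < e" by blast
qed

lemma rat_padic_cauchy_inverse:
  assumes p: "prime p" and X: "rat_padic_cauchy p X" and nz: "\<not> rat_padic_null p X"
  shows "rat_padic_cauchy p (\<lambda>n. inverse (X n))"
  unfolding rat_padic_cauchy_def
proof (intro allI impI)
  fix e :: real assume e: "e > 0"
  obtain c M where c: "c > 0" and M: "\<And>n. n \<ge> M \<Longrightarrow> rat_padic_norm p (X n) = c"
    using rat_padic_cauchy_cases[OF assms] by metis
  have "e * c * c > 0" using e c by simp
  then obtain N where N: "\<And>m n. m \<ge> N \<Longrightarrow> n \<ge> N \<Longrightarrow> rat_padic_norm p (X m - X n) < e * c * c"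
    using X unfolding rat_padic_cauchy_def by metis
  have "rat_padic_norm p (inverse (X m) - inverse (X n)) < e" if mn: "m \<ge> max M N" "n \<ge> max M N" for m n
  proof -
    have "X m \<noteq> 0" "X n \<noteq> 0" using M[of m] M[of n] mn c by auto
    then have i: "inverse (X m) - inverse (X n) = (X n - X m) * (inverse (X m) * inverse (X n))"
      by (simp add: field_simps)
    have "rat_padic_norm p (inverse (X m) - inverse (X n)) = rat_padic_norm p (X n - X m) * (inverse c * inverse c)"
      unfolding i rat_padic_norm_mult[OF p] rat_padic_norm_inverse[OF p] using M[of m] M[of n] mn by simp
    also have "\<dots> = rat_padic_norm p (X n - X m) / (c * c)" by (simp add: divide_inverse)
    also have "\<dots> < e" using N[of n m] mn c by (simp add: pos_divide_less_eq mult.assoc)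
    finally show ?thesis .
  qed
  then show "\<exists>N. \<forall>m\<ge>N. \<forall>n\<ge>N. rat_padic_norm p (inverse (X m) - inverse (X n)) < e" by blast
qed

definition rat_padic_rel :: "nat \<Rightarrow> ((nat \<Rightarrow> rat) \<times> (nat \<Rightarrow> rat)) set" where
  "rat_padic_rel p = {(X, Y). rat_padic_cauchy p X \<and> rat_padic_cauchy p Y \<and>
     rat_padic_null p (\<lambda>n. X n - Y n)}"

lemma equiv_rat_padic_rel:
  assumes p: "prime p"
  shows "equiv {X. rat_padic_cauchy p X} (rat_padic_rel p)"
proof (rule equivI)
  show "sym (rat_padic_rel p)"
    by (rule symI) (auto simp: rat_padic_rel_def dest: rat_padic_null_minus[OF p])
  show "trans (rat_padic_rel p)"
    by (rule transI) (auto simp: rat_padic_rel_def dest: rat_padic_null_add[OF p])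
qed (auto simp: rat_padic_rel_def refl_on_def rat_padic_null_def)

typedef (overloaded) ('p::prime_card) padic =
  "{X. rat_padic_cauchy CARD('p) X} // rat_padic_rel CARD('p)"
  using quotientI[of "\<lambda>_. 0" "{X. rat_padic_cauchy CARD('p) X}"] by auto

definition padic_of_seq :: "(nat \<Rightarrow> rat) \<Rightarrow> 'p::prime_card padic" where
  "padic_of_seq X = Abs_padic (rat_padic_rel CARD('p) `` {X})"

definition seq_of_padic :: "'p::prime_card padic \<Rightarrow> nat \<Rightarrow> rat" where
  "seq_of_padic x = (SOME X. X \<in> Rep_padic x)"

lemma padic_of_seq_eq_iff:
  assumes "rat_padic_cauchy CARD('p::prime_card) X" "rat_padic_cauchy CARD('p) Y"
  shows "(padic_of_seq X :: 'p padic) = padic_of_seq Y \<longleftrightarrow>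
    rat_padic_null CARD('p) (\<lambda>n. X n - Y n)"
proof -
  have E: "equiv {X. rat_padic_cauchy CARD('p) X} (rat_padic_rel CARD('p))"
    by (rule equiv_rat_padic_rel[OF prime_card])
  show ?thesis
    unfolding padic_of_seq_def
    using assms Abs_padic_inject[where 'p='p, OF quotientI quotientI] eq_equiv_class_iff[OF E]
    by (auto simp: rat_padic_rel_def)
qed

lemma seq_of_padic:
  fixes x :: "'p::prime_card padic"
  shows "rat_padic_cauchy CARD('p) (seq_of_padic x)" "padic_of_seq (seq_of_padic x) = x"
proof -
  have E: "equiv {X. rat_padic_cauchy CARD('p) X} (rat_padic_rel CARD('p))"
    by (rule equiv_rat_padic_rel[OF prime_card])
  obtain X where X: "rat_padic_cauchy CARD('p) X" "Rep_padic x = rat_padic_rel CARD('p) `` {X}"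
    using Rep_padic[of x] by (auto elim: quotientE)
  then have "X \<in> Rep_padic x" using equiv_class_self[OF E] by auto
  then have "seq_of_padic x \<in> Rep_padic x" unfolding seq_of_padic_def by (rule someI[where P="\<lambda>X. X \<in> Rep_padic x"])
  then have r: "(X, seq_of_padic x) \<in> rat_padic_rel CARD('p)" using X by simp
  then show "rat_padic_cauchy CARD('p) (seq_of_padic x)" by (auto simp: rat_padic_rel_def)
  show "padic_of_seq (seq_of_padic x) = x"
    unfolding padic_of_seq_def equiv_class_eq[OF E r, symmetric] X(2)[symmetric] by (rule Rep_padic_inverse)
qed

lemma padic_cases [cases type: padic]:
  fixes x :: "'p::prime_card padic"
  obtains X where "rat_padic_cauchy CARD('p) X" "x = padic_of_seq X"
  using seq_of_padic by metis

lemma null_seq_of_padic: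
  assumes "rat_padic_cauchy CARD('p::prime_card) X"
  shows "rat_padic_null CARD('p) (\<lambda>n. seq_of_padic (padic_of_seq X :: 'p padic) n - X n)"
  using padic_of_seq_eq_iff[where 'p='p, OF seq_of_padic(1) assms, of "padic_of_seq X"]
  by (simp add: seq_of_padic(2))

instantiation padic :: (prime_card) "{zero,one,plus,minus,uminus,times,inverse}"
begin
definition "0 = padic_of_seq (\<lambda>_. 0)"
definition "1 = padic_of_seq (\<lambda>_. 1)"
definition "x + y = padic_of_seq (\<lambda>n. seq_of_padic x n + seq_of_padic y n)"
definition "- x = padic_of_seq (\<lambda>n. - seq_of_padic x n)"
definition "x - y = x + - (y :: 'a padic)"
definition "x * y = padic_of_seq (\<lambda>n. seq_of_padic x n * seq_of_padic y n)"
definition "inverse x = (if x = 0 then 0 else padic_of_seq (\<lambda>n. inverse (seq_of_padic x n)))"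
definition "x div y = x * inverse (y :: 'a padic)"
instance ..
end

lemma padic_of_seq_minus:
  assumes X: "rat_padic_cauchy CARD('p::prime_card) X"
  shows "(- padic_of_seq X :: 'p padic) = padic_of_seq (\<lambda>n. - X n)"
  unfolding uminus_padic_def
proof (subst padic_of_seq_eq_iff)
  have "rat_padic_null CARD('p) (\<lambda>n. - (seq_of_padic (padic_of_seq X :: 'p padic) n - X n))"
    by (intro rat_padic_null_minus prime_card null_seq_of_padic X)
  then show "rat_padic_null CARD('p) (\<lambda>n. - seq_of_padic (padic_of_seq X :: 'p padic) n - - X n)"
    by (simp add: algebra_simps)
qed (intro rat_padic_cauchy_minus prime_card seq_of_padic X)+

lemma padic_of_seq_eq_0_iff:
  assumes X: "rat_padic_cauchy CARD('p::prime_card) X"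
  shows "(padic_of_seq X :: 'p padic) = 0 \<longleftrightarrow> rat_padic_null CARD('p) X"
  unfolding zero_padic_def by (subst padic_of_seq_eq_iff) (auto simp: X)

context
  fixes X Y :: "nat \<Rightarrow> rat" and T :: "'p::prime_card itself"
  assumes X: "rat_padic_cauchy CARD('p) X" and Y: "rat_padic_cauchy CARD('p) Y"
begin

lemma padic_of_seq_add:
  "(padic_of_seq X + padic_of_seq Y :: 'p padic) = padic_of_seq (\<lambda>n. X n + Y n)"
  unfolding plus_padic_def
proof (subst padic_of_seq_eq_iff)
  have "rat_padic_null CARD('p) (\<lambda>n. (seq_of_padic (padic_of_seq X :: 'p padic) n - X n)
      + (seq_of_padic (padic_of_seq Y :: 'p padic) n - Y n))"
    by (intro rat_padic_null_add prime_card null_seq_of_padic X Y)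
  then show "rat_padic_null CARD('p) (\<lambda>n. seq_of_padic (padic_of_seq X :: 'p padic) n
      + seq_of_padic (padic_of_seq Y :: 'p padic) n - (X n + Y n))" by (simp add: algebra_simps)
qed (intro rat_padic_cauchy_add prime_card seq_of_padic X Y)+

lemma padic_of_seq_mult:
  "(padic_of_seq X * padic_of_seq Y :: 'p padic) = padic_of_seq (\<lambda>n. X n * Y n)"
  unfolding times_padic_def
proof (subst padic_of_seq_eq_iff)
  let ?x = "seq_of_padic (padic_of_seq X :: 'p padic)" and ?y = "seq_of_padic (padic_of_seq Y :: 'p padic)"
  obtain A where A: "A > 0" "\<And>n. rat_padic_norm CARD('p) (X n) \<le> A"
    using rat_padic_cauchy_bounded[OF prime_card X] by metis
  obtain B where B: "B > 0" "\<And>n. rat_padic_norm CARD('p) (?y n) \<le> B"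
    using rat_padic_cauchy_bounded[OF prime_card seq_of_padic(1)] by metis
  have "rat_padic_null CARD('p) (\<lambda>n. (?x n - X n) * ?y n + (?y n - Y n) * X n)"
    by (rule rat_padic_null_add[OF prime_card
          rat_padic_null_mult_bounded[OF prime_card null_seq_of_padic[OF X] B(2)]
          rat_padic_null_mult_bounded[OF prime_card null_seq_of_padic[OF Y] A(2)]])
  then show "rat_padic_null CARD('p) (\<lambda>n. ?x n * ?y n - X n * Y n)"
    by (simp add: algebra_simps)
qed (intro rat_padic_cauchy_mult prime_card seq_of_padic X Y)+

end

lemma padic_inverse:
  fixes x :: "'p::prime_card padic"
  assumes "x \<noteq> 0"
  shows "inverse x * x = 1"
proof -
  let ?X = "seq_of_padic x"
  have X: "rat_padic_cauchy CARD('p) ?X" "x = padic_of_seq ?X" by (simp_all add: seq_of_padic)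
  have nn: "\<not> rat_padic_null CARD('p) ?X"
    using assms padic_of_seq_eq_0_iff[OF X(1)] X(2) by simp
  have C: "rat_padic_cauchy CARD('p) (\<lambda>n. inverse (?X n))"
    by (rule rat_padic_cauchy_inverse[OF prime_card X(1) nn])
  obtain c N where cN: "c > 0" "\<And>n. n \<ge> N \<Longrightarrow> rat_padic_norm CARD('p) (?X n) = c"
    using rat_padic_cauchy_cases[OF prime_card X(1) nn] by metis
  have nz: "?X n \<noteq> 0" if "n \<ge> N" for n using cN(2)[OF that] cN(1) by auto
  have "inverse x * x = padic_of_seq (\<lambda>n. inverse (?X n)) * padic_of_seq ?X"
    using assms X(2) by (simp add: inverse_padic_def)
  also have "\<dots> = padic_of_seq (\<lambda>n. inverse (?X n) * ?X n)" by (rule padic_of_seq_mult[OF C X(1)])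
  also have "\<dots> = 1"
    unfolding one_padic_def
  proof (subst padic_of_seq_eq_iff)
    show "rat_padic_null CARD('p) (\<lambda>n. inverse (?X n) * ?X n - 1)"
      unfolding rat_padic_null_def
      by (rule tendsto_eventually) (use nz in \<open>auto simp: eventually_sequentially intro!: exI[of _ N]\<close>)
  qed (auto intro: rat_padic_cauchy_mult C X prime_card)
  finally show ?thesis .
qed

instance padic :: (prime_card) field
proof
  fix a b c :: "'a padic"
  note cauchy = rat_padic_cauchy_add rat_padic_cauchy_mult rat_padic_cauchy_minus prime_card
  note seqs = padic_of_seq_add[where 'p='a] padic_of_seq_mult[where 'p='a] padic_of_seq_minus[where 'p='a]
  obtain A where A [simp]: "rat_padic_cauchy CARD('a) A" "a = padic_of_seq A" by (rule padic_cases)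
  obtain B where B [simp]: "rat_padic_cauchy CARD('a) B" "b = padic_of_seq B" by (rule padic_cases)
  obtain C where C [simp]: "rat_padic_cauchy CARD('a) C" "c = padic_of_seq C" by (rule padic_cases)
  show "a + b + c = a + (b + c)" by (simp add: seqs cauchy add_ac)
  show "a + b = b + a" by (simp add: seqs cauchy add_ac)
  show "0 + a = a" by (simp add: zero_padic_def seqs cauchy)
  show "- a + a = 0" by (simp add: zero_padic_def seqs cauchy)
  show "a - b = a + - b" by (rule minus_padic_def)
  show "a * b * c = a * (b * c)" by (simp add: seqs cauchy mult_ac)
  show "a * b = b * a" by (simp add: seqs cauchy mult_ac)
  show "1 * a = a" by (simp add: one_padic_def seqs cauchy)
  show "(a + b) * c = a * c + b * c" by (simp add: seqs cauchy algebra_simps)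
  show "(0::'a padic) \<noteq> 1"
    unfolding zero_padic_def one_padic_def
    by (subst padic_of_seq_eq_iff) (auto simp: rat_padic_null_def prime_card LIMSEQ_const_iff)
  show "a \<noteq> 0 \<Longrightarrow> inverse a * a = 1" by (rule padic_inverse)
  show "a / b = a * inverse b" by (rule divide_padic_def)
  show "inverse (0::'a padic) = 0" by (simp add: inverse_padic_def)
qed

text \<open>
  The overloaded \<open>norm\<close> is reserved for real normed vector spaces, hence a separate constant.
\<close>

definition padic_norm :: "'p::prime_card padic \<Rightarrow> real" where
  "padic_norm x = lim (\<lambda>n. rat_padic_norm CARD('p) (seq_of_padic x n))"

lemma padic_norm_of_seq:
  assumes X: "rat_padic_cauchy CARD('p::prime_card) X"
  shows "(\<lambda>n. rat_padic_norm CARD('p) (X n)) \<longlonglongrightarrow> padic_norm (padic_of_seq X :: 'p padic)"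
proof -
  let ?x = "seq_of_padic (padic_of_seq X :: 'p padic)"
  have x: "(\<lambda>n. rat_padic_norm CARD('p) (?x n)) \<longlonglongrightarrow> padic_norm (padic_of_seq X :: 'p padic)"
    unfolding padic_norm_def
    using rat_padic_cauchy_convergent[OF prime_card seq_of_padic(1)] by (simp add: convergent_LIMSEQ_iff)
  have "(\<lambda>n. rat_padic_norm CARD('p) (?x n) - rat_padic_norm CARD('p) (X n)) \<longlonglongrightarrow> 0"
    using null_seq_of_padic[OF X] unfolding rat_padic_null_def
    by (rule tendsto_0_le[where K=1])
       (auto intro!: always_eventually simp: rat_padic_norm_triangle[OF prime_card])
  from tendsto_diff[OF x this] show ?thesis by simp
qed

lemma padic_norm_eq_0_iff: "padic_norm (x::'p::prime_card padic) = 0 \<longleftrightarrow> x = 0"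
proof -
  obtain X where X: "rat_padic_cauchy CARD('p) X" "x = padic_of_seq X" by (rule padic_cases)
  show ?thesis
    using padic_norm_of_seq[OF X(1)] padic_of_seq_eq_0_iff[OF X(1)] X(2)
    unfolding rat_padic_null_def by (auto dest: LIMSEQ_unique)
qed

lemma padic_norm_minus: "padic_norm (- (x::'p::prime_card padic)) = padic_norm x"
proof -
  obtain X where X: "rat_padic_cauchy CARD('p) X" "x = padic_of_seq X" by (rule padic_cases)
  have m: "- x = padic_of_seq (\<lambda>n. - X n)" unfolding X(2) by (rule padic_of_seq_minus[OF X(1)])
  show ?thesis
    using padic_norm_of_seq[OF rat_padic_cauchy_minus[OF prime_card X(1)]]
      padic_norm_of_seq[OF X(1)] unfolding m[symmetric] X(2)[symmetric]
    by (auto simp: prime_card dest: LIMSEQ_unique)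
qed

lemma padic_norm_mult: "padic_norm (x * y) = padic_norm x * padic_norm (y::'p::prime_card padic)"
proof -
  obtain X where X: "rat_padic_cauchy CARD('p) X" "x = padic_of_seq X" by (rule padic_cases)
  obtain Y where Y: "rat_padic_cauchy CARD('p) Y" "y = padic_of_seq Y" by (rule padic_cases)
  have m: "x * y = padic_of_seq (\<lambda>n. X n * Y n)"
    unfolding X(2) Y(2) by (rule padic_of_seq_mult[OF X(1) Y(1)])
  show ?thesis
    using padic_norm_of_seq[OF rat_padic_cauchy_mult[OF prime_card X(1) Y(1)]]
      tendsto_mult[OF padic_norm_of_seq[OF X(1)] padic_norm_of_seq[OF Y(1)]]
    unfolding m[symmetric] X(2)[symmetric] Y(2)[symmetric]
    by (auto simp: rat_padic_norm_mult prime_card dest: LIMSEQ_unique)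
qed

lemma padic_norm_add: "padic_norm (x + y) \<le> max (padic_norm x) (padic_norm (y::'p::prime_card padic))"
proof -
  obtain X where X: "rat_padic_cauchy CARD('p) X" "x = padic_of_seq X" by (rule padic_cases)
  obtain Y where Y: "rat_padic_cauchy CARD('p) Y" "y = padic_of_seq Y" by (rule padic_cases)
  have m: "x + y = padic_of_seq (\<lambda>n. X n + Y n)"
    unfolding X(2) Y(2) by (rule padic_of_seq_add[OF X(1) Y(1)])
  show ?thesis
    using tendsto_le[OF _ tendsto_max[OF padic_norm_of_seq[OF X(1)] padic_norm_of_seq[OF Y(1)]]
       padic_norm_of_seq[OF rat_padic_cauchy_add[OF prime_card X(1) Y(1)]]]
    unfolding m[symmetric] X(2)[symmetric] Y(2)[symmetric]
    by (auto simp: rat_padic_norm_add prime_card)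
qed

lemma padic_norm_nonneg: "padic_norm (x::'p::prime_card padic) \<ge> 0"
  using padic_norm_add[of x "- x"] padic_norm_minus[of x] padic_norm_eq_0_iff[of "0::'p padic"] by simp

instantiation padic :: (prime_card) metric_space
begin

definition "dist x y = padic_norm (x - y :: 'a padic)"

definition "uniformity = (INF e\<in>{0<..}. principal {(x :: 'a padic, y). dist x y < e})"

definition "open (U :: 'a padic set) \<longleftrightarrow>
  (\<forall>x\<in>U. eventually (\<lambda>(x', y). x' = x \<longrightarrow> y \<in> U) uniformity)"

instance
proof
  fix x y z :: "'a padic" and U :: "'a padic set"
  show "dist x y = 0 \<longleftrightarrow> x = y" by (simp add: dist_padic_def padic_norm_eq_0_iff)
  have "dist x y \<le> max (dist x z) (dist y z)"
    using padic_norm_add[of "x - z" "z - y"] padic_norm_minus[of "y - z"] by (simp add: dist_padic_def)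
  then show "dist x y \<le> dist x z + dist y z"
    using padic_norm_nonneg[of "x - z"] padic_norm_nonneg[of "y - z"] by (simp add: dist_padic_def)
  show "uniformity = (INF e\<in>{0<..}. principal {(x, y::'a padic). dist x y < e})"
    by (rule uniformity_padic_def)
  show "open U \<longleftrightarrow> (\<forall>x\<in>U. eventually (\<lambda>(x', y). x' = x \<longrightarrow> y \<in> U) uniformity)"
    by (rule open_padic_def)
qed

end

lemma padic_of_int:
  "(of_int m :: 'p::prime_card padic) = padic_of_seq (\<lambda>_. of_int m)"
proof -
  have n: "(of_nat k :: 'p padic) = padic_of_seq (\<lambda>_. of_nat k)" for k
    by (induction k) (simp_all add: zero_padic_def one_padic_def padic_of_seq_add)
  show ?thesis
  proof (cases "m \<ge> 0")
    case True
    then obtain k where "m = int k" using nonneg_int_cases by blast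
    then show ?thesis by (simp add: n)
  next
    case False
    then obtain k where "m = - int k" by (metis int_cases4 linorder_not_le nle_le of_nat_0_le_iff)
    then show ?thesis by (simp add: n padic_of_seq_minus)
  qed
qed

lemma rat_padic_norm_of_int_less_1:
  assumes p: "prime p"
  shows "rat_padic_norm p (of_int m) < 1 \<longleftrightarrow> int p dvd m"
proof (cases "m = 0")
  case False
  have "rat_padic_norm p (of_int m / of_int 1) = real p powi (- int (multiplicity (int p) m))"
    using rat_padic_norm_fraction[OF p False, of 1] by simp
  also have "\<dots> = inverse (real p ^ multiplicity (int p) m)" by (simp add: power_int_minus)
  finally have e: "rat_padic_norm p (of_int m) = inverse (real p ^ multiplicity (int p) m)" by simp
  have p1: "real p > 1" using prime_gt_1_nat[OF p] by simp
  have "int p dvd m \<longleftrightarrow> multiplicity (int p) m > 0"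
    using False p by (subst prime_multiplicity_gt_zero_iff) auto
  then show ?thesis
    unfolding e using p1 by (cases "multiplicity (int p) m = 0") (auto simp: inverse_less_1_iff intro!: one_less_power)
qed auto

lemma padic_norm_of_rat_seq:
  "padic_norm (padic_of_seq (\<lambda>_. r) :: 'p::prime_card padic) = rat_padic_norm CARD('p) r"
  using padic_norm_of_seq[of "\<lambda>_. r", where 'p='p] LIMSEQ_unique[OF _ tendsto_const] by fastforce

lemma padic_norm_of_int_less_1:
  "padic_norm (of_int m :: 'p::prime_card padic) < 1 \<longleftrightarrow> int CARD('p) dvd m"
  by (simp add: padic_of_int padic_norm_of_rat_seq rat_padic_norm_of_int_less_1 prime_card)

definition padic_integers :: "'p::prime_card padic set" where
  "padic_integers = {x. padic_norm x \<le> 1}"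

text \<open>
  Reduction modulo \<open>p\<close>; meaningful on \<open>padic_integers\<close> only, see \<open>padic_residueI\<close> and
  \<open>padic_integers_residue_ex\<close> below.
\<close>

definition padic_residue :: "'p::prime_card padic \<Rightarrow> 'p mod_ring" where
  "padic_residue x = (THE r. \<exists>m. padic_norm (x - of_int m) < 1 \<and> r = of_int m)"

lemma padic_residueI:
  fixes x :: "'p::prime_card padic"
  assumes "padic_norm (x - of_int m) < 1"
  shows "padic_residue x = of_int m"
  unfolding padic_residue_def
proof (rule the_equality)
  fix r :: "'p mod_ring" assume "\<exists>k. padic_norm (x - of_int k) < 1 \<and> r = of_int k"
  then obtain k where k: "padic_norm (x - of_int k) < 1" "r = of_int k" by blast
  have "padic_norm (of_int (k - m) :: 'p padic) \<le> max (padic_norm (x - of_int m)) (padic_norm (- (x - of_int k)))"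
    using padic_norm_add[of "x - of_int m" "- (x - of_int k)"] by simp
  then have "padic_norm (of_int (k - m) :: 'p padic) < 1"
    using k(1) assms padic_norm_minus[of "x - of_int k"] by linarith
  then have "int CARD('p) dvd k - m" by (simp only: padic_norm_of_int_less_1)
  then have "k mod int CARD('p) = m mod int CARD('p)" by (simp add: mod_eq_dvd_iff)
  then show "r = of_int m" unfolding k(2) of_int_of_int_mod_ring
    by transfer simp
qed (use assms in blast)

lemma padic_integers_residue_ex:
  fixes x :: "'p::prime_card padic"
  assumes "x \<in> padic_integers"
  obtains m where "padic_norm (x - of_int m) < 1"
proof -
  let ?p = "CARD('p)"
  have p: "prime ?p" by (rule prime_card)
  obtain X where X: "rat_padic_cauchy ?p X" "x = padic_of_seq X" by (rule padic_cases)
  obtain N where N: "\<And>m n. m \<ge> N \<Longrightarrow> n \<ge> N \<Longrightarrow> rat_padic_norm ?p (X m - X n) < 1/2"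
    using X(1) unfolding rat_padic_cauchy_def by (metis half_gt_zero zero_less_one)
  define r where "r = X N"
  have c: "rat_padic_cauchy ?p (\<lambda>n. X n - r)"
    using rat_padic_cauchy_add[OF p X(1) rat_padic_cauchy_const[of ?p "- r"]] by simp
  have xr: "x - padic_of_seq (\<lambda>_. r) = padic_of_seq (\<lambda>n. X n - r)"
    unfolding X(2) minus_padic_def padic_of_seq_minus[OF rat_padic_cauchy_const]
    by (subst padic_of_seq_add) (auto simp: X)
  have "padic_norm (x - padic_of_seq (\<lambda>_. r)) \<le> 1/2"
    unfolding xr by (rule LIMSEQ_le_const2[OF padic_norm_of_seq[OF c]])
       (use N in \<open>auto simp: r_def intro!: exI[of _ N] less_imp_le\<close>)
  then have d: "padic_norm (x - padic_of_seq (\<lambda>_. r)) < 1" by simp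
  have "padic_norm (padic_of_seq (\<lambda>_. r) :: 'p padic) \<le> max (padic_norm x) (padic_norm (- (x - padic_of_seq (\<lambda>_. r))))"
    using padic_norm_add[of x "- (x - padic_of_seq (\<lambda>_. r))"] by simp
  then have r1: "rat_padic_norm ?p r \<le> 1"
    using d assms padic_norm_minus[of "x - padic_of_seq (\<lambda>_. r)"]
    unfolding padic_norm_of_rat_seq padic_integers_def by simp
  obtain a b where q: "quotient_of r = (a, b)" by (cases "quotient_of r")
  have b: "b > 0" using quotient_of_denom_pos[OF q] .
  have ab: "coprime a b" using quotient_of_coprime[OF q] .
  have rab: "r = of_int a / of_int b" using quotient_of_div[OF q] .
  have nb: "\<not> int ?p dvd b"
  proof
    assume pb: "int ?p dvd b"
    then have "\<not> int ?p dvd a" using ab p by (metis coprime_common_divisor not_prime_unit prime_nat_int_transfer)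
    then have "\<not> rat_padic_norm ?p (of_int a) < 1" "rat_padic_norm ?p (of_int b) < 1"
      using pb rat_padic_norm_of_int_less_1[OF p] by auto
    moreover have "rat_padic_norm ?p (of_int a) = rat_padic_norm ?p r * rat_padic_norm ?p (of_int b)"
      using b unfolding rab rat_padic_norm_mult[OF p, symmetric] by simp
    ultimately show False
      using mult_mono[OF r1, of "rat_padic_norm ?p (of_int b)" "rat_padic_norm ?p (of_int b)"] by simp
  qed
  then have "coprime b (int ?p)" using p by (metis coprime_commute prime_imp_coprime prime_nat_int_transfer)
  then obtain b' where b': "[b * b' = 1] (mod int ?p)" using cong_solve_coprime_int by blast
  define m where "m = a * b'"
  have "int ?p dvd a * (1 - b * b')" using b' by (simp add: cong_iff_dvd_diff dvd_diff_commute)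
  then have "int ?p dvd a - b * m" by (simp add: m_def algebra_simps)
  then have "rat_padic_norm ?p (of_int (a - b * m)) < 1" using rat_padic_norm_of_int_less_1[OF p] by blast
  moreover have "rat_padic_norm ?p (of_int (a - b * m)) = rat_padic_norm ?p (of_int b) * rat_padic_norm ?p (r - of_int m)"
    unfolding rat_padic_norm_mult[OF p, symmetric] using b by (simp add: rab right_diff_distrib)
  moreover have "rat_padic_norm ?p (of_int b) \<ge> 1"
    using rat_padic_norm_of_int_less_1[OF p, of b] nb by linarith
  ultimately have rm: "rat_padic_norm ?p (r - of_int m) < 1"
    using mult_right_mono[of 1 "rat_padic_norm ?p (of_int b)" "rat_padic_norm ?p (r - of_int m)"] by simp
  have rme: "padic_of_seq (\<lambda>_. r) - of_int m = (padic_of_seq (\<lambda>_. r - of_int m) :: 'p padic)"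
    unfolding minus_padic_def padic_of_int padic_of_seq_minus[OF rat_padic_cauchy_const]
    by (subst padic_of_seq_add) auto
  have "padic_norm (x - of_int m) \<le> max (padic_norm (x - padic_of_seq (\<lambda>_. r))) (padic_norm (padic_of_seq (\<lambda>_. r) - of_int m :: 'p padic))"
    using padic_norm_add[of "x - padic_of_seq (\<lambda>_. r)" "padic_of_seq (\<lambda>_. r) - of_int m"] by simp
  also have "\<dots> < 1" using d rm by (simp add: rme padic_norm_of_rat_seq)
  finally show ?thesis using that by blast
qed

text \<open>
  The Haar measure on \<open>Q_p^n\<close> giving \<open>Z_p^n\<close> measure one.  Local finiteness and regularity
  follow from the last clause, since \<open>Q_p^n\<close> is second countable and locally compact and
  \<open>Z_p^n\<close> is a compact open subgroup.
\<close>

definition haar_measure_normalized :: "('p::prime_card padic ^ 'n::finite) measure \<Rightarrow> bool" where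
  "haar_measure_normalized \<mu> \<longleftrightarrow>
     sets \<mu> = sets borel \<and>
     (\<forall>a. \<forall>A\<in>sets borel. emeasure \<mu> ((+) a ` A) = emeasure \<mu> A) \<and>
     emeasure \<mu> {x. \<forall>i. x $ i \<in> padic_integers} = 1"

text \<open>
  Polynomials in variables indexed by \<open>'n\<close>: finitely supported maps from exponent vectors to
  coefficients, so that \<open>Poly_Mapping.keys f\<close> is the support of \<open>f\<close>.
\<close>

type_synonym ('a, 'n) multipoly = "nat ^ 'n \<Rightarrow>\<^sub>0 'a"

definition multipoly_eval :: "('a::comm_semiring_1, 'n::finite) multipoly \<Rightarrow> 'a ^ 'n \<Rightarrow> 'a" where
  "multipoly_eval f x = (\<Sum>\<omega>\<in>Poly_Mapping.keys f. Poly_Mapping.lookup f \<omega> *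
     (\<Prod>i\<in>UNIV. x $ i ^ (\<omega> $ i)))"

lift_definition multipoly_pderiv ::
    "'n::finite \<Rightarrow> ('a::comm_semiring_1, 'n) multipoly \<Rightarrow> ('a, 'n) multipoly"
  is "\<lambda>i f \<omega>. of_nat (\<omega> $ i + 1) * f (\<omega> + axis i 1)"
proof -
  fix i :: 'n and f :: "nat ^ 'n \<Rightarrow> 'a"
  assume "finite {\<omega>. f \<omega> \<noteq> 0}"
  then have "finite ((\<lambda>\<omega>. \<omega> + axis i 1) -` {\<omega>. f \<omega> \<noteq> 0})"
    by (rule finite_vimageI) (simp add: inj_def)
  then show "finite {\<omega>. of_nat (\<omega> $ i + 1) * f (\<omega> + axis i 1) \<noteq> 0}"
    by (rule rev_finite_subset) auto
qed

definition exponent_point :: "nat ^ 'n \<Rightarrow> real ^ 'n::finite" where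
  "exponent_point \<omega> = (\<chi> i. real (\<omega> $ i))"

definition newton_polyhedron :: "('a::zero, 'n::finite) multipoly \<Rightarrow> (real ^ 'n) set" where
  "newton_polyhedron f =
     convex hull (\<Union>\<omega>\<in>Poly_Mapping.keys f. (+) (exponent_point \<omega>) ` {t. \<forall>i. 0 \<le> t $ i})"

definition newton_face :: "('a::zero, 'n::finite) multipoly \<Rightarrow> (real ^ 'n) set \<Rightarrow> bool" where
  "newton_face f \<tau> \<longleftrightarrow> \<tau> = newton_polyhedron f \<or>
     (\<exists>a b. a \<noteq> 0 \<and> newton_polyhedron f \<subseteq> {x. a \<bullet> x \<ge> b} \<and>
        newton_polyhedron f \<inter> {x. a \<bullet> x = b} \<noteq> {} \<and>
        \<tau> = newton_polyhedron f \<inter> {x. a \<bullet> x = b})"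

definition newton_facet :: "('a::zero, 'n::finite) multipoly \<Rightarrow> (real ^ 'n) set \<Rightarrow> bool" where
  "newton_facet f \<tau> \<longleftrightarrow> newton_face f \<tau> \<and> aff_dim \<tau> = aff_dim (newton_polyhedron f) - 1"

lift_definition face_poly ::
    "('a::zero, 'n::finite) multipoly \<Rightarrow> (real ^ 'n) set \<Rightarrow> ('a, 'n) multipoly"
  is "\<lambda>f \<tau> \<omega>. if exponent_point \<omega> \<in> \<tau> then f \<omega> else 0"
  by (rule rev_finite_subset) auto

text \<open>
  \<open>g\<close> is the reduction modulo \<open>p\<close> of the face polynomial; its derivatives and zeros are taken over
  the field with \<open>p\<close> elements.
\<close>

definition nondegenerate :: "('p::prime_card padic, 'n::finite) multipoly \<Rightarrow> bool" where
  "nondegenerate f \<longleftrightarrow>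
     (\<forall>\<tau>. newton_face f \<tau> \<and> compact \<tau> \<longrightarrow>
        (let g = Poly_Mapping.map padic_residue (face_poly f \<tau>) in
         \<nexists>x. (\<forall>i. x $ i \<noteq> 0) \<and> multipoly_eval g x = 0 \<and>
             (\<forall>i. multipoly_eval (multipoly_pderiv i g) x = 0)))"

text \<open>
  The defining integral, meant for \<open>Re s > 0\<close>.  Note that \<open>0 powr s = 0\<close>.
\<close>

definition igusa_zeta ::
    "('p::prime_card padic ^ 'n::finite) measure \<Rightarrow> ('p padic, 'n) multipoly \<Rightarrow> complex \<Rightarrow> complex"
  where "igusa_zeta \<mu> f s =
    (LINT x:{x. \<forall>i. x $ i \<in> (*) (of_nat CARD('p)) ` padic_integers}|\<mu>.
       complex_of_real (padic_norm (multipoly_eval f x)) powr s)"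

definition igusa_zeta_continuation ::
    "('p::prime_card padic ^ 'n::finite) measure \<Rightarrow> ('p padic, 'n) multipoly \<Rightarrow> (complex \<Rightarrow> complex) \<Rightarrow> bool"
  where "igusa_zeta_continuation \<mu> f Z \<longleftrightarrow>
    Z meromorphic_on UNIV \<and> (\<forall>s. Re s > 0 \<longrightarrow> Z s = igusa_zeta \<mu> f s)"

definition newton_m :: "('a::zero, 'n::finite) multipoly \<Rightarrow> real ^ 'n \<Rightarrow> real" where
  "newton_m f k = (INF x\<in>newton_polyhedron f. k \<bullet> x)"

definition newton_sigma :: "real ^ 'n::finite \<Rightarrow> real" where
  "newton_sigma k = (\<Sum>i\<in>UNIV. k $ i)"

text \<open>
  For a facet \<open>\<tau>\<close> there is exactly one such \<open>v\<close>.
\<close>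

definition primitive_normal :: "(real ^ 'n::finite) set \<Rightarrow> nat ^ 'n \<Rightarrow> bool" where
  "primitive_normal \<tau> v \<longleftrightarrow> v \<noteq> 0 \<and> Gcd (range (\<lambda>i. v $ i)) = 1 \<and>
     (\<forall>x\<in>\<tau>. \<forall>y\<in>\<tau>. exponent_point v \<bullet> (x - y) = 0)"

definition candidate_pole :: "('p::prime_card padic, 'n::finite) multipoly \<Rightarrow> complex \<Rightarrow> bool" where
  "candidate_pole f s \<longleftrightarrow>
     (\<exists>k::int. s = -1 + 2 * of_int k * of_real pi * \<i> / of_real (ln (real CARD('p)))) \<or>
     (\<exists>\<tau> v. newton_facet f \<tau> \<and> primitive_normal \<tau> v \<and> newton_m f (exponent_point v) \<noteq> 0 \<and>
        (\<exists>k::int. s =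
           - of_real (newton_sigma (exponent_point v) / newton_m f (exponent_point v)) +
           2 * of_int k * of_real pi * \<i> /
             of_real (newton_m f (exponent_point v) * ln (real CARD('p)))))"

definition contributes ::
    "('p::prime_card padic, 'n::finite) multipoly \<Rightarrow> (real ^ 'n) set \<Rightarrow> complex \<Rightarrow> bool" where
  "contributes f \<tau> s \<longleftrightarrow> newton_facet f \<tau> \<and>
     (\<exists>v. primitive_normal \<tau> v \<and>
        of_nat CARD('p) powr
          (of_real (newton_sigma (exponent_point v)) + of_real (newton_m f (exponent_point v)) * s) = 1)"

text \<open>
  The coordinates \<open>x_1, x_2, x_3\<close> are the components \<open>1, 2, 3\<close> of type \<open>3\<close> (in which \<open>3 = 0\<close>).
\<close>

definition B1_simplex :: "3 \<Rightarrow> (real ^ 3) set \<Rightarrow> bool" where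
  "B1_simplex i \<tau> \<longleftrightarrow> (\<exists>a b c. card {a, b, c} = 3 \<and> \<not> affine_dependent {a, b, c} \<and>
     \<tau> = convex hull {a, b, c} \<and> a $ i = 0 \<and> b $ i = 0 \<and> c $ i = 1)"

definition noncompact_for :: "'n::finite \<Rightarrow> (real ^ 'n) set \<Rightarrow> bool" where
  "noncompact_for j \<tau> \<longleftrightarrow> (\<forall>x\<in>\<tau>. x + axis j 1 \<in> \<tau>)"

text \<open>
  The projection forgetting the \<open>j\<close>-th coordinate, its target being identified with the
  coordinate hyperplane on which the \<open>j\<close>-th coordinate vanishes; the other coordinates keep their names.
\<close>

definition forget_coordinate :: "'n::finite \<Rightarrow> real ^ 'n \<Rightarrow> real ^ 'n" where
  "forget_coordinate j x = (\<chi> l. if l = j then 0 else x $ l)"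

definition B1_noncompact :: "3 \<Rightarrow> (real ^ 3) set \<Rightarrow> bool" where
  "B1_noncompact i \<tau> \<longleftrightarrow> (\<exists>j. j \<noteq> i \<and> (\<forall>k. noncompact_for k \<tau> \<longleftrightarrow> k = j) \<and>
     (\<exists>a b. forget_coordinate j ` \<tau> = closed_segment a b \<and> a $ i = 0 \<and> b $ i = 1))"

definition B1_facet :: "('a::zero, 3) multipoly \<Rightarrow> 3 \<Rightarrow> (real ^ 3) set \<Rightarrow> bool" where
  "B1_facet f i \<tau> \<longleftrightarrow> newton_facet f \<tau> \<and> (B1_simplex i \<tau> \<or> B1_noncompact i \<tau>)"

end

theory Submission
  imports Defs
begin

text \<open>
  The zeta function is the sum, over the vectors \<open>k\<close> of positive integers, of the integrals over the
  points with coordinates of orders \<open>k_i\<close>.  By non-degeneracy such an integral is \<open>p^(-\<sigma>(k) - m(k) s)\<close>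
  times a factor which depends only on the face on which \<open>k\<close> is minimal and whose poles have real
  part \<open>-1\<close>.  Summing over the lattice points of a cone generated by normals \<open>v\<close> gives a fraction with
  denominators \<open>1 - p^(-\<sigma>(v) - m(v) s)\<close>, so only the normals of contributing facets matter.

  Three contributing normals cannot belong to the same vertex \<open>C\<close> with \<open>C_i = 1\<close>, as they would lie in a
  plane.  Hence contributing facets occur isolated or in pairs of adjacent facets with a common vertex
  \<open>C\<close> and a common vertex in \<open>x_i = 0\<close>.  Around such a cluster one regroups the dual fan: the triangles
  and the quadrilateral cut off at the vertices of the facets by the neighbouring normals \<open>a\<close>, \<open>b\<close> form the
  cone generated by \<open>a\<close>, \<open>b\<close> and \<open>e_i\<close>.  There one integrates over \<open>x_i\<close> first.  As \<open>C\<close> dominates all terms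
  divisible by \<open>x_i\<close>, the result is that for the monomial \<open>C\<close>: a sum over the cone generated by the
  non-contributing vectors \<open>a\<close>, \<open>b\<close>, \<open>e_i\<close>.
\<close>

text \<open>Two difficulties shape the argument. The dual cones are in general not simplicial; every
  region that is summed over is therefore kept as a set of lattice points stable under adding its
  generators, and rationality is derived for such sets directly. Secondly, m is not linear on the
  cone over \<open>a\<close>, \<open>b\<close>, \<open>e_i\<close>: on part of it exponents of
  height 0 are minimal. The weight of the monomial \<open>C\<close> is thus wrong at single points
  and right only after summation along a half line in direction \<open>e_i\<close>. Hence a cluster
  has to be a union of complete half lines, and adjacent contributing facets have to be for the same
  variable. The assumption \<open>Re s0 \<noteq> -1\<close> enters in three places: in the geometric
  series of the local factors, in the ratio p^(-1-s0) of the generator \<open>e_i\<close> at a point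
  of height 1, and in the equation of the plane through contributing normals, whose
  \<open>i\<close>-th coefficient is \<open>1 + Re s0\<close>. Strict inequalities decide to whom
  the walls belong: a cluster point has a positive coefficient on a contributing normal, so the
  outer walls fall to the remaining cones.\<close>

no_notation fps_nth (infixl \<open>$\<close> 75)

section \<open>Generating series of lattice cones\<close>

text \<open>Having no pole at \<open>s0\<close> is expressed by a relation between entire functions on a half plane, so that
  no meromorphic continuation of the summands has to be constructed.\<close>

definition regular_at :: "complex \<Rightarrow> (complex \<Rightarrow> complex) \<Rightarrow> bool" where
  "regular_at s0 g \<longleftrightarrow> (\<exists>Q N. Q holomorphic_on UNIV \<and> N holomorphic_on UNIV \<and> Q s0 \<noteq> 0 \<and>
     (\<forall>s. Re s > 0 \<longrightarrow> Q s * g s = N s))"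

lemma regular_at_cong:
  assumes "\<And>s. Re s > 0 \<Longrightarrow> f s = g s" "regular_at s0 g"
  shows "regular_at s0 f"
  using assms unfolding regular_at_def by metis

lemma regular_at_holomorphic: "f holomorphic_on UNIV \<Longrightarrow> regular_at s0 f"
  unfolding regular_at_def by (intro exI[of _ "\<lambda>_. 1"] exI[of _ f]) auto

lemma regular_at_add:
  assumes "regular_at s0 f" "regular_at s0 g"
  shows "regular_at s0 (\<lambda>s. f s + g s)"
proof -
  obtain Q N where 1: "Q holomorphic_on UNIV" "N holomorphic_on UNIV" "Q s0 \<noteq> 0" "\<And>s. Re s > 0 \<Longrightarrow> Q s * f s = N s"
    using assms(1) unfolding regular_at_def by blast
  obtain Q' N' where 2: "Q' holomorphic_on UNIV" "N' holomorphic_on UNIV" "Q' s0 \<noteq> 0" "\<And>s. Re s > 0 \<Longrightarrow> Q' s * g s = N' s"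
    using assms(2) unfolding regular_at_def by blast
  have "(Q s * Q' s) * (f s + g s) = N s * Q' s + N' s * Q s" if "Re s > 0" for s
  proof -
    have "(Q s * Q' s) * (f s + g s) = (Q s * f s) * Q' s + (Q' s * g s) * Q s" by (simp add: algebra_simps)
    then show ?thesis by (simp only: 1(4)[OF that] 2(4)[OF that])
  qed
  then show ?thesis unfolding regular_at_def
    by (intro exI[of _ "\<lambda>s. Q s * Q' s"] exI[of _ "\<lambda>s. N s * Q' s + N' s * Q s"])
       (use 1 2 in \<open>auto intro!: holomorphic_intros\<close>)
qed

lemma regular_at_mult:
  assumes "regular_at s0 f" "regular_at s0 g"
  shows "regular_at s0 (\<lambda>s. f s * g s)"
proof -
  obtain Q N where 1: "Q holomorphic_on UNIV" "N holomorphic_on UNIV" "Q s0 \<noteq> 0" "\<And>s. Re s > 0 \<Longrightarrow> Q s * f s = N s"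
    using assms(1) unfolding regular_at_def by blast
  obtain Q' N' where 2: "Q' holomorphic_on UNIV" "N' holomorphic_on UNIV" "Q' s0 \<noteq> 0" "\<And>s. Re s > 0 \<Longrightarrow> Q' s * g s = N' s"
    using assms(2) unfolding regular_at_def by blast
  have "(Q s * Q' s) * (f s * g s) = N s * N' s" if "Re s > 0" for s
  proof -
    have "(Q s * Q' s) * (f s * g s) = (Q s * f s) * (Q' s * g s)" by (simp add: algebra_simps)
    then show ?thesis by (simp only: 1(4)[OF that] 2(4)[OF that])
  qed
  then show ?thesis unfolding regular_at_def
    by (intro exI[of _ "\<lambda>s. Q s * Q' s"] exI[of _ "\<lambda>s. N s * N' s"])
       (use 1 2 in \<open>auto intro!: holomorphic_intros\<close>)
qed

lemma regular_at_sum: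
  "finite A \<Longrightarrow> (\<And>a. a \<in> A \<Longrightarrow> regular_at s0 (f a)) \<Longrightarrow> regular_at s0 (\<lambda>s. \<Sum>a\<in>A. f a s)"
  by (induction A rule: finite_induct) (auto intro: regular_at_holomorphic regular_at_add)

text \<open>Geometric series enter through this lemma: the sum is multiplied by one minus its ratio,
  an entire function that does not vanish at \<open>s0\<close>.\<close>

lemma regular_at_divide:
  assumes "regular_at s0 (\<lambda>s. e s * g s)" "e holomorphic_on UNIV" "e s0 \<noteq> 0"
  shows "regular_at s0 g"
proof -
  obtain Q N where 1: "Q holomorphic_on UNIV" "N holomorphic_on UNIV" "Q s0 \<noteq> 0" "\<And>s. Re s > 0 \<Longrightarrow> Q s * (e s * g s) = N s"
    using assms(1) unfolding regular_at_def by blast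
  show ?thesis unfolding regular_at_def
    by (intro exI[of _ "\<lambda>s. Q s * e s"] exI[of _ N])
       (use 1 assms in \<open>auto intro!: holomorphic_intros simp: mult.assoc\<close>)
qed

text \<open>Identity theorem: \<open>Q * Z - N\<close> is meromorphic on the plane and vanishes on a
  half plane, hence outside a discrete set. Near \<open>s0\<close> the function \<open>Z\<close>
  therefore agrees with \<open>N / Q\<close>, which has a finite limit there.\<close>

lemma regular_at_imp_not_pole:
  assumes Z: "Z meromorphic_on UNIV" and g: "regular_at s0 g" and eq: "\<And>s. Re s > 0 \<Longrightarrow> Z s = g s"
  shows "\<not> is_pole Z s0"
proof
  assume pole: "is_pole Z s0"
  obtain Q N where 1: "Q holomorphic_on UNIV" "N holomorphic_on UNIV" "Q s0 \<noteq> 0" "\<And>s. Re s > 0 \<Longrightarrow> Q s * g s = N s"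
    using g unfolding regular_at_def by blast
  define h where "h = (\<lambda>s. Q s * Z s - N s)"
  have hm: "h meromorphic_on UNIV"
    unfolding h_def by (intro meromorphic_intros analytic_on_imp_meromorphic_on Z)
       (use 1 in \<open>auto simp: analytic_on_open\<close>)
  have h0: "h s = 0" if "Re s > 0" for s using 1(4)[OF that] eq[OF that] by (simp add: h_def)
  \<comment> \<open>The point 1 is an arbitrary point of the half plane; zeros accumulating there
    exclude that \<open>h\<close> is nonzero off a discrete set.\<close>
  have "eventually (\<lambda>z. h z = 0) (at 1)"
  proof -
    have "eventually (\<lambda>z::complex. z \<in> {z. Re z > 0}) (at 1)"
      by (rule eventually_at_in_open') (auto simp: open_halfspace_Re_gt)
    then show ?thesis by eventually_elim (use h0 in auto)
  qed
  then have "\<not> eventually (\<lambda>z. h z \<noteq> 0) (at 1)"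
    using eventually_frequently[of "at (1::complex)"] by (auto simp: frequently_def)
  then have "\<not> (\<forall>\<^sub>\<approx>z\<in>UNIV. h z \<noteq> 0)" by (auto simp: eventually_cosparse_open_eq)
  then have "\<forall>\<^sub>\<approx>z\<in>UNIV. h z = 0"
    using meromorphic_imp_constant_or_avoid[OF hm, of 0] by auto
  then have ev: "eventually (\<lambda>z. h z = 0) (at s0)"
    by (auto simp: eventually_cosparse_open_eq)
  have "isCont Q s0" "isCont N s0"
    using 1 holomorphic_on_imp_continuous_on continuous_on_eq_continuous_at open_UNIV by blast+
  then have c: "((\<lambda>s. N s / Q s) \<longlongrightarrow> N s0 / Q s0) (at s0)" "(Q \<longlongrightarrow> Q s0) (at s0)"
    using 1(3) by (auto intro!: tendsto_intros simp: isCont_def)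
  have "eventually (\<lambda>s. Q s \<noteq> 0) (at s0)" using c(2) 1(3) tendsto_imp_eventually_ne by blast
  with ev have "eventually (\<lambda>s. N s / Q s = Z s) (at s0)"
    by eventually_elim (auto simp: h_def field_simps)
  with c(1) have "(Z \<longlongrightarrow> N s0 / Q s0) (at s0)" by (simp add: tendsto_cong)
  with pole show False
    unfolding is_pole_def using not_tendsto_and_filterlim_at_infinity[of "at s0" Z] by auto
qed

section \<open>Sets generated over a finitely generated monoid\<close>

inductive_set gen :: "(nat^'n::finite) set \<Rightarrow> (nat^'n) set \<Rightarrow> (nat^'n) set" for H R where
  base: "h \<in> H \<Longrightarrow> h \<in> gen H R"
| step: "x \<in> gen H R \<Longrightarrow> r \<in> R \<Longrightarrow> x + r \<in> gen H R"

lemma gen_mono: "x \<in> gen H R \<Longrightarrow> H \<subseteq> H' \<Longrightarrow> R \<subseteq> R' \<Longrightarrow> x \<in> gen H' R'"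
proof (induction rule: gen.induct)
  case (base h)
  then show ?case by (intro gen.base) blast
next
  case (step x r)
  then show ?case by (intro gen.step) blast+
qed

lemma gen_empty [simp]: "gen H {} = H"
  by (auto elim: gen.cases intro: gen.intros)

lemma gen_translate: "x \<in> gen {a} R \<Longrightarrow> x + c \<in> gen {a + c} R"
proof (induction rule: gen.induct)
  case (step x r)
  have "x + r + c = (x + c) + r" by (simp add: add_ac)
  with step show ?case by (metis gen.step)
qed (auto intro: gen.intros)

lemma gen_smult: "x \<in> gen H R \<Longrightarrow> r \<in> R \<Longrightarrow> x + j *s r \<in> gen H R"
proof (induction j)
  case (Suc j)
  have "x + Suc j *s r = (x + j *s r) + r"
    by (simp add: vec_eq_iff)
  with Suc show ?case by (metis gen.step)
qed simp

lemma gen_insertE: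
  assumes "x \<in> gen H (insert r R)"
  obtains y j where "y \<in> gen H R" "x = y + j *s r"
proof -
  from assms have "\<exists>y j. y \<in> gen H R \<and> x = y + j *s r"
  proof (induction rule: gen.induct)
    case (base h)
    then show ?case by (intro exI[of _ h] exI[of _ 0]) (auto intro: gen.intros)
  next
    case (step x r')
    then obtain y j where y: "y \<in> gen H R" "x = y + j *s r" by blast
    show ?case
    proof (cases "r' = r")
      case True
      have "x + r' = y + Suc j *s r" using y True by (simp add: vec_eq_iff)
      then show ?thesis using y by blast
    next
      case False
      then have "y + r' \<in> gen H R" using y step by (auto intro: gen.intros)
      moreover have "x + r' = (y + r') + j *s r" using y by (simp add: vec_eq_iff)
      ultimately show ?thesis by blast
    qed
  qed
  then show ?thesis using that by blast
qed

lemma gen_closed_subset: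
  assumes "x \<in> gen H R" "H \<subseteq> U" "\<And>x r. x \<in> U \<Longrightarrow> r \<in> R \<Longrightarrow> x + r \<in> U"
  shows "x \<in> U"
  using assms(1) by (induction rule: gen.induct) (use assms in auto)

text \<open>A decreasing sequence of natural numbers is eventually constant, so a monotone
  subsequence can be taken increasing in either case.\<close>

lemma nat_incseq_subseq:
  fixes f :: "nat \<Rightarrow> nat"
  obtains g where "strict_mono g" "incseq (f \<circ> g)"
proof -
  obtain g where g: "strict_mono g" "monoseq (\<lambda>n. f (g n))" using seq_monosub by blast
  show ?thesis
  proof (cases "incseq (\<lambda>n. f (g n))")
    case True
    then show ?thesis using that g by (auto simp: comp_def)
  next
    case False
    then have d: "decseq (\<lambda>n. f (g n))" using g(2) by (simp add: monoseq_iff)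
    obtain N where N: "\<And>n. f (g N) \<le> f (g n)"
      using ex_has_least_nat[of "\<lambda>_. True" undefined "\<lambda>n. f (g n)"] by auto
    have "f (g (N + n)) = f (g N)" for n
      using N[of "N + n"] d by (metis decseq_def le_add1 le_antisym)
    then have "incseq (f \<circ> (\<lambda>n. g (N + n)))" by (auto simp: incseq_def)
    moreover have "strict_mono (\<lambda>n. g (N + n))" using g(1) by (auto simp: strict_mono_def)
    ultimately show ?thesis using that by blast
  qed
qed

text \<open>Dickson's lemma for the submonoid generated by \<open>R\<close>; \<open>gen_acc\<close> is the resulting chain condition.\<close>

lemma gen_wqo:
  assumes "finite R" "finite H" "\<And>i. y i \<in> gen H R"
  shows "\<exists>\<phi>::nat \<Rightarrow> nat. strict_mono \<phi> \<and> (\<forall>i j. i \<le> j \<longrightarrow> y (\<phi> j) \<in> gen {y (\<phi> i)} R)"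
  using assms
proof (induction R arbitrary: y rule: finite_induct)
  case empty
  then have "range y \<subseteq> H" by auto
  then have "finite (range y)" using empty finite_subset by blast
  then obtain a where a: "infinite {i. y i = y a}"
    using pigeonhole_infinite[OF infinite_UNIV_nat \<open>finite (range y)\<close>] by auto
  show ?case
    by (rule exI[of _ "enumerate {i. y i = y a}"])
       (use a enumerate_in_set[OF a] in \<open>auto simp: strict_mono_enumerate\<close>)
next
  case (insert r R)
  have "\<exists>y' n. y' \<in> gen H R \<and> y i = y' + n *s r" for i using insert.prems(2)[of i] gen_insertE by metis
  then obtain y' n where y': "\<And>i. y' i \<in> gen H R" "\<And>i. y i = y' i + n i *s r" by metis
  obtain \<phi> :: "nat \<Rightarrow> nat" where \<phi>: "strict_mono \<phi>" "\<And>i j. i \<le> j \<Longrightarrow> y' (\<phi> j) \<in> gen {y' (\<phi> i)} R"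
    using insert.IH[of y'] insert.prems y' by blast
  \<comment> \<open>Along \<open>\<phi>\<close> the parts free of \<open>r\<close> already grow;
    thinning out once more makes the multiplicities of \<open>r\<close> grow too and keeps the first
    property.\<close>
  obtain \<psi> where \<psi>: "strict_mono \<psi>" "incseq ((n \<circ> \<phi>) \<circ> \<psi>)"
    using nat_incseq_subseq[of "n \<circ> \<phi>"] by blast
  have "y (\<phi> (\<psi> j)) \<in> gen {y (\<phi> (\<psi> i))} (insert r R)" if "i \<le> j" for i j
  proof -
    have "n (\<phi> (\<psi> i)) \<le> n (\<phi> (\<psi> j))" using \<psi>(2) that by (auto simp: incseq_def)
    then obtain d where d: "n (\<phi> (\<psi> j)) = n (\<phi> (\<psi> i)) + d" using le_Suc_ex by blast
    have "\<psi> i \<le> \<psi> j" using \<psi>(1) that by (simp add: strict_mono_less_eq)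
    then have "y' (\<phi> (\<psi> j)) \<in> gen {y' (\<phi> (\<psi> i))} R" by (rule \<phi>(2))
    from gen_translate[OF this, of "n (\<phi> (\<psi> i)) *s r"]
    have "y' (\<phi> (\<psi> j)) + n (\<phi> (\<psi> i)) *s r \<in> gen {y (\<phi> (\<psi> i))} (insert r R)"
      unfolding y'(2) by (rule gen_mono) auto
    from gen_smult[OF this, of r d] show ?thesis
      unfolding y'(2)[of "\<phi> (\<psi> j)"] d by (simp add: vector_sadd_rdistrib add.assoc)
  qed
  moreover have "strict_mono (\<phi> \<circ> \<psi>)" using \<phi> \<psi> strict_mono_o by blast
  ultimately show ?case by (intro exI[of _ "\<phi> \<circ> \<psi>"]) (simp add: comp_def)
qed

lemma gen_acc:
  assumes "finite R" "finite H" and U: "incseq U" "\<And>n. U n \<subseteq> gen H R"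
    and cl: "\<And>n x r. x \<in> U n \<Longrightarrow> r \<in> R \<Longrightarrow> x + r \<in> U n"
  obtains N where "\<And>n. n \<ge> N \<Longrightarrow> U n = U N"
proof -
  have "\<exists>N. \<forall>n\<ge>N. U n = U N"
  proof (rule ccontr)
    assume "\<nexists>N. \<forall>n\<ge>N. U n = U N"
    then have "\<exists>n x. n \<ge> N \<and> x \<in> U n - U N" for N
      using U(1) by (metis (full_types) DiffI incseqD subsetI subset_antisym)
    then obtain g :: "nat \<Rightarrow> nat" and x where g: "\<And>N. g N \<ge> N" "\<And>N. x N \<in> U (g N)" "\<And>N. x N \<notin> U N" by (metis DiffE)
    \<comment> \<open>Iterating \<open>g\<close> links the escaping elements: \<open>x (m i)\<close>
      lies in \<open>U (m (Suc i))\<close> but not in \<open>U (m i)\<close>. A later element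
      generated by an earlier one would stay in the earlier stable set.\<close>
    define m where "m i = (g ^^ i) 0" for i
    have m: "m (Suc i) = g (m i)" for i by (simp add: m_def)
    have mm: "incseq m" by (rule incseq_SucI) (simp add: m g)
    have "x (m i) \<in> gen H R" for i using g(2) U(2) by blast
    then obtain \<phi> :: "nat \<Rightarrow> nat" where \<phi>: "strict_mono \<phi>" "\<And>i j. i \<le> j \<Longrightarrow> x (m (\<phi> j)) \<in> gen {x (m (\<phi> i))} R"
      using gen_wqo[OF assms(1,2), of "\<lambda>i. x (m i)"] by blast
    have "x (m (\<phi> 1)) \<in> U (m (Suc (\<phi> 0)))"
      by (rule gen_closed_subset[OF \<phi>(2)[of 0 1]]) (use g cl in \<open>auto simp: m\<close>)
    moreover have "U (m (Suc (\<phi> 0))) \<subseteq> U (m (\<phi> 1))"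
      using \<phi>(1) U(1) mm by (intro incseqD[OF U(1)] incseqD[OF mm]) (simp add: Suc_leI strict_mono_less)
    ultimately show False using g(3) by blast
  qed
  then show ?thesis using that by blast
qed

locale exponential_weight =
  fixes W :: "nat^'n::finite \<Rightarrow> complex \<Rightarrow> complex" and e :: "nat^'n \<Rightarrow> complex \<Rightarrow> complex"
  assumes W_add: "\<And>x r s. W (x + r) s = W x s * e r s"
    and W_holo: "\<And>x. W x holomorphic_on UNIV" and e_holo: "\<And>r. e r holomorphic_on UNIV"
    and W_sum: "\<And>s. Re s > 0 \<Longrightarrow> (\<lambda>x. norm (W x s)) summable_on UNIV"
begin

lemma W_summable: "Re s > 0 \<Longrightarrow> (\<lambda>x. W x s) summable_on A"
  by (rule summable_on_subset_banach[OF abs_summable_summable[OF W_sum]]) auto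

lemma W_smult: "W (x + j *s r) s = W x s * e r s ^ j"
proof (induction j)
  case (Suc j)
  have "x + Suc j *s r = (x + j *s r) + r" by (simp add: vec_eq_iff)
  then have "W (x + Suc j *s r) s = W (x + j *s r) s * e r s" by (metis W_add)
  also have "\<dots> = W x s * e r s ^ Suc j" by (simp only: Suc power_Suc2 mult.assoc)
  finally show ?case .
qed simp

lemma infsum_W_translate:
  "infsum (\<lambda>x. W x s) ((\<lambda>x. x + j *s r) ` A) = e r s ^ j * infsum (\<lambda>x. W x s) A"
proof -
  have inj: "inj_on (\<lambda>x. x + j *s r) A" by (rule inj_onI) simp
  have "infsum (\<lambda>x. W x s) ((\<lambda>x. x + j *s r) ` A) = infsum (\<lambda>x. W (x + j *s r) s) A"
    using infsum_reindex[OF inj, of "\<lambda>x. W x s"] by (simp only: comp_def)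
  also have "\<dots> = infsum (\<lambda>x. e r s ^ j * W x s) A"
    by (simp only: W_smult mult.commute)
  also have "\<dots> = e r s ^ j * infsum (\<lambda>x. W x s) A"
    by (rule infsum_cmult_right')
  finally show ?thesis .
qed

text \<open>Each point of \<open>U - V\<close> is uniquely \<open>y + j *s r\<close> with \<open>y\<close> generated without \<open>r\<close> and \<open>j\<close> minimal.  By the chain
  condition the sets of admissible \<open>y\<close> are constant for large \<open>j\<close>, so that the tail of the sum is a
  geometric series with ratio \<open>e r s\<close>.  These sets are differences of stable sets again.\<close>

lemma regular_at_gen_diff:
  assumes "finite R" "finite H" "\<And>r. r \<in> R \<Longrightarrow> e r s0 \<noteq> 1"
    and "U \<subseteq> gen H R" "\<And>x r. x \<in> U \<Longrightarrow> r \<in> R \<Longrightarrow> x + r \<in> U"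
    and "\<And>x r. x \<in> V \<Longrightarrow> r \<in> R \<Longrightarrow> x + r \<in> V"
  shows "regular_at s0 (\<lambda>s. infsum (\<lambda>x. W x s) (U - V))"
  using assms
proof (induction R arbitrary: U V rule: finite_induct)
  case empty
  then have "U - V \<subseteq> H" by auto
  then have "finite (U - V)" using empty.prems(1) by (rule finite_subset)
  then have "regular_at s0 (\<lambda>s. \<Sum>x\<in>U - V. W x s)"
    by (rule regular_at_sum) (rule regular_at_holomorphic[OF W_holo])
  moreover have "infsum (\<lambda>x. W x s) (U - V) = (\<Sum>x\<in>U - V. W x s)" for s
    by (rule infsum_finite) fact
  ultimately show ?case by simp
next
  case (insert r R)
  define Y where "Y = gen H R"
  have Ycl: "y + r' \<in> Y" if "y \<in> Y" "r' \<in> R" for y r' using that by (auto simp: Y_def intro: gen.intros)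
  have swap: "(y + r') + j *s r = (y + j *s r) + r'" for y r' j by (simp add: add_ac)
  define P where "P j = {y \<in> Y. y + j *s r \<in> U}" for j
  \<comment> \<open>If \<open>y + l *s r\<close> were again in \<open>Y\<close>, the multiplicity
    \<open>j\<close> could be lowered to \<open>j - l\<close>; excluding this makes \<open>j\<close>
    minimal. Letting \<open>l\<close> range up to \<open>j\<close> makes \<open>M\<close>
    increasing, so that the chain condition applies to it as well as to \<open>P\<close>.\<close>
  define M where "M j = {y \<in> Y. y + j *s r \<in> V \<or> (\<exists>l\<in>{1..j}. y + l *s r \<in> Y)}" for j
  define X where "X j = P j - M j" for j
  have Suc_eq: "y + Suc j *s r = (y + j *s r) + r" for y j by (simp add: vec_eq_iff)
  have Pm: "incseq P" by (rule incseq_SucI) (use insert.prems(4) in \<open>auto simp only: P_def Suc_eq\<close>)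
  have Mm: "incseq M"
  proof (rule incseq_SucI, rule subsetI)
    fix j y assume "y \<in> M j"
    then have "y \<in> Y" "y + j *s r \<in> V \<or> (\<exists>l\<in>{1..j}. y + l *s r \<in> Y)" by (auto simp: M_def)
    moreover have "y + Suc j *s r \<in> V" if "y + j *s r \<in> V" unfolding Suc_eq using that insert.prems(5) by blast
    moreover have "\<exists>l\<in>{1..Suc j}. y + l *s r \<in> Y" if "l \<in> {1..j}" "y + l *s r \<in> Y" for l
      using that by (intro bexI[of _ l]) auto
    ultimately show "y \<in> M (Suc j)" unfolding M_def by blast
  qed
  have Pcl: "y + r' \<in> P j" if "y \<in> P j" "r' \<in> R" for y r' j
  proof -
    have "(y + j *s r) + r' \<in> U" using that insert.prems(4) by (auto simp: P_def)
    then have "(y + r') + j *s r \<in> U" by (simp only: swap)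
    moreover have "y + r' \<in> Y" using that Ycl by (simp add: P_def)
    ultimately show ?thesis by (simp add: P_def)
  qed
  have Mcl: "y + r' \<in> M j" if "y \<in> M j" "r' \<in> R" for y r' j
  proof -
    have y: "y \<in> Y" "y + j *s r \<in> V \<or> (\<exists>l\<in>{1..j}. y + l *s r \<in> Y)" using that by (auto simp: M_def)
    then have "(y + r') + j *s r \<in> V \<or> (\<exists>l\<in>{1..j}. (y + r') + l *s r \<in> Y)"
      unfolding swap using insert.prems(5) that Ycl by blast
    then show ?thesis using Ycl[OF y(1) that(2)] by (simp only: M_def mem_Collect_eq simp_thms)
  qed
  have PY: "P j \<subseteq> gen H R" and MY: "M j \<subseteq> gen H R" for j by (auto simp: P_def M_def Y_def)
  obtain J1 where J1: "\<And>j. j \<ge> J1 \<Longrightarrow> P j = P J1"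
    by (rule gen_acc[OF insert.hyps(1) insert.prems(1) Pm PY Pcl], assumption, assumption, rule that)
  obtain J2 where J2: "\<And>j. j \<ge> J2 \<Longrightarrow> M j = M J2"
    by (rule gen_acc[OF insert.hyps(1) insert.prems(1) Mm MY Mcl], assumption, assumption, rule that)
  define J where "J = max J1 J2"
  have XJ: "X j = X J" if "j \<ge> J" for j
  proof -
    have "P j = P J" "M j = M J" using J1[of j] J1[of J] J2[of j] J2[of J] that by (simp_all add: J_def)
    then show ?thesis by (simp add: X_def)
  qed
  define sl where "sl j = (\<lambda>y. y + j *s r) ` X j" for j
  have reg: "regular_at s0 (\<lambda>s. infsum (\<lambda>x. W x s) (X j))" for j
    unfolding X_def by (rule insert.IH[OF insert.prems(1) _ PY Pcl Mcl]) (simp_all add: insert.prems(2))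
  have disj: "sl i \<inter> sl j = {}" if "i < j" for i j
  proof (rule ccontr)
    assume "sl i \<inter> sl j \<noteq> {}"
    then obtain y y' where y: "y \<in> X i" "y' \<in> X j" "y + i *s r = y' + j *s r" by (auto simp: sl_def)
    define d where "d = j - i"
    then have d: "j = d + i" "d \<ge> 1" using that by auto
    have "y + i *s r = (y' + d *s r) + i *s r" using y(3) by (simp add: d vector_sadd_rdistrib add.assoc)
    then have "y = y' + d *s r" by simp
    then have "y' + d *s r \<in> Y" using y(1) by (simp add: X_def P_def)
    then have "\<exists>l\<in>{1..j}. y' + l *s r \<in> Y" using d by (intro bexI[of _ d]) auto
    then have "y' \<in> M j" using y(2) by (simp add: M_def X_def P_def)
    then show False using y(2) by (simp add: X_def)
  qed
  have Uc: "U - V = (\<Union>j. sl j)"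
  proof (intro equalityI subsetI)
    fix x assume x: "x \<in> U - V"
    then have "x \<in> gen H (insert r R)" using insert.prems(3) by blast
    then have "\<exists>j y. y \<in> Y \<and> x = y + j *s r" unfolding Y_def by (rule gen_insertE) blast
    then obtain j where j: "\<exists>y. y \<in> Y \<and> x = y + j *s r" "\<And>i. i < j \<Longrightarrow> \<not>(\<exists>y. y \<in> Y \<and> x = y + i *s r)"
      using exists_least_iff[of "\<lambda>j. \<exists>y. y \<in> Y \<and> x = y + j *s r"] by blast
    then obtain y where y: "y \<in> Y" "x = y + j *s r" by blast
    have "y + l *s r \<notin> Y" if "l \<in> {1..j}" for l
    proof
      assume "y + l *s r \<in> Y"
      moreover have "x = (y + l *s r) + (j - l) *s r"
        using y that by (simp add: add.assoc flip: vector_sadd_rdistrib)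
      ultimately show False using j(2)[of "j - l"] that by auto
    qed
    then have "y \<in> X j" using x y by (auto simp: X_def P_def M_def)
    then show "x \<in> (\<Union>j. sl j)" using y by (auto simp: sl_def)
  next
    fix x assume "x \<in> (\<Union>j. sl j)"
    then obtain j y where "y \<in> X j" "x = y + j *s r" by (auto simp: sl_def)
    then show "x \<in> U - V" by (auto simp: X_def P_def M_def)
  qed
  define T where "T = (\<Union>j\<in>{J..}. sl j)"
  have slS: "sl (Suc j) = (\<lambda>x. x + 1 *s r) ` sl j" if "j \<ge> J" for j
    using XJ[of j] XJ[of "Suc j"] that by (auto simp: sl_def image_image Suc_eq)
  have TS: "(\<lambda>x. x + 1 *s r) ` T = (\<Union>j\<in>{Suc J..}. sl j)"
  proof -
    have "(\<lambda>x. x + 1 *s r) ` T = (\<Union>j\<in>{J..}. sl (Suc j))"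
      unfolding T_def image_UN by (intro SUP_cong refl) (rule slS[symmetric], simp)
    also have "\<dots> = (\<Union>j\<in>Suc ` {J..}. sl j)" by (simp only: image_image)
    also have "Suc ` {J..} = {Suc J..}"
    proof (intro equalityI subsetI)
      fix x assume "x \<in> {Suc J..}"
      then have "x = Suc (x - 1)" "x - 1 \<in> {J..}" by auto
      then show "x \<in> Suc ` {J..}" by (rule image_eqI)
    qed auto
    finally show ?thesis .
  qed
  have T: "T = sl J \<union> (\<lambda>x. x + 1 *s r) ` T"
  proof -
    have "{J..} = insert J {Suc J..}" by auto
    then have "T = sl J \<union> (\<Union>j\<in>{Suc J..}. sl j)" by (simp only: T_def UN_insert)
    then show ?thesis unfolding TS .
  qed
  have disjU: "sl i \<inter> (\<Union>j\<in>A. sl j) = {}" if "\<And>j. j \<in> A \<Longrightarrow> i < j" for i A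
    using disj that by blast
  have Td: "sl J \<inter> (\<lambda>x. x + 1 *s r) ` T = {}"
    unfolding TS by (rule disjU) simp
  have regT: "regular_at s0 (\<lambda>s. infsum (\<lambda>x. W x s) T)"
  proof (rule regular_at_divide)
    show "regular_at s0 (\<lambda>s. (1 - e r s) * infsum (\<lambda>x. W x s) T)"
    proof (rule regular_at_cong)
      fix s :: complex assume s: "Re s > 0"
      have "infsum (\<lambda>x. W x s) T = infsum (\<lambda>x. W x s) (sl J) + infsum (\<lambda>x. W x s) ((\<lambda>x. x + 1 *s r) ` T)"
        by (subst T) (rule infsum_Un_disjoint[OF W_summable[OF s] W_summable[OF s] Td])
      also have "\<dots> = e r s ^ J * infsum (\<lambda>x. W x s) (X J) + e r s * infsum (\<lambda>x. W x s) T"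
        unfolding sl_def infsum_W_translate by simp
      finally show "(1 - e r s) * infsum (\<lambda>x. W x s) T = e r s ^ J * infsum (\<lambda>x. W x s) (X J)"
        by (simp add: algebra_simps)
    qed (intro regular_at_mult regular_at_holomorphic reg holomorphic_intros e_holo)
  qed (use insert.prems e_holo in \<open>auto intro!: holomorphic_intros\<close>)
  show ?case
  proof (rule regular_at_cong)
    fix s :: complex assume s: "Re s > 0"
    have "UNIV = {..<J} \<union> {J..}" by auto
    then have UV: "U - V = (\<Union>j\<in>{..<J}. sl j) \<union> T" unfolding Uc T_def by (metis UN_Un)
    have dT: "(\<Union>j\<in>{..<J}. sl j) \<inter> T = {}"
    proof -
      have "sl i \<inter> T = {}" if "i < J" for i unfolding T_def by (rule disjU) (use that in auto)
      then show ?thesis by blast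
    qed
    have "infsum (\<lambda>x. W x s) (U - V) = infsum (\<lambda>x. W x s) (\<Union>j\<in>{..<J}. sl j) + infsum (\<lambda>x. W x s) T"
      unfolding UV by (rule infsum_Un_disjoint[OF W_summable[OF s] W_summable[OF s] dT])
    also have "infsum (\<lambda>x. W x s) (\<Union>j\<in>{..<J}. sl j) = (\<Sum>j<J. infsum (\<lambda>x. W x s) (sl j))"
    proof (rule sum_infsum[symmetric])
      show "finite {..<J}" by simp
      show "(\<lambda>x. W x s) summable_on sl j" for j by (rule W_summable[OF s])
      fix a b assume "a \<in> {..<J}" "b \<in> {..<J}" "a \<noteq> b"
      then show "sl a \<inter> sl b = {}" using disj[of a b] disj[of b a] by (metis Int_commute linorder_neqE_nat)
    qed
    finally show "infsum (\<lambda>x. W x s) (U - V) = (\<Sum>j<J. e r s ^ j * infsum (\<lambda>x. W x s) (X j)) + infsum (\<lambda>x. W x s) T"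
      by (simp add: sl_def infsum_W_translate)
  qed (intro regular_at_add regT regular_at_sum regular_at_mult regular_at_holomorphic reg holomorphic_intros e_holo; simp)
qed

end

section \<open>Weights of lattice points\<close>

abbreviation dotn :: "nat^'n::finite \<Rightarrow> nat^'n \<Rightarrow> nat" where
  "dotn P k \<equiv> (\<Sum>i\<in>UNIV. P $ i * k $ i)"

text \<open>This is p^(-\<sigma>(k) - (P.k) s). Having \<open>P.k\<close> instead of m(k) makes it
  multiplicative in \<open>k\<close> on all lattice points; on the dual cone of \<open>P\<close> the
  two agree.\<close>

definition zeta_weight :: "nat \<Rightarrow> nat^'n::finite \<Rightarrow> nat^'n \<Rightarrow> complex \<Rightarrow> complex" where
  "zeta_weight p P k s =
     exp (- of_real (ln (real p)) * (of_nat (\<Sum>i\<in>UNIV. k $ i) + of_nat (dotn P k) * s))"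

lemma zeta_weight_add: "zeta_weight p P (x + r) s = zeta_weight p P x s * zeta_weight p P r s"
  unfolding zeta_weight_def exp_add[symmetric]
  by (rule arg_cong[of _ _ exp]) (simp add: algebra_simps sum.distrib)

lemma zeta_weight_holomorphic: "zeta_weight p P x holomorphic_on A"
  unfolding zeta_weight_def by (intro holomorphic_intros)

lemma summable_power_vec:
  fixes q :: real
  assumes q: "0 \<le> q" "q < 1"
  shows "(\<lambda>k::nat^'n::finite. q ^ (\<Sum>i\<in>UNIV. k $ i)) summable_on UNIV"
proof (rule nonneg_bdd_above_summable_on)
  show "bdd_above (sum (\<lambda>k::nat^'n. q ^ (\<Sum>i\<in>UNIV. k $ i)) ` {F. F \<subseteq> UNIV \<and> finite F})"
  proof (rule bdd_aboveI2)
    fix F :: "(nat^'n) set" assume "F \<in> {F. F \<subseteq> UNIV \<and> finite F}"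
    then have F: "finite F" by simp
    \<comment> \<open>\<open>N\<close> exceeds every coordinate occurring in \<open>F\<close>, so
      \<open>F\<close> lies in a cube over which the sum factors into finite geometric
      series.\<close>
    define N where "N = Suc (\<Sum>k\<in>F. \<Sum>i\<in>UNIV. k $ i)"
    define B where "B = vec_lambda ` (PiE (UNIV::'n set) (\<lambda>_. {..<N}))"
    have inj: "inj_on vec_lambda A" for A :: "('n \<Rightarrow> nat) set" by (rule inj_onI) (simp add: vec_lambda_inject)
    have "k $ i < N" if "k \<in> F" for k i
    proof -
      have "k $ i \<le> (\<Sum>i\<in>UNIV. k $ i)" by (rule member_le_sum) auto
      also have "\<dots> \<le> (\<Sum>k\<in>F. \<Sum>i\<in>UNIV. k $ i)" using F that by (intro member_le_sum) auto
      finally show ?thesis by (simp add: N_def)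
    qed
    then have FB: "F \<subseteq> B" unfolding B_def by (auto intro!: image_eqI[of _ _ "vec_nth _"] simp: vec_nth_inverse)
    have "sum (\<lambda>k::nat^'n. q ^ (\<Sum>i\<in>UNIV. k $ i)) F \<le> sum (\<lambda>k. q ^ (\<Sum>i\<in>UNIV. k $ i)) B"
      by (rule sum_mono2) (use FB q in \<open>auto simp: B_def intro!: finite_imageI finite_PiE\<close>)
    also have "\<dots> = (\<Sum>x\<in>PiE (UNIV::'n set) (\<lambda>_. {..<N}). \<Prod>i\<in>UNIV. q ^ x i)"
      unfolding B_def by (subst sum.reindex[OF inj]) (simp add: power_sum)
    also have "\<dots> = (\<Prod>i\<in>(UNIV::'n set). \<Sum>j<N. q ^ j)"
      by (rule prod_sum_PiE[symmetric]) auto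
    also have "\<dots> \<le> (\<Prod>i\<in>(UNIV::'n set). 1 / (1 - q))"
      by (rule prod_mono) (use q in \<open>auto intro!: divide_nonneg_nonneg simp: sum_gp_strict divide_right_mono power_le_one\<close>)
    finally show "sum (\<lambda>k::nat^'n. q ^ (\<Sum>i\<in>UNIV. k $ i)) F \<le> (\<Prod>i\<in>(UNIV::'n set). 1 / (1 - q))" .
  qed
qed (use q in auto)

lemma norm_zeta_weight_le:
  assumes p: "p \<ge> 2" and s: "Re s \<ge> 0"
  shows "norm (zeta_weight p P k s) \<le> (1 / real p) ^ (\<Sum>i\<in>UNIV. k $ i)"
proof -
  have l: "ln (real p) \<ge> 0" using p by simp
  have "norm (zeta_weight p P k s) = exp (- ln (real p) * (real (\<Sum>i\<in>UNIV. k $ i) + real (dotn P k) * Re s))"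
    by (simp add: zeta_weight_def)
  also have "\<dots> \<le> exp (- ln (real p) * real (\<Sum>i\<in>UNIV. k $ i))"
    using l s by (auto simp: algebra_simps intro!: mult_nonneg_nonneg sum_nonneg)
  also have "\<dots> = exp (- ln (real p)) ^ (\<Sum>i\<in>UNIV. k $ i)"
    by (metis exp_of_nat_mult mult.commute)
  also have "exp (- ln (real p)) = 1 / real p" using p by (simp add: exp_minus inverse_eq_divide)
  finally show ?thesis .
qed

lemma norm_zeta_weight_summable:
  assumes p: "p \<ge> 2" and s: "Re s \<ge> 0"
  shows "(\<lambda>k. norm (zeta_weight p P k s)) summable_on A"
  by (rule summable_on_comparison_test[OF summable_on_subset_banach[OF summable_power_vec[of "1 / real p"]]])
     (use assms norm_zeta_weight_le[OF assms] in auto)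

lemma exponential_weight_zeta: "p \<ge> 2 \<Longrightarrow> exponential_weight (zeta_weight p P) (zeta_weight p P)"
  by unfold_locales
     (auto simp: zeta_weight_add zeta_weight_holomorphic intro: norm_zeta_weight_summable)

section \<open>Cones generated by integer vectors\<close>

definition ncone :: "(nat^'n::finite) set \<Rightarrow> (real^'n) set" where
  "ncone R = {x. \<exists>c. (\<forall>r\<in>R. 0 \<le> c r) \<and> x = (\<Sum>r\<in>R. c r *\<^sub>R exponent_point r)}"

lemma exponent_point_nth [simp]: "exponent_point v $ i = real (v $ i)"
  by (simp add: exponent_point_def)

lemma exponent_point_add: "exponent_point (v + w) = exponent_point v + exponent_point w"
  by (simp add: vec_eq_iff)

lemma exponent_point_inject: "exponent_point v = exponent_point w \<longleftrightarrow> v = w"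
  by (simp add: vec_eq_iff)

lemma ncone_zero: "0 \<in> ncone R"
  unfolding ncone_def by (auto intro!: exI[of _ "\<lambda>_. 0"])

lemma ncone_add: "x \<in> ncone R \<Longrightarrow> y \<in> ncone R \<Longrightarrow> x + y \<in> ncone R"
  unfolding ncone_def
proof clarify
  fix c d :: "nat^'a \<Rightarrow> real" assume "\<forall>r\<in>R. 0 \<le> c r" "\<forall>r\<in>R. 0 \<le> d r"
  then show "\<exists>e. (\<forall>r\<in>R. 0 \<le> e r) \<and>
      (\<Sum>r\<in>R. c r *\<^sub>R exponent_point r) + (\<Sum>r\<in>R. d r *\<^sub>R exponent_point r) = (\<Sum>r\<in>R. e r *\<^sub>R exponent_point r)"
    by (intro exI[of _ "\<lambda>r. c r + d r"]) (auto simp: sum.distrib scaleR_left_distrib)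
qed

lemma ncone_scale: "x \<in> ncone R \<Longrightarrow> 0 \<le> t \<Longrightarrow> t *\<^sub>R x \<in> ncone R"
  unfolding ncone_def
proof clarify
  fix c :: "nat^'a \<Rightarrow> real" assume "\<forall>r\<in>R. 0 \<le> c r" "0 \<le> t"
  then show "\<exists>e. (\<forall>r\<in>R. 0 \<le> e r) \<and>
      t *\<^sub>R (\<Sum>r\<in>R. c r *\<^sub>R exponent_point r) = (\<Sum>r\<in>R. e r *\<^sub>R exponent_point r)"
    by (intro exI[of _ "\<lambda>r. t * c r"]) (auto simp: scaleR_sum_right)
qed

lemma ncone_mem: "finite R \<Longrightarrow> r \<in> R \<Longrightarrow> exponent_point r \<in> ncone R"
  unfolding ncone_def
  by (intro CollectI exI[of _ "\<lambda>x. if x = r then 1 else 0"]) (auto simp: if_distrib[of "\<lambda>c. c *\<^sub>R _"] cong: if_cong)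

lemma ncone_sum: "finite A \<Longrightarrow> (\<And>a. a \<in> A \<Longrightarrow> f a \<in> ncone R) \<Longrightarrow> sum f A \<in> ncone R"
  by (induction A rule: finite_induct) (auto intro: ncone_zero ncone_add)

lemma ncone_mono:
  assumes "x \<in> ncone R" "R \<subseteq> R'" "finite R'"
  shows "x \<in> ncone R'"
proof -
  obtain c where c: "\<forall>r\<in>R. 0 \<le> c r" "x = (\<Sum>r\<in>R. c r *\<^sub>R exponent_point r)"
    using assms(1) unfolding ncone_def by blast
  show ?thesis unfolding c(2)
    by (rule ncone_sum) (use assms c in \<open>auto intro!: ncone_scale ncone_mem intro: finite_subset\<close>)
qed

lemma ncone_induct:
  assumes "x \<in> ncone R" "finite R" "P 0" "\<And>x y. P x \<Longrightarrow> P y \<Longrightarrow> P (x + y)"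
    "\<And>r t. r \<in> R \<Longrightarrow> 0 \<le> t \<Longrightarrow> P (t *\<^sub>R exponent_point r)"
  shows "P x"
proof -
  obtain c where c: "\<forall>r\<in>R. 0 \<le> c r" "x = (\<Sum>r\<in>R. c r *\<^sub>R exponent_point r)"
    using assms(1) unfolding ncone_def by blast
  have "P (\<Sum>r\<in>A. c r *\<^sub>R exponent_point r)" if "finite A" "A \<subseteq> R" for A
    using that by (induction A rule: finite_induct) (use assms c in auto)
  then show ?thesis using c assms by blast
qed

lemma gen_add_sum:
  assumes "finite A" "A \<subseteq> R" "h \<in> H"
  shows "h + (\<Sum>r\<in>A. n r *s r) \<in> gen H R"
  using assms(1,2)
proof (induction A rule: finite_induct)
  case empty
  then show ?case using assms by (auto intro: gen.base)
next
  case (insert a A)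
  then have "(h + (\<Sum>r\<in>A. n r *s r)) + n a *s a \<in> gen H R" by (intro gen_smult) auto
  then show ?case using insert by (simp add: add_ac)
qed

text \<open>Gordan's lemma: subtracting the integer parts of the coefficients leaves a vector with
  natural coordinates that is bounded by the sum of the generators.\<close>

lemma ncone_gen:
  assumes R: "finite R" and k: "exponent_point k \<in> ncone R"
  shows "k \<in> gen {h. \<forall>i. h $ i \<le> (\<Sum>r\<in>R. r $ i)} R"
proof -
  obtain c where c: "\<forall>r\<in>R. 0 \<le> c r" "exponent_point k = (\<Sum>r\<in>R. c r *\<^sub>R exponent_point r)"
    using k unfolding ncone_def by blast
  have ki: "real (k $ i) = (\<Sum>r\<in>R. c r * real (r $ i))" for i
    using arg_cong[OF c(2), of "\<lambda>x. x $ i"] by (simp add: sum_component)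
  define n where "n r = nat \<lfloor>c r\<rfloor>" for r
  have n: "real (n r) \<le> c r" "c r \<le> real (n r) + 1" if "r \<in> R" for r
  proof -
    have "0 \<le> c r" using c(1) that by blast
    then show "real (n r) \<le> c r" "c r \<le> real (n r) + 1" unfolding n_def by linarith+
  qed
  have le: "(\<Sum>r\<in>R. n r * r $ i) \<le> k $ i" for i
  proof -
    have "real (\<Sum>r\<in>R. n r * r $ i) \<le> (\<Sum>r\<in>R. c r * real (r $ i))"
      unfolding of_nat_sum of_nat_mult by (intro sum_mono mult_right_mono n) auto
    then show ?thesis using ki[of i] by linarith
  qed
  define h where "h = (\<chi> i. k $ i - (\<Sum>r\<in>R. n r * r $ i))"
  have "h $ i \<le> (\<Sum>r\<in>R. r $ i)" for i
  proof -
    have "real (k $ i) \<le> (\<Sum>r\<in>R. (real (n r) + 1) * real (r $ i))"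
      unfolding ki by (intro sum_mono mult_right_mono n) auto
    also have "\<dots> = real ((\<Sum>r\<in>R. n r * r $ i) + (\<Sum>r\<in>R. r $ i))"
      by (simp add: algebra_simps sum.distrib)
    finally show ?thesis using le[of i] by (simp add: h_def del: of_nat_add of_nat_sum)
  qed
  then have "h + (\<Sum>r\<in>R. n r *s r) \<in> gen {h. \<forall>i. h $ i \<le> (\<Sum>r\<in>R. r $ i)} R"
    by (intro gen_add_sum R) auto
  also have "h + (\<Sum>r\<in>R. n r *s r) = k"
    using le by (simp add: vec_eq_iff h_def sum_component)
  finally show ?thesis .
qed

lemma finite_vec_le: "finite {h::nat^'n::finite. \<forall>i. h $ i \<le> b i}"
proof -
  have "{h::nat^'n. \<forall>i. h $ i \<le> b i} \<subseteq> vec_lambda ` (PiE UNIV (\<lambda>i. {..b i}))"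
    by (auto intro!: image_eqI[of _ _ "vec_nth _"] simp: vec_nth_inverse)
  then show ?thesis by (rule finite_subset) (intro finite_imageI finite_PiE, auto)
qed

text \<open>The generators may be linearly dependent: stability of \<open>T\<close> under adding
  them takes the place of a subdivision into simplicial cones, and Gordan's lemma supplies the
  finite set of starting points.\<close>

lemma regular_at_cone_series:
  assumes p: "p \<ge> 2" and R: "finite R" "\<And>r. r \<in> R \<Longrightarrow> zeta_weight p P r s0 \<noteq> 1"
    and T: "\<And>k. k \<in> T \<Longrightarrow> exponent_point k \<in> ncone R" "\<And>k r. k \<in> T \<Longrightarrow> r \<in> R \<Longrightarrow> k + r \<in> T"
  shows "regular_at s0 (\<lambda>s. infsum (\<lambda>k. zeta_weight p P k s) T)"
proof -
  interpret exponential_weight "zeta_weight p P" "zeta_weight p P" by (rule exponential_weight_zeta[OF p])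
  have "regular_at s0 (\<lambda>s. infsum (\<lambda>k. zeta_weight p P k s) (T - {}))"
    by (rule regular_at_gen_diff[OF R(1) finite_vec_le[of "\<lambda>i. \<Sum>r\<in>R. r $ i"] R(2)]) (use T ncone_gen[OF R(1)] in auto)
  then show ?thesis by simp
qed

section \<open>Norms and Haar measure\<close>

abbreviation pinv :: "'p::prime_card itself \<Rightarrow> real" where
  "pinv _ \<equiv> 1 / real CARD('p)"

abbreviation padic_p :: "'p::prime_card padic" where
  "padic_p \<equiv> of_nat CARD('p)"

lemma card_ge_2: "CARD('p::prime_card) \<ge> 2"
  using prime_ge_2_nat[OF prime_card] .

lemma pinv_bounds: "0 < pinv TYPE('p::prime_card)" "pinv TYPE('p) < 1"
  using card_ge_2[where 'p='p] by (auto simp: field_simps)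

lemma padic_norm_0 [simp]: "padic_norm (0::'p::prime_card padic) = 0"
  by (simp add: padic_norm_eq_0_iff)

lemma padic_norm_1 [simp]: "padic_norm (1::'p::prime_card padic) = 1"
  using padic_norm_mult[of "1::'p padic" 1] padic_norm_eq_0_iff[of "1::'p padic"] by simp

lemma padic_norm_power: "padic_norm (x ^ n) = padic_norm (x::'p::prime_card padic) ^ n"
  by (induction n) (auto simp: padic_norm_mult)

lemma padic_norm_prod: "padic_norm (\<Prod>i\<in>A. f i) = (\<Prod>i\<in>A. padic_norm (f i :: 'p::prime_card padic))"
  by (induction A rule: infinite_finite_induct) (auto simp: padic_norm_mult)

lemma padic_norm_minus_commute: "padic_norm (x - y) = padic_norm (y - x :: 'p::prime_card padic)"
  by (metis minus_diff_eq padic_norm_minus)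

lemma padic_norm_diff_le: "padic_norm x \<le> c \<Longrightarrow> padic_norm y \<le> c \<Longrightarrow> padic_norm (x - y :: 'p::prime_card padic) \<le> c"
  using padic_norm_add[of x "- y"] by (simp add: padic_norm_minus)

lemma padic_norm_add_le: "padic_norm x \<le> c \<Longrightarrow> padic_norm y \<le> c \<Longrightarrow> padic_norm (x + y :: 'p::prime_card padic) \<le> c"
  using padic_norm_add[of x y] by simp

lemma padic_norm_add_less: "padic_norm x < c \<Longrightarrow> padic_norm y < c \<Longrightarrow> padic_norm (x + y :: 'p::prime_card padic) < c"
  using padic_norm_add[of x y] by simp

lemma padic_norm_sum_le:
  assumes "\<And>i. i \<in> A \<Longrightarrow> padic_norm (f i :: 'p::prime_card padic) \<le> c" "0 \<le> c"
  shows "padic_norm (\<Sum>i\<in>A. f i) \<le> c"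
  using assms by (induction A rule: infinite_finite_induct) (auto intro: padic_norm_add_le)

lemma padic_norm_eq_of_diff:
  assumes "padic_norm (x - y) < padic_norm (y::'p::prime_card padic)"
  shows "padic_norm x = padic_norm y"
proof (rule antisym)
  show "padic_norm x \<le> padic_norm y"
    using padic_norm_add[of "x - y" y] assms by simp
  show "padic_norm y \<le> padic_norm x"
    using padic_norm_add[of "y - x" x] assms by (simp add: padic_norm_minus_commute[of y x] split: if_splits add: max_def)
qed

lemma padic_norm_of_int_le: "padic_norm (of_int m :: 'p::prime_card padic) \<le> 1"
proof -
  have "padic_norm (of_nat k :: 'p padic) \<le> 1" for k by (induction k) (auto intro: padic_norm_add_le)
  then show ?thesis by (cases m) (simp_all add: padic_norm_minus del: of_nat_Suc)
qed

lemma padic_norm_of_nat_le: "padic_norm (of_nat m :: 'p::prime_card padic) \<le> 1"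
  using padic_norm_of_int_le[of "int m"] by simp

lemma padic_norm_p: "padic_norm (padic_p :: 'p::prime_card padic) = pinv TYPE('p)"
proof -
  have p: "prime CARD('p)" by (rule prime_card)
  have "rat_padic_norm CARD('p) (of_int (int CARD('p)) / of_int 1) = real CARD('p) powi (int (multiplicity (int CARD('p)) 1) - int (multiplicity (int CARD('p)) (int CARD('p))))"
    by (rule rat_padic_norm_fraction[OF p]) (use card_ge_2[where 'p='p] in auto)
  also have "multiplicity (int CARD('p)) (int CARD('p)) = 1"
    using p by (intro multiplicity_self) auto
  finally have "rat_padic_norm CARD('p) (of_int (int CARD('p))) = pinv TYPE('p)"
    by (simp add: power_int_minus inverse_eq_divide)
  moreover have "(padic_p :: 'p padic) = of_int (int CARD('p))" by simp
  ultimately show ?thesis by (simp only: padic_of_int padic_norm_of_rat_seq)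
qed

text \<open>A Cauchy sequence that is not null has eventually constant norm, so completing the
  rationals creates no new values.\<close>

lemma padic_norm_values:
  assumes "x \<noteq> (0::'p::prime_card padic)"
  obtains n :: int where "padic_norm x = pinv TYPE('p) powi n"
proof -
  obtain X where X: "rat_padic_cauchy CARD('p) X" "x = padic_of_seq X" by (rule padic_cases)
  have "\<not> rat_padic_null CARD('p) X" using assms padic_of_seq_eq_0_iff[OF X(1)] X(2) by simp
  then obtain c N where c: "c > 0" "\<And>n. n \<ge> N \<Longrightarrow> rat_padic_norm CARD('p) (X n) = c"
    using rat_padic_cauchy_cases[OF prime_card X(1)] by metis
  have "(\<lambda>n. rat_padic_norm CARD('p) (X n)) \<longlonglongrightarrow> c"
    by (rule tendsto_eventually) (use c in \<open>auto simp: eventually_sequentially\<close>)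
  with padic_norm_of_seq[OF X(1)] X(2) have "padic_norm x = c" using LIMSEQ_unique by blast
  also have "c = rat_padic_norm CARD('p) (X N)" using c by simp
  also have "\<dots> = real CARD('p) powi (int (multiplicity (int CARD('p)) (snd (quotient_of (X N)))) - int (multiplicity (int CARD('p)) (fst (quotient_of (X N)))))"
    using c(1) c(2)[of N] by (auto simp: rat_padic_norm_def)
  finally obtain j :: int where j: "padic_norm x = real CARD('p) powi j" by blast
  have "real CARD('p) powi j = pinv TYPE('p) powi (- j)"
    by (simp add: power_int_minus power_int_divide_distrib)
  with j show ?thesis using that[of "- j"] by simp
qed

lemma padic_norm_nat_power:
  assumes "x \<noteq> (0::'p::prime_card padic)" "padic_norm x \<le> 1"
  obtains n :: nat where "padic_norm x = pinv TYPE('p) ^ n"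
proof -
  obtain n where n: "padic_norm x = pinv TYPE('p) powi n" using padic_norm_values[OF assms(1)] .
  have "n \<ge> 0"
  proof (rule ccontr)
    assume "\<not> n \<ge> 0"
    then have "pinv TYPE('p) powi 0 < pinv TYPE('p) powi n"
      using pinv_bounds[where 'p='p] by (intro power_int_strict_decreasing) auto
    then show False using n assms by simp
  qed
  then show ?thesis using that[of "nat n"] n by (simp add: power_int_def)
qed

text \<open>Discreteness of the values; it turns a strict inequality at level \<open>n\<close> into
  a weak one at level \<open>Suc n\<close>.\<close>

lemma padic_norm_less_imp_le:
  assumes "padic_norm (x::'p::prime_card padic) < pinv TYPE('p) ^ n"
  shows "padic_norm x \<le> pinv TYPE('p) ^ Suc n"
proof (cases "x = 0")
  case False
  obtain j where j: "padic_norm x = pinv TYPE('p) powi j" using padic_norm_values[OF False] .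
  have "int n < j"
  proof (rule ccontr)
    assume "\<not> int n < j"
    then have "pinv TYPE('p) powi int n \<le> pinv TYPE('p) powi j"
      using pinv_bounds[where 'p='p] by (intro power_int_decreasing) auto
    then show False using assms j by simp
  qed
  then have "pinv TYPE('p) powi j \<le> pinv TYPE('p) powi int (Suc n)"
    using pinv_bounds[where 'p='p] by (intro power_int_decreasing) auto
  then show ?thesis using j by (simp only: power_int_of_nat)
qed (use pinv_bounds[where 'p='p] in simp)

lemma pinv_power_less_iff: "pinv TYPE('p::prime_card) ^ a < pinv TYPE('p) ^ b \<longleftrightarrow> b < a"
  using pinv_bounds[where 'p='p] by (intro power_strict_decreasing_iff) auto

lemma pinv_power_le_iff: "pinv TYPE('p::prime_card) ^ a \<le> pinv TYPE('p) ^ b \<longleftrightarrow> b \<le> a"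
  using pinv_bounds[where 'p='p] by (intro power_decreasing_iff) auto

lemma pinv_power_eq_iff: "pinv TYPE('p::prime_card) ^ a = pinv TYPE('p) ^ b \<longleftrightarrow> a = b"
  using pinv_power_le_iff[where 'p='p, of a b] pinv_power_le_iff[where 'p='p, of b a]
  by (metis le_antisym order_refl)

lemma padic_digit:
  assumes "padic_norm (x::'p::prime_card padic) \<le> 1"
  shows "\<exists>!r. r < CARD('p) \<and> padic_norm (x - of_nat r) < 1"
proof (rule ex_ex1I)
  obtain m where m: "padic_norm (x - of_int m) < 1"
    using padic_integers_residue_ex[of x] assms unfolding padic_integers_def by blast
  define r where "r = nat (m mod int CARD('p))"
  have r: "int r = m mod int CARD('p)" "r < CARD('p)"
    using card_ge_2[where 'p='p] by (auto simp: r_def nat_less_iff)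
  have "int CARD('p) dvd m - int r" unfolding r(1) by (simp add: minus_mod_eq_div_mult)
  then have "padic_norm (of_int (m - int r) :: 'p padic) < 1" by (simp only: padic_norm_of_int_less_1)
  with m have "padic_norm ((x - of_int m) + of_int (m - int r)) < 1" by (rule padic_norm_add_less)
  then show "\<exists>r. r < CARD('p) \<and> padic_norm (x - of_nat r) < 1" using r(2) by auto
next
  fix r r' assume 1: "r < CARD('p) \<and> padic_norm (x - of_nat r) < 1" "r' < CARD('p) \<and> padic_norm (x - of_nat r') < 1"
  have "padic_norm ((x - of_nat r') + (of_nat r - x)) < 1"
    using 1 by (intro padic_norm_add_less) (auto simp: padic_norm_minus_commute[of "of_nat r"])
  then have "padic_norm (of_int (int r - int r') :: 'p padic) < 1" by simp
  then have "int CARD('p) dvd int r - int r'" by (simp only: padic_norm_of_int_less_1)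
  then have "int r mod int CARD('p) = int r' mod int CARD('p)" by (simp add: mod_eq_dvd_iff)
  then show "r = r'" using 1 by simp
qed

text \<open>The number \<open>r\<close> is the leading digit of \<open>- y / c\<close>. Uniqueness
  of digits thus says that exactly one of the translates of \<open>y\<close> drops to the next
  level, which is the source of every factor 1/p below.\<close>

lemma padic_digit_scaled:
  fixes c :: "'p::prime_card padic"
  assumes c: "padic_norm c = pinv TYPE('p) ^ n" and y: "padic_norm y \<le> pinv TYPE('p) ^ n"
  shows "\<exists>!r. r < CARD('p) \<and> padic_norm (y + of_nat r * c) \<le> pinv TYPE('p) ^ Suc n"
proof -
  have q: "pinv TYPE('p) ^ n > 0" using pinv_bounds[where 'p='p] by simp
  have c0: "c \<noteq> 0" using c q by auto
  have "padic_norm (- y / c) * padic_norm c = padic_norm y"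
    using c0 by (simp add: padic_norm_mult[symmetric] padic_norm_minus)
  then have "padic_norm (- y / c) * pinv TYPE('p) ^ n \<le> 1 * pinv TYPE('p) ^ n" using c y by simp
  then have "padic_norm (- y / c) \<le> 1" using q by (rule mult_right_le_imp_le)
  from padic_digit[OF this]
  have "\<exists>!r. r < CARD('p) \<and> padic_norm (- y / c - of_nat r) < 1" .
  moreover have "padic_norm (- y / c - of_nat r) < 1 \<longleftrightarrow> padic_norm (y + of_nat r * c) \<le> pinv TYPE('p) ^ Suc n" for r
  proof -
    have "y + of_nat r * c = - ((- y / c - of_nat r) * c)" using c0 by (simp add: field_simps)
    then have e: "padic_norm (y + of_nat r * c) = padic_norm (- y / c - of_nat r) * pinv TYPE('p) ^ n"
      by (metis padic_norm_minus padic_norm_mult c)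
    have "padic_norm (- y / c - of_nat r) < 1 \<longleftrightarrow> padic_norm (y + of_nat r * c) < pinv TYPE('p) ^ n"
      unfolding e using q by (auto simp: mult_less_cancel_right1)
    also have "\<dots> \<longleftrightarrow> padic_norm (y + of_nat r * c) \<le> pinv TYPE('p) ^ Suc n"
      using padic_norm_less_imp_le[of "y + of_nat r * c" n] pinv_power_less_iff[where 'p='p, of "Suc n" n] by fastforce
    finally show ?thesis .
  qed
  ultimately show ?thesis by simp
qed

section \<open>Boxes and their measure\<close>

definition padic_box :: "'p::prime_card padic ^ 'n::finite \<Rightarrow> nat ^ 'n \<Rightarrow> ('p padic ^ 'n) set" where
  "padic_box x k = {y. \<forall>i. padic_norm (y $ i - x $ i) \<le> pinv TYPE('p) ^ (k $ i)}"

lemma padic_open_if_locally_constant: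
  fixes A :: "('p::prime_card padic ^ 'n::finite) set"
  assumes "\<And>x y. x \<in> A \<Longrightarrow> (\<And>i. padic_norm (y $ i - x $ i) \<le> pinv TYPE('p) ^ n) \<Longrightarrow> y \<in> A"
  shows "open A"
  unfolding open_vec_def
proof (intro ballI)
  fix x assume x: "x \<in> A"
  show "\<exists>S. (\<forall>i. open (S i) \<and> x $ i \<in> S i) \<and> (\<forall>y. (\<forall>i. y $ i \<in> S i) \<longrightarrow> y \<in> A)"
  proof (intro exI[of _ "\<lambda>i. ball (x $ i) (pinv TYPE('p) ^ n)"] conjI allI impI)
    fix y assume "\<forall>i. y $ i \<in> ball (x $ i) (pinv TYPE('p) ^ n)"
    then show "y \<in> A" by (intro assms[OF x]) (auto simp: dist_padic_def padic_norm_minus_commute less_imp_le)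
  qed (use pinv_bounds[where 'p='p] in auto)
qed

lemma padic_box_open: "open (padic_box x k :: ('p::prime_card padic ^ 'n::finite) set)"
proof (rule padic_open_if_locally_constant[of _ "\<Sum>i\<in>UNIV. k $ i"])
  fix y z :: "'p padic ^ 'n"
  assume y: "y \<in> padic_box x k" and z: "\<And>i. padic_norm (z $ i - y $ i) \<le> pinv TYPE('p) ^ (\<Sum>i\<in>UNIV. k $ i)"
  have "padic_norm (z $ i - x $ i) \<le> pinv TYPE('p) ^ (k $ i)" for i
  proof -
    have "k $ i \<le> (\<Sum>i\<in>UNIV. k $ i)" by (rule member_le_sum) auto
    then have "padic_norm (z $ i - y $ i) \<le> pinv TYPE('p) ^ (k $ i)"
      using z[of i] pinv_power_le_iff[where 'p='p] by (meson order_trans)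
    then have "padic_norm ((z $ i - y $ i) + (y $ i - x $ i)) \<le> pinv TYPE('p) ^ (k $ i)"
      using y by (intro padic_norm_add_le) (auto simp: padic_box_def)
    then show ?thesis by simp
  qed
  then show "z \<in> padic_box x k" by (simp add: padic_box_def)
qed

locale haar =
  fixes \<mu> :: "('p::prime_card padic ^ 'n::finite) measure"
  assumes haar: "haar_measure_normalized \<mu>"
begin

lemma sets_eq [measurable_cong]: "sets \<mu> = sets borel"
  using haar by (simp add: haar_measure_normalized_def)

lemma translate: "A \<in> sets borel \<Longrightarrow> emeasure \<mu> ((+) a ` A) = emeasure \<mu> A"
  using haar by (simp add: haar_measure_normalized_def)

lemma open_sets: "open A \<Longrightarrow> A \<in> sets \<mu>"
  by (simp add: sets_eq)

lemma translate_sets: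
  assumes "A \<in> sets borel"
  shows "(+) (a :: 'p padic ^ 'n) ` A \<in> sets borel"
proof -
  have c: "continuous_on UNIV (\<lambda>x. - a + x :: 'p padic ^ 'n)"
    unfolding continuous_on_open_vimage[OF open_UNIV]
  proof (intro allI impI)
    fix B :: "('p padic ^ 'n) set" assume B: "open B"
    show "open ((\<lambda>x. - a + x) -` B \<inter> UNIV)"
      unfolding open_vec_def
    proof (intro ballI)
      fix x assume "x \<in> (\<lambda>x. - a + x) -` B \<inter> UNIV"
      then have "- a + x \<in> B" by simp
      then obtain S where S: "\<And>i. open (S i)" "\<And>i. (- a + x) $ i \<in> S i" "\<And>y. (\<And>i. y $ i \<in> S i) \<Longrightarrow> y \<in> B"
        using B unfolding open_vec_def by (metis (no_types, lifting))
      have "\<exists>e>0. ball ((- a + x) $ i) e \<subseteq> S i" for i using S(1,2) open_contains_ball by blast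
      then obtain e where e: "\<And>i. e i > 0" "\<And>i. ball ((- a + x) $ i) (e i) \<subseteq> S i" by metis
      show "\<exists>S. (\<forall>i. open (S i) \<and> x $ i \<in> S i) \<and> (\<forall>y. (\<forall>i. y $ i \<in> S i) \<longrightarrow> y \<in> (\<lambda>x. - a + x) -` B \<inter> UNIV)"
      proof (intro exI[of _ "\<lambda>i. ball (x $ i) (e i)"] conjI allI impI)
        fix y assume y: "\<forall>i. y $ i \<in> ball (x $ i) (e i)"
        have "(- a + y) $ i \<in> S i" for i
        proof (rule subsetD[OF e(2)])
          have "- a $ i + x $ i - (- a $ i + y $ i) = x $ i - y $ i" by simp
          then show "(- a + y) $ i \<in> ball ((- a + x) $ i) (e i)"
            using y by (simp add: dist_padic_def)
        qed
        then show "y \<in> (\<lambda>x. - a + x) -` B \<inter> UNIV" using S(3) by simp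
      qed (use e in auto)
    qed
  qed
  have "(\<lambda>x. - a + x) \<in> borel_measurable borel" by (rule borel_measurable_continuous_onI[OF c])
  from measurable_sets[OF this assms] have "(\<lambda>x. - a + x) -` A \<in> sets borel" by simp
  moreover have "(+) a ` A = (\<lambda>x. - a + x) -` A" by (auto intro!: image_eqI[of _ _ "- a + _"])
  ultimately show ?thesis by simp
qed

text \<open>The hypotheses make \<open>E\<close> the disjoint union of the translates of
  \<open>E'\<close> by \<open>- r *s \<delta>\<close> for the digits \<open>r\<close>; translation
  invariance gives all of them the same measure.\<close>

lemma emeasure_split:
  fixes \<delta> :: "'p padic ^ 'n"
  assumes E': "E' \<in> sets borel"
    and 1: "\<And>x. x \<in> E \<Longrightarrow> \<exists>!r. r < CARD('p) \<and> x + of_nat r *s \<delta> \<in> E'"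
    and 2: "\<And>x r. x \<in> E' \<Longrightarrow> r < CARD('p) \<Longrightarrow> x - of_nat r *s \<delta> \<in> E"
  shows "emeasure \<mu> E = of_nat CARD('p) * emeasure \<mu> E'"
proof -
  define F where "F r = (+) (- (of_nat r *s \<delta>)) ` E'" for r :: nat
  have F_iff: "x \<in> F r \<longleftrightarrow> x + of_nat r *s \<delta> \<in> E'" for x r
    by (auto simp: F_def intro!: image_eqI[of _ _ "x + of_nat r *s \<delta>"])
  have "E = (\<Union>r\<in>{..<CARD('p)}. F r)"
  proof (intro equalityI subsetI)
    fix x assume "x \<in> E"
    then obtain r where "r < CARD('p)" "x + of_nat r *s \<delta> \<in> E'" using 1 by blast
    then show "x \<in> (\<Union>r\<in>{..<CARD('p)}. F r)"
      by (intro UN_I[of r]) (auto simp: F_iff)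
  qed (use 2 in \<open>auto simp: F_def\<close>)
  moreover have "disjoint_family_on F {..<CARD('p)}"
    unfolding disjoint_family_on_def
  proof (intro ballI impI)
    fix r r' assume r: "r \<in> {..<CARD('p)}" "r' \<in> {..<CARD('p)}" "r \<noteq> r'"
    show "F r \<inter> F r' = {}"
    proof (rule ccontr)
      assume "F r \<inter> F r' \<noteq> {}"
      then obtain x where x: "x + of_nat r *s \<delta> \<in> E'" "x + of_nat r' *s \<delta> \<in> E'" by (auto simp: F_iff)
      have "(x + of_nat r *s \<delta>) - of_nat r *s \<delta> \<in> E" using 2[OF x(1)] r by blast
      then have "x \<in> E" by simp
      then show False using 1 x r by blast
    qed
  qed
  moreover have "F r \<in> sets \<mu>" for r unfolding F_def sets_eq by (rule translate_sets[OF E'])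
  then have "F ` {..<CARD('p)} \<subseteq> sets \<mu>" by blast
  ultimately have "emeasure \<mu> E = (\<Sum>r<CARD('p). emeasure \<mu> (F r))"
    using sum_emeasure[of F "{..<CARD('p)}" \<mu>] by simp
  also have "\<dots> = (\<Sum>r<CARD('p). emeasure \<mu> E')"
    unfolding F_def translate[OF E'] ..
  finally show ?thesis by simp
qed

lemma padic_box_translate: "padic_box x k = (+) x ` padic_box (0 :: 'p padic ^ 'n) k"
proof (intro equalityI subsetI)
  fix y assume "y \<in> padic_box x k"
  then show "y \<in> (+) x ` padic_box 0 k"
    by (intro image_eqI[of _ _ "y - x"]) (auto simp: padic_box_def)
qed (auto simp: padic_box_def)

lemma emeasure_padic_box_0: "emeasure \<mu> (padic_box (0 :: 'p padic ^ 'n) k) = ennreal (pinv TYPE('p) ^ (\<Sum>i\<in>UNIV. k $ i))"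
proof (induction "\<Sum>i\<in>UNIV. k $ i" arbitrary: k)
  case 0
  then have "k $ i = 0" for i by simp
  then have "padic_box (0 :: 'p padic ^ 'n) k = {x. \<forall>i. x $ i \<in> padic_integers}"
    by (simp add: padic_box_def padic_integers_def)
  then show ?case using haar 0 by (simp add: haar_measure_normalized_def)
next
  case (Suc m)
  then obtain i where i: "k $ i > 0" by (metis gr0I sum.neutral Zero_not_Suc)
  \<comment> \<open>One step is undone in a coordinate \<open>i\<close> in which the box is not
    maximal; the larger box consists of p translates of the given one along that axis.\<close>
  define k' where "k' = (\<chi> j. if j = i then k $ i - 1 else k $ j)"
  have ki: "k $ i = Suc (k' $ i)" using i by (simp add: k'_def)
  have kj: "k $ j = k' $ j" if "j \<noteq> i" for j using that by (simp add: k'_def)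
  have sk: "(\<Sum>j\<in>UNIV. k $ j) = Suc (\<Sum>j\<in>UNIV. k' $ j)"
    using kj ki by (simp add: sum.remove[of UNIV i])
  have m: "m = (\<Sum>j\<in>UNIV. k' $ j)" using Suc.hyps(2) sk by simp
  define \<delta> :: "'p padic ^ 'n" where "\<delta> = axis i (padic_p ^ (k' $ i))"
  have np: "padic_norm (padic_p ^ (k' $ i) :: 'p padic) = pinv TYPE('p) ^ (k' $ i)"
    by (simp add: padic_norm_power padic_norm_p)
  have b: "x + of_nat r *s \<delta> \<in> padic_box 0 k \<longleftrightarrow>
      padic_norm (x $ i + of_nat r * padic_p ^ (k' $ i)) \<le> pinv TYPE('p) ^ Suc (k' $ i)"
    if "x \<in> padic_box (0 :: 'p padic ^ 'n) k'" for x r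
    using that ki kj unfolding padic_box_def by (auto simp: \<delta>_def axis_def)
  have "emeasure \<mu> (padic_box (0 :: 'p padic ^ 'n) k') = of_nat CARD('p) * emeasure \<mu> (padic_box (0 :: 'p padic ^ 'n) k)"
  proof (rule emeasure_split[of _ _ \<delta>])
    show "padic_box 0 k \<in> sets borel" by (simp add: padic_box_open)
    fix x :: "'p padic ^ 'n" assume x: "x \<in> padic_box 0 k'"
    have "padic_norm (x $ i) \<le> pinv TYPE('p) ^ (k' $ i)" using x by (simp add: padic_box_def)
    from padic_digit_scaled[OF np this]
    show "\<exists>!r. r < CARD('p) \<and> x + of_nat r *s \<delta> \<in> padic_box 0 k" by (simp only: b[OF x])
  next
    fix x :: "'p padic ^ 'n" and r :: nat assume x: "x \<in> padic_box 0 k"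
    have "padic_norm (x $ i - of_nat r * padic_p ^ (k' $ i)) \<le> pinv TYPE('p) ^ (k' $ i)"
    proof (rule padic_norm_diff_le)
      have "padic_norm (x $ i) \<le> pinv TYPE('p) ^ (k $ i)" using x by (simp add: padic_box_def)
      also have "\<dots> \<le> pinv TYPE('p) ^ (k' $ i)" unfolding pinv_power_le_iff ki by simp
      finally show "padic_norm (x $ i) \<le> pinv TYPE('p) ^ (k' $ i)" .
      show "padic_norm (of_nat r * padic_p ^ (k' $ i) :: 'p padic) \<le> pinv TYPE('p) ^ (k' $ i)"
        unfolding padic_norm_mult np using padic_norm_of_nat_le[of r, where 'p='p] pinv_bounds[where 'p='p]
        by (intro mult_left_le_one_le) (auto simp: padic_norm_nonneg)
    qed
    then have "padic_norm ((x - of_nat r *s \<delta>) $ j) \<le> pinv TYPE('p) ^ (k' $ j)" for j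
      using x kj[of j] unfolding padic_box_def by (cases "j = i") (auto simp: \<delta>_def axis_def dest: spec[of _ j])
    then show "x - of_nat r *s \<delta> \<in> padic_box 0 k'" by (simp add: padic_box_def)
  qed
  then have e: "of_nat CARD('p) * emeasure \<mu> (padic_box (0 :: 'p padic ^ 'n) k) = ennreal (pinv TYPE('p) ^ m)"
    using Suc.hyps(1)[OF m] m by simp
  have p0: "real CARD('p) > 0" by simp
  have "ennreal (pinv TYPE('p)) * (of_nat CARD('p) * emeasure \<mu> (padic_box (0 :: 'p padic ^ 'n) k))
      = emeasure \<mu> (padic_box (0 :: 'p padic ^ 'n) k)"
  proof -
    have "ennreal (pinv TYPE('p)) * of_nat CARD('p) = 1"
      unfolding ennreal_of_nat_eq_real_of_nat by (subst ennreal_mult[symmetric]) auto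
    then show ?thesis by (simp add: mult.assoc[symmetric])
  qed
  then have "emeasure \<mu> (padic_box (0 :: 'p padic ^ 'n) k) = ennreal (pinv TYPE('p)) * ennreal (pinv TYPE('p) ^ m)"
    unfolding e by simp
  also have "\<dots> = ennreal (pinv TYPE('p) ^ Suc m)" by (subst ennreal_mult[symmetric]) auto
  finally show ?case using Suc.hyps(2) by simp
qed

lemma emeasure_padic_box: "emeasure \<mu> (padic_box x k) = ennreal (pinv TYPE('p) ^ (\<Sum>i\<in>UNIV. k $ i))"
  using translate[of "padic_box 0 k" x] padic_box_open[of "0 :: 'p padic ^ 'n" k]
  by (simp add: padic_box_translate[of x] emeasure_padic_box_0)

end

section \<open>Igusa integrals over shells\<close>

abbreviation supp :: "('a::zero, 'n::finite) multipoly \<Rightarrow> (nat ^ 'n) set" where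
  "supp \<equiv> Poly_Mapping.keys"

definition mono_eval :: "nat ^ 'n::finite \<Rightarrow> 'a::comm_semiring_1 ^ 'n \<Rightarrow> 'a" where
  "mono_eval \<omega> x = (\<Prod>i\<in>UNIV. x $ i ^ (\<omega> $ i))"

lemma multipoly_eval_mono: "multipoly_eval f x = (\<Sum>\<omega>\<in>supp f. Poly_Mapping.lookup f \<omega> * mono_eval \<omega> x)"
  by (simp add: multipoly_eval_def mono_eval_def)

lemma mono_eval_split: "mono_eval \<omega> x = (\<Prod>l\<in>UNIV - {i}. x $ l ^ (\<omega> $ l)) * x $ i ^ (\<omega> $ i)"
  unfolding mono_eval_def by (subst prod.remove[of UNIV i]) (auto simp: mult.commute)

lemma mono_eval_shift:
  "mono_eval \<omega> (x + axis i t) = (\<Prod>l\<in>UNIV - {i}. x $ l ^ (\<omega> $ l)) * (x $ i + t) ^ (\<omega> $ i)"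
  unfolding mono_eval_split[of _ _ i] by (auto simp: axis_def intro!: arg_cong2[of _ _ _ _ "(*)"] prod.cong)

lemma padic_power_diff_le:
  fixes z t :: "'p::prime_card padic"
  assumes "padic_norm z \<le> M" "padic_norm t \<le> M"
  shows "padic_norm ((z + t) ^ Suc l - z ^ Suc l) \<le> padic_norm t * M ^ l"
proof (induction l)
  case (Suc l)
  have M: "0 \<le> M" using assms(1) padic_norm_nonneg[of z] by linarith
  have e: "(z + t) ^ Suc (Suc l) - z ^ Suc (Suc l) = (z + t) * ((z + t) ^ Suc l - z ^ Suc l) + t * z ^ Suc l"
    by (simp add: algebra_simps)
  show ?case unfolding e
  proof (rule padic_norm_add_le)
    have "padic_norm (z + t) * padic_norm ((z + t) ^ Suc l - z ^ Suc l) \<le> M * (padic_norm t * M ^ l)"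
      by (rule mult_mono[OF padic_norm_add_le[OF assms] Suc]) (auto simp: M padic_norm_nonneg)
    then show "padic_norm ((z + t) * ((z + t) ^ Suc l - z ^ Suc l)) \<le> padic_norm t * M ^ Suc l"
      by (simp add: padic_norm_mult mult_ac)
    have "padic_norm z ^ Suc l \<le> M ^ Suc l" by (rule power_mono[OF assms(1)]) (rule padic_norm_nonneg)
    then show "padic_norm (t * z ^ Suc l) \<le> padic_norm t * M ^ Suc l"
      unfolding padic_norm_mult padic_norm_power by (rule mult_left_mono) (rule padic_norm_nonneg)
  qed
qed simp

text \<open>The linear term is written with the relative increment \<open>t / z\<close> so that it
  turns into the Euler operator \<open>theta\<close> when summed over monomials. All coefficients
  are integers and hence of norm at most 1, so the remainder is quadratic in the relative
  increment.\<close>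

lemma padic_power_taylor_le:
  fixes z t :: "'p::prime_card padic"
  assumes "z \<noteq> 0" "padic_norm t \<le> padic_norm z"
  shows "padic_norm ((z + t) ^ l - z ^ l - t / z * of_nat l * z ^ l) \<le> padic_norm (t / z) ^ 2 * padic_norm z ^ l"
proof (induction l)
  case 0
  then show ?case by (simp add: padic_norm_nonneg)
next
  case (Suc l)
  have e: "(z + t) ^ Suc l - z ^ Suc l - t / z * of_nat (Suc l) * z ^ Suc l
      = (z + t) * ((z + t) ^ l - z ^ l - t / z * of_nat l * z ^ l) + (t / z) ^ 2 * of_nat l * z ^ Suc l"
    using assms(1) by (simp add: field_simps power2_eq_square)
  show ?case unfolding e
  proof (rule padic_norm_add_le)
    have "padic_norm (z + t) * padic_norm ((z + t) ^ l - z ^ l - t / z * of_nat l * z ^ l)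
        \<le> padic_norm z * (padic_norm (t / z) ^ 2 * padic_norm z ^ l)"
      by (rule mult_mono[OF padic_norm_add_le[OF order_refl assms(2)] Suc]) (auto simp: padic_norm_nonneg)
    then show "padic_norm ((z + t) * ((z + t) ^ l - z ^ l - t / z * of_nat l * z ^ l)) \<le> padic_norm (t / z) ^ 2 * padic_norm z ^ Suc l"
      by (simp add: padic_norm_mult mult_ac)
    have "padic_norm ((t / z) ^ 2 * of_nat l * z ^ Suc l) = (padic_norm (t / z) ^ 2 * padic_norm z ^ Suc l) * padic_norm (of_nat l :: 'p padic)"
      unfolding padic_norm_mult padic_norm_power by (simp only: mult_ac)
    also have "\<dots> \<le> (padic_norm (t / z) ^ 2 * padic_norm z ^ Suc l)"
      by (rule mult_left_le[OF padic_norm_of_nat_le]) (simp add: padic_norm_nonneg)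
    finally show "padic_norm ((t / z) ^ 2 * of_nat l * z ^ Suc l) \<le> padic_norm (t / z) ^ 2 * padic_norm z ^ Suc l" .
  qed
qed

text \<open>The Euler operator x_i df/dx_i. On a shell its terms obey the same bounds as those of
  \<open>f\<close>, whatever the sizes of the coordinates, and on the torus it vanishes exactly
  where the partial derivative does.\<close>

definition theta :: "'n::finite \<Rightarrow> ('a::comm_semiring_1, 'n) multipoly \<Rightarrow> 'a ^ 'n \<Rightarrow> 'a" where
  "theta i f x = (\<Sum>\<omega>\<in>supp f. Poly_Mapping.lookup f \<omega> * of_nat (\<omega> $ i) * mono_eval \<omega> x)"

definition shell :: "nat ^ 'n::finite \<Rightarrow> ('p::prime_card padic ^ 'n) set" where
  "shell k = {x. \<forall>i. padic_norm (x $ i) = pinv TYPE('p) ^ (k $ i)}"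

text \<open>Up to the points with \<open>x $ i = 0\<close> this is the union of the shells at
  \<open>k + t *s axis i 1\<close>. In contrast to a single shell it is stable under all
  translations of the \<open>i\<close>-th coordinate by elements of norm at most p^(-k_i).\<close>

definition half_shell :: "'n::finite \<Rightarrow> nat ^ 'n \<Rightarrow> ('p::prime_card padic ^ 'n) set" where
  "half_shell i k = {x. (\<forall>l. l \<noteq> i \<longrightarrow> padic_norm (x $ l) = pinv TYPE('p) ^ (k $ l)) \<and>
     padic_norm (x $ i) \<le> pinv TYPE('p) ^ (k $ i)}"

lemma padic_norm_mono_shell:
  assumes "x \<in> (shell k :: ('p::prime_card padic ^ 'n::finite) set)"
  shows "padic_norm (mono_eval \<omega> x) = pinv TYPE('p) ^ dotn \<omega> k"
  using assms unfolding mono_eval_def shell_def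
  by (simp add: padic_norm_prod padic_norm_power power_mult[symmetric] power_sum[symmetric] mult.commute)

locale integral_poly =
  fixes f :: "('p::prime_card padic, 'n::finite) multipoly"
  assumes integral: "\<And>\<omega>. Poly_Mapping.lookup f \<omega> \<in> padic_integers"
begin

lemma coeff_le: "padic_norm (Poly_Mapping.lookup f \<omega>) \<le> 1"
  using integral[of \<omega>] by (simp add: padic_integers_def)

lemma term_le: "padic_norm y \<le> c \<Longrightarrow> padic_norm (Poly_Mapping.lookup f \<omega> * y) \<le> c"
  unfolding padic_norm_mult using coeff_le[of \<omega>] padic_norm_nonneg[of y]
  by (meson mult_left_le_one_le order_trans padic_norm_nonneg)

context
  fixes k :: "nat ^ 'n" and m :: nat
  assumes m: "\<And>\<omega>. \<omega> \<in> supp f \<Longrightarrow> m \<le> dotn \<omega> k"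
begin

lemma mono_shell_le: "x \<in> (shell k :: ('p padic ^ 'n) set) \<Longrightarrow> \<omega> \<in> supp f \<Longrightarrow>
    padic_norm (mono_eval \<omega> x) \<le> pinv TYPE('p) ^ m"
  by (simp only: padic_norm_mono_shell pinv_power_le_iff m)

lemma eval_shell_le: "x \<in> shell k \<Longrightarrow> padic_norm (multipoly_eval f x) \<le> pinv TYPE('p) ^ m"
  unfolding multipoly_eval_mono by (intro padic_norm_sum_le term_le mono_shell_le) auto

lemma shell_shift:
  assumes "x \<in> (shell k :: ('p padic ^ 'n) set)" "padic_norm t \<le> pinv TYPE('p) ^ Suc (k $ i)"
  shows "x + axis i t \<in> shell k"
proof -
  have "padic_norm (x $ i + t) = padic_norm (x $ i)"
  proof (rule padic_norm_eq_of_diff)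
    have "padic_norm t < pinv TYPE('p) ^ (k $ i)"
      using assms(2) pinv_power_less_iff[where 'p='p, of "Suc (k $ i)" "k $ i"] by simp
    then show "padic_norm (x $ i + t - x $ i) < padic_norm (x $ i)" using assms(1) by (simp add: shell_def)
  qed
  then show ?thesis using assms(1) by (auto simp: shell_def axis_def)
qed

text \<open>The exponent \<open>k $ i + j\<close> means that the shift has relative size p^(-j) with
  respect to the coordinate \<open>x $ i\<close>. A monomial then changes by relative order
  \<open>j\<close>, and by order \<open>2 * j\<close> once the linear term is removed.\<close>

lemma mono_shift_le:
  assumes x: "x \<in> (shell k :: ('p padic ^ 'n) set)" and t: "padic_norm t \<le> pinv TYPE('p) ^ (k $ i + j)"
    and \<omega>: "\<omega> \<in> supp f"
  shows "padic_norm (mono_eval \<omega> (x + axis i t) - mono_eval \<omega> x) \<le> pinv TYPE('p) ^ (m + j)"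
    "padic_norm (mono_eval \<omega> (x + axis i t) - mono_eval \<omega> x - t / x $ i * of_nat (\<omega> $ i) * mono_eval \<omega> x)
      \<le> pinv TYPE('p) ^ (m + 2 * j)"
proof -
  let ?q = "pinv TYPE('p)"
  define A where "A = (\<Prod>l\<in>UNIV - {i}. x $ l ^ (\<omega> $ l))"
  have q: "?q > 0" using pinv_bounds[where 'p='p] by simp
  have xi: "padic_norm (x $ i) = ?q ^ (k $ i)" using x by (simp add: shell_def)
  then have x0: "x $ i \<noteq> 0" using q by auto
  have tz: "padic_norm (t / x $ i) \<le> ?q ^ j"
  proof -
    have "padic_norm (t / x $ i) * padic_norm (x $ i) = padic_norm t"
      using x0 by (simp add: padic_norm_mult[symmetric])
    then have "padic_norm (t / x $ i) * ?q ^ (k $ i) \<le> ?q ^ j * ?q ^ (k $ i)"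
      using t xi by (simp add: power_add mult.commute)
    then show ?thesis using q by simp
  qed
  have t': "padic_norm t \<le> padic_norm (x $ i)"
    using t pinv_power_le_iff[where 'p='p, of "k $ i + j" "k $ i"] unfolding xi by simp
  have mn: "padic_norm A * ?q ^ (k $ i * \<omega> $ i) \<le> ?q ^ m"
    using mono_shell_le[OF x \<omega>] unfolding mono_eval_split[of \<omega> x i] padic_norm_mult A_def[symmetric] padic_norm_power xi
    by (simp add: power_mult)
  have "padic_norm ((x $ i + t) ^ (\<omega> $ i) - x $ i ^ (\<omega> $ i) - t / x $ i * of_nat (\<omega> $ i) * x $ i ^ (\<omega> $ i))
      \<le> padic_norm (t / x $ i) ^ 2 * padic_norm (x $ i) ^ (\<omega> $ i)"
    by (rule padic_power_taylor_le[OF x0 t'])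
  also have "\<dots> \<le> (?q ^ j) ^ 2 * padic_norm (x $ i) ^ (\<omega> $ i)"
    by (intro mult_right_mono power_mono tz) (auto simp: padic_norm_nonneg)
  finally have a: "padic_norm ((x $ i + t) ^ (\<omega> $ i) - x $ i ^ (\<omega> $ i) - t / x $ i * of_nat (\<omega> $ i) * x $ i ^ (\<omega> $ i))
      \<le> ?q ^ (2 * j) * ?q ^ (k $ i * \<omega> $ i)"
    by (simp only: xi power_mult[symmetric] mult.commute[of j 2])
  have e: "mono_eval \<omega> (x + axis i t) - mono_eval \<omega> x - t / x $ i * of_nat (\<omega> $ i) * mono_eval \<omega> x
     = A * ((x $ i + t) ^ (\<omega> $ i) - x $ i ^ (\<omega> $ i) - t / x $ i * of_nat (\<omega> $ i) * x $ i ^ (\<omega> $ i))"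
    unfolding mono_eval_shift mono_eval_split[of \<omega> x i] A_def[symmetric] by (simp add: algebra_simps)
  have "padic_norm A * padic_norm ((x $ i + t) ^ (\<omega> $ i) - x $ i ^ (\<omega> $ i) - t / x $ i * of_nat (\<omega> $ i) * x $ i ^ (\<omega> $ i))
     \<le> padic_norm A * (?q ^ (2 * j) * ?q ^ (k $ i * \<omega> $ i))"
    by (rule mult_left_mono[OF a padic_norm_nonneg])
  also have "\<dots> = ?q ^ (2 * j) * (padic_norm A * ?q ^ (k $ i * \<omega> $ i))" by (simp only: mult_ac)
  also have "\<dots> \<le> ?q ^ (2 * j) * ?q ^ m" by (rule mult_left_mono[OF mn]) simp
  finally show 2: "padic_norm (mono_eval \<omega> (x + axis i t) - mono_eval \<omega> x - t / x $ i * of_nat (\<omega> $ i) * mono_eval \<omega> x)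
      \<le> ?q ^ (m + 2 * j)" unfolding e padic_norm_mult by (simp add: power_add mult.commute)
  have "padic_norm (t / x $ i * of_nat (\<omega> $ i) * mono_eval \<omega> x) \<le> ?q ^ (m + j)"
  proof -
    have "padic_norm (t / x $ i) * padic_norm (of_nat (\<omega> $ i) :: 'p padic) \<le> ?q ^ j * 1"
      by (rule mult_mono[OF tz padic_norm_of_nat_le]) (auto simp: padic_norm_nonneg)
    then have "padic_norm (t / x $ i) * padic_norm (of_nat (\<omega> $ i) :: 'p padic) * padic_norm (mono_eval \<omega> x)
        \<le> ?q ^ j * 1 * ?q ^ m"
      by (rule mult_mono[OF _ mono_shell_le[OF x \<omega>]]) (auto simp: padic_norm_nonneg)
    also have "\<dots> = ?q ^ (m + j)" by (simp add: power_add mult.commute)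
    finally show ?thesis unfolding padic_norm_mult .
  qed
  moreover have "padic_norm (mono_eval \<omega> (x + axis i t) - mono_eval \<omega> x - t / x $ i * of_nat (\<omega> $ i) * mono_eval \<omega> x)
      \<le> ?q ^ (m + j)"
    by (rule order_trans[OF 2]) (simp only: pinv_power_le_iff)
  ultimately have "padic_norm ((mono_eval \<omega> (x + axis i t) - mono_eval \<omega> x - t / x $ i * of_nat (\<omega> $ i) * mono_eval \<omega> x)
      + t / x $ i * of_nat (\<omega> $ i) * mono_eval \<omega> x) \<le> ?q ^ (m + j)" by (intro padic_norm_add_le)
  then show "padic_norm (mono_eval \<omega> (x + axis i t) - mono_eval \<omega> x) \<le> ?q ^ (m + j)" by simp
qed

lemma eval_shift_le:
  assumes x: "x \<in> (shell k :: ('p padic ^ 'n) set)" and t: "padic_norm t \<le> pinv TYPE('p) ^ (k $ i + j)"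
  shows "padic_norm (multipoly_eval f (x + axis i t) - multipoly_eval f x - t / x $ i * theta i f x)
      \<le> pinv TYPE('p) ^ (m + 2 * j)"
proof -
  have "multipoly_eval f (x + axis i t) - multipoly_eval f x - t / x $ i * theta i f x =
    (\<Sum>\<omega>\<in>supp f. Poly_Mapping.lookup f \<omega> *
      (mono_eval \<omega> (x + axis i t) - mono_eval \<omega> x - t / x $ i * of_nat (\<omega> $ i) * mono_eval \<omega> x))"
    unfolding multipoly_eval_mono theta_def sum_distrib_left sum_subtractf[symmetric]
    by (rule sum.cong) (auto simp: algebra_simps)
  also have "padic_norm \<dots> \<le> pinv TYPE('p) ^ (m + 2 * j)"
    by (intro padic_norm_sum_le term_le mono_shift_le x t) auto
  finally show ?thesis .
qed

lemma theta_shift_le: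
  assumes x: "x \<in> (shell k :: ('p padic ^ 'n) set)" and t: "padic_norm t \<le> pinv TYPE('p) ^ (k $ i + j)"
  shows "padic_norm (theta l f (x + axis i t) - theta l f x) \<le> pinv TYPE('p) ^ (m + j)"
proof -
  have "theta l f (x + axis i t) - theta l f x =
    (\<Sum>\<omega>\<in>supp f. Poly_Mapping.lookup f \<omega> *
      (of_nat (\<omega> $ l) * (mono_eval \<omega> (x + axis i t) - mono_eval \<omega> x)))"
    unfolding theta_def sum_subtractf[symmetric] by (rule sum.cong) (auto simp: algebra_simps)
  also have "padic_norm \<dots> \<le> pinv TYPE('p) ^ (m + j)"
  proof (intro padic_norm_sum_le term_le)
    fix \<omega> assume "\<omega> \<in> supp f"
    then show "padic_norm (of_nat (\<omega> $ l) * (mono_eval \<omega> (x + axis i t) - mono_eval \<omega> x)) \<le> pinv TYPE('p) ^ (m + j)"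
      unfolding padic_norm_mult using mono_shift_le(1)[OF x t] padic_norm_of_nat_le[of "\<omega> $ l", where 'p='p]
      by (meson mult_left_le_one_le order_trans padic_norm_nonneg)
  qed simp
  finally show ?thesis .
qed

end

lemma mono_lipschitz:
  assumes "\<And>i. padic_norm (x $ i :: 'p padic) \<le> 1" "\<And>i. padic_norm (y $ i - x $ i) \<le> c" "c \<le> 1"
  shows "padic_norm (mono_eval \<omega> y - mono_eval \<omega> (x :: 'p padic ^ 'n)) \<le> c"
proof -
  have c: "0 \<le> c" using assms(2)[of undefined] padic_norm_nonneg by (meson order_trans)
  have y: "padic_norm (y $ i) \<le> 1" for i
    using padic_norm_add_le[of "y $ i - x $ i" 1 "x $ i"] assms(1)[of i] assms(2)[of i] assms(3) by simp
  have pw: "padic_norm (y $ i ^ n - x $ i ^ n) \<le> c" for i n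
  proof (cases n)
    case (Suc l)
    have "padic_norm ((x $ i + (y $ i - x $ i)) ^ Suc l - x $ i ^ Suc l) \<le> padic_norm (y $ i - x $ i) * 1 ^ l"
      by (rule padic_power_diff_le) (use assms(1)[of i] assms(2)[of i] assms(3) in auto)
    then show ?thesis using assms(2)[of i] Suc by simp
  qed (use c in simp)
  have "padic_norm ((\<Prod>i\<in>A. y $ i ^ (\<omega> $ i)) - (\<Prod>i\<in>A. x $ i ^ (\<omega> $ i))) \<le> c" for A
  proof (induction A rule: infinite_finite_induct)
    case (insert a A)
    have x1: "padic_norm (\<Prod>i\<in>A. x $ i ^ (\<omega> $ i)) \<le> 1" and y1: "padic_norm (y $ a ^ (\<omega> $ a)) \<le> 1"
      using assms(1) y unfolding padic_norm_prod padic_norm_power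
      by (auto intro!: prod_le_1 power_le_one simp: padic_norm_nonneg)
    have e: "(\<Prod>i\<in>insert a A. y $ i ^ (\<omega> $ i)) - (\<Prod>i\<in>insert a A. x $ i ^ (\<omega> $ i)) =
      y $ a ^ (\<omega> $ a) * ((\<Prod>i\<in>A. y $ i ^ (\<omega> $ i)) - (\<Prod>i\<in>A. x $ i ^ (\<omega> $ i)))
      + (y $ a ^ (\<omega> $ a) - x $ a ^ (\<omega> $ a)) * (\<Prod>i\<in>A. x $ i ^ (\<omega> $ i))"
      using insert by (simp add: algebra_simps)
    show ?case unfolding e
    proof (rule padic_norm_add_le; unfold padic_norm_mult)
      show "padic_norm (y $ a ^ (\<omega> $ a)) * padic_norm ((\<Prod>i\<in>A. y $ i ^ (\<omega> $ i)) - (\<Prod>i\<in>A. x $ i ^ (\<omega> $ i))) \<le> c"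
        using mult_mono[OF y1 insert.IH] by (simp add: padic_norm_nonneg)
      show "padic_norm (y $ a ^ (\<omega> $ a) - x $ a ^ (\<omega> $ a)) * padic_norm (\<Prod>i\<in>A. x $ i ^ (\<omega> $ i)) \<le> c"
        using mult_mono[OF pw[of a "\<omega> $ a"] x1] c by (simp add: padic_norm_nonneg)
    qed
  qed (use c in auto)
  then show ?thesis unfolding mono_eval_def .
qed

lemma eval_lipschitz:
  assumes "\<And>i. padic_norm (x $ i :: 'p padic) \<le> 1" "\<And>i. padic_norm (y $ i - x $ i) \<le> c" "c \<le> 1"
  shows "padic_norm (multipoly_eval f y - multipoly_eval f x) \<le> c"
proof -
  have c: "0 \<le> c" using assms(2)[of undefined] padic_norm_nonneg by (meson order_trans)
  have "multipoly_eval f y - multipoly_eval f x =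
    (\<Sum>\<omega>\<in>supp f. Poly_Mapping.lookup f \<omega> * (mono_eval \<omega> y - mono_eval \<omega> x))"
    unfolding multipoly_eval_mono sum_subtractf[symmetric] by (simp add: algebra_simps)
  also have "padic_norm \<dots> \<le> c" by (intro padic_norm_sum_le term_le mono_lipschitz assms c)
  finally show ?thesis .
qed

lemma theta_lipschitz:
  assumes "\<And>i. padic_norm (x $ i :: 'p padic) \<le> 1" "\<And>i. padic_norm (y $ i - x $ i) \<le> c" "c \<le> 1"
  shows "padic_norm (theta l f y - theta l f x) \<le> c"
proof -
  have c: "0 \<le> c" using assms(2)[of undefined] padic_norm_nonneg by (meson order_trans)
  have "theta l f y - theta l f x =
    (\<Sum>\<omega>\<in>supp f. Poly_Mapping.lookup f \<omega> * (of_nat (\<omega> $ l) * (mono_eval \<omega> y - mono_eval \<omega> x)))"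
    unfolding theta_def sum_subtractf[symmetric] by (simp add: algebra_simps)
  also have "padic_norm \<dots> \<le> c"
  proof (intro padic_norm_sum_le term_le)
    fix \<omega>
    show "padic_norm (of_nat (\<omega> $ l) * (mono_eval \<omega> y - mono_eval \<omega> x)) \<le> c"
      unfolding padic_norm_mult using mono_lipschitz[OF assms, of \<omega>] padic_norm_of_nat_le[of "\<omega> $ l", where 'p='p]
      by (meson mult_left_le_one_le order_trans padic_norm_nonneg)
  qed (rule c)
  finally show ?thesis .
qed

text \<open>Terms free of x_i do not change at all, the term \<open>C\<close> is linear in x_i and
  changes exactly by the subtracted amount, and any other term is strictly dominated by
  \<open>C\<close>, which pushes its change one level deeper than \<open>n\<close>.\<close>

lemma half_shell_shift_le:
  assumes C: "C \<in> supp f" "C $ i = 1"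
    and dom: "\<And>\<omega>. \<omega> \<in> supp f \<Longrightarrow> \<omega> $ i \<ge> 1 \<Longrightarrow> \<omega> \<noteq> C \<Longrightarrow> dotn C k < dotn \<omega> k"
    and x: "x \<in> (half_shell i k :: ('p padic ^ 'n) set)" and n: "n \<ge> dotn C k"
    and t: "padic_norm t \<le> pinv TYPE('p) ^ (n - dotn C k + k $ i)"
  shows "padic_norm (multipoly_eval f (x + axis i t) - multipoly_eval f x
      - t * (Poly_Mapping.lookup f C * (\<Prod>l\<in>UNIV - {i}. x $ l ^ (C $ l)))) \<le> pinv TYPE('p) ^ Suc n"
proof -
  let ?q = "pinv TYPE('p)"
  define A where "A \<omega> = (\<Prod>l\<in>UNIV - {i}. x $ l ^ (\<omega> $ l))" for \<omega> :: "nat^'n"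
  have A: "padic_norm (A \<omega>) * ?q ^ (\<omega> $ i * k $ i) = ?q ^ dotn \<omega> k" for \<omega>
  proof -
    have "padic_norm (A \<omega>) = (\<Prod>l\<in>UNIV - {i}. ?q ^ (\<omega> $ l * k $ l))"
      using x unfolding A_def half_shell_def
      by (auto simp: padic_norm_prod padic_norm_power power_mult[symmetric] mult.commute intro!: prod.cong)
    also have "\<dots> = ?q ^ (\<Sum>l\<in>UNIV - {i}. \<omega> $ l * k $ l)" by (rule power_sum[symmetric])
    finally show ?thesis by (simp add: sum.remove[of UNIV i] power_add mult.commute)
  qed
  have D: "padic_norm (mono_eval \<omega> (x + axis i t) - mono_eval \<omega> x - (if \<omega> = C then t * A C else 0)) \<le> ?q ^ Suc n"
    if w: "\<omega> \<in> supp f" for \<omega>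
  proof -
    have e: "mono_eval \<omega> (x + axis i t) - mono_eval \<omega> x = A \<omega> * ((x $ i + t) ^ (\<omega> $ i) - x $ i ^ (\<omega> $ i))"
      unfolding mono_eval_shift mono_eval_split[of \<omega> x i] A_def[symmetric] by (simp add: algebra_simps)
    consider "\<omega> $ i = 0" | "\<omega> = C" | l where "\<omega> $ i = Suc l" "\<omega> \<noteq> C" by (cases "\<omega> $ i") auto
    then show ?thesis
    proof cases
      case 1
      then have "\<omega> \<noteq> C" using C by auto
      then show ?thesis using 1 unfolding e by simp
    next
      case 2
      then show ?thesis unfolding e using C by (simp add: algebra_simps)
    next
      case 3
      have tq: "padic_norm t \<le> ?q ^ (k $ i)"
        using t pinv_power_le_iff[where 'p='p, of "n - dotn C k + k $ i" "k $ i"] by simp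
      have "padic_norm ((x $ i + t) ^ Suc l - x $ i ^ Suc l) \<le> padic_norm t * (?q ^ (k $ i)) ^ l"
        by (rule padic_power_diff_le[OF _ tq]) (use x in \<open>simp add: half_shell_def\<close>)
      also have "\<dots> \<le> ?q ^ (n - dotn C k + k $ i) * (?q ^ (k $ i)) ^ l"
        by (rule mult_right_mono[OF t]) simp
      also have "\<dots> = ?q ^ (n - dotn C k) * ?q ^ (\<omega> $ i * k $ i)"
        by (simp add: 3 power_add power_mult[symmetric] mult.commute)
      finally have "padic_norm (A \<omega>) * padic_norm ((x $ i + t) ^ Suc l - x $ i ^ Suc l)
          \<le> padic_norm (A \<omega>) * (?q ^ (n - dotn C k) * ?q ^ (\<omega> $ i * k $ i))"
        by (rule mult_left_mono) (rule padic_norm_nonneg)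
      also have "\<dots> = ?q ^ (n - dotn C k) * ?q ^ dotn \<omega> k"
        unfolding A[of \<omega>, symmetric] by (simp only: mult_ac)
      also have "\<dots> = ?q ^ (n - dotn C k + dotn \<omega> k)" by (simp add: power_add)
      also have "\<dots> \<le> ?q ^ Suc n"
        unfolding pinv_power_le_iff using dom[OF w _ 3(2)] 3(1) n by simp
      finally show ?thesis using 3 unfolding e by (simp add: padic_norm_mult)
    qed
  qed
  have "multipoly_eval f (x + axis i t) - multipoly_eval f x - t * (Poly_Mapping.lookup f C * A C)
    = (\<Sum>\<omega>\<in>supp f. Poly_Mapping.lookup f \<omega> *
      (mono_eval \<omega> (x + axis i t) - mono_eval \<omega> x - (if \<omega> = C then t * A C else 0)))"
    unfolding multipoly_eval_mono right_diff_distrib sum_subtractf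
    using C(1) by (simp add: if_distrib sum.delta cong: if_cong)
  also have "padic_norm \<dots> \<le> ?q ^ Suc n" by (intro padic_norm_sum_le term_le D) auto
  finally show ?thesis unfolding A_def .
qed

end

text \<open>The compact open subsets of Z_p^n, described by a common radius. The class is closed
  under conditions on the levels of \<open>f\<close> and \<open>theta\<close> and supplies
  measurability and finiteness of the measure at once.\<close>

definition locally_const :: "('p::prime_card padic ^ 'n::finite) set \<Rightarrow> bool" where
  "locally_const A \<longleftrightarrow> A \<subseteq> padic_box 0 0 \<and>
     (\<exists>n. \<forall>x\<in>A. \<forall>y. (\<forall>i. padic_norm (y $ i - x $ i) \<le> pinv TYPE('p) ^ n) \<longrightarrow> y \<in> A)"

lemma locally_const_open: "locally_const A \<Longrightarrow> open A"
  unfolding locally_const_def using padic_open_if_locally_constant by blast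

lemma padic_box_0_iff: "x \<in> padic_box (0 :: 'p::prime_card padic ^ 'n::finite) 0 \<longleftrightarrow> (\<forall>i. padic_norm (x $ i) \<le> 1)"
  by (simp add: padic_box_def)

lemma locally_const_inter_pred:
  fixes D :: "('p::prime_card padic ^ 'n::finite) set"
  assumes D: "locally_const D"
    and Q: "\<And>x y. (\<And>i. padic_norm (x $ i) \<le> 1) \<Longrightarrow> (\<And>i. padic_norm (y $ i - x $ i) \<le> pinv TYPE('p) ^ n) \<Longrightarrow> Q x \<Longrightarrow> Q y"
  shows "locally_const {x\<in>D. Q x}"
proof -
  obtain n' where n': "\<And>x y. x \<in> D \<Longrightarrow> (\<And>i. padic_norm (y $ i - x $ i) \<le> pinv TYPE('p) ^ n') \<Longrightarrow> y \<in> D"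
    using D unfolding locally_const_def by blast
  have D': "padic_norm (x $ i) \<le> 1" if "x \<in> D" for x i
    using D that unfolding locally_const_def padic_box_def by auto
  have "y \<in> {x\<in>D. Q x}" if "x \<in> {x\<in>D. Q x}" "\<And>i. padic_norm (y $ i - x $ i) \<le> pinv TYPE('p) ^ max n n'" for x y
  proof -
    have "padic_norm (y $ i - x $ i) \<le> pinv TYPE('p) ^ n" "padic_norm (y $ i - x $ i) \<le> pinv TYPE('p) ^ n'" for i
      using that(2)[of i] by (meson max.cobounded1 max.cobounded2 order_trans pinv_power_le_iff)+
    then show ?thesis using that(1) n' Q D' by blast
  qed
  then show ?thesis using D unfolding locally_const_def by blast
qed

lemma padic_norm_eq_stable:
  assumes "padic_norm (y - x :: 'p::prime_card padic) \<le> pinv TYPE('p) ^ Suc n"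
  shows "padic_norm x = pinv TYPE('p) ^ n \<longleftrightarrow> padic_norm y = pinv TYPE('p) ^ n"
proof -
  have l: "padic_norm (y - x) < pinv TYPE('p) ^ n"
    using assms pinv_power_less_iff[where 'p='p, of "Suc n" n] by simp
  show ?thesis
    using padic_norm_eq_of_diff[of y x] padic_norm_eq_of_diff[of x y] l padic_norm_minus_commute[of x y] by auto
qed

lemma padic_norm_le_stable:
  assumes "padic_norm (y - x :: 'p::prime_card padic) \<le> c" "padic_norm x \<le> c"
  shows "padic_norm y \<le> c"
  using padic_norm_add_le[OF assms] by simp

lemma locally_const_box: "locally_const (padic_box (0 :: 'p::prime_card padic ^ 'n::finite) 0)"
  unfolding locally_const_def
  by (rule conjI[OF subset_refl], rule exI[of _ 0])
     (auto simp: padic_box_0_iff intro: padic_norm_le_stable)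

lemma shell_subset: "shell k \<subseteq> (padic_box (0 :: 'p::prime_card padic ^ 'n::finite) 0)"
  and half_shell_subset: "half_shell i k \<subseteq> (padic_box (0 :: 'p::prime_card padic ^ 'n::finite) 0)"
proof -
  have q: "pinv TYPE('p) ^ n \<le> 1" for n using pinv_bounds[where 'p='p] by (intro power_le_one) auto
  show "shell k \<subseteq> (padic_box (0 :: 'p padic ^ 'n) 0)" using q by (auto simp: shell_def padic_box_0_iff simp del: power_divide)
  show "half_shell i k \<subseteq> (padic_box (0 :: 'p padic ^ 'n) 0)"
  proof
    fix x :: "'p padic ^ 'n" assume x: "x \<in> half_shell i k"
    have "padic_norm (x $ l) \<le> 1" for l
      using x q[of "k $ l"] unfolding half_shell_def by (cases "l = i") (auto intro: order_trans)
    then show "x \<in> padic_box 0 0" by (simp add: padic_box_0_iff)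
  qed
qed

lemma pinv_decr: "a \<le> b \<Longrightarrow> x \<le> pinv TYPE('p::prime_card) ^ b \<Longrightarrow> x \<le> pinv TYPE('p) ^ a"
  by (meson order_trans pinv_power_le_iff)

lemma locally_const_shell: "locally_const (shell k :: ('p::prime_card padic ^ 'n::finite) set)"
proof -
  have "locally_const {x\<in>padic_box (0 :: 'p padic ^ 'n) 0. \<forall>i. padic_norm (x $ i) = pinv TYPE('p) ^ (k $ i)}"
  proof (rule locally_const_inter_pred[OF locally_const_box, where n = "Suc (\<Sum>i\<in>UNIV. k $ i)"], rule allI)
    fix x y :: "'p padic ^ 'n" and i
    assume d: "\<And>i. padic_norm (y $ i - x $ i) \<le> pinv TYPE('p) ^ Suc (\<Sum>i\<in>UNIV. k $ i)"
      and x: "\<forall>i. padic_norm (x $ i) = pinv TYPE('p) ^ (k $ i)"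
    have "k $ i \<le> (\<Sum>i\<in>UNIV. k $ i)" by (rule member_le_sum) auto
    then have "padic_norm (y $ i - x $ i) \<le> pinv TYPE('p) ^ Suc (k $ i)" by (intro pinv_decr[OF _ d]) simp
    then show "padic_norm (y $ i) = pinv TYPE('p) ^ (k $ i)" using x padic_norm_eq_stable by blast
  qed
  also have "{x\<in>padic_box (0 :: 'p padic ^ 'n) 0. \<forall>i. padic_norm (x $ i) = pinv TYPE('p) ^ (k $ i)} = shell k"
    using shell_subset by (auto simp: shell_def)
  finally show ?thesis .
qed

lemma locally_const_half_shell: "locally_const (half_shell j k :: ('p::prime_card padic ^ 'n::finite) set)"
proof -
  have "locally_const {x\<in>padic_box (0 :: 'p padic ^ 'n) 0. (\<forall>l. l \<noteq> j \<longrightarrow> padic_norm (x $ l) = pinv TYPE('p) ^ (k $ l)) \<and>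
     padic_norm (x $ j) \<le> pinv TYPE('p) ^ (k $ j)}"
  proof (rule locally_const_inter_pred[OF locally_const_box, where n = "Suc (\<Sum>i\<in>UNIV. k $ i)"])
    fix x y :: "'p padic ^ 'n"
    assume d: "\<And>i. padic_norm (y $ i - x $ i) \<le> pinv TYPE('p) ^ Suc (\<Sum>i\<in>UNIV. k $ i)"
      and x: "(\<forall>l. l \<noteq> j \<longrightarrow> padic_norm (x $ l) = pinv TYPE('p) ^ (k $ l)) \<and> padic_norm (x $ j) \<le> pinv TYPE('p) ^ (k $ j)"
    have s: "k $ i \<le> (\<Sum>i\<in>UNIV. k $ i)" for i by (rule member_le_sum) auto
    have a: "padic_norm (y $ i - x $ i) \<le> pinv TYPE('p) ^ Suc (k $ i)" for i by (intro pinv_decr[OF _ d]) (simp add: s)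
    have "padic_norm (y $ j) \<le> pinv TYPE('p) ^ (k $ j)"
      by (rule padic_norm_le_stable[OF pinv_decr[OF _ a]]) (use x in auto)
    moreover have "padic_norm (y $ l) = pinv TYPE('p) ^ (k $ l)" if "l \<noteq> j" for l
      using x a that padic_norm_eq_stable by blast
    ultimately show "(\<forall>l. l \<noteq> j \<longrightarrow> padic_norm (y $ l) = pinv TYPE('p) ^ (k $ l)) \<and> padic_norm (y $ j) \<le> pinv TYPE('p) ^ (k $ j)" by blast
  qed
  also have "{x\<in>padic_box (0 :: 'p padic ^ 'n) 0. (\<forall>l. l \<noteq> j \<longrightarrow> padic_norm (x $ l) = pinv TYPE('p) ^ (k $ l)) \<and>
     padic_norm (x $ j) \<le> pinv TYPE('p) ^ (k $ j)} = half_shell j k"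
    using half_shell_subset by (auto simp: half_shell_def)
  finally show ?thesis .
qed

context integral_poly
begin

lemma locally_const_level_le:
  assumes "locally_const (D :: ('p padic ^ 'n) set)"
  shows "locally_const {x\<in>D. padic_norm (multipoly_eval f x) \<le> pinv TYPE('p) ^ n}"
proof (rule locally_const_inter_pred[OF assms, where n = n])
  fix x y :: "'p padic ^ 'n"
  assume 1: "\<And>i. padic_norm (x $ i) \<le> 1" "\<And>i. padic_norm (y $ i - x $ i) \<le> pinv TYPE('p) ^ n"
    "padic_norm (multipoly_eval f x) \<le> pinv TYPE('p) ^ n"
  have "pinv TYPE('p) ^ n \<le> 1" using pinv_bounds[where 'p='p] by (intro power_le_one) auto
  from padic_norm_le_stable[OF eval_lipschitz[OF 1(1,2) this] 1(3)]
  show "padic_norm (multipoly_eval f y) \<le> pinv TYPE('p) ^ n" .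
qed

lemma locally_const_level_eq:
  assumes "locally_const (D :: ('p padic ^ 'n) set)"
  shows "locally_const {x\<in>D. padic_norm (multipoly_eval f x) = pinv TYPE('p) ^ n}"
proof (rule locally_const_inter_pred[OF assms, where n = "Suc n"])
  fix x y :: "'p padic ^ 'n"
  assume 1: "\<And>i. padic_norm (x $ i) \<le> 1" "\<And>i. padic_norm (y $ i - x $ i) \<le> pinv TYPE('p) ^ Suc n"
    "padic_norm (multipoly_eval f x) = pinv TYPE('p) ^ n"
  have "pinv TYPE('p) ^ Suc n \<le> 1" using pinv_bounds[where 'p='p] by (intro power_le_one) auto
  from eval_lipschitz[OF 1(1,2) this]
  have "padic_norm (multipoly_eval f y - multipoly_eval f x) \<le> pinv TYPE('p) ^ Suc n" .
  then show "padic_norm (multipoly_eval f y) = pinv TYPE('p) ^ n" using 1 padic_norm_eq_stable by blast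
qed

lemma locally_const_theta_eq:
  assumes "locally_const (D :: ('p padic ^ 'n) set)"
  shows "locally_const {x\<in>D. {i. padic_norm (theta i f x) = pinv TYPE('p) ^ n} = J}"
proof (rule locally_const_inter_pred[OF assms, where n = "Suc n"])
  fix x y :: "'p padic ^ 'n"
  assume 1: "\<And>i. padic_norm (x $ i) \<le> 1" "\<And>i. padic_norm (y $ i - x $ i) \<le> pinv TYPE('p) ^ Suc n"
    "{i. padic_norm (theta i f x) = pinv TYPE('p) ^ n} = J"
  have "pinv TYPE('p) ^ Suc n \<le> 1" using pinv_bounds[where 'p='p] by (intro power_le_one) auto
  from theta_lipschitz[OF 1(1,2) this]
  have "padic_norm (theta i f y - theta i f x) \<le> pinv TYPE('p) ^ Suc n" for i .
  then show "{i. padic_norm (theta i f y) = pinv TYPE('p) ^ n} = J" using 1(3) padic_norm_eq_stable by blast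
qed

end

context haar
begin

lemma lc_sets: "locally_const A \<Longrightarrow> A \<in> sets \<mu>"
  by (rule open_sets[OF locally_const_open])

lemma emeasure_lc_le_1: "locally_const A \<Longrightarrow> emeasure \<mu> A \<le> 1"
  using emeasure_mono[of A "padic_box 0 0" \<mu>] open_sets[OF padic_box_open] emeasure_padic_box[of 0 0]
  by (auto simp: locally_const_def)

lemma fmeasurable_lc: "locally_const A \<Longrightarrow> A \<in> fmeasurable \<mu>"
  using emeasure_lc_le_1[of A] lc_sets[of A] by (intro fmeasurableI) (auto intro: le_less_trans)

lemma measure_lc_le_1: "locally_const A \<Longrightarrow> measure \<mu> A \<le> 1"
  using emeasure_lc_le_1[of A] by (simp add: measure_def enn2real_leI)

text \<open>One step of Hensel lifting: up to the next level, \<open>F\<close> changes linearly in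
  \<open>r\<close> with a slope of norm exactly p^(-n), so exactly one digit \<open>r\<close> moves
  a point of level \<open>n\<close> to level \<open>Suc n\<close>. The multiplier \<open>r\<close>
  is an integer because the splitting also translates backwards.\<close>

lemma emeasure_level_step:
  fixes F :: "'p padic ^ 'n \<Rightarrow> 'p padic"
  assumes "locally_const {x\<in>D. padic_norm (F x) \<le> pinv TYPE('p) ^ Suc n}"
    and D: "\<And>x r. x \<in> D \<Longrightarrow> x + of_int r *s \<delta> \<in> D"
    and c: "\<And>x. x \<in> D \<Longrightarrow> padic_norm (c x) = pinv TYPE('p) ^ n"
    and F: "\<And>x r. x \<in> D \<Longrightarrow> padic_norm (F (x + of_int r *s \<delta>) - F x - of_int r * c x) \<le> pinv TYPE('p) ^ Suc n"
  shows "emeasure \<mu> {x\<in>D. padic_norm (F x) \<le> pinv TYPE('p) ^ n}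
       = of_nat CARD('p) * emeasure \<mu> {x\<in>D. padic_norm (F x) \<le> pinv TYPE('p) ^ Suc n}"
proof (rule emeasure_split[of _ _ \<delta>])
  show "{x\<in>D. padic_norm (F x) \<le> pinv TYPE('p) ^ Suc n} \<in> sets borel" using lc_sets[OF assms(1)] sets_eq by simp
  fix x assume x: "x \<in> {x\<in>D. padic_norm (F x) \<le> pinv TYPE('p) ^ n}"
  have "padic_norm (F (x + of_nat r *s \<delta>)) \<le> pinv TYPE('p) ^ Suc n \<longleftrightarrow>
      padic_norm (F x + of_nat r * c x) \<le> pinv TYPE('p) ^ Suc n" for r
  proof -
    have "padic_norm (F (x + of_nat r *s \<delta>) - (F x + of_nat r * c x)) \<le> pinv TYPE('p) ^ Suc n"
      using F[of x "int r"] x by (simp add: algebra_simps)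
    then show ?thesis using padic_norm_le_stable padic_norm_minus_commute by metis
  qed
  moreover have "x + of_nat r *s \<delta> \<in> D" for r using D[of x "int r"] x by simp
  ultimately show "\<exists>!r. r < CARD('p) \<and> x + of_nat r *s \<delta> \<in> {x\<in>D. padic_norm (F x) \<le> pinv TYPE('p) ^ Suc n}"
    using padic_digit_scaled[OF c, of x "F x"] x by simp
next
  fix x r assume x: "x \<in> {x\<in>D. padic_norm (F x) \<le> pinv TYPE('p) ^ Suc n}"
  have e: "x + of_int (- int r) *s \<delta> = x - of_nat r *s \<delta>" by (simp add: vec_eq_iff)
  have xD: "x - of_nat r *s \<delta> \<in> D" using D[of x "- int r"] x by (simp add: e)
  have "padic_norm (of_int (- int r) * c x) \<le> pinv TYPE('p) ^ n"
    using c[of x] x padic_norm_of_int_le[of "- int r", where 'p='p]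
    unfolding padic_norm_mult by (metis (mono_tags, lifting) mem_Collect_eq mult_left_le_one_le padic_norm_nonneg)
  moreover have "padic_norm (F (x - of_nat r *s \<delta>) - F x - of_int (- int r) * c x) \<le> pinv TYPE('p) ^ n"
    by (rule pinv_decr[of n "Suc n"]) (use F[of x "- int r"] x in \<open>simp_all add: e\<close>)
  moreover have "padic_norm (F x) \<le> pinv TYPE('p) ^ n"
    by (rule pinv_decr[of n "Suc n"]) (use x in simp_all)
  ultimately have "padic_norm ((F (x - of_nat r *s \<delta>) - F x - of_int (- int r) * c x) + of_int (- int r) * c x + F x) \<le> pinv TYPE('p) ^ n"
    by (intro padic_norm_add_le)
  then have "padic_norm (F (x - of_nat r *s \<delta>)) \<le> pinv TYPE('p) ^ n" by simp
  with xD show "x - of_nat r *s \<delta> \<in> {x\<in>D. padic_norm (F x) \<le> pinv TYPE('p) ^ n}" by simp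
qed

lemma measure_of_emeasure_step:
  assumes "emeasure \<mu> A = of_nat CARD('p) * emeasure \<mu> B"
  shows "measure \<mu> B = pinv TYPE('p) * measure \<mu> A"
  using assms by (simp add: measure_def enn2real_mult)

end

locale haar_poly = haar \<mu> + integral_poly f
  for \<mu> :: "('p::prime_card padic ^ 'n::finite) measure" and f :: "('p padic, 'n) multipoly"
begin

abbreviation level :: "('p padic ^ 'n) set \<Rightarrow> nat \<Rightarrow> ('p padic ^ 'n) set" where
  "level D n \<equiv> {x\<in>D. padic_norm (multipoly_eval f x) \<le> pinv TYPE('p) ^ n}"

text \<open>Up to level \<open>dotn C k\<close> the condition is void since every term of
  \<open>f\<close> is that small; from there on each level has 1/p of the measure of the preceding
  one.\<close>

lemma measure_level_half_shell:
  assumes C: "C \<in> supp f" "C $ i = 1" "padic_norm (Poly_Mapping.lookup f C) = 1"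
    and dom: "\<And>\<omega>. \<omega> \<in> supp f \<Longrightarrow> \<omega> $ i \<ge> 1 \<Longrightarrow> \<omega> \<noteq> C \<Longrightarrow> dotn C k < dotn \<omega> k"
    and dom': "\<And>\<omega>. \<omega> \<in> supp f \<Longrightarrow> dotn C k \<le> dotn \<omega> k"
  shows "measure \<mu> (level (half_shell i k) n) = pinv TYPE('p) ^ (n - dotn C k) * measure \<mu> (half_shell i k)"
proof -
  let ?q = "pinv TYPE('p)"
  let ?c = "dotn C k"
  have low: "level (half_shell i k) n = half_shell i k" if "n \<le> ?c" for n
  proof -
    have "padic_norm (multipoly_eval f x) \<le> ?q ^ n" if x: "x \<in> half_shell i k" for x
      unfolding multipoly_eval_mono
    proof (intro padic_norm_sum_le term_le)
      fix \<omega> assume w: "\<omega> \<in> supp f"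
      have "padic_norm (mono_eval \<omega> x) \<le> (\<Prod>l\<in>UNIV. ?q ^ (\<omega> $ l * k $ l))"
        unfolding mono_eval_def padic_norm_prod padic_norm_power
      proof (rule prod_mono, rule conjI)
        fix l
        have "padic_norm (x $ l) \<le> ?q ^ (k $ l)" using x unfolding half_shell_def by (cases "l = i") simp_all
        then have "padic_norm (x $ l) ^ (\<omega> $ l) \<le> (?q ^ (k $ l)) ^ (\<omega> $ l)" by (rule power_mono) (rule padic_norm_nonneg)
        then show "padic_norm (x $ l) ^ (\<omega> $ l) \<le> ?q ^ (\<omega> $ l * k $ l)"
          by (simp only: power_mult[symmetric] mult.commute)
      qed (simp add: padic_norm_nonneg)
      also have "\<dots> = ?q ^ dotn \<omega> k" by (rule power_sum[symmetric])
      also have "\<dots> \<le> ?q ^ n" unfolding pinv_power_le_iff using dom'[OF w] \<open>n \<le> ?c\<close> by linarith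
      finally show "padic_norm (mono_eval \<omega> x) \<le> ?q ^ n" .
    qed simp
    then show ?thesis by blast
  qed
  have step: "measure \<mu> (level (half_shell i k) (Suc n)) = ?q * measure \<mu> (level (half_shell i k) n)" if n: "n \<ge> ?c" for n
  proof (rule measure_of_emeasure_step)
    \<comment> \<open>The size is chosen so that shifting the \<open>i\<close>-th coordinate by
      \<open>d\<close> changes the term \<open>C\<close> by norm exactly p^(-n): the remaining
      factors of \<open>C\<close> contribute level \<open>dotn C k - k $ i\<close>.\<close>
    define d :: "'p padic" where "d = padic_p ^ (n - ?c + k $ i)"
    have d: "padic_norm d = ?q ^ (n - ?c + k $ i)" by (simp only: d_def padic_norm_power padic_norm_p)
    have rd: "padic_norm (of_int r * d) \<le> ?q ^ (n - ?c + k $ i)" for r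
      unfolding padic_norm_mult d by (intro mult_left_le_one_le padic_norm_of_int_le) (auto simp: padic_norm_nonneg)
    have sh: "x + of_int r *s axis i d = x + axis i (of_int r * d)" for x :: "'p padic ^ 'n" and r
      by (simp add: vec_eq_iff axis_def)
    define c where "c x = d * (Poly_Mapping.lookup f C * (\<Prod>l\<in>UNIV - {i}. x $ l ^ (C $ l)))" for x
    show "emeasure \<mu> (level (half_shell i k) n) = of_nat CARD('p) * emeasure \<mu> (level (half_shell i k) (Suc n))"
    proof (rule emeasure_level_step[of _ _ _ "axis i d" c])
      show "locally_const (level (half_shell i k) (Suc n))" by (rule locally_const_level_le[OF locally_const_half_shell])
      fix x :: "'p padic ^ 'n" and r :: int assume x: "x \<in> half_shell i k"
      have "padic_norm (x $ i + of_int r * d) \<le> ?q ^ (k $ i)"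
        by (rule padic_norm_add_le[OF _ pinv_decr[OF _ rd]]) (use x in \<open>simp_all add: half_shell_def\<close>)
      then show "x + of_int r *s axis i d \<in> half_shell i k"
        unfolding sh using x by (auto simp: half_shell_def axis_def)
      have "padic_norm (\<Prod>l\<in>UNIV - {i}. x $ l ^ (C $ l)) = (\<Prod>l\<in>UNIV - {i}. ?q ^ (C $ l * k $ l))"
        using x unfolding half_shell_def
        by (auto simp: padic_norm_prod padic_norm_power power_mult[symmetric] mult.commute intro!: prod.cong)
      also have "\<dots> = ?q ^ (\<Sum>l\<in>UNIV - {i}. C $ l * k $ l)" by (rule power_sum[symmetric])
      finally have "padic_norm (c x) = ?q ^ (n - ?c + k $ i + (\<Sum>l\<in>UNIV - {i}. C $ l * k $ l))"
        by (simp only: c_def padic_norm_mult d C(3) mult_1_left power_add)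
      also have "n - ?c + k $ i + (\<Sum>l\<in>UNIV - {i}. C $ l * k $ l) = n"
        using n by (simp add: sum.remove[of UNIV i] C(2))
      finally show "padic_norm (c x) = ?q ^ n" .
      show "padic_norm (multipoly_eval f (x + of_int r *s axis i d) - multipoly_eval f x - of_int r * c x) \<le> ?q ^ Suc n"
      proof -
        have "padic_norm (multipoly_eval f (x + axis i (of_int r * d)) - multipoly_eval f x
            - (of_int r * d) * (Poly_Mapping.lookup f C * (\<Prod>l\<in>UNIV - {i}. x $ l ^ (C $ l)))) \<le> ?q ^ Suc n"
          by (rule half_shell_shift_le[OF C(1,2) _ x n rd]) (rule dom)
        then show ?thesis unfolding sh c_def by (simp only: mult.assoc)
      qed
    qed
  qed
  have "measure \<mu> (level (half_shell i k) (?c + j)) = ?q ^ j * measure \<mu> (half_shell i k)" for j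
  proof (induction j)
    case 0
    then show ?case using low[of ?c] by simp
  next
    case (Suc j)
    then show ?case using step[of "?c + j"] by (simp add: mult.assoc)
  qed
  from this[of "n - ?c"] show ?thesis using low[of n] by (cases "n \<le> ?c") auto
qed

text \<open>Below level \<open>m\<close> some \<open>theta i f\<close> has its largest possible
  norm, and Hensel steps in the direction of that coordinate divide the measure by p.\<close>

lemma measure_level_shell:
  assumes m: "\<And>\<omega>. \<omega> \<in> supp f \<Longrightarrow> m \<le> dotn \<omega> k"
    and nd: "\<And>x. x \<in> shell k \<Longrightarrow> padic_norm (multipoly_eval f x) < pinv TYPE('p) ^ m \<Longrightarrow>
       \<exists>i. padic_norm (theta i f x) = pinv TYPE('p) ^ m"
  shows "measure \<mu> (level (shell k) (Suc m + j)) = pinv TYPE('p) ^ j * measure \<mu> (level (shell k) (Suc m))"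
proof -
  let ?q = "pinv TYPE('p)"
  \<comment> \<open>Which of the derivatives is large may vary from point to point. Sorting by the
    set \<open>J\<close> of all large ones gives pieces that are stable under the shifts used below,
    and on each of them one direction from \<open>J\<close> serves all points.\<close>
  define D where "D J = {x\<in>shell k. {i. padic_norm (theta i f x) = ?q ^ m} = J}" for J
  have lcD: "locally_const (D J)" for J unfolding D_def by (rule locally_const_theta_eq[OF locally_const_shell])
  have split: "measure \<mu> (level (shell k) (Suc m + j)) = (\<Sum>J\<in>Pow UNIV - {{}}. measure \<mu> (level (D J) (Suc m + j)))" for j
  proof -
    have "level (shell k) (Suc m + j) = (\<Union>J\<in>Pow UNIV - {{}}. level (D J) (Suc m + j))"
    proof (intro equalityI subsetI)
      fix x assume x: "x \<in> level (shell k) (Suc m + j)"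
      have "?q ^ (Suc m + j) < ?q ^ m" by (simp only: pinv_power_less_iff)
      with x have "padic_norm (multipoly_eval f x) < ?q ^ m" by (auto intro: le_less_trans)
      then have "{i. padic_norm (theta i f x) = ?q ^ m} \<noteq> {}" using nd x by blast
      then show "x \<in> (\<Union>J\<in>Pow UNIV - {{}}. level (D J) (Suc m + j))" using x by (auto simp: D_def)
    qed (auto simp: D_def)
    moreover have "measure \<mu> (\<Union>J\<in>Pow UNIV - {{}}. level (D J) (Suc m + j)) = (\<Sum>J\<in>Pow UNIV - {{}}. measure \<mu> (level (D J) (Suc m + j)))"
    proof (rule measure_finite_Union)
      show "(\<lambda>J. level (D J) (Suc m + j)) ` (Pow UNIV - {{}}) \<subseteq> sets \<mu>"
        using lc_sets[OF locally_const_level_le[OF lcD]] by blast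
      show "disjoint_family_on (\<lambda>J. level (D J) (Suc m + j)) (Pow UNIV - {{}})"
        by (auto simp: disjoint_family_on_def D_def)
      show "emeasure \<mu> (level (D J) (Suc m + j)) \<noteq> \<infinity>" for J
        unfolding infinity_ennreal_def by (rule fmeasurableD2[OF fmeasurable_lc[OF locally_const_level_le[OF lcD]]])
    qed simp
    ultimately show ?thesis by simp
  qed
  have step: "measure \<mu> (level (D J) (Suc n)) = ?q * measure \<mu> (level (D J) n)" if n: "n \<ge> Suc m" and J: "J \<noteq> {}" for n J
  proof (rule measure_of_emeasure_step)
    obtain i where i: "i \<in> J" using J by blast
    define l where "l = n - m"
    \<comment> \<open>Here it matters that the count starts at \<open>Suc m\<close>: the quadratic
      error has level \<open>m + 2 * l\<close>, which is at least \<open>Suc n\<close> because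
      \<open>l\<close> is positive.\<close>
    have l: "n = m + l" "l \<ge> 1" using n by (auto simp: l_def)
    define d :: "'p padic" where "d = padic_p ^ (k $ i + l)"
    have d: "padic_norm d = ?q ^ (k $ i + l)" by (simp only: d_def padic_norm_power padic_norm_p)
    have rd: "padic_norm (of_int r * d) \<le> ?q ^ (k $ i + l)" for r
      unfolding padic_norm_mult d by (intro mult_left_le_one_le padic_norm_of_int_le) (auto simp: padic_norm_nonneg)
    have sh: "x + of_int r *s axis i d = x + axis i (of_int r * d)" for x :: "'p padic ^ 'n" and r
      by (simp add: vec_eq_iff axis_def)
    define c where "c x = d / x $ i * theta i f x" for x
    show "emeasure \<mu> (level (D J) n) = of_nat CARD('p) * emeasure \<mu> (level (D J) (Suc n))"
    proof (rule emeasure_level_step[of _ _ _ "axis i d" c])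
      show "locally_const (level (D J) (Suc n))" by (rule locally_const_level_le[OF lcD])
      fix x :: "'p padic ^ 'n" and r :: int assume xJ: "x \<in> D J"
      then have x: "x \<in> shell k" by (simp add: D_def)
      have "x + axis i (of_int r * d) \<in> shell k"
        by (rule shell_shift[OF m x pinv_decr[OF _ rd]]) (use l in auto)
      moreover have "padic_norm (theta i' f (x + axis i (of_int r * d)) - theta i' f x) \<le> ?q ^ Suc m" for i'
        by (rule pinv_decr[OF _ theta_shift_le[OF m x rd]]) (use l in auto)
      then have "{i'. padic_norm (theta i' f (x + axis i (of_int r * d))) = ?q ^ m} = {i'. padic_norm (theta i' f x) = ?q ^ m}"
        using padic_norm_eq_stable by blast
      ultimately show "x + of_int r *s axis i d \<in> D J" using xJ unfolding sh by (simp add: D_def)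
      have xi: "padic_norm (x $ i) = ?q ^ (k $ i)" using x by (simp add: shell_def)
      have x0: "x $ i \<noteq> 0"
      proof
        assume "x $ i = 0"
        then have "?q ^ (k $ i) = 0" using xi by simp
        then show False using pinv_bounds[where 'p='p] by simp
      qed
      have "c x * x $ i = d * theta i f x" using x0 by (simp add: c_def)
      then have "padic_norm (c x) * ?q ^ (k $ i) = ?q ^ (k $ i + l) * padic_norm (theta i f x)"
        by (metis padic_norm_mult xi d)
      also have "padic_norm (theta i f x) = ?q ^ m" using xJ i by (auto simp: D_def)
      finally have "padic_norm (c x) * ?q ^ (k $ i) = ?q ^ n * ?q ^ (k $ i)"
        by (simp only: l(1) power_add mult_ac)
      then show "padic_norm (c x) = ?q ^ n" by simp
      show "padic_norm (multipoly_eval f (x + of_int r *s axis i d) - multipoly_eval f x - of_int r * c x) \<le> ?q ^ Suc n"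
      proof -
        have "padic_norm (multipoly_eval f (x + axis i (of_int r * d)) - multipoly_eval f x
            - of_int r * d / x $ i * theta i f x) \<le> ?q ^ Suc n"
          by (rule pinv_decr[OF _ eval_shift_le[OF m x rd]]) (use l in auto)
        moreover have "of_int r * d / x $ i * theta i f x = of_int r * c x" by (simp add: c_def)
        ultimately show ?thesis unfolding sh by (simp only:)
      qed
    qed
  qed
  have "measure \<mu> (level (D J) (Suc m + j)) = ?q ^ j * measure \<mu> (level (D J) (Suc m))" if "J \<noteq> {}" for J
  proof (induction j)
    case (Suc j)
    then show ?case using step[of "Suc m + j" J] that by (simp add: mult.assoc)
  qed simp
  then have "(\<Sum>J\<in>Pow UNIV - {{}}. measure \<mu> (level (D J) (Suc m + j))) = ?q ^ j * (\<Sum>J\<in>Pow UNIV - {{}}. measure \<mu> (level (D J) (Suc m)))"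
    unfolding sum_distrib_left by (intro sum.cong) auto
  then show ?thesis using split[of j] split[of 0] by simp
qed

end

section \<open>Scaling and decomposition into shells\<close>

definition padic_scale :: "nat ^ 'n::finite \<Rightarrow> 'p::prime_card padic ^ 'n \<Rightarrow> 'p padic ^ 'n" where
  "padic_scale k u = (\<chi> i. padic_p ^ (k $ i) * u $ i)"

lemma padic_p_nonzero: "(padic_p :: 'p::prime_card padic) \<noteq> 0"
  using padic_norm_p[where 'p='p] by auto

lemma padic_norm_p_power: "padic_norm (padic_p ^ n :: 'p::prime_card padic) = pinv TYPE('p) ^ n"
  by (simp only: padic_norm_power padic_norm_p)

lemma pinv_power_pos: "0 < pinv TYPE('p::prime_card) ^ n"
  using pinv_bounds[where 'p='p] by simp

lemma mono_eval_scale: "mono_eval \<omega> (padic_scale k u) = padic_p ^ dotn \<omega> k * mono_eval \<omega> u"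
  by (simp add: mono_eval_def padic_scale_def power_mult_distrib prod.distrib power_mult[symmetric] power_sum mult.commute)

lemma shell_eq_scale: "shell k = padic_scale k ` (shell 0 :: ('p::prime_card padic ^ 'n::finite) set)"
proof (intro equalityI subsetI)
  fix x :: "'p padic ^ 'n" assume x: "x \<in> shell k"
  define u :: "'p padic ^ 'n" where "u = (\<chi> i. x $ i / padic_p ^ (k $ i))"
  have xu: "x = padic_scale k u" using padic_p_nonzero[where 'p='p] by (simp add: u_def padic_scale_def vec_eq_iff)
  have "padic_norm (u $ i) = 1" for i
  proof -
    have "pinv TYPE('p) ^ (k $ i) * padic_norm (u $ i) = padic_norm (x $ i)"
      by (simp only: xu padic_scale_def vec_lambda_beta padic_norm_mult padic_norm_p_power)
    also have "\<dots> = pinv TYPE('p) ^ (k $ i)" using x by (simp add: shell_def)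
    finally show ?thesis using pinv_power_pos[where 'p='p, of "k $ i"] by simp
  qed
  then show "x \<in> padic_scale k ` shell 0" using xu by (auto simp: shell_def)
qed (auto simp: shell_def padic_scale_def padic_norm_mult padic_norm_p_power)

context haar
begin

text \<open>\<open>B\<close> is a union of residue classes modulo p. Scaling maps each class to a
  box of known measure, so both sides count the digit vectors \<open>rep r\<close> lying in
  \<open>B\<close>.\<close>

lemma measure_scale:
  assumes B1: "B \<subseteq> padic_box (0 :: 'p padic ^ 'n) 0"
    and B2: "\<And>x y. x \<in> B \<Longrightarrow> (\<And>i. padic_norm (y $ i - x $ i) \<le> pinv TYPE('p)) \<Longrightarrow> y \<in> B"
  shows "measure \<mu> (padic_scale k ` B) = pinv TYPE('p) ^ (\<Sum>i\<in>UNIV. k $ i) * measure \<mu> B"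
proof -
  let ?q = "pinv TYPE('p)"
  define rep :: "('n \<Rightarrow> nat) \<Rightarrow> 'p padic ^ 'n" where "rep r = (\<chi> i. of_nat (r i))" for r
  define I where "I = {r \<in> PiE UNIV (\<lambda>_. {..<CARD('p)}). rep r \<in> B}"
  have finI: "finite I" unfolding I_def using finite_PiE[of "UNIV::'n set" "\<lambda>_. {..<CARD('p)}"] by simp
  have box: "y \<in> padic_box (padic_scale k v) (k + 1) \<longleftrightarrow> (\<exists>u. y = padic_scale k u \<and> (\<forall>i. padic_norm (u $ i - v $ i) \<le> ?q))"
    for y v :: "'p padic ^ 'n" and k
  proof
    assume y: "y \<in> padic_box (padic_scale k v) (k + 1)"
    define u :: "'p padic ^ 'n" where "u = (\<chi> i. y $ i / padic_p ^ (k $ i))"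
    have yu: "y = padic_scale k u" using padic_p_nonzero[where 'p='p] by (simp add: u_def padic_scale_def vec_eq_iff)
    have "padic_norm (u $ i - v $ i) \<le> ?q" for i
    proof -
      have e: "padic_scale k u $ i - padic_scale k v $ i = padic_p ^ (k $ i) * (u $ i - v $ i)" by (simp add: padic_scale_def algebra_simps)
      have "padic_norm (padic_scale k u $ i - padic_scale k v $ i) \<le> ?q ^ (k $ i + 1)"
        using y unfolding yu padic_box_def by auto
      then have "?q ^ (k $ i) * padic_norm (u $ i - v $ i) \<le> ?q ^ (k $ i) * ?q"
        unfolding e padic_norm_mult padic_norm_p_power by (simp only: power_add power_one_right)
      then show ?thesis using pinv_power_pos[where 'p='p, of "k $ i"] by (rule mult_left_le_imp_le)
    qed
    then show "\<exists>u. y = padic_scale k u \<and> (\<forall>i. padic_norm (u $ i - v $ i) \<le> ?q)" using yu by blast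
  next
    assume "\<exists>u. y = padic_scale k u \<and> (\<forall>i. padic_norm (u $ i - v $ i) \<le> ?q)"
    then obtain u where u: "y = padic_scale k u" "\<And>i. padic_norm (u $ i - v $ i) \<le> ?q" by blast
    have "padic_norm (y $ i - padic_scale k v $ i) \<le> ?q ^ ((k + 1) $ i)" for i
    proof -
      have e: "y $ i - padic_scale k v $ i = padic_p ^ (k $ i) * (u $ i - v $ i)" by (simp add: u padic_scale_def algebra_simps)
      show ?thesis unfolding e padic_norm_mult padic_norm_p_power
        using mult_left_mono[OF u(2)[of i], of "?q ^ (k $ i)"] by (simp add: mult.commute)
    qed
    then show "y \<in> padic_box (padic_scale k v) (k + 1)" by (simp add: padic_box_def)
  qed
  have dig: "\<exists>r\<in>I. \<forall>i. padic_norm (u $ i - rep r $ i) \<le> ?q" if u: "u \<in> B" for u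
  proof -
    have "\<exists>r. r < CARD('p) \<and> padic_norm (u $ i - of_nat r) < 1" for i
      using padic_digit[of "u $ i"] u B1 by (auto simp: padic_box_def)
    then obtain r where r: "\<And>i. r i < CARD('p)" "\<And>i. padic_norm (u $ i - of_nat (r i)) < 1" by metis
    have d: "padic_norm (u $ i - rep r $ i) \<le> ?q" for i
      using padic_norm_less_imp_le[of "u $ i - rep r $ i" 0] r(2)[of i] by (simp add: rep_def)
    have "rep r \<in> B" by (rule B2[OF u]) (metis d padic_norm_minus_commute)
    then show ?thesis using r(1) d by (intro bexI[of _ r]) (auto simp: I_def)
  qed
  have uniq: "r = r'" if r: "r \<in> I" "r' \<in> I" "\<And>i. padic_norm (u $ i - rep r $ i) \<le> ?q" "\<And>i. padic_norm (u $ i - rep r' $ i) \<le> ?q" for r r' u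
  proof
    fix i
    have q1: "?q < 1" using pinv_bounds[where 'p='p] by simp
    have l: "padic_norm (u $ i - of_nat (r i)) < 1" "padic_norm (u $ i - of_nat (r' i)) < 1"
      using le_less_trans[OF r(3)[of i] q1] le_less_trans[OF r(4)[of i] q1] by (simp_all add: rep_def)
    have "padic_norm ((u $ i - of_nat (r i)) + of_nat (r i)) \<le> 1"
      by (rule padic_norm_add_le) (use l(1) padic_norm_of_nat_le[of "r i"] in auto)
    then have "padic_norm (u $ i) \<le> 1" by simp
    moreover have "r i < CARD('p)" "r' i < CARD('p)" using r(1,2) by (auto simp: I_def)
    ultimately show "r i = r' i" using padic_digit[of "u $ i"] l by blast
  qed
  have main: "measure \<mu> (padic_scale k ` B) = real (card I) * ?q ^ (\<Sum>i\<in>UNIV. (k + 1) $ i)" for k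
  proof -
    define F where "F r = padic_box (padic_scale k (rep r)) (k + 1)" for r
    have "padic_scale k ` B = (\<Union>r\<in>I. F r)"
    proof (intro equalityI subsetI)
      fix x assume "x \<in> padic_scale k ` B"
      then obtain u where u: "u \<in> B" "x = padic_scale k u" by blast
      obtain r where "r \<in> I" "\<forall>i. padic_norm (u $ i - rep r $ i) \<le> ?q" using dig[OF u(1)] by blast
      moreover from this u(2) have "x \<in> F r" unfolding F_def by (intro box[THEN iffD2] exI conjI)
      ultimately show "x \<in> (\<Union>r\<in>I. F r)" by blast
    next
      fix x assume "x \<in> (\<Union>r\<in>I. F r)"
      then obtain r where r0: "r \<in> I" "x \<in> F r" by blast
      obtain u where u: "x = padic_scale k u" "\<forall>i. padic_norm (u $ i - rep r $ i) \<le> ?q"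
        using box[THEN iffD1, OF r0(2)[unfolded F_def]] by blast
      then have r: "r \<in> I" "x = padic_scale k u" "\<And>i. padic_norm (u $ i - rep r $ i) \<le> ?q" using r0 by auto
      have "u \<in> B" by (rule B2[of "rep r"]) (use r in \<open>auto simp: I_def\<close>)
      then show "x \<in> padic_scale k ` B" using r by blast
    qed
    moreover have "disjoint_family_on F I"
    proof -
      have "padic_scale k u = padic_scale k u' \<Longrightarrow> u = u'" for u u' :: "'p padic ^ 'n"
        using padic_p_nonzero[where 'p='p] by (simp add: padic_scale_def vec_eq_iff)
      note inj = this
      show ?thesis unfolding disjoint_family_on_def
      proof (intro ballI impI, rule ccontr)
        fix r r' assume r: "r \<in> I" "r' \<in> I" "r \<noteq> r'" "F r \<inter> F r' \<noteq> {}"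
        then obtain x where x: "x \<in> F r" "x \<in> F r'" by blast
        obtain u where u: "x = padic_scale k u" "\<forall>i. padic_norm (u $ i - rep r $ i) \<le> ?q"
          using box[THEN iffD1, OF x(1)[unfolded F_def]] by blast
        obtain u' where u': "x = padic_scale k u'" "\<forall>i. padic_norm (u' $ i - rep r' $ i) \<le> ?q"
          using box[THEN iffD1, OF x(2)[unfolded F_def]] by blast
        have "u' = u" using inj[of u' u] u(1) u'(1) by simp
        then show False using uniq[OF r(1,2), of u] u(2) u'(2) r(3) by blast
      qed
    qed
    moreover have "F ` I \<subseteq> sets \<mu>" using open_sets[OF padic_box_open] by (auto simp: F_def)
    moreover have mF: "emeasure \<mu> (F r) = ennreal (?q ^ (\<Sum>i\<in>UNIV. (k + 1) $ i))" for r
      unfolding F_def by (rule emeasure_padic_box)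
    moreover have "measure \<mu> (F r) = ?q ^ (\<Sum>i\<in>UNIV. (k + 1) $ i)" for r
      unfolding measure_def mF by (rule enn2real_ennreal) (rule less_imp_le[OF pinv_power_pos])
    ultimately show ?thesis
      using measure_finite_Union[OF finI, of F \<mu>] by simp
  qed
  have s0: "padic_scale 0 ` B = B" by (simp add: padic_scale_def vec_lambda_eta)
  have "measure \<mu> B = real (card I) * ?q ^ (\<Sum>i\<in>(UNIV::'n set). (0 + 1 :: nat^'n) $ i)"
    using main[of 0] unfolding s0 .
  moreover have "?q ^ (\<Sum>i\<in>UNIV. (k + 1) $ i) = ?q ^ (\<Sum>i\<in>UNIV. k $ i) * ?q ^ (\<Sum>i\<in>(UNIV::'n set). (0 + 1 :: nat^'n) $ i)"
    by (simp only: power_add[symmetric] sum.distrib[symmetric] vector_add_component zero_index add_0)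
  ultimately show ?thesis unfolding main by (simp only: mult_ac)
qed

text \<open>What the shells with all \<open>k $ i \<le> N\<close> leave out lies in the slabs on
  which one coordinate has norm at most p^(-N-1). Their total measure tends to 0, and they also
  contain the points with a vanishing coordinate.\<close>

lemma measure_has_sum_shells:
  assumes E: "locally_const E" and K: "\<And>x. x \<in> E \<Longrightarrow> (\<And>i. x $ i \<noteq> 0) \<Longrightarrow> \<exists>k\<in>K. x \<in> shell k"
  shows "((\<lambda>k. measure \<mu> (E \<inter> shell k)) has_sum measure \<mu> E) K"
  unfolding has_sum_def tendsto_iff eventually_finite_subsets_at_top
proof (intro allI impI)
  let ?q = "pinv TYPE('p)"
  fix \<epsilon> :: real assume eps: "\<epsilon> > 0"
  have "(\<lambda>N. real CARD('n) * ?q ^ Suc N) \<longlonglongrightarrow> real CARD('n) * 0"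
    using pinv_bounds[where 'p='p] by (intro tendsto_mult tendsto_const LIMSEQ_Suc LIMSEQ_power_zero) auto
  then have "eventually (\<lambda>N. real CARD('n) * ?q ^ Suc N < \<epsilon>) sequentially"
    using order_tendstoD(2)[of _ "real CARD('n) * 0" sequentially \<epsilon>] eps by simp
  then obtain N where N: "real CARD('n) * ?q ^ Suc N < \<epsilon>" by (auto simp: eventually_sequentially)
  define X where "X = K \<inter> {k. \<forall>i. k $ i \<le> N}"
  have lcE: "locally_const (E \<inter> shell k)" for k
  proof -
    have "locally_const {x\<in>E. x \<in> shell k}"
    proof -
      obtain n where n: "\<And>x y. x \<in> (shell k :: ('p padic ^ 'n) set) \<Longrightarrow> (\<And>i. padic_norm (y $ i - x $ i) \<le> ?q ^ n) \<Longrightarrow> y \<in> shell k"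
        using locally_const_shell[of k, where 'p='p] unfolding locally_const_def by blast
      show ?thesis by (rule locally_const_inter_pred[OF E, where n = n]) (rule n)
    qed
    moreover have "{x\<in>E. x \<in> shell k} = E \<inter> shell k" by blast
    ultimately show ?thesis by simp
  qed
  have "dist (\<Sum>k\<in>Y. measure \<mu> (E \<inter> shell k)) (measure \<mu> E) < \<epsilon>" if Y: "finite Y" "X \<subseteq> Y" "Y \<subseteq> K" for Y
  proof -
    define U where "U = (\<Union>k\<in>Y. E \<inter> shell k)"
    have disj: "disjoint_family_on (\<lambda>k. E \<inter> shell k) Y"
    proof -
      have "k = k'" if "x \<in> shell k" "x \<in> shell k'" for x :: "'p padic ^ 'n" and k k'
        using that pinv_power_eq_iff[where 'p='p] by (simp add: shell_def vec_eq_iff)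
      then show ?thesis unfolding disjoint_family_on_def by blast
    qed
    have mU: "measure \<mu> U = (\<Sum>k\<in>Y. measure \<mu> (E \<inter> shell k))"
      unfolding U_def
    proof (rule measure_finite_Union[OF Y(1) _ disj])
      show "(\<lambda>k. E \<inter> shell k) ` Y \<subseteq> sets \<mu>" using lc_sets[OF lcE] by blast
      show "emeasure \<mu> (E \<inter> shell k) \<noteq> \<infinity>" for k
        unfolding infinity_ennreal_def by (rule fmeasurableD2[OF fmeasurable_lc[OF lcE]])
    qed
    have Us: "U \<in> sets \<mu>" unfolding U_def using Y(1) lc_sets[OF lcE] by blast
    have UE: "U \<subseteq> E" by (auto simp: U_def)
    define V where "V i = padic_box (0 :: 'p padic ^ 'n) (axis i (Suc N))" for i
    have mV: "emeasure \<mu> (V i) = ennreal (?q ^ Suc N)" for i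
    proof -
      have "(\<Sum>j\<in>UNIV. axis i (Suc N) $ j) = Suc N" by (simp add: axis_def)
      then show ?thesis unfolding V_def emeasure_padic_box by simp
    qed
    have "E - U \<subseteq> (\<Union>i. V i)"
    proof
      fix x assume x: "x \<in> E - U"
      have x1: "padic_norm (x $ i) \<le> 1" for i using x E by (auto simp: locally_const_def padic_box_def)
      have "\<exists>i. padic_norm (x $ i) \<le> ?q ^ Suc N"
      proof (cases "\<exists>i. x $ i = 0")
        case False
        then obtain k where k: "k \<in> K" "x \<in> shell k" using K x by blast
        then have "k \<notin> Y" using x by (auto simp: U_def)
        then have "k \<notin> X" using Y by blast
        then obtain i where "k $ i \<ge> Suc N" using k by (auto simp: X_def not_le Suc_le_eq)
        moreover have "padic_norm (x $ i) = ?q ^ (k $ i)" using k by (simp add: shell_def)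
        ultimately have "padic_norm (x $ i) \<le> ?q ^ Suc N" by (simp only: pinv_power_le_iff)
        then show ?thesis by blast
      next
        case True
        then obtain i where "x $ i = 0" by blast
        then have "padic_norm (x $ i) \<le> ?q ^ Suc N" using pinv_power_pos[where 'p='p, of "Suc N"] by simp
        then show ?thesis by blast
      qed
      then obtain i where i: "padic_norm (x $ i) \<le> ?q ^ Suc N" by blast
      have "padic_norm (x $ j) \<le> ?q ^ (axis i (Suc N) $ j)" for j
        using i x1[of j] by (cases "j = i") (simp_all add: axis_def)
      then have "x \<in> V i" by (simp add: V_def padic_box_def)
      then show "x \<in> (\<Union>i. V i)" by blast
    qed
    then have "emeasure \<mu> (E - U) \<le> emeasure \<mu> (\<Union>i. V i)"
      by (rule emeasure_mono) (auto simp: V_def intro!: open_sets padic_box_open)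
    also have "\<dots> \<le> (\<Sum>i\<in>UNIV. emeasure \<mu> (V i))"
      by (rule emeasure_subadditive_finite) (auto simp: V_def intro!: open_sets padic_box_open)
    also have "\<dots> = ennreal (real CARD('n) * ?q ^ Suc N)"
      unfolding mV sum_constant ennreal_of_nat_eq_real_of_nat
      by (rule ennreal_mult[symmetric]) (simp_all add: less_imp_le[OF pinv_power_pos])
    finally have "measure \<mu> (E - U) \<le> real CARD('n) * ?q ^ Suc N"
      unfolding measure_def by (rule enn2real_leI[rotated]) (simp add: less_imp_le[OF pinv_power_pos])
    moreover have "measure \<mu> (E - U) = measure \<mu> E - measure \<mu> U"
      by (rule measure_Diff[OF _ lc_sets[OF E] Us UE])
         (use fmeasurableD2[OF fmeasurable_lc[OF E]] in \<open>simp add: infinity_ennreal_def\<close>)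
    moreover have "measure \<mu> (E - U) \<ge> 0" by simp
    ultimately show ?thesis using N mU by (simp add: dist_real_def)
  qed
  moreover have "finite X" unfolding X_def using finite_vec_le[of "\<lambda>_. N"] by blast
  moreover have "X \<subseteq> K" by (simp add: X_def)
  ultimately show "\<exists>X. finite X \<and> X \<subseteq> K \<and> (\<forall>Y. finite Y \<and> X \<subseteq> Y \<and> Y \<subseteq> K \<longrightarrow>
      dist (\<Sum>k\<in>Y. measure \<mu> (E \<inter> shell k)) (measure \<mu> E) < \<epsilon>)" by blast
qed

end

section \<open>The integral as a power series in p^(-s)\<close>

abbreviation pexp :: "'p::prime_card itself \<Rightarrow> complex \<Rightarrow> complex" where
  "pexp _ s \<equiv> exp (- of_real (ln (real CARD('p))) * s)"

lemma norm_pexp: "Re s > 0 \<Longrightarrow> norm (pexp TYPE('p::prime_card) s) < 1"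
  using card_ge_2[where 'p='p] by simp

lemma pinv_exp: "complex_of_real (pinv TYPE('p::prime_card) ^ n) = exp (- of_real (ln (real CARD('p))) * of_nat n)"
proof -
  have "pinv TYPE('p) = exp (- ln (real CARD('p)))" using card_ge_2[where 'p='p] by (simp add: exp_minus inverse_eq_divide)
  then have "pinv TYPE('p) ^ n = exp (real n * - ln (real CARD('p)))" by (simp only: exp_of_nat_mult)
  then show ?thesis by (simp add: exp_of_real[symmetric] mult.commute)
qed

lemma zeta_weight_eq:
  "zeta_weight CARD('p::prime_card) P k s = of_real (pinv TYPE('p) ^ (\<Sum>i\<in>UNIV. k $ i)) * pexp TYPE('p) s ^ dotn P k"
  unfolding zeta_weight_def pinv_exp exp_of_nat_mult[symmetric] exp_add[symmetric]
  by (rule arg_cong[of _ _ exp]) (simp add: algebra_simps)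

context haar_poly
begin

definition lev :: "('p padic ^ 'n) set \<Rightarrow> nat \<Rightarrow> real" where
  "lev D n = measure \<mu> {x\<in>D. padic_norm (multipoly_eval f x) = pinv TYPE('p) ^ n}"

text \<open>The integral of |f|^s over \<open>D\<close>, sorted by the values of |f|. The unordered
  sum makes the later interchange with sums over shells possible.\<close>

definition ser :: "('p padic ^ 'n) set \<Rightarrow> complex \<Rightarrow> complex" where
  "ser D s = infsum (\<lambda>n. of_real (lev D n) * pexp TYPE('p) s ^ n) UNIV"

lemma lev_nonneg: "lev D n \<ge> 0" by (simp add: lev_def)

lemma lev_le_1: "locally_const D \<Longrightarrow> lev D n \<le> 1"
  unfolding lev_def by (intro measure_lc_le_1 locally_const_level_eq)

lemma lev_diff:
  assumes D: "locally_const D"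
  shows "lev D n = measure \<mu> (level D n) - measure \<mu> (level D (Suc n))"
proof -
  have "level D n = {x\<in>D. padic_norm (multipoly_eval f x) = pinv TYPE('p) ^ n} \<union> level D (Suc n)"
    using padic_norm_less_imp_le[where 'p='p, of _ n] pinv_decr[where 'p='p, of n "Suc n"]
    by (auto simp: le_less)
  moreover have "{x\<in>D. padic_norm (multipoly_eval f x) = pinv TYPE('p) ^ n} \<inter> level D (Suc n) = {}"
    using pinv_power_le_iff[where 'p='p, of n "Suc n"] by auto
  ultimately have "measure \<mu> (level D n) = lev D n + measure \<mu> (level D (Suc n))"
    unfolding lev_def
    using measure_Un2[OF fmeasurable_lc[OF locally_const_level_eq[OF D]] fmeasurable_lc[OF locally_const_level_le[OF D]], of n "Suc n"]
    by (simp add: Diff_triv Int_commute)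
  then show ?thesis by simp
qed

lemma ser_summable:
  assumes D: "locally_const D" and s: "Re s > 0"
  shows "summable (\<lambda>n. norm (of_real (lev D n) * pexp TYPE('p) s ^ n))"
proof (rule summable_comparison_test'[where N = 0])
  show "summable (\<lambda>n. norm (pexp TYPE('p) s) ^ n)" using norm_pexp[OF s, where 'p='p] by (intro summable_geometric) simp
  show "norm (norm (of_real (lev D n) * pexp TYPE('p) s ^ n)) \<le> norm (pexp TYPE('p) s) ^ n" for n
    using lev_le_1[OF D, of n] lev_nonneg[of D n]
    by (simp add: norm_mult norm_power mult_left_le_one_le del: norm_exp_eq_Re)
qed

lemma ser_sums:
  assumes D: "locally_const D" and s: "Re s > 0" and S: "(\<lambda>n. of_real (lev D n) * pexp TYPE('p) s ^ n) sums S"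
  shows "ser D s = S"
  unfolding ser_def by (rule infsumI[OF norm_summable_imp_has_sum[OF ser_summable[OF D s] S]])

text \<open>For the norms, the sum over the shells gives the measure of a whole level, and the sum
  over levels is dominated by a geometric series. This absolute convergence justifies exchanging the
  two sums.\<close>

lemma ser_decompose:
  assumes D: "locally_const D" and K: "\<And>x. x \<in> D \<Longrightarrow> (\<And>i. x $ i \<noteq> 0) \<Longrightarrow> \<exists>k\<in>K. x \<in> shell k"
    and K': "\<And>k. k \<in> K \<Longrightarrow> shell k \<subseteq> D" and s: "Re s > 0"
  shows "ser D s = infsum (\<lambda>k. ser (shell k) s) K"
    "(\<lambda>k. ser (shell k) s) summable_on K"
proof -
  define g where "g n k = complex_of_real (lev (shell k) n) * pexp TYPE('p) s ^ n" for n k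
  have hs: "((\<lambda>k. lev (shell k) n) has_sum lev D n) K" for n
  proof -
    have "((\<lambda>k. measure \<mu> ({x\<in>D. padic_norm (multipoly_eval f x) = pinv TYPE('p) ^ n} \<inter> shell k)) has_sum lev D n) K"
      unfolding lev_def by (rule measure_has_sum_shells[OF locally_const_level_eq[OF D]]) (use K in blast)
    moreover have "measure \<mu> ({x\<in>D. padic_norm (multipoly_eval f x) = pinv TYPE('p) ^ n} \<inter> shell k) = lev (shell k) n" if "k \<in> K" for k
      unfolding lev_def using K'[OF that] by (intro arg_cong[of _ _ "measure \<mu>"]) auto
    ultimately show ?thesis by (simp cong: has_sum_cong)
  qed
  have gs: "(g n has_sum (of_real (lev D n) * pexp TYPE('p) s ^ n)) K" for n
    unfolding g_def by (intro has_sum_cmult_left has_sum_of_real hs)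
  have gn: "((\<lambda>k. norm (g n k)) has_sum (lev D n * norm (pexp TYPE('p) s) ^ n)) K" for n
  proof -
    have "norm (g n k) = lev (shell k) n * norm (pexp TYPE('p) s) ^ n" for k
      unfolding g_def norm_mult norm_power using lev_nonneg[of "shell k" n] by simp
    then show ?thesis using has_sum_cmult_left[OF hs[of n], of "norm (pexp TYPE('p) s) ^ n"] by simp
  qed
  have "(\<lambda>x. norm ((\<lambda>(n, k). g n k) x)) summable_on UNIV \<times> K"
  proof (rule Infinite_Sum.abs_summable_on_Sigma_iff[THEN iffD2], intro conjI ballI)
    fix n :: nat
    show "(\<lambda>k. norm (case (n, k) of (n, k) \<Rightarrow> g n k)) summable_on K"
      using gn[of n] by (auto simp: summable_on_def)
  next
    have e: "(\<Sum>\<^sub>\<infinity>k\<in>K. norm (case (n, k) of (n, k) \<Rightarrow> g n k)) = norm (of_real (lev D n) * pexp TYPE('p) s ^ n)" for n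
      using infsumI[OF gn[of n]] lev_nonneg[of D n] by (simp add: norm_mult norm_power)
    show "(\<lambda>n. norm (\<Sum>\<^sub>\<infinity>k\<in>K. norm (case (n, k) of (n, k) \<Rightarrow> g n k))) summable_on UNIV"
      unfolding e by (rule norm_summable_imp_summable_on) (use ser_summable[OF D s] in \<open>simp del: norm_exp_eq_Re\<close>)
  qed
  then have sm: "(\<lambda>(n, k). g n k) summable_on UNIV \<times> K" by (rule abs_summable_summable)
  have "ser D s = infsum (\<lambda>n. infsum (\<lambda>k. g n k) K) UNIV"
    unfolding ser_def using infsumI[OF gs] by simp
  also have "\<dots> = infsum (\<lambda>k. infsum (\<lambda>n. g n k) UNIV) K"
    by (rule infsum_swap_banach[OF sm])
  finally show "ser D s = infsum (\<lambda>k. ser (shell k) s) K" unfolding ser_def g_def .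
  have "(\<lambda>(k, n). g n k) summable_on K \<times> UNIV"
    using sm by (subst summable_on_swap) (simp add: case_prod_beta)
  then have "(\<lambda>k. infsum (\<lambda>n. g n k) UNIV) summable_on K"
    using summable_on_Sigma_banach[of "\<lambda>k n. g n k" K "\<lambda>_. UNIV"] by simp
  then show "(\<lambda>k. ser (shell k) s) summable_on K" unfolding ser_def g_def .
qed

definition kappa :: real where "kappa = measure \<mu> (shell 0)"

text \<open>The measure of the unit vectors at which the face polynomial with exponents
  \<open>\<phi>\<close> vanishes modulo p. It depends on \<open>k\<close> only through the
  face.\<close>

definition face_measure :: "(nat ^ 'n) set \<Rightarrow> real" where
  "face_measure \<phi> = measure \<mu> {u\<in>shell 0. padic_norm (\<Sum>\<omega>\<in>\<phi>. Poly_Mapping.lookup f \<omega> * mono_eval \<omega> u) \<le> pinv TYPE('p)}"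

lemma measure_shell: "measure \<mu> (shell k) = pinv TYPE('p) ^ (\<Sum>i\<in>UNIV. k $ i) * kappa"
  unfolding kappa_def shell_eq_scale[of k]
proof (rule measure_scale[OF shell_subset])
  fix x y :: "'p padic ^ 'n" assume x: "x \<in> shell 0" and d: "\<And>i. padic_norm (y $ i - x $ i) \<le> pinv TYPE('p)"
  have "padic_norm (y $ i) = pinv TYPE('p) ^ 0" for i
    using padic_norm_eq_stable[of "y $ i" "x $ i" 0] d[of i] x by (simp add: shell_def)
  then show "y \<in> shell 0" by (simp add: shell_def)
qed

text \<open>For x = p^k u with units u, \<open>f\<close> equals p^m times the face polynomial at u
  up to an error of level \<open>Suc m\<close>.\<close>

lemma measure_first_level:
  assumes m: "\<And>\<omega>. \<omega> \<in> supp f \<Longrightarrow> m \<le> dotn \<omega> k"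
  shows "measure \<mu> (level (shell k) (Suc m)) =
    pinv TYPE('p) ^ (\<Sum>i\<in>UNIV. k $ i) * face_measure {\<omega>\<in>supp f. dotn \<omega> k = m}"
proof -
  let ?q = "pinv TYPE('p)"
  let ?\<phi> = "{\<omega>\<in>supp f. dotn \<omega> k = m}"
  define g where "g u = (\<Sum>\<omega>\<in>?\<phi>. Poly_Mapping.lookup f \<omega> * mono_eval \<omega> u)" for u
  define B where "B = {u\<in>shell 0. padic_norm (g u) \<le> ?q}"
  have fin: "finite (supp f)" by simp
  have key: "padic_norm (multipoly_eval f (padic_scale k u)) \<le> ?q ^ Suc m \<longleftrightarrow> padic_norm (g u) \<le> ?q" if u: "u \<in> shell 0" for u
  proof -
    have 1: "multipoly_eval f (padic_scale k u) - padic_p ^ m * g u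
       = (\<Sum>\<omega>\<in>supp f - ?\<phi>. Poly_Mapping.lookup f \<omega> * mono_eval \<omega> (padic_scale k u))"
    proof -
      have "padic_p ^ m * g u = (\<Sum>\<omega>\<in>?\<phi>. Poly_Mapping.lookup f \<omega> * mono_eval \<omega> (padic_scale k u))"
        unfolding g_def sum_distrib_left mono_eval_scale by (rule sum.cong) auto
      moreover have "multipoly_eval f (padic_scale k u) =
          (\<Sum>\<omega>\<in>supp f - ?\<phi>. Poly_Mapping.lookup f \<omega> * mono_eval \<omega> (padic_scale k u)) +
          (\<Sum>\<omega>\<in>?\<phi>. Poly_Mapping.lookup f \<omega> * mono_eval \<omega> (padic_scale k u))"
        unfolding multipoly_eval_mono by (rule sum.subset_diff[OF _ fin]) auto
      ultimately show ?thesis by (simp only: add_diff_cancel_right')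
    qed
    have "padic_scale k u \<in> shell k" using u shell_eq_scale[of k] by blast
    then have "padic_norm (multipoly_eval f (padic_scale k u) - padic_p ^ m * g u) \<le> ?q ^ Suc m"
      unfolding 1
    proof (intro padic_norm_sum_le term_le)
      fix \<omega> assume x: "padic_scale k u \<in> shell k" and w: "\<omega> \<in> supp f - ?\<phi>"
      have "Suc m \<le> dotn \<omega> k" using w m[of \<omega>] by auto
      then show "padic_norm (mono_eval \<omega> (padic_scale k u)) \<le> ?q ^ Suc m"
        by (simp only: padic_norm_mono_shell[OF x] pinv_power_le_iff)
    qed simp
    then have "padic_norm (multipoly_eval f (padic_scale k u)) \<le> ?q ^ Suc m \<longleftrightarrow> padic_norm (padic_p ^ m * g u) \<le> ?q ^ Suc m"
      using padic_norm_le_stable padic_norm_minus_commute by metis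
    also have "\<dots> \<longleftrightarrow> ?q ^ m * padic_norm (g u) \<le> ?q ^ m * ?q"
      unfolding padic_norm_mult padic_norm_p_power by (simp add: mult.commute)
    also have "\<dots> \<longleftrightarrow> padic_norm (g u) \<le> ?q"
      using pinv_power_pos[where 'p='p, of m] by (intro mult_le_cancel_left_pos)
    finally show ?thesis .
  qed
  have lev: "level (shell k) (Suc m) = padic_scale k ` B"
  proof (intro equalityI subsetI)
    fix x assume x: "x \<in> level (shell k) (Suc m)"
    then obtain u where "u \<in> shell 0" "x = padic_scale k u" using shell_eq_scale[of k] by blast
    then show "x \<in> padic_scale k ` B" using x key[of u] by (auto simp: B_def)
  next
    fix x assume "x \<in> padic_scale k ` B"
    then obtain u where u: "u \<in> shell 0" "padic_norm (g u) \<le> ?q" "x = padic_scale k u" by (auto simp: B_def)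
    then show "x \<in> level (shell k) (Suc m)" using key[of u] shell_eq_scale[of k] by blast
  qed
  have "measure \<mu> (padic_scale k ` B) = ?q ^ (\<Sum>i\<in>UNIV. k $ i) * measure \<mu> B"
  proof (rule measure_scale)
    show "B \<subseteq> padic_box 0 0" using shell_subset by (auto simp: B_def)
    fix x y :: "'p padic ^ 'n" assume x: "x \<in> B" and d: "\<And>i. padic_norm (y $ i - x $ i) \<le> ?q"
    have x1: "padic_norm (x $ i) \<le> 1" for i using x by (simp add: B_def shell_def)
    have "padic_norm (y $ i) = ?q ^ 0" for i
      using padic_norm_eq_stable[of "y $ i" "x $ i" 0] d[of i] x by (simp add: B_def shell_def)
    then have "y \<in> shell 0" by (simp add: shell_def)
    moreover have "padic_norm (g y - g x) \<le> ?q"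
    proof -
      have "g y - g x = (\<Sum>\<omega>\<in>?\<phi>. Poly_Mapping.lookup f \<omega> * (mono_eval \<omega> y - mono_eval \<omega> x))"
        unfolding g_def sum_subtractf[symmetric] by (simp add: algebra_simps)
      also have "padic_norm \<dots> \<le> ?q"
        using pinv_bounds[where 'p='p] by (intro padic_norm_sum_le term_le mono_lipschitz x1 d) auto
      finally show ?thesis .
    qed
    ultimately show "y \<in> B" using x by (auto simp: B_def intro: padic_norm_le_stable)
  qed
  then show ?thesis unfolding lev face_measure_def B_def g_def .
qed

end

context haar_poly
begin

text \<open>On a shell on which \<open>f\<close> is non-degenerate its first level is equidistributed, and every further level
  has \<open>1 / p\<close> of the measure of the preceding one.\<close>

definition local_factor :: "real \<Rightarrow> complex \<Rightarrow> complex" where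
  "local_factor fm s = of_real (kappa - fm) +
     of_real (fm * (1 - pinv TYPE('p))) * pexp TYPE('p) s / (1 - of_real (pinv TYPE('p)) * pexp TYPE('p) s)"

lemma one_minus_nonzero:
  assumes "Re s > 0"
  shows "norm (of_real (pinv TYPE('p)) * pexp TYPE('p) s) < 1"
proof -
  have "norm (of_real (pinv TYPE('p)) * pexp TYPE('p) s) = pinv TYPE('p) * norm (pexp TYPE('p) s)"
    by (simp add: norm_mult norm_divide)
  also have "\<dots> < 1 * 1"
    by (rule mult_strict_mono) (use pinv_bounds[where 'p='p] norm_pexp[OF assms, where 'p='p] in auto)
  finally show ?thesis by simp
qed

lemma ser_shell:
  assumes P: "P \<in> supp f" and min: "\<And>\<omega>. \<omega> \<in> supp f \<Longrightarrow> dotn P k \<le> dotn \<omega> k"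
    and nd: "\<And>x. x \<in> shell k \<Longrightarrow> padic_norm (multipoly_eval f x) < pinv TYPE('p) ^ dotn P k \<Longrightarrow>
       \<exists>i. padic_norm (theta i f x) = pinv TYPE('p) ^ dotn P k"
    and s: "Re s > 0"
  shows "ser (shell k) s = zeta_weight CARD('p) P k s *
     local_factor (face_measure {\<omega>\<in>supp f. dotn \<omega> k = dotn P k}) s"
proof -
  let ?q = "pinv TYPE('p)" and ?e = "pexp TYPE('p) s"
  define m where "m = dotn P k"
  define Q where "Q = ?q ^ (\<Sum>i\<in>UNIV. k $ i)"
  define fm where "fm = face_measure {\<omega>\<in>supp f. dotn \<omega> k = m}"
  note lc = locally_const_shell[of k, where 'p='p]
  have min': "\<omega> \<in> supp f \<Longrightarrow> m \<le> dotn \<omega> k" for \<omega> using min by (simp add: m_def)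
  have low: "measure \<mu> (level (shell k) n) = Q * kappa" if "n \<le> m" for n
  proof -
    have "level (shell k) n = shell k" using eval_shell_le[OF min'] pinv_decr[OF that] by blast
    then show ?thesis by (simp add: measure_shell Q_def)
  qed
  have first: "measure \<mu> (level (shell k) (Suc m)) = Q * fm"
    unfolding fm_def Q_def by (rule measure_first_level[OF min'])
  have high: "measure \<mu> (level (shell k) (Suc m + j)) = ?q ^ j * (Q * fm)" for j
    unfolding first[symmetric] by (rule measure_level_shell[OF min']) (use nd in \<open>auto simp: m_def\<close>)
  have l1: "lev (shell k) n = 0" if "n < m" for n
    using low[of n] low[of "Suc n"] that by (simp add: lev_diff[OF lc])
  have l2: "lev (shell k) m = Q * (kappa - fm)"
    using low[of m] first by (simp add: lev_diff[OF lc] right_diff_distrib)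
  have l3: "lev (shell k) (j + Suc m) = Q * fm * (1 - ?q) * ?q ^ j" for j
  proof -
    have "lev (shell k) (Suc m + j) = ?q ^ j * (Q * fm) - ?q ^ Suc j * (Q * fm)"
      using high[of j] high[of "Suc j"] by (simp only: lev_diff[OF lc] add_Suc_right)
    also have "\<dots> = Q * fm * (1 - ?q) * ?q ^ j" by (simp add: algebra_simps)
    finally show ?thesis by (simp only: add.commute)
  qed
  have n1: "norm (of_real ?q * ?e) < 1" by (rule one_minus_nonzero[OF s])
  have "(\<lambda>j. of_real (Q * fm * (1 - ?q)) * ?e ^ Suc m * (of_real ?q * ?e) ^ j) sums
      (of_real (Q * fm * (1 - ?q)) * ?e ^ Suc m * (1 / (1 - of_real ?q * ?e)))"
    by (intro sums_mult geometric_sums n1)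
  moreover have "of_real (lev (shell k) (j + Suc m)) * ?e ^ (j + Suc m) =
      of_real (Q * fm * (1 - ?q)) * ?e ^ Suc m * (of_real ?q * ?e) ^ j" for j
    unfolding l3 power_add power_mult_distrib of_real_mult of_real_power by (simp only: mult_ac)
  ultimately have "(\<lambda>j. of_real (lev (shell k) (j + Suc m)) * ?e ^ (j + Suc m)) sums
      (of_real (Q * fm * (1 - ?q)) * ?e ^ Suc m * (1 / (1 - of_real ?q * ?e)))" by (simp only:)
  then have "(\<lambda>n. of_real (lev (shell k) n) * ?e ^ n) sums
      (of_real (Q * fm * (1 - ?q)) * ?e ^ Suc m * (1 / (1 - of_real ?q * ?e)) + (\<Sum>n<Suc m. of_real (lev (shell k) n) * ?e ^ n))"
    by (rule sums_iff_shift[THEN iffD1])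
  moreover have "(\<Sum>n<Suc m. of_real (lev (shell k) n) * ?e ^ n) = of_real (Q * (kappa - fm)) * ?e ^ m"
    using l1 l2 by simp
  ultimately have "ser (shell k) s = of_real (Q * fm * (1 - ?q)) * ?e ^ Suc m * (1 / (1 - of_real ?q * ?e)) + of_real (Q * (kappa - fm)) * ?e ^ m"
    using ser_sums[OF lc s] by simp
  also have "\<dots> = (of_real Q * ?e ^ m) * local_factor fm s"
  proof -
    have ring: "(a * b * c) * (e * em) * (1 / d) + (a * g) * em = (a * em) * (g + b * c * e / d)" for a b c d e em g :: complex
      by (simp add: algebra_simps)
    show ?thesis unfolding local_factor_def power_Suc of_real_mult by (rule ring)
  qed
  also have "of_real Q * ?e ^ m = zeta_weight CARD('p) P k s"
    unfolding zeta_weight_eq Q_def m_def ..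
  finally show ?thesis unfolding fm_def m_def .
qed

lemma local_factor_regular:
  assumes "Re s0 \<noteq> -1"
  shows "regular_at s0 (local_factor fm)"
proof (rule regular_at_divide)
  let ?q = "pinv TYPE('p)"
  show "(\<lambda>s. 1 - of_real ?q * pexp TYPE('p) s) holomorphic_on UNIV" by (intro holomorphic_intros)
  show "1 - of_real ?q * pexp TYPE('p) s0 \<noteq> 0"
  proof
    assume "1 - of_real ?q * pexp TYPE('p) s0 = 0"
    then have "norm (of_real ?q * pexp TYPE('p) s0) = 1" by (metis eq_iff_diff_eq_0 norm_one)
    moreover have "norm (of_real ?q * pexp TYPE('p) s0) = exp (- ln (real CARD('p)) * (1 + Re s0))"
    proof -
      have "?q = exp (- ln (real CARD('p)))" using card_ge_2[where 'p='p] by (simp add: exp_minus inverse_eq_divide)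
      moreover have "norm (of_real ?q * pexp TYPE('p) s0) = ?q * exp (- ln (real CARD('p)) * Re s0)"
        by (simp add: norm_mult norm_divide)
      ultimately show ?thesis by (simp only: exp_add[symmetric]) (simp add: algebra_simps)
    qed
    ultimately have "ln (real CARD('p)) * (1 + Re s0) = 0" by simp
    moreover have "ln (real CARD('p)) > 0" using card_ge_2[where 'p='p] by simp
    ultimately show False using assms by simp
  qed
  show "regular_at s0 (\<lambda>s. (1 - of_real ?q * pexp TYPE('p) s) * local_factor fm s)"
  proof (rule regular_at_cong)
    fix s :: complex assume s: "Re s > 0"
    have nz: "1 - of_real ?q * pexp TYPE('p) s \<noteq> 0" using one_minus_nonzero[OF s] by (metis eq_iff_diff_eq_0 less_irrefl norm_one)
    have ring: "d * (a + b * e / d) = d * a + b * e" if "d \<noteq> 0" for a b d e :: complex using that by (simp add: field_simps)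
    show "(1 - of_real ?q * pexp TYPE('p) s) * local_factor fm s =
      (1 - of_real ?q * pexp TYPE('p) s) * of_real (kappa - fm) + of_real (fm * (1 - ?q)) * pexp TYPE('p) s"
      unfolding local_factor_def by (rule ring[OF nz])
  qed (intro regular_at_holomorphic holomorphic_intros)
qed

lemma half_shell_decompose:
  assumes s: "Re s > 0"
  shows "ser (half_shell i k) s = infsum (\<lambda>t. ser (shell (k + t *s axis i 1)) s) UNIV"
proof -
  define h where "h t = k + t *s axis i 1" for t
  have inj: "inj h" by (rule injI) (auto simp: h_def vec_eq_iff axis_def split: if_splits)
  have "ser (half_shell i k) s = infsum (\<lambda>k. ser (shell k) s) (range h)"
  proof (rule ser_decompose[OF locally_const_half_shell _ _ s])
    fix x :: "'p padic ^ 'n" assume x: "x \<in> half_shell i k" and nz: "\<And>i. x $ i \<noteq> 0"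
    have "padic_norm (x $ i) \<le> 1" using subsetD[OF half_shell_subset x] by (simp add: padic_box_def)
    then obtain n where n: "padic_norm (x $ i) = pinv TYPE('p) ^ n" using padic_norm_nat_power[OF nz] by blast
    have "pinv TYPE('p) ^ n \<le> pinv TYPE('p) ^ (k $ i)" using x n by (simp add: half_shell_def)
    then have "k $ i \<le> n" by (simp only: pinv_power_le_iff)
    then have "x \<in> shell (h (n - k $ i))" using x n by (auto simp: shell_def h_def half_shell_def axis_def)
    then show "\<exists>k\<in>range h. x \<in> shell k" by blast
  next
    fix k' assume "k' \<in> range h"
    then obtain t where "k' = h t" by blast
    then have k': "k' $ l = k $ l + (if l = i then t else 0)" for l by (simp add: h_def axis_def)
    show "shell k' \<subseteq> (half_shell i k :: ('p padic ^ 'n) set)"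
    proof
      fix x :: "'p padic ^ 'n" assume x: "x \<in> shell k'"
      have "pinv TYPE('p) ^ (k' $ i) \<le> pinv TYPE('p) ^ (k $ i)" unfolding pinv_power_le_iff by (simp add: k')
      then show "x \<in> half_shell i k" using x k' by (simp add: shell_def half_shell_def)
    qed
  qed
  also have "\<dots> = infsum (\<lambda>t. ser (shell (h t)) s) UNIV"
    by (subst infsum_reindex[OF inj]) (simp add: comp_def)
  finally show ?thesis unfolding h_def .
qed

text \<open>Because of truncated subtraction both powers equal 1 below \<open>dotn C k\<close>, so
  the formula covers the empty levels too. The right-hand side involves \<open>f\<close> only
  through \<open>C\<close>, which is what allows the comparison with the monomial.\<close>

lemma lev_half_shell:
  assumes C: "C \<in> supp f" "C $ i = 1" "padic_norm (Poly_Mapping.lookup f C) = 1"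
    and dom: "\<And>\<omega>. \<omega> \<in> supp f \<Longrightarrow> \<omega> $ i \<ge> 1 \<Longrightarrow> \<omega> \<noteq> C \<Longrightarrow> dotn C k < dotn \<omega> k"
    and dom': "\<And>\<omega>. \<omega> \<in> supp f \<Longrightarrow> dotn C k \<le> dotn \<omega> k"
  shows "lev (half_shell i k) n =
    (pinv TYPE('p) ^ (n - dotn C k) - pinv TYPE('p) ^ (Suc n - dotn C k)) * measure \<mu> (half_shell i k)"
proof -
  have "measure \<mu> (level (half_shell i k) n) = pinv TYPE('p) ^ (n - dotn C k) * measure \<mu> (half_shell i k)" for n
    by (rule measure_level_half_shell[OF C]) (use dom dom' in auto)
  then show ?thesis by (simp only: lev_diff[OF locally_const_half_shell] left_diff_distrib)
qed

end

text \<open>The monomial is itself an integral polynomial, so the statements about half shells can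
  be applied to it verbatim. Coefficient 1 is as good as any unit.\<close>

lemma (in haar) haar_poly_monomial: "haar_poly \<mu> (Poly_Mapping.single C 1)"
  by unfold_locales (simp add: lookup_single when_def padic_integers_def)

lemma (in haar) ser_shell_monomial:
  assumes s: "Re s > 0"
  shows "haar_poly.ser \<mu> (Poly_Mapping.single C 1) (shell k) s =
    of_real (haar_poly.kappa \<mu>) * zeta_weight CARD('p) C k s"
proof -
  interpret M: haar_poly \<mu> "Poly_Mapping.single C 1" by (rule haar_poly_monomial)
  have ev: "multipoly_eval (Poly_Mapping.single C 1) x = mono_eval C x" for x :: "'p padic ^ 'n"
    by (simp add: multipoly_eval_mono)
  have l: "M.lev (shell k) n = (if n = dotn C k then measure \<mu> (shell k) else 0)" for n
  proof (cases "n = dotn C k")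
    case True
    then have "{x\<in>(shell k :: ('p padic ^ 'n) set). padic_norm (multipoly_eval (Poly_Mapping.single C 1) x) = pinv TYPE('p) ^ n} = shell k"
      unfolding ev by (auto simp: padic_norm_mono_shell simp del: power_divide)
    then show ?thesis using True by (simp add: M.lev_def)
  next
    case False
    have "{x\<in>(shell k :: ('p padic ^ 'n) set). padic_norm (multipoly_eval (Poly_Mapping.single C 1) x) = pinv TYPE('p) ^ n} = {}"
      unfolding ev using padic_norm_mono_shell False pinv_power_eq_iff[where 'p='p, of "dotn C k" n]
      by (auto simp: padic_norm_mono_shell simp del: power_divide)
    then show ?thesis using False unfolding M.lev_def by (simp only: measure_empty if_False)
  qed
  have "(\<lambda>n. if n = dotn C k then of_real (measure \<mu> (shell k)) * pexp TYPE('p) s ^ n else 0) sums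
      (of_real (measure \<mu> (shell k)) * pexp TYPE('p) s ^ dotn C k)"
    using sums_single[of "dotn C k" "\<lambda>n. of_real (measure \<mu> (shell k)) * pexp TYPE('p) s ^ n"] .
  moreover have "(\<lambda>n. if n = dotn C k then of_real (measure \<mu> (shell k)) * pexp TYPE('p) s ^ n else 0)
      = (\<lambda>n. of_real (M.lev (shell k) n) * pexp TYPE('p) s ^ n)" unfolding l by auto
  ultimately have "M.ser (shell k) s = of_real (measure \<mu> (shell k)) * pexp TYPE('p) s ^ dotn C k"
    using M.ser_sums[OF locally_const_shell s] by (simp only:)
  then show ?thesis unfolding M.measure_shell zeta_weight_eq of_real_mult by (simp only: mult_ac)
qed

context haar_poly
begin

text \<open>
  Integrating over the \<open>i\<close>-th coordinate first, \<open>f\<close> has the same distribution as its monomial \<open>C\<close>: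
  translations in that coordinate shift \<open>f\<close> by a multiple of the monomial divided by \<open>x_i\<close>.
\<close>

lemma infsum_ser_fibre:
  assumes C: "C \<in> supp f" "C $ i = 1" "padic_norm (Poly_Mapping.lookup f C) = 1"
    and dom: "\<And>\<omega>. \<omega> \<in> supp f \<Longrightarrow> \<omega> $ i \<ge> 1 \<Longrightarrow> \<omega> \<noteq> C \<Longrightarrow> dotn C k < dotn \<omega> k"
    and dom': "\<And>\<omega>. \<omega> \<in> supp f \<Longrightarrow> dotn C k \<le> dotn \<omega> k"
    and s: "Re s > 0"
  shows "infsum (\<lambda>t. ser (shell (k + t *s axis i 1)) s) UNIV =
    infsum (\<lambda>t. of_real kappa * zeta_weight CARD('p) C (k + t *s axis i 1) s) UNIV"
proof -
  interpret M: haar_poly \<mu> "Poly_Mapping.single C 1" by (rule haar_poly_monomial)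
  have "lev (half_shell i k) n = M.lev (half_shell i k) n" for n
  proof -
    have "lev (half_shell i k) n =
      (pinv TYPE('p) ^ (n - dotn C k) - pinv TYPE('p) ^ (Suc n - dotn C k)) * measure \<mu> (half_shell i k)"
      by (rule lev_half_shell[OF C]) (use dom dom' in auto)
    moreover have "M.lev (half_shell i k) n =
      (pinv TYPE('p) ^ (n - dotn C k) - pinv TYPE('p) ^ (Suc n - dotn C k)) * measure \<mu> (half_shell i k)"
      by (rule M.lev_half_shell) (use C in \<open>auto split: if_splits\<close>)
    ultimately show ?thesis by simp
  qed
  then have "ser (half_shell i k) s = M.ser (half_shell i k) s"
    by (simp only: ser_def M.ser_def)
  then show ?thesis
    unfolding half_shell_decompose[OF s] M.half_shell_decompose[OF s] ser_shell_monomial[OF s] .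
qed

section \<open>The zeta function as a sum over shells\<close>

lemma locally_const_maximal_box: "locally_const (padic_box (0 :: 'p padic ^ 'n) 1)"
proof -
  have "locally_const {x\<in>padic_box (0 :: 'p padic ^ 'n) 0. \<forall>i. padic_norm (x $ i) \<le> pinv TYPE('p) ^ 1}"
    by (rule locally_const_inter_pred[OF locally_const_box, where n = 1]) (blast intro: padic_norm_le_stable)
  also have "{x\<in>padic_box (0 :: 'p padic ^ 'n) 0. \<forall>i. padic_norm (x $ i) \<le> pinv TYPE('p) ^ 1} = padic_box 0 1"
    using pinv_bounds[where 'p='p] by (auto simp: padic_box_def intro: order_trans)
  finally show ?thesis .
qed

lemma igusa_zeta_eq_ser:
  assumes s: "Re s > 0"
  shows "igusa_zeta \<mu> f s = ser (padic_box 0 1) s"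
proof -
  let ?q = "pinv TYPE('p)" and ?e = "pexp TYPE('p) s"
  let ?A = "padic_box (0 :: 'p padic ^ 'n) 1"
  have A: "{x :: 'p padic ^ 'n. \<forall>i. x $ i \<in> (*) (of_nat CARD('p)) ` padic_integers} = ?A"
  proof -
    have "y \<in> (*) padic_p ` padic_integers \<longleftrightarrow> padic_norm y \<le> ?q" for y :: "'p padic"
    proof
      assume "padic_norm y \<le> ?q"
      then have "?q * padic_norm (y / padic_p) \<le> ?q * 1"
        using padic_norm_mult[of padic_p "y / padic_p"] padic_p_nonzero[where 'p='p] padic_norm_p[where 'p='p] by simp
      then have "padic_norm (y / padic_p) \<le> 1" using pinv_bounds(1)[where 'p='p] by (rule mult_left_le_imp_le)
      then show "y \<in> (*) padic_p ` padic_integers"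
        using padic_p_nonzero[where 'p='p] by (intro image_eqI[of _ _ "y / padic_p"]) (auto simp: padic_integers_def)
    next
      assume "y \<in> (*) padic_p ` padic_integers"
      then obtain z where z: "y = padic_p * z" "padic_norm z \<le> 1" by (auto simp: padic_integers_def)
      have "padic_norm y = ?q * padic_norm z" unfolding z(1) padic_norm_mult padic_norm_p ..
      moreover have "?q * padic_norm z \<le> ?q * 1"
        by (rule mult_left_mono[OF z(2) less_imp_le[OF pinv_bounds(1)]])
      ultimately show "padic_norm y \<le> ?q" by simp
    qed
    then show ?thesis by (simp add: padic_box_def)
  qed
  have q0: "0 < ?q" "?q < 1" by (rule pinv_bounds)+
  note lcA = locally_const_maximal_box
  define B where "B n = {x\<in>?A. padic_norm (multipoly_eval f x) = ?q ^ n}" for n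
  have lcB: "locally_const (B n)" for n unfolding B_def by (rule locally_const_level_eq[OF lcA])
  define g where "g n x = indicat_real (B n) x *\<^sub>R ?e ^ n" for n x
  have fin: "emeasure \<mu> (B n) < \<infinity>" for n
    using fmeasurableD2[OF fmeasurable_lc[OF lcB]] by (simp add: less_top infinity_ennreal_def)
  have hb: "has_bochner_integral \<mu> (g n) (measure \<mu> (B n) *\<^sub>R ?e ^ n)" for n
    unfolding g_def by (rule has_bochner_integral_indicator[OF lc_sets[OF lcB] fin])
  have hbn: "has_bochner_integral \<mu> (\<lambda>x. norm (g n x)) (measure \<mu> (B n) *\<^sub>R norm (?e ^ n))" for n
  proof -
    have "norm (g n x) = indicat_real (B n) x *\<^sub>R norm (?e ^ n)" for x by (simp add: g_def indicator_def)
    then show ?thesis using has_bochner_integral_indicator[OF lc_sets[OF lcB] fin, of n "norm (?e ^ n)"] by simp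
  qed
  define h where "h x = complex_of_real (padic_norm (multipoly_eval f x)) powr s" for x
  have pw: "(\<lambda>n. g n x) sums (indicat_real ?A x *\<^sub>R h x) \<and> summable (\<lambda>n. norm (g n x))" for x
  proof (cases "x \<in> ?A \<and> multipoly_eval f x \<noteq> 0")
    \<comment> \<open>At a zero of \<open>f\<close> no level contains the point, and the integrand
      vanishes as well since \<open>0 powr s = 0\<close>.\<close>
    case False
    have g0: "g n x = 0" for n
    proof -
      have "?q ^ n \<noteq> 0" using q0 by simp
      then have "x \<notin> B n" using False by (auto simp: B_def)
      then show ?thesis by (simp add: g_def)
    qed
    have h0: "indicat_real ?A x *\<^sub>R h x = 0" using False by (auto simp: h_def indicator_def)
    show ?thesis unfolding g0 h0 by simp
  next
    case True
    have "padic_norm (multipoly_eval f x) \<le> 1"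
    proof -
      have "x \<in> padic_box 0 0" using lcA True by (auto simp: locally_const_def)
      then have "x \<in> level (padic_box 0 0) 0"
        unfolding multipoly_eval_mono mem_Collect_eq
        by (auto intro!: padic_norm_sum_le term_le prod_le_1 power_le_one simp: mono_eval_def padic_norm_prod padic_norm_power padic_box_def padic_norm_nonneg)
      then show ?thesis by simp
    qed
    then obtain N where N: "padic_norm (multipoly_eval f x) = ?q ^ N" using padic_norm_nat_power True by blast
    have gx: "g n x = (if n = N then ?e ^ n else 0)" for n
      using True N pinv_power_eq_iff[where 'p='p, of N n] by (auto simp: g_def B_def indicator_def)
    have "h x = ?e ^ N"
    proof -
      have "h x = exp (s * of_real (ln (?q ^ N)))"
        unfolding h_def N powr_def Ln_of_real[OF pinv_power_pos] using pinv_power_pos[where 'p='p, of N]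
        by (simp del: power_divide of_real_power)
      also have "ln (?q ^ N) = - real N * ln (real CARD('p))"
        using q0 card_ge_2[where 'p='p] by (simp add: ln_realpow ln_div)
      also have "exp (s * of_real (- real N * ln (real CARD('p)))) = ?e ^ N"
        unfolding exp_of_nat_mult[symmetric] by (rule arg_cong[of _ _ exp]) simp
      finally show ?thesis .
    qed
    then have "indicat_real ?A x *\<^sub>R h x = ?e ^ N" using True by simp
    then show ?thesis unfolding gx
      using sums_single[of N "\<lambda>n. ?e ^ n"] summable_finite[of "{N}" "\<lambda>n. norm (if n = N then ?e ^ n else 0)"] by auto
  qed
  have "(\<lambda>n. integral\<^sup>L \<mu> (g n)) sums (\<integral>x. (suminf (\<lambda>n. g n x)) \<partial>\<mu>)"
  proof (rule sums_integral)
    show "integrable \<mu> (g n)" for n using hb by (rule has_bochner_integral_iff[THEN iffD1, THEN conjunct1])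
    show "AE x in \<mu>. summable (\<lambda>n. norm (g n x))" using pw by simp
    have "(\<integral>x. norm (g n x) \<partial>\<mu>) = norm (of_real (lev ?A n) * ?e ^ n)" for n
      using has_bochner_integral_integral_eq[OF hbn[of n]] lev_nonneg[of ?A n]
      by (simp add: lev_def B_def norm_mult)
    then show "summable (\<lambda>n. \<integral>x. norm (g n x) \<partial>\<mu>)" using ser_summable[OF lcA s] by (simp only:)
  qed
  moreover have "(suminf (\<lambda>n. g n x)) = indicat_real ?A x *\<^sub>R h x" for x using pw[of x] sums_unique by metis
  moreover have "integral\<^sup>L \<mu> (g n) = of_real (lev ?A n) * ?e ^ n" for n
    using has_bochner_integral_integral_eq[OF hb[of n]] by (simp add: lev_def B_def scaleR_conv_of_real)
  ultimately have "(\<lambda>n. of_real (lev ?A n) * ?e ^ n) sums (\<integral>x. indicat_real ?A x *\<^sub>R h x \<partial>\<mu>)" by simp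
  from ser_sums[OF lcA s this] show ?thesis
    unfolding igusa_zeta_def A set_lebesgue_integral_def h_def by simp
qed

lemma igusa_zeta_eq_infsum:
  assumes s: "Re s > 0"
  shows "igusa_zeta \<mu> f s = infsum (\<lambda>k. ser (shell k) s) {k. \<forall>i. k $ i \<ge> 1}"
    "(\<lambda>k. ser (shell k) s) summable_on {k. \<forall>i. k $ i \<ge> 1}"
proof -
  let ?q = "pinv TYPE('p)"
  let ?A = "padic_box (0 :: 'p padic ^ 'n) 1"
  have q0: "0 < ?q" "?q < 1" by (rule pinv_bounds)+
  note lcA = locally_const_maximal_box
  have 1: "\<exists>k\<in>{k. \<forall>i. k $ i \<ge> 1}. x \<in> shell k" if x: "x \<in> ?A" "\<And>i. x $ i \<noteq> 0" for x
  proof -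
    have "\<exists>n. padic_norm (x $ i) = ?q ^ n \<and> n \<ge> 1" for i
    proof -
      have le: "padic_norm (x $ i) \<le> ?q ^ 1" using x(1) by (simp add: padic_box_def)
      moreover have "?q ^ 1 \<le> 1" using q0 by simp
      ultimately have "padic_norm (x $ i) \<le> 1" by (rule order_trans)
      then obtain n where n: "padic_norm (x $ i) = ?q ^ n" using padic_norm_nat_power[OF x(2)] by blast
      then show ?thesis using le unfolding n pinv_power_le_iff by blast
    qed
    then obtain n where n: "\<And>i. padic_norm (x $ i) = ?q ^ n i" "\<And>i. n i \<ge> 1" by metis
    then show ?thesis by (intro bexI[of _ "vec_lambda n"]) (auto simp: shell_def)
  qed
  have 2: "shell k \<subseteq> ?A" if "k \<in> {k. \<forall>i. k $ i \<ge> 1}" for k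
  proof
    fix x :: "'p padic ^ 'n" assume x: "x \<in> shell k"
    have "padic_norm (x $ i) \<le> ?q ^ 1" for i
      using x that by (simp only: shell_def mem_Collect_eq pinv_power_le_iff)
    then show "x \<in> ?A" by (simp add: padic_box_def)
  qed
  show "igusa_zeta \<mu> f s = infsum (\<lambda>k. ser (shell k) s) {k. \<forall>i. k $ i \<ge> 1}"
    unfolding igusa_zeta_eq_ser[OF s] by (rule ser_decompose(1)[OF lcA 1 2 s])
  show "(\<lambda>k. ser (shell k) s) summable_on {k. \<forall>i. k $ i \<ge> 1}"
    by (rule ser_decompose(2)[OF lcA 1 2 s])
qed

end

section \<open>The dual fan of a Newton polyhedron\<close>

abbreviation ep :: "nat ^ 'n::finite \<Rightarrow> real ^ 'n" where "ep \<equiv> exponent_point"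

definition minface :: "(nat ^ 'n::finite) set \<Rightarrow> real ^ 'n \<Rightarrow> (nat ^ 'n) set" where
  "minface K x = {\<omega>\<in>K. \<forall>\<omega>'\<in>K. ep \<omega> \<bullet> x \<le> ep \<omega>' \<bullet> x}"

text \<open>The closed cone of the dual fan that belongs to \<open>P\<close>; it is cut out by the
  linear inequalities \<open>constr K P\<close>.\<close>

definition dcone :: "(nat ^ 'n::finite) set \<Rightarrow> nat ^ 'n \<Rightarrow> (real ^ 'n) set" where
  "dcone K P = {x. (\<forall>i. 0 \<le> x $ i) \<and> P \<in> minface K x}"

definition constr :: "(nat ^ 'n::finite) set \<Rightarrow> nat ^ 'n \<Rightarrow> (real ^ 'n) set" where
  "constr K P = (\<lambda>\<omega>. ep \<omega> - ep P) ` K \<union> range (\<lambda>i. axis i 1)"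

text \<open>\<open>v\<close> spans a one-dimensional cone of the dual fan: the constraints active at
  \<open>v\<close> have the line through \<open>v\<close> as common kernel. Comparing all pairs of
  minimal exponents keeps the notion independent of a vertex.\<close>

definition is_ray :: "(nat ^ 'n::finite) set \<Rightarrow> real ^ 'n \<Rightarrow> bool" where
  "is_ray K v \<longleftrightarrow> v \<noteq> 0 \<and> (\<forall>i. 0 \<le> v $ i) \<and>
     (\<forall>d. (\<forall>\<omega>\<in>minface K v. \<forall>\<omega>'\<in>minface K v. ep \<omega> \<bullet> d = ep \<omega>' \<bullet> d) \<and> (\<forall>i. v $ i = 0 \<longrightarrow> d $ i = 0)
        \<longrightarrow> (\<exists>c. d = c *\<^sub>R v))"

definition prim_rays :: "(nat ^ 'n::finite) set \<Rightarrow> (nat ^ 'n) set" where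
  "prim_rays K = {v. Gcd (range (\<lambda>i. v $ i)) = 1 \<and> is_ray K (ep v)}"

definition rays :: "(nat ^ 'n::finite) set \<Rightarrow> nat ^ 'n \<Rightarrow> (nat ^ 'n) set" where
  "rays K P = {v \<in> prim_rays K. P \<in> minface K (ep v)}"

lemma inner_axis_1 [simp]: "axis i 1 \<bullet> (x :: real ^ 'n::finite) = x $ i" "(x :: real ^ 'n) \<bullet> axis i 1 = x $ i"
  by (simp_all add: inner_axis' inner_axis)

lemma finite_constr: "finite K \<Longrightarrow> finite (constr K P)"
  by (simp add: constr_def)

lemma dcone_iff: "P \<in> K \<Longrightarrow> x \<in> dcone K P \<longleftrightarrow> (\<forall>c\<in>constr K P. 0 \<le> c \<bullet> x)"
  unfolding dcone_def constr_def minface_def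
  by (simp add: ball_Un inner_diff_left conj_commute)

lemma dconeD: "x \<in> dcone K P \<Longrightarrow> P \<in> K" "x \<in> dcone K P \<Longrightarrow> 0 \<le> x $ i"
  "x \<in> dcone K P \<Longrightarrow> \<omega> \<in> K \<Longrightarrow> ep P \<bullet> x \<le> ep \<omega> \<bullet> x"
  by (auto simp: dcone_def minface_def)

lemma dcone_add: "x \<in> dcone K P \<Longrightarrow> y \<in> dcone K P \<Longrightarrow> x + y \<in> dcone K P"
  by (auto simp: dcone_def minface_def inner_add_right intro: add_mono)

lemma dcone_scale: "x \<in> dcone K P \<Longrightarrow> 0 \<le> t \<Longrightarrow> t *\<^sub>R x \<in> dcone K P"
  by (auto simp: dcone_def minface_def intro: mult_left_mono)

lemma dcone_zero: "P \<in> K \<Longrightarrow> 0 \<in> dcone K P"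
  by (auto simp: dcone_def minface_def)

lemma rays_dcone: "v \<in> rays K P \<Longrightarrow> ep v \<in> dcone K P"
  by (auto simp: rays_def dcone_def)

lemma ncone_subset_dcone:
  assumes "x \<in> ncone R" "finite R" "P \<in> K" "\<And>r. r \<in> R \<Longrightarrow> ep r \<in> dcone K P"
  shows "x \<in> dcone K P"
  using assms(1,2) by (rule ncone_induct) (use assms in \<open>auto intro: dcone_zero dcone_add dcone_scale\<close>)

lemma minface_eq: "P \<in> minface K x \<Longrightarrow> minface K x = {\<omega>\<in>K. ep \<omega> \<bullet> x = ep P \<bullet> x}"
  unfolding minface_def by (auto intro: antisym)

lemma minface_nonempty:
  assumes "finite K" "K \<noteq> {}"
  obtains P where "P \<in> minface K x"
proof -
  obtain P where "P \<in> K" "\<And>\<omega>. \<omega> \<in> K \<Longrightarrow> ep P \<bullet> x \<le> ep \<omega> \<bullet> x"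
    using ex_is_arg_min_if_finite[OF assms, of "\<lambda>\<omega>. ep \<omega> \<bullet> x"] by (auto simp: is_arg_min_linorder)
  then show ?thesis using that by (auto simp: minface_def)
qed

lemma is_rayD:
  assumes "is_ray K v" "\<And>\<omega> \<omega>'. \<omega> \<in> minface K v \<Longrightarrow> \<omega>' \<in> minface K v \<Longrightarrow> ep \<omega> \<bullet> d = ep \<omega>' \<bullet> d"
    "\<And>i. v $ i = 0 \<Longrightarrow> d $ i = 0"
  obtains c where "d = c *\<^sub>R v"
proof -
  have "(\<forall>\<omega>\<in>minface K v. \<forall>\<omega>'\<in>minface K v. ep \<omega> \<bullet> d = ep \<omega>' \<bullet> d) \<and> (\<forall>i. v $ i = 0 \<longrightarrow> d $ i = 0)"
    by (intro conjI ballI allI impI assms(2,3))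
  moreover have all: "\<forall>d. (\<forall>\<omega>\<in>minface K v. \<forall>\<omega>'\<in>minface K v. ep \<omega> \<bullet> d = ep \<omega>' \<bullet> d) \<and> (\<forall>i. v $ i = 0 \<longrightarrow> d $ i = 0)
      \<longrightarrow> (\<exists>c. d = c *\<^sub>R v)"
    using assms(1) unfolding is_ray_def by (elim conjE)
  have "(\<forall>\<omega>\<in>minface K v. \<forall>\<omega>'\<in>minface K v. ep \<omega> \<bullet> d = ep \<omega>' \<bullet> d) \<and> (\<forall>i. v $ i = 0 \<longrightarrow> d $ i = 0)
      \<longrightarrow> (\<exists>c. d = c *\<^sub>R v)" using all by (rule spec)
  ultimately have "\<exists>c. d = c *\<^sub>R v" by (rule mp[rotated])
  then show ?thesis using that by (elim exE)
qed

lemma minface_inner_eq: "\<omega> \<in> minface K x \<Longrightarrow> \<omega>' \<in> minface K x \<Longrightarrow> ep \<omega> \<bullet> x = ep \<omega>' \<bullet> x"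
  by (simp add: minface_def order_antisym)

lemma is_ray_iff:
  assumes P: "P \<in> minface K v"
  shows "is_ray K v \<longleftrightarrow> v \<noteq> 0 \<and> (\<forall>i. 0 \<le> v $ i) \<and>
    (\<forall>d. (\<forall>c\<in>constr K P. c \<bullet> v = 0 \<longrightarrow> c \<bullet> d = 0) \<longrightarrow> (\<exists>a. d = a *\<^sub>R v))"
proof -
  have "(\<forall>\<omega>\<in>minface K v. \<forall>\<omega>'\<in>minface K v. ep \<omega> \<bullet> d = ep \<omega>' \<bullet> d) \<and> (\<forall>i. v $ i = 0 \<longrightarrow> d $ i = 0) \<longleftrightarrow>
     (\<forall>c\<in>constr K P. c \<bullet> v = 0 \<longrightarrow> c \<bullet> d = 0)" (is "?A \<and> ?Z \<longleftrightarrow> ?C") for d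
  proof
    assume A: "?A \<and> ?Z"
    show ?C
    proof (intro ballI impI)
      fix c assume c: "c \<in> constr K P" "c \<bullet> v = 0"
      then consider \<omega> where "\<omega> \<in> K" "c = ep \<omega> - ep P" | i where "c = axis i 1" by (auto simp: constr_def)
      then show "c \<bullet> d = 0"
      proof cases
        case 1
        then have "\<omega> \<in> minface K v" using c(2) unfolding minface_eq[OF P] by (simp add: inner_diff_left)
        then have "ep \<omega> \<bullet> d = ep P \<bullet> d" using A P by blast
        then show ?thesis using 1 by (simp add: inner_diff_left)
      next
        case 2
        then show ?thesis using A c(2) by simp
      qed
    qed
  next
    assume C: ?C
    have "ep \<omega> \<bullet> d = ep P \<bullet> d" if "\<omega> \<in> minface K v" for \<omega>
    proof -
      have "ep \<omega> - ep P \<in> constr K P" "(ep \<omega> - ep P) \<bullet> v = 0"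
        using that unfolding minface_eq[OF P] by (auto simp: constr_def inner_diff_left)
      then have "(ep \<omega> - ep P) \<bullet> d = 0" using C by blast
      then show ?thesis by (simp add: inner_diff_left)
    qed
    moreover have "d $ i = 0" if "v $ i = 0" for i
    proof -
      have "axis i 1 \<in> constr K P" by (simp add: constr_def)
      then have "axis i 1 \<bullet> v = 0 \<longrightarrow> axis i 1 \<bullet> d = 0" using C by blast
      then show ?thesis using that by simp
    qed
    ultimately show "?A \<and> ?Z" by simp
  qed
  then show ?thesis unfolding is_ray_def by simp
qed

text \<open>A constraint active at \<open>v\<close> is nonnegative on both summands and hence
  vanishes on each of them, so the summands lie in the kernel, which is the line through
  \<open>v\<close>.\<close>

lemma ray_extreme:
  assumes v: "is_ray K v" and P: "P \<in> minface K v" and x: "x \<in> dcone K P" "y \<in> dcone K P" and e: "v = x + y"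
  obtains c where "0 \<le> c" "x = c *\<^sub>R v"
proof -
  have PK: "P \<in> K" using P by (simp add: minface_def)
  have "c \<bullet> x = 0" if "c \<in> constr K P" "c \<bullet> v = 0" for c
  proof -
    have "0 \<le> c \<bullet> x" "0 \<le> c \<bullet> y" using x that dcone_iff[OF PK] by blast+
    then show ?thesis using that(2) unfolding e inner_add_right by linarith
  qed
  then obtain a where a: "x = a *\<^sub>R v" using v unfolding is_ray_iff[OF P] by blast
  have v0: "v \<noteq> 0" "\<And>i. 0 \<le> v $ i" using v by (auto simp: is_ray_def)
  then obtain i where i: "v $ i > 0" by (metis vec_eq_iff zero_index order_le_less)
  have "0 \<le> a * v $ i" using dconeD(2)[OF x(1), of i] a by simp
  then have "0 \<le> a" using i by (simp add: zero_le_mult_iff)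
  then show ?thesis using a that by blast
qed

text \<open>Proportionality gives v_i w_j = w_i v_j; taking the gcd over j yields the claim directly
  from primitivity.\<close>

lemma prim_parallel:
  fixes v w :: "nat ^ 'n::finite"
  assumes "Gcd (range (\<lambda>i. v $ i)) = 1" "Gcd (range (\<lambda>i. w $ i)) = 1" "ep v = t *\<^sub>R ep w"
  shows "v = w"
proof -
  have t: "real (v $ i) = t * real (w $ i)" for i using arg_cong[OF assms(3), of "\<lambda>x. x $ i"] by simp
  have "real (v $ i * w $ j) = real (w $ i * v $ j)" for i j by (simp add: t)
  then have e: "v $ i * w $ j = w $ i * v $ j" for i j by (simp only: of_nat_eq_iff)
  have "v $ i = w $ i" for i
  proof -
    have "v $ i * Gcd (range (\<lambda>j. w $ j)) = Gcd ((*) (v $ i) ` range (\<lambda>j. w $ j))" by (simp add: Gcd_mult)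
    also have "(*) (v $ i) ` range (\<lambda>j. w $ j) = (*) (w $ i) ` range (\<lambda>j. v $ j)"
      unfolding image_image e ..
    also have "Gcd \<dots> = w $ i * Gcd (range (\<lambda>j. v $ j))" by (simp add: Gcd_mult)
    finally show ?thesis using assms by simp
  qed
  then show ?thesis by (simp add: vec_eq_iff)
qed

lemma ray_extreme_eq:
  assumes v: "v \<in> rays K P" and r: "r \<in> rays K P" and y: "y \<in> dcone K P" and c: "0 < c" and e: "ep v = c *\<^sub>R ep r + y"
  shows "r = v"
proof -
  have "c *\<^sub>R ep r \<in> dcone K P" using rays_dcone[OF r] c by (intro dcone_scale) auto
  moreover have "is_ray K (ep v)" "P \<in> minface K (ep v)" using v by (auto simp: rays_def prim_rays_def)
  ultimately obtain t where t: "c *\<^sub>R ep r = t *\<^sub>R ep v" using ray_extreme y e by metis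
  then have "ep r = (t / c) *\<^sub>R ep v" using c by (metis divide_inverse_commute less_irrefl scaleR_scaleR vector_fraction_eq_iff)
  then show ?thesis using v r prim_parallel[of r v] by (auto simp: rays_def prim_rays_def)
qed

lemma ray_ncone_eq:
  assumes v: "v \<in> rays K P" and x: "ep v \<in> ncone R" and R: "finite R" "R \<subseteq> rays K P"
  shows "v \<in> R"
proof -
  obtain c where c: "\<forall>r\<in>R. 0 \<le> c r" "ep v = (\<Sum>r\<in>R. c r *\<^sub>R ep r)" using x unfolding ncone_def by blast
  have "ep v \<noteq> 0" using v by (auto simp: rays_def prim_rays_def is_ray_def)
  then obtain r where r: "r \<in> R" "c r *\<^sub>R ep r \<noteq> 0" using c(2) by (metis (no_types, lifting) sum.neutral)
  then have cr: "0 < c r" using c(1) by (metis order_le_less scaleR_zero_left)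
  have PK: "P \<in> K" using v by (auto simp: rays_def minface_def)
  have "(\<Sum>r'\<in>R - {r}. c r' *\<^sub>R ep r') \<in> ncone R"
    by (rule ncone_sum) (use R c in \<open>auto intro!: ncone_scale ncone_mem\<close>)
  then have "(\<Sum>r'\<in>R - {r}. c r' *\<^sub>R ep r') \<in> dcone K P"
    by (rule ncone_subset_dcone[OF _ R(1) PK]) (use R rays_dcone in blast)
  moreover have "ep v = c r *\<^sub>R ep r + (\<Sum>r'\<in>R - {r}. c r' *\<^sub>R ep r')"
    unfolding c(2) by (rule sum.remove[OF R(1) r(1)])
  ultimately have "r = v" using ray_extreme_eq[OF v _ _ cr] r R by blast
  then show ?thesis using r by simp
qed

text \<open>The ratio test of linear programming: \<open>t\<close> is the first time at which a
  positive constraint becomes active. Constraints already active at \<open>x\<close> stay so, as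
  they vanish on \<open>e\<close>.\<close>

lemma move_to_wall:
  fixes x e :: "real ^ 'n::finite"
  assumes C: "finite C" "\<And>c. c \<in> C \<Longrightarrow> 0 \<le> c \<bullet> x" "\<And>c. c \<in> C \<Longrightarrow> c \<bullet> x = 0 \<Longrightarrow> c \<bullet> e = 0"
    and neg: "c0 \<in> C" "c0 \<bullet> e < 0"
  obtains t where "0 < t" "\<And>c. c \<in> C \<Longrightarrow> 0 \<le> c \<bullet> (x + t *\<^sub>R e)"
    "{c\<in>C. 0 < c \<bullet> (x + t *\<^sub>R e)} \<subset> {c\<in>C. 0 < c \<bullet> x}"
proof -
  define N where "N = {c\<in>C. c \<bullet> e < 0}"
  have N: "finite N" "N \<noteq> {}" using C neg by (auto simp: N_def)
  define t where "t = Min ((\<lambda>c. c \<bullet> x / - (c \<bullet> e)) ` N)"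
  have tm: "t \<in> (\<lambda>c. c \<bullet> x / - (c \<bullet> e)) ` N" unfolding t_def by (rule Min_in) (use N in auto)
  then obtain c1 where c1: "c1 \<in> N" "t = c1 \<bullet> x / - (c1 \<bullet> e)" by blast
  have pos: "0 < c \<bullet> x" if "c \<in> N" for c using that C(2,3)[of c] by (force simp: N_def)
  have t0: "0 < t" unfolding c1(2) by (rule divide_pos_pos) (use pos[OF c1(1)] c1(1) in \<open>simp_all add: N_def\<close>)
  have nn: "0 \<le> c \<bullet> (x + t *\<^sub>R e)" if c: "c \<in> C" for c
  proof (cases "c \<in> N")
    case True
    have "t \<le> c \<bullet> x / - (c \<bullet> e)" unfolding t_def by (rule Min_le) (use N True in auto)
    then have "t * - (c \<bullet> e) \<le> c \<bullet> x" using True by (simp add: N_def pos_le_divide_eq del: divide_minus_right)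
    then show ?thesis by (simp add: inner_add_right)
  next
    case False
    then have "0 \<le> c \<bullet> e" using c by (simp add: N_def)
    then show ?thesis using C(2)[OF c] t0 by (simp add: inner_add_right)
  qed
  have "t * (c1 \<bullet> e) = - (c1 \<bullet> x)" using c1 by (simp add: N_def)
  then have z: "c1 \<bullet> (x + t *\<^sub>R e) = 0" by (simp add: inner_add_right)
  have "{c\<in>C. 0 < c \<bullet> (x + t *\<^sub>R e)} \<subseteq> {c\<in>C. 0 < c \<bullet> x}"
  proof clarify
    fix c assume c: "c \<in> C" "0 < c \<bullet> (x + t *\<^sub>R e)"
    show "0 < c \<bullet> x"
    proof (rule ccontr)
      assume "\<not> 0 < c \<bullet> x"
      then have "c \<bullet> x = 0" using C(2)[OF c(1)] by simp
      then show False using C(3)[OF c(1)] c(2) by (simp add: inner_add_right)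
    qed
  qed
  moreover have "c1 \<in> {c\<in>C. 0 < c \<bullet> x}" "c1 \<notin> {c\<in>C. 0 < c \<bullet> (x + t *\<^sub>R e)}"
    using c1(1) pos z by (auto simp: N_def)
  ultimately have "{c\<in>C. 0 < c \<bullet> (x + t *\<^sub>R e)} \<subset> {c\<in>C. 0 < c \<bullet> x}" by blast
  then show ?thesis using that t0 nn by blast
qed

text \<open>Only the active constraints restrict a small step; the finitely many others are positive
  at \<open>x\<close> and tolerate it.\<close>

lemma perturb:
  fixes x d :: "real ^ 'n::finite"
  assumes "finite C" "\<And>c. c \<in> C \<Longrightarrow> 0 \<le> c \<bullet> x" "\<And>c. c \<in> C \<Longrightarrow> c \<bullet> x = 0 \<Longrightarrow> 0 \<le> c \<bullet> d"
  shows "\<exists>\<epsilon>>0. \<forall>t\<in>{0..\<epsilon>}. \<forall>c\<in>C. 0 \<le> c \<bullet> (x + t *\<^sub>R d)"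
  using assms
proof (induction C rule: finite_induct)
  case empty
  then show ?case by (auto intro: exI[of _ 1])
next
  case (insert a C)
  then obtain e where e: "e > 0" "\<forall>t\<in>{0..e}. \<forall>c\<in>C. 0 \<le> c \<bullet> (x + t *\<^sub>R d)" by auto
  obtain e' where e': "e' > 0" "\<And>t. 0 \<le> t \<Longrightarrow> t \<le> e' \<Longrightarrow> 0 \<le> a \<bullet> (x + t *\<^sub>R d)"
  proof (cases "0 \<le> a \<bullet> d")
    case True
    then show ?thesis using insert.prems(1)[of a] that[of 1] by (simp add: inner_add_right)
  next
    case False
    then have p: "0 < a \<bullet> x" using insert.prems[of a] by force
    show ?thesis
    proof (rule that[of "(a \<bullet> x) / - (a \<bullet> d)"])
      show "0 < a \<bullet> x / - (a \<bullet> d)" using p False by (intro divide_pos_pos) auto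
      fix t assume "t \<le> a \<bullet> x / - (a \<bullet> d)"
      then have "t * - (a \<bullet> d) \<le> a \<bullet> x" using False by (simp add: pos_le_divide_eq del: divide_minus_right)
      then show "0 \<le> a \<bullet> (x + t *\<^sub>R d)" by (simp add: inner_add_right)
    qed
  qed
  show ?case using e e' by (intro exI[of _ "min e e'"]) auto
qed

lemma is_ray_scale:
  assumes "is_ray K x" "0 < t"
  shows "is_ray K (t *\<^sub>R x)"
proof -
  have m: "minface K (t *\<^sub>R x) = minface K x" using assms(2) by (simp add: minface_def)
  have x: "x \<noteq> 0" "\<And>i. 0 \<le> x $ i" using assms(1) by (auto simp: is_ray_def)
  have "\<exists>c. d = c *\<^sub>R t *\<^sub>R x"
    if d: "\<forall>\<omega>\<in>minface K x. \<forall>\<omega>'\<in>minface K x. ep \<omega> \<bullet> d = ep \<omega>' \<bullet> d" "\<forall>i. (t *\<^sub>R x) $ i = 0 \<longrightarrow> d $ i = 0" for d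
  proof -
    obtain a where "d = a *\<^sub>R x"
    proof (rule is_rayD[OF assms(1), of d])
      show "ep \<omega> \<bullet> d = ep \<omega>' \<bullet> d" if "\<omega> \<in> minface K x" "\<omega>' \<in> minface K x" for \<omega> \<omega>' using d(1) that by blast
      show "d $ i = 0" if "x $ i = 0" for i using d(2) that by simp
    qed
    then show ?thesis using assms(2) by (intro exI[of _ "a / t"]) simp
  qed
  moreover have "t *\<^sub>R x \<noteq> 0" "\<forall>i. 0 \<le> (t *\<^sub>R x) $ i" using x assms(2) by auto
  ultimately show ?thesis unfolding is_ray_def m by metis
qed

lemma minface_scale: "0 < t \<Longrightarrow> minface K (t *\<^sub>R x) = minface K x"
  by (simp add: minface_def)

text \<open>A primitive ray is determined by its minimal face and its vanishing coordinates, for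
  which there are finitely many choices.\<close>

lemma finite_prim_rays:
  fixes K :: "(nat ^ 'n::finite) set"
  assumes K: "finite K"
  shows "finite (prim_rays K)"
proof -
  define g where "g v = (minface K (ep v), {i. v $ i = 0})" for v :: "nat^'n"
  have "inj_on g (prim_rays K)"
  proof (rule inj_onI)
    fix v w assume v: "v \<in> prim_rays K" and w: "w \<in> prim_rays K" and e: "g v = g w"
    have m: "minface K (ep v) = minface K (ep w)" "{i. v $ i = 0} = {i. w $ i = 0}" using e by (simp_all add: g_def)
    obtain c where "ep w = c *\<^sub>R ep v"
    proof (rule is_rayD[of K "ep v" "ep w"])
      show "is_ray K (ep v)" using v by (simp add: prim_rays_def)
      show "ep \<omega> \<bullet> ep w = ep \<omega>' \<bullet> ep w" if "\<omega> \<in> minface K (ep v)" "\<omega>' \<in> minface K (ep v)" for \<omega> \<omega>'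
        using that unfolding m(1) by (rule minface_inner_eq)
      show "ep w $ i = 0" if "ep v $ i = 0" for i using that m(2) by auto
    qed
    then show "v = w" using v w prim_parallel[of w v] by (auto simp: prim_rays_def)
  qed
  moreover have "g ` prim_rays K \<subseteq> Pow K \<times> UNIV" by (auto simp: g_def minface_def)
  then have "finite (g ` prim_rays K)" by (rule finite_subset) (use K in simp)
  ultimately show ?thesis using finite_imageD by blast
qed

lemma finite_rays: "finite K \<Longrightarrow> finite (rays K P)"
  unfolding rays_def using finite_prim_rays[of K] by simp

lemma integer_direction:
  fixes x w :: "real ^ 'n::finite"
  assumes x0: "x \<noteq> 0" "\<And>i. 0 \<le> x $ i" and a: "x = a *\<^sub>R w" and w: "\<And>i. w $ i \<in> \<int>"
  obtains n :: "nat ^ 'n" and t where "Gcd (range (\<lambda>i. n $ i)) = 1" "0 < t" "x = t *\<^sub>R ep n"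
proof -
  have a0: "a \<noteq> 0" using x0 a by auto
  have "\<exists>m. \<bar>w $ i\<bar> = real m" for i
  proof -
    obtain z where "w $ i = of_int z" using w[of i] by (elim Ints_cases)
    then show ?thesis by (intro exI[of _ "nat \<bar>z\<bar>"]) simp
  qed
  then obtain m where m: "\<And>i. \<bar>w $ i\<bar> = real (m i)" by metis
  define k where "k = vec_lambda m"
  have xk: "x $ i = \<bar>a\<bar> * real (k $ i)" for i
  proof -
    have "x $ i = \<bar>a * w $ i\<bar>" using x0(2)[of i] by (simp add: a)
    then show ?thesis using m[of i] by (simp add: k_def abs_mult)
  qed
  define g where "g = Gcd (range (\<lambda>i. k $ i))"
  obtain i where "x $ i \<noteq> 0" using x0(1) by (auto simp: vec_eq_iff)
  then have ki: "k $ i \<noteq> 0" using xk[of i] by auto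
  have gd: "g dvd k $ i" for i unfolding g_def by (intro Gcd_dvd) auto
  have g0: "g \<noteq> 0" using ki gd[of i] by auto
  define n where "n = (\<chi> i. k $ i div g)"
  have kn: "k $ i = g * n $ i" for i using gd[of i] by (simp add: n_def)
  have "g * Gcd (range (\<lambda>i. n $ i)) = Gcd ((*) g ` range (\<lambda>i. n $ i))" by (simp add: Gcd_mult)
  also have "(*) g ` range (\<lambda>i. n $ i) = range (\<lambda>i. k $ i)" by (auto simp: kn)
  finally have "g * Gcd (range (\<lambda>i. n $ i)) = g * 1" by (simp add: g_def)
  then have "Gcd (range (\<lambda>i. n $ i)) = 1" using g0 by simp
  moreover have "x = (\<bar>a\<bar> * real g) *\<^sub>R ep n" by (simp add: vec_eq_iff xk kn)
  moreover have "0 < \<bar>a\<bar> * real g" using a0 g0 by simp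
  ultimately show ?thesis using that by blast
qed

text \<open>In dimension three the line through \<open>x\<close> is the intersection of two active
  constraints. These are integral, so their cross product is an integer vector on that line.\<close>

lemma ray_lattice:
  fixes K :: "(nat ^ 3) set"
  assumes r: "is_ray K x" and P: "P \<in> minface K x"
  obtains v t where "v \<in> rays K P" "0 < t" "x = t *\<^sub>R ep v"
proof -
  define T where "T = {c \<in> constr K P. c \<bullet> x = 0}"
  have x0: "x \<noteq> 0" "\<And>i. 0 \<le> x $ i" using r by (auto simp: is_ray_def)
  have ker: "\<exists>a. d = a *\<^sub>R x" if "\<And>c. c \<in> T \<Longrightarrow> c \<bullet> d = 0" for d
    using r that unfolding is_ray_iff[OF P] T_def by blast
  have "\<exists>c1\<in>T. \<exists>c2\<in>T. cross3 c1 c2 \<noteq> 0"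
  proof (rule ccontr)
    assume neg: "\<not> ?thesis"
    \<comment> \<open>If all active constraints are parallel, \<open>cross3 c x\<close> is
      orthogonal to each of them, hence a multiple of \<open>x\<close>; being orthogonal to
      \<open>x\<close> too, it is zero. As \<open>c\<close> is orthogonal to \<open>x\<close>, this
      forces \<open>c = 0\<close>, and the common kernel would be the whole space.\<close>
    have c0: "c = 0" if c: "c \<in> T" for c
    proof (rule ccontr)
      assume "c \<noteq> 0"
      have "c' \<bullet> cross3 c x = 0" if "c' \<in> T" for c'
        using neg c that cross_triple[of c' c x] cross_triple[of c x c'] by (simp add: inner_commute)
      then obtain a where a: "cross3 c x = a *\<^sub>R x" using ker by blast
      have "a * (x \<bullet> x) = 0" using dot_cross_self(2)[of x c] unfolding a by simp
      then have "cross3 c x = 0" using a x0 by simp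
      moreover have "c \<bullet> x = 0" using c by (simp add: T_def)
      ultimately show False using norm_and_cross_eq_0[of c x] \<open>c \<noteq> 0\<close> x0 by simp
    qed
    have "\<exists>a. d = a *\<^sub>R x" for d by (rule ker) (metis c0 inner_zero_left)
    then obtain a b where a: "axis 1 1 = a *\<^sub>R x" and b: "axis 2 1 = b *\<^sub>R x" by metis
    have "1 = a * x $ 1" "0 = a * x $ 2" "1 = b * x $ 2"
      using arg_cong[OF a, of "\<lambda>y. y $ 1"] arg_cong[OF a, of "\<lambda>y. y $ 2"] arg_cong[OF b, of "\<lambda>y. y $ 2"]
      by (auto simp: axis_def)
    then show False by auto
  qed
  then obtain c1 c2 where c: "c1 \<in> T" "c2 \<in> T" "cross3 c1 c2 \<noteq> 0" by blast
  have "cross3 x (cross3 c1 c2) = 0"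
    unfolding Lagrange using c(1,2) by (simp add: T_def inner_commute)
  then have "collinear {0, cross3 c1 c2, x}" unfolding cross_eq_0 by (simp add: insert_commute)
  then obtain a where a: "x = a *\<^sub>R cross3 c1 c2" using c(3) x0(1) unfolding collinear_lemma by auto
  have int: "c $ i \<in> \<int>" if "c \<in> constr K P" for c i
    using that by (auto simp: constr_def axis_def)
  have "cross3 c1 c2 $ i \<in> \<int>" for i
    using exhaust_3[of i] c(1,2) int unfolding T_def by (auto simp: cross_components intro!: Ints_diff Ints_mult)
  then obtain v t where v: "Gcd (range (\<lambda>i. v $ i)) = 1" "0 < t" "x = t *\<^sub>R ep v"
    using integer_direction[OF x0 a] by metis
  have "ep v = (1 / t) *\<^sub>R x" using v by simp
  then have "is_ray K (ep v)" "P \<in> minface K (ep v)" using is_ray_scale[OF r, of "1 / t"] P v(2) minface_scale[of "1 / t" K x] by auto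
  then show ?thesis using that v by (auto simp: rays_def prim_rays_def)
qed

text \<open>
  A non-extreme point of a pointed cone lies between two points with fewer inactive constraints.
\<close>

lemma dcone_generated:
  fixes K :: "(nat ^ 3) set"
  assumes K: "finite K" and x: "x \<in> dcone K P"
  shows "x \<in> ncone (rays K P)"
  using x
proof (induction "card {c \<in> constr K P. 0 < c \<bullet> x}" arbitrary: x rule: less_induct)
  case less
  have PK: "P \<in> K" and P: "P \<in> minface K x" using less.prems by (auto simp: dcone_def minface_def)
  note C = finite_constr[OF K, of P]
  have nn: "0 \<le> c \<bullet> x" if "c \<in> constr K P" for c using less.prems that dcone_iff[OF PK] by blast
  show ?case
  proof (cases "x = 0 \<or> is_ray K x")
    case True
    then show ?thesis
    proof
      assume "is_ray K x"
      then obtain v t where "v \<in> rays K P" "0 < t" "x = t *\<^sub>R ep v" using ray_lattice P by metis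
      then show ?thesis using finite_rays[OF K] by (auto intro!: ncone_scale ncone_mem)
    qed (auto intro: ncone_zero)
  next
    case False
    have x0: "\<And>i. 0 \<le> x $ i" using less.prems by (auto simp: dcone_def)
    then obtain d where d: "\<And>c. c \<in> constr K P \<Longrightarrow> c \<bullet> x = 0 \<Longrightarrow> c \<bullet> d = 0" "\<And>a. d \<noteq> a *\<^sub>R x"
      using False unfolding is_ray_iff[OF P] by blast
    define \<sigma> where "\<sigma> y = (\<Sum>i\<in>UNIV. y $ i)" for y :: "real ^ 3"
    have "\<sigma> x \<noteq> 0" using x0 False by (auto simp: \<sigma>_def sum_nonneg_eq_0_iff vec_eq_iff)
    \<comment> \<open>Correcting \<open>d\<close> along \<open>x\<close> makes the coordinate sum
      zero. Then both \<open>e\<close> and \<open>- e\<close> have a negative coordinate, so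
      following either of them from \<open>x\<close> leaves the orthant and meets a wall.\<close>
    define e where "e = d - (\<sigma> d / \<sigma> x) *\<^sub>R x"
    have e0: "e \<noteq> 0" using d(2)[of "\<sigma> d / \<sigma> x"] by (auto simp: e_def)
    have "\<sigma> e = \<sigma> d - (\<sigma> d / \<sigma> x) * \<sigma> x"
      by (simp add: \<sigma>_def e_def sum_subtractf sum_distrib_left)
    then have se: "\<sigma> e = 0" using \<open>\<sigma> x \<noteq> 0\<close> by simp
    have ec: "c \<bullet> e = 0" if "c \<in> constr K P" "c \<bullet> x = 0" for c
      using d(1)[OF that] that(2) by (simp add: e_def inner_diff_right)
    have step: "\<exists>t>0. x + t *\<^sub>R u \<in> ncone (rays K P)"
      if u: "\<And>c. c \<in> constr K P \<Longrightarrow> c \<bullet> x = 0 \<Longrightarrow> c \<bullet> u = 0" "u \<noteq> 0" "\<sigma> u = 0" for u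
    proof -
      have "\<exists>i. u $ i < 0"
      proof (rule ccontr)
        assume "\<not> (\<exists>i. u $ i < 0)"
        then have "u $ i = 0" for i using u(3) by (simp add: \<sigma>_def sum_nonneg_eq_0_iff not_less)
        then show False using u(2) by (simp add: vec_eq_iff)
      qed
      then obtain i where i: "axis i 1 \<in> constr K P" "axis i 1 \<bullet> u < 0" by (auto simp: constr_def)
      obtain t where t: "0 < t" "\<And>c. c \<in> constr K P \<Longrightarrow> 0 \<le> c \<bullet> (x + t *\<^sub>R u)"
        "{c\<in>constr K P. 0 < c \<bullet> (x + t *\<^sub>R u)} \<subset> {c\<in>constr K P. 0 < c \<bullet> x}"
        using move_to_wall[OF C nn u(1) i] by blast
      have "x + t *\<^sub>R u \<in> dcone K P" using t(2) dcone_iff[OF PK] by blast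
      moreover have "card {c\<in>constr K P. 0 < c \<bullet> (x + t *\<^sub>R u)} < card {c\<in>constr K P. 0 < c \<bullet> x}"
        by (rule psubset_card_mono[OF _ t(3)]) (use C in simp)
      ultimately show ?thesis using less.hyps t(1) by blast
    qed
    obtain t1 where t1: "t1 > 0" "x + t1 *\<^sub>R e \<in> ncone (rays K P)" using step[OF ec e0 se] by blast
    have "\<sigma> (- e) = 0" using se by (simp add: \<sigma>_def sum_negf)
    then obtain t2 where t2: "t2 > 0" "x + t2 *\<^sub>R - e \<in> ncone (rays K P)" using step[of "- e"] ec e0 by auto
    have "(t2 / (t1 + t2)) *\<^sub>R (x + t1 *\<^sub>R e) + (t1 / (t1 + t2)) *\<^sub>R (x + t2 *\<^sub>R - e) \<in> ncone (rays K P)"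
      by (rule ncone_add[OF ncone_scale[OF t1(2)] ncone_scale[OF t2(2)]]) (use t1 t2 in auto)
    also have "(t2 / (t1 + t2)) *\<^sub>R (x + t1 *\<^sub>R e) + (t1 / (t1 + t2)) *\<^sub>R (x + t2 *\<^sub>R - e) = x"
    proof -
      have "(t2 / (t1 + t2)) *\<^sub>R (x + t1 *\<^sub>R e) + (t1 / (t1 + t2)) *\<^sub>R (x + t2 *\<^sub>R - e)
        = (t2 / (t1 + t2) + t1 / (t1 + t2)) *\<^sub>R x + (t2 / (t1 + t2) * t1 - t1 / (t1 + t2) * t2) *\<^sub>R e"
        by (simp add: algebra_simps)
      also have "t2 / (t1 + t2) + t1 / (t1 + t2) = 1" using t1 t2 by (simp add: add_divide_distrib[symmetric] add.commute)
      finally show ?thesis by (simp add: mult.commute)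
    qed
    finally show ?thesis .
  qed
qed

text \<open>A cone stays generated by the remaining rays after cutting off those on one side of a plane
  that meets it in the cone over two remaining rays.\<close>

lemma ncone_eliminate:
  fixes R G :: "(nat ^ 'n::finite) set"
  assumes R: "finite R" "G \<subseteq> R" and k: "k \<in> ncone R"
    and N: "\<And>v. v \<in> R - G \<Longrightarrow> \<exists>N. linear N \<and> 0 < N (ep v) \<and> N k \<le> (0::real) \<and>
        (\<forall>w\<in>ncone R. N w = 0 \<longrightarrow> w \<in> ncone G)"
  shows "k \<in> ncone G"
  using R k N
proof (induction "card (R - G)" arbitrary: R rule: less_induct)
  case less
  show ?case
  proof (cases "R = G")
    case False
    then obtain v where v: "v \<in> R - G" using less.prems by blast
    obtain N :: "real ^ 'n \<Rightarrow> real" where N: "linear N" "0 < N (ep v)" "N k \<le> 0" "\<And>w. w \<in> ncone R \<Longrightarrow> N w = 0 \<Longrightarrow> w \<in> ncone G"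
      using less.prems(4)[OF v] by blast
    define R' where "R' = G \<union> {r\<in>R. N (ep r) \<le> 0}"
    have fR': "finite R'" and R'R: "R' \<subseteq> R" using less.prems(1,2) finite_subset[of G R] by (auto simp: R'_def)
    obtain c where c: "\<forall>r\<in>R. 0 \<le> c r" "k = (\<Sum>r\<in>R. c r *\<^sub>R ep r)" using less.prems(3) unfolding ncone_def by blast
    define A B where "A = {r\<in>R. 0 < N (ep r)}" and "B = {r\<in>R. N (ep r) \<le> 0}"
    define a b where "a = (\<Sum>r\<in>A. c r *\<^sub>R ep r)" and "b = (\<Sum>r\<in>B. c r *\<^sub>R ep r)"
    have RAB: "R = A \<union> B" "A \<inter> B = {}" "finite A" "finite B" using less.prems(1) by (auto simp: A_def B_def)
    have kab: "k = a + b" unfolding c(2) a_def b_def by (subst RAB(1)) (rule sum.union_disjoint[OF RAB(3,4,2)])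
    have aR: "a \<in> ncone R" unfolding a_def by (rule ncone_sum) (use c RAB less.prems(1) in \<open>auto intro!: ncone_scale ncone_mem\<close>)
    have bR: "b \<in> ncone R'" unfolding b_def
    proof (rule ncone_sum[OF RAB(4)])
      fix r assume r: "r \<in> B"
      then have "0 \<le> c r" using c(1) RAB(1) by blast
      moreover have "r \<in> R'" using r by (auto simp: B_def R'_def)
      ultimately show "c r *\<^sub>R ep r \<in> ncone R'" using fR' by (intro ncone_scale ncone_mem)
    qed
    have Na: "N a = (\<Sum>r\<in>A. c r * N (ep r))" unfolding a_def by (simp add: linear_sum[OF N(1)] linear_scale[OF N(1)])
    have Nb: "N b = (\<Sum>r\<in>B. c r * N (ep r))" unfolding b_def by (simp add: linear_sum[OF N(1)] linear_scale[OF N(1)])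
    have cA: "0 \<le> c r * N (ep r)" if "r \<in> A" for r
    proof -
      have "0 \<le> c r" using that c(1) RAB(1) by blast
      then show ?thesis using that by (simp add: A_def)
    qed
    have Na0: "0 \<le> N a" unfolding Na by (rule sum_nonneg[OF cA])
    have Nk: "N k = N a + N b" unfolding kab by (rule linear_add[OF N(1)])
    have kR': "k \<in> ncone R'"
    proof (cases "N a = 0")
      case True
      have "\<forall>r\<in>A. c r * N (ep r) = 0"
        using True unfolding Na by (subst (asm) sum_nonneg_eq_0_iff[OF RAB(3) cA])
      then have "a = 0" unfolding a_def by (intro sum.neutral) (auto simp: A_def)
      then show ?thesis using bR kab by simp
    next
      case False
      \<comment> \<open>Just enough of \<open>b\<close> is added to \<open>a\<close> to reach the
        plane \<open>N = 0\<close>, where the hypothesis applies. Since \<open>N k \<le> 0\<close>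
        there is enough of it, that is \<open>t \<le> 1\<close>.\<close>
      define t where "t = N a / - N b"
      have Nb': "N b < 0" using Nk N(3) Na0 False by linarith
      have tN: "t * N b = - N a" using Nb' by (simp add: t_def)
      have t0: "0 \<le> t" unfolding t_def by (rule divide_nonneg_nonneg) (use Na0 Nb' in auto)
      have "N a \<le> 1 * - N b" using Nk N(3) by linarith
      then have "t \<le> 1" unfolding t_def using Nb' by (simp only: pos_divide_le_eq neg_0_less_iff_less)
      note t = t0 this
      have "a + t *\<^sub>R b \<in> ncone R" by (intro ncone_add aR ncone_scale t ncone_mono[OF bR R'R less.prems(1)])
      moreover have "N (a + t *\<^sub>R b) = 0" using tN by (simp add: linear_add[OF N(1)] linear_scale[OF N(1)])
      ultimately have "a + t *\<^sub>R b \<in> ncone G" by (rule N(4))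
      then have "a + t *\<^sub>R b \<in> ncone R'" by (rule ncone_mono) (use fR' in \<open>auto simp: R'_def\<close>)
      then have "(a + t *\<^sub>R b) + (1 - t) *\<^sub>R b \<in> ncone R'" by (rule ncone_add[OF _ ncone_scale[OF bR]]) (use t in auto)
      moreover have "(a + t *\<^sub>R b) + (1 - t) *\<^sub>R b = k" unfolding kab by (simp add: scaleR_left_diff_distrib)
      ultimately show ?thesis by (simp only:)
    qed
    have "v \<notin> R'" using v N(2) by (auto simp: R'_def)
    then have "R' - G \<subset> R - G" using R'R v by blast
    then have "card (R' - G) < card (R - G)" by (rule psubset_card_mono[rotated]) (use less.prems(1) in simp)
    then show ?thesis
    proof (rule less.hyps[OF _ fR' _ kR'])
      show "G \<subseteq> R'" by (simp add: R'_def)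
      fix u assume "u \<in> R' - G"
      then have "u \<in> R - G" using R'R by blast
      from less.prems(4)[OF this] obtain M :: "real ^ 'n \<Rightarrow> real" where "linear M" "0 < M (ep u)" "M k \<le> 0"
        "\<forall>w\<in>ncone R. M w = 0 \<longrightarrow> w \<in> ncone G" by metis
      then show "\<exists>N. linear N \<and> 0 < N (ep u) \<and> N k \<le> (0::real) \<and> (\<forall>w\<in>ncone R'. N w = 0 \<longrightarrow> w \<in> ncone G)"
        using ncone_mono[OF _ R'R less.prems(1)] by (intro exI[of _ M]) auto
    qed
  qed (use less.prems in simp)
qed

section \<open>Faces of the polyhedron as first meet loci\<close>

definition newton_tau :: "('a::zero, 'n::finite) multipoly \<Rightarrow> real ^ 'n \<Rightarrow> (real ^ 'n) set" where
  "newton_tau f x = newton_polyhedron f \<inter> {y. x \<bullet> y = newton_m f x}"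

lemma newton_polyhedron_add:
  fixes f :: "('a::zero, 'n::finite) multipoly"
  assumes w: "\<omega> \<in> supp f" and t: "\<And>i. 0 \<le> t $ i"
  shows "ep \<omega> + t \<in> newton_polyhedron f"
  unfolding newton_polyhedron_def by (rule hull_inc) (use w t in auto)

lemma newton_polyhedron_ep: "\<omega> \<in> supp f \<Longrightarrow> ep \<omega> \<in> newton_polyhedron f"
  using newton_polyhedron_add[of \<omega> f 0] by simp

lemma convex_newton_polyhedron: "convex (newton_polyhedron f)"
  unfolding newton_polyhedron_def by (rule convex_convex_hull)

lemma newton_polyhedron_lower:
  fixes f :: "('a::zero, 'n::finite) multipoly"
  assumes x: "x \<in> dcone (supp f) P" and y: "y \<in> newton_polyhedron f"
  shows "ep P \<bullet> x \<le> x \<bullet> y"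
proof -
  have "newton_polyhedron f \<subseteq> {y. x \<bullet> y \<ge> ep P \<bullet> x}"
    unfolding newton_polyhedron_def
  proof (rule hull_minimal)
    show "(\<Union>\<omega>\<in>supp f. (+) (ep \<omega>) ` {t. \<forall>i. 0 \<le> t $ i}) \<subseteq> {y. x \<bullet> y \<ge> ep P \<bullet> x}"
    proof clarify
      fix \<omega> and t :: "real ^ 'n" assume w: "\<omega> \<in> supp f" and t: "\<forall>i. 0 \<le> t $ i"
      have "0 \<le> x \<bullet> t" unfolding inner_vec_def by (rule sum_nonneg) (use t dconeD(2)[OF x] in simp)
      then show "ep P \<bullet> x \<le> x \<bullet> (ep \<omega> + t)" using dconeD(3)[OF x w] by (simp add: inner_add_right inner_commute)
    qed
    show "convex {y. x \<bullet> y \<ge> ep P \<bullet> x}" by (rule convex_halfspace_ge)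
  qed
  then show ?thesis using y by blast
qed

lemma newton_polyhedron_up:
  fixes f :: "('a::zero, 'n::finite) multipoly"
  assumes y: "y \<in> newton_polyhedron f" and t: "\<And>i. 0 \<le> t $ i"
  shows "y + t \<in> newton_polyhedron f"
proof -
  let ?U = "\<Union>\<omega>\<in>supp f. (+) (ep \<omega>) ` {t. \<forall>i. 0 \<le> t $ i}"
  have "(+) t ` ?U \<subseteq> ?U"
  proof
    fix z assume "z \<in> (+) t ` ?U"
    then obtain \<omega> u where "\<omega> \<in> supp f" "\<forall>i. 0 \<le> u $ i" "z = ep \<omega> + (t + u)" by (auto simp: algebra_simps)
    then show "z \<in> ?U" using t by (intro UN_I[of \<omega>] image_eqI[of _ _ "t + u"]) auto
  qed
  then have "convex hull ((+) t ` ?U) \<subseteq> convex hull ?U" by (rule hull_mono)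
  then have "(+) t ` (convex hull ?U) \<subseteq> convex hull ?U" by (simp only: convex_hull_translation)
  then show ?thesis using y unfolding newton_polyhedron_def by (auto simp: add.commute)
qed

lemma newton_m_eq:
  fixes f :: "('a::zero, 'n::finite) multipoly"
  assumes x: "x \<in> dcone (supp f) P"
  shows "newton_m f x = ep P \<bullet> x"
proof (rule antisym)
  have PK: "P \<in> supp f" by (rule dconeD(1)[OF x])
  have bdd: "bdd_below ((\<bullet>) x ` newton_polyhedron f)"
    by (rule bdd_belowI2[where m = "ep P \<bullet> x"]) (rule newton_polyhedron_lower[OF x])
  show "newton_m f x \<le> ep P \<bullet> x"
    unfolding newton_m_def
    by (rule cINF_lower2[OF bdd newton_polyhedron_ep[OF PK]]) (simp add: inner_commute)
  show "ep P \<bullet> x \<le> newton_m f x"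
    unfolding newton_m_def
    by (rule cINF_greatest) (use newton_polyhedron_ep[OF PK] newton_polyhedron_lower[OF x] in auto)
qed

lemma newton_tau_eq: "x \<in> dcone (supp f) P \<Longrightarrow> newton_tau f x = newton_polyhedron f \<inter> {y. x \<bullet> y = ep P \<bullet> x}"
  by (simp add: newton_tau_def newton_m_eq)

lemma ep_in_tau_iff:
  fixes f :: "('a::zero, 'n::finite) multipoly"
  assumes x: "x \<in> dcone (supp f) P" and w: "\<omega> \<in> supp f"
  shows "ep \<omega> \<in> newton_tau f x \<longleftrightarrow> \<omega> \<in> minface (supp f) x"
proof -
  have "P \<in> minface (supp f) x" using x by (simp add: dcone_def)
  then show ?thesis unfolding newton_tau_eq[OF x] minface_eq[OF \<open>P \<in> minface (supp f) x\<close>]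
    using newton_polyhedron_ep[OF w] w by (auto simp: inner_commute)
qed

lemma newton_face_tau:
  fixes f :: "('a::zero, 'n::finite) multipoly"
  assumes x: "x \<in> dcone (supp f) P" "x \<noteq> 0"
  shows "newton_face f (newton_tau f x)"
proof -
  have "newton_polyhedron f \<subseteq> {y. x \<bullet> y \<ge> ep P \<bullet> x}" using newton_polyhedron_lower[OF x(1)] by blast
  moreover have "ep P \<in> newton_polyhedron f \<inter> {y. x \<bullet> y = ep P \<bullet> x}"
    using newton_polyhedron_ep[OF dconeD(1)[OF x(1)]] by (simp add: inner_commute)
  ultimately show ?thesis unfolding newton_face_def newton_tau_eq[OF x(1)] using x(2) by blast
qed

lemma dcone_perturb:
  assumes K: "finite K" and x: "x \<in> dcone K P"
    and g: "\<And>\<omega>. \<omega> \<in> minface K x \<Longrightarrow> ep P \<bullet> g \<le> ep \<omega> \<bullet> g" "\<And>l. x $ l = 0 \<Longrightarrow> 0 \<le> g $ l"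
  obtains \<epsilon> where "0 < \<epsilon>" "\<And>t. 0 \<le> t \<Longrightarrow> t \<le> \<epsilon> \<Longrightarrow> x + t *\<^sub>R g \<in> dcone K P"
proof -
  have PK: "P \<in> K" and P: "P \<in> minface K x" using x by (auto simp: dcone_def minface_def)
  have "0 \<le> c \<bullet> g" if "c \<in> constr K P" "c \<bullet> x = 0" for c
  proof -
    from that consider \<omega> where "\<omega> \<in> K" "c = ep \<omega> - ep P" | i where "c = axis i 1" by (auto simp: constr_def)
    then show ?thesis
    proof cases
      case 1
      then have "\<omega> \<in> minface K x" using that(2) unfolding minface_eq[OF P] by (simp add: inner_diff_left)
      then show ?thesis using g(1) 1 by (simp add: inner_diff_left)
    next
      case 2
      then show ?thesis using g(2) that by simp
    qed
  qed
  moreover have "0 \<le> c \<bullet> x" if "c \<in> constr K P" for c using x dcone_iff[OF PK] that by blast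
  ultimately obtain \<epsilon> where "\<epsilon> > 0" "\<forall>t\<in>{0..\<epsilon>}. \<forall>c\<in>constr K P. 0 \<le> c \<bullet> (x + t *\<^sub>R g)"
    using perturb[OF finite_constr[OF K], of P x g] by blast
  then show ?thesis using that[of \<epsilon>] dcone_iff[OF PK] by auto
qed

text \<open>An inequality valid on the exponents of the face passes to the whole face, even an
  unbounded one: \<open>P\<close> stays minimal for \<open>x + e *\<^sub>R g\<close> with small
  \<open>e\<close>, and on the face the contribution of \<open>x\<close> cancels.\<close>

lemma newton_tau_lower:
  fixes f :: "('a::zero, 'n::finite) multipoly"
  assumes x: "x \<in> dcone (supp f) P"
    and g: "\<And>\<omega>. \<omega> \<in> minface (supp f) x \<Longrightarrow> ep P \<bullet> g \<le> ep \<omega> \<bullet> g" "\<And>l. x $ l = 0 \<Longrightarrow> 0 \<le> g $ l"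
    and y: "y \<in> newton_tau f x"
  shows "ep P \<bullet> g \<le> y \<bullet> g"
proof -
  obtain e where e: "0 < e" "\<And>t. 0 \<le> t \<Longrightarrow> t \<le> e \<Longrightarrow> x + t *\<^sub>R g \<in> dcone (supp f) P"
    using dcone_perturb[OF finite_keys x g] by blast
  have "x + e *\<^sub>R g \<in> dcone (supp f) P" using e by simp
  moreover have y': "y \<in> newton_polyhedron f" "x \<bullet> y = ep P \<bullet> x" using y by (auto simp: newton_tau_eq[OF x])
  ultimately have "ep P \<bullet> (x + e *\<^sub>R g) \<le> (x + e *\<^sub>R g) \<bullet> y" using newton_polyhedron_lower by blast
  then have "e * (ep P \<bullet> g) \<le> e * (y \<bullet> g)" using y'(2) by (simp add: inner_add_left inner_add_right inner_commute)
  then show ?thesis using e(1) by simp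
qed

lemma aff_dim_newton_polyhedron:
  fixes f :: "('a::zero, 'n::finite) multipoly"
  assumes "\<omega> \<in> supp f"
  shows "aff_dim (newton_polyhedron f) = int CARD('n)"
proof -
  have "cbox (ep \<omega>) (ep \<omega> + (\<chi> i. 1)) \<subseteq> newton_polyhedron f"
  proof
    fix y assume "y \<in> cbox (ep \<omega>) (ep \<omega> + (\<chi> i. 1))"
    then have "\<And>i. 0 \<le> (y - ep \<omega>) $ i" by (simp add: mem_box_cart)
    from newton_polyhedron_add[OF assms this] show "y \<in> newton_polyhedron f" by simp
  qed
  then have "interior (cbox (ep \<omega>) (ep \<omega> + (\<chi> i. 1))) \<subseteq> interior (newton_polyhedron f)" by (rule interior_mono)
  moreover have "box (ep \<omega>) (ep \<omega> + (\<chi> i. 1)) \<noteq> {}"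
    unfolding interval_ne_empty_cart(2) by simp
  ultimately have "interior (newton_polyhedron f) \<noteq> {}" by (auto simp: interior_cbox)
  then show ?thesis by (simp add: aff_dim_nonempty_interior)
qed

text \<open>A vector orthogonal to all directions of the face satisfies the equations in the
  definition of \<open>is_ray\<close>, the recession directions giving the vanishing coordinates.
  The orthogonal complement is therefore a line.\<close>

lemma ray_facet:
  fixes f :: "('a::zero, 'n::finite) multipoly"
  assumes r: "is_ray (supp f) x" and P: "P \<in> minface (supp f) x"
  shows "newton_facet f (newton_tau f x)"
proof -
  have x: "x \<in> dcone (supp f) P" "x \<noteq> 0" using r P by (auto simp: dcone_def is_ray_def)
  have PK: "P \<in> supp f" by (rule dconeD(1)[OF x(1)])
  let ?D = "(\<lambda>y. - ep P + y) ` newton_tau f x"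
  have PT: "ep P \<in> newton_tau f x" using ep_in_tau_iff[OF x(1) PK] P by simp
  have dim: "aff_dim (newton_tau f x) = int (dim ?D)"
    by (rule aff_dim_eq_dim[OF hull_inc[OF PT]])
  have "?D \<subseteq> {y. x \<bullet> y = 0}"
    by (auto simp: newton_tau_eq[OF x(1)] inner_diff_right inner_commute)
  then have "dim ?D \<le> dim {y. x \<bullet> y = 0}" by (rule dim_subset)
  also have "\<dots> = CARD('n) - 1" using dim_hyperplane[OF x(2)] by simp
  finally have le: "dim ?D \<le> CARD('n) - 1" .
  have "{y \<in> UNIV. \<forall>z\<in>span ?D. orthogonal z y} \<subseteq> span {x}"
  proof clarify
    fix y assume o: "\<forall>z\<in>span ?D. orthogonal z y"
    have o': "(z - ep P) \<bullet> y = 0" if "z \<in> newton_tau f x" for z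
      using o span_base[of "- ep P + z" ?D] that by (auto simp: orthogonal_def)
    obtain c where "y = c *\<^sub>R x"
    proof (rule is_rayD[OF r, of y])
      have w: "ep \<omega> \<bullet> y = ep P \<bullet> y" if "\<omega> \<in> minface (supp f) x" for \<omega>
        using o'[of "ep \<omega>"] that ep_in_tau_iff[OF x(1), of \<omega>] by (auto simp: minface_def inner_diff_left)
      show "ep \<omega> \<bullet> y = ep \<omega>' \<bullet> y" if "\<omega> \<in> minface (supp f) x" "\<omega>' \<in> minface (supp f) x" for \<omega> \<omega>'
        using w[OF that(1)] w[OF that(2)] by simp
      fix i assume i: "x $ i = 0"
      have "ep P + axis i 1 \<in> newton_polyhedron f"
        by (rule newton_polyhedron_add[OF PK]) (simp add: axis_def)
      then have "ep P + axis i 1 \<in> newton_tau f x" using i by (simp add: newton_tau_eq[OF x(1)] inner_add_right inner_commute)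
      from o'[OF this] show "y $ i = 0" by simp
    qed
    then show "y \<in> span {x}" by (simp add: span_base span_scale)
  qed
  then have "dim {y \<in> UNIV. \<forall>z\<in>span ?D. orthogonal z y} \<le> dim (span {x})" by (rule dim_subset)
  also have "\<dots> \<le> 1" using dim_le_card'[of "{x}"] by simp
  finally have "CARD('n) \<le> dim ?D + 1"
    using dim_subspace_orthogonal_to_vectors[of "span ?D" "UNIV :: (real^'n) set"] by simp
  then have "int (dim ?D) = int CARD('n) - 1" using le zero_less_card_finite[where 'a='n] by linarith
  then show ?thesis
    unfolding newton_facet_def dim aff_dim_newton_polyhedron[OF PK] using newton_face_tau[OF x] by simp
qed

lemma newton_tau_positive:
  fixes f :: "('a::zero, 'n::finite) multipoly"
  assumes x: "x \<in> dcone (supp f) P" and pos: "\<And>i. 0 < x $ i"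
  shows "newton_tau f x = convex hull (ep ` minface (supp f) x)"
proof (intro equalityI subsetI)
  let ?M = "convex hull (ep ` minface (supp f) x)"
  let ?m = "ep P \<bullet> x"
  have P: "P \<in> minface (supp f) x" using x by (simp add: dcone_def)
  have M: "?M \<subseteq> {y. x \<bullet> y = ?m}"
    by (rule hull_minimal[where S = convex, OF _ convex_hyperplane]) (auto simp: minface_eq[OF P] inner_commute)
  \<comment> \<open>The hull of the minimal exponents together with the open half space beyond them
    is convex and contains all generators of the polyhedron, since positive coordinates of
    \<open>x\<close> make every step into the orthant strict.\<close>
  have conv: "convex (?M \<union> {y. x \<bullet> y > ?m})"
  proof (intro iffD2[OF convex_alt] ballI allI impI)
    fix a b and u :: real assume a: "a \<in> ?M \<union> {y. x \<bullet> y > ?m}" and b: "b \<in> ?M \<union> {y. x \<bullet> y > ?m}" and u: "0 \<le> u \<and> u \<le> 1"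
    have ab: "x \<bullet> a \<ge> ?m" "x \<bullet> b \<ge> ?m" using a b M by auto
    consider "a \<in> ?M" "b \<in> ?M" | "u = 0" | "u = 1" | "x \<bullet> a > ?m \<or> x \<bullet> b > ?m" "0 < u" "u < 1" using a b u by force
    then show "(1 - u) *\<^sub>R a + u *\<^sub>R b \<in> ?M \<union> {y. x \<bullet> y > ?m}"
    proof cases
      case 1
      then show ?thesis using u convex_convex_hull[of "ep ` minface (supp f) x"] unfolding convex_alt by blast
    next
      case 4
      have "(1 - u) * (x \<bullet> a - ?m) \<ge> 0" "u * (x \<bullet> b - ?m) \<ge> 0" using 4 ab by auto
      moreover have "(1 - u) * (x \<bullet> a - ?m) > 0 \<or> u * (x \<bullet> b - ?m) > 0" using 4 by auto
      ultimately have "0 < (1 - u) * (x \<bullet> a - ?m) + u * (x \<bullet> b - ?m)" by linarith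
      then have "x \<bullet> ((1 - u) *\<^sub>R a + u *\<^sub>R b) > ?m" by (simp add: inner_add_right algebra_simps)
      then show ?thesis by simp
    qed (use a b in auto)
  qed
  have "newton_polyhedron f \<subseteq> ?M \<union> {y. x \<bullet> y > ?m}"
    unfolding newton_polyhedron_def
  proof (rule hull_minimal[where S = convex, OF _ conv], rule subsetI, rule ccontr)
    fix z assume "z \<in> (\<Union>\<omega>\<in>supp f. (+) (ep \<omega>) ` {t. \<forall>i. 0 \<le> t $ i})" and zn: "z \<notin> ?M \<union> {y. x \<bullet> y > ?m}"
    then obtain \<omega> and t :: "real ^ 'n" where w: "\<omega> \<in> supp f" and t: "\<forall>i. 0 \<le> t $ i" and z: "z = ep \<omega> + t" by auto
    have n: "\<not> x \<bullet> (ep \<omega> + t) > ?m" using zn z by simp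
    have xt: "0 \<le> x $ i * t $ i" for i using pos[of i] t by (simp add: less_imp_le)
    then have "0 \<le> x \<bullet> t" unfolding inner_vec_def by (intro sum_nonneg) simp
    moreover have "?m \<le> x \<bullet> ep \<omega>" using dconeD(3)[OF x w] by (simp add: inner_commute)
    ultimately have e: "x \<bullet> t = 0" "x \<bullet> ep \<omega> = ?m" using n by (simp_all add: inner_add_right)
    have "x $ i * t $ i = 0" for i
      using e(1) xt unfolding inner_vec_def by (simp add: sum_nonneg_eq_0_iff)
    then have "t = 0" using pos by (simp add: vec_eq_iff) (metis less_irrefl)
    moreover have "ep \<omega> \<in> ?M" by (rule hull_inc) (use w e in \<open>simp add: minface_eq[OF P] inner_commute\<close>)
    ultimately show False using zn z by simp
  qed
  then show "y \<in> ?M" if "y \<in> newton_tau f x" for y using that by (auto simp: newton_tau_eq[OF x])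
  have "?M \<subseteq> newton_polyhedron f"
    by (rule hull_minimal[where S = convex, OF _ convex_newton_polyhedron]) (auto simp: minface_def newton_polyhedron_ep)
  then show "y \<in> newton_tau f x" if "y \<in> ?M" for y using that M by (auto simp: newton_tau_eq[OF x])
qed

lemma compact_newton_tau:
  fixes f :: "('a::zero, 'n::finite) multipoly"
  assumes "x \<in> dcone (supp f) P" "\<And>i. 0 < x $ i"
  shows "compact (newton_tau f x)"
  unfolding newton_tau_positive[OF assms] by (intro finite_imp_compact_convex_hull) (simp add: minface_def)

section \<open>Normals of B1-facets\<close>

text \<open>\<open>v\<close> is normal to a \<open>B_1\<close>-facet for \<open>x_i\<close> with vertices \<open>E\<close>, \<open>D\<close> at height 0 and \<open>C\<close> at height 1.  In the
  non-compact case the facet has only one vertex \<open>E\<close> at height 0, and \<open>D\<close> is the point at distance 1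
  from it in the direction of recession; it need not belong to the support.\<close>

definition B1_normal :: "(nat ^ 3) set \<Rightarrow> 3 \<Rightarrow> nat ^ 3 \<Rightarrow> nat ^ 3 \<Rightarrow> nat ^ 3 \<Rightarrow> nat ^ 3 \<Rightarrow> bool" where
  "B1_normal K i v E D C \<longleftrightarrow> E \<in> minface K (ep v) \<and> C \<in> minface K (ep v) \<and> E $ i = 0 \<and> D $ i = 0 \<and> C $ i = 1 \<and> E \<noteq> D \<and>
     ((D \<in> minface K (ep v) \<and> (\<forall>l. 0 < v $ l) \<and>
        (\<forall>\<omega>\<in>minface K (ep v). \<omega> = C \<or> (\<exists>s. 0 \<le> s \<and> s \<le> 1 \<and> ep \<omega> = ep E + s *\<^sub>R (ep D - ep E)))) \<or>
      (\<exists>j. j \<noteq> i \<and> D = E + axis j 1 \<and> v $ j = 0 \<and> (\<forall>l. l \<noteq> j \<longrightarrow> 0 < v $ l) \<and>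
        (\<forall>\<omega>\<in>minface K (ep v). \<exists>s\<ge>0. ep \<omega> = ep E + s *\<^sub>R axis j 1 \<or> ep \<omega> = ep C + s *\<^sub>R axis j 1)))"

lemma extreme_vertex:
  fixes f :: "('a::zero, 'n::finite) multipoly"
  assumes x: "x \<in> dcone (supp f) P" and a: "a extreme_point_of newton_tau f x"
  obtains A where "A \<in> minface (supp f) x" "a = ep A"
proof -
  have "newton_tau f x face_of newton_polyhedron f"
    unfolding newton_tau_eq[OF x]
    by (rule face_of_Int_supporting_hyperplane_ge[OF convex_newton_polyhedron newton_polyhedron_lower[OF x]])
  then have ae: "a extreme_point_of newton_polyhedron f" and at: "a \<in> newton_tau f x"
    using a by (auto simp: extreme_point_of_face)
  then have "a \<in> (\<Union>\<omega>\<in>supp f. (+) (ep \<omega>) ` {t. \<forall>i. 0 \<le> t $ i})"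
    unfolding newton_polyhedron_def by (intro extreme_point_of_convex_hull)
  then obtain A t where A: "A \<in> supp f" "\<And>i. 0 \<le> t $ i" "a = ep A + t" by auto
  have "t = 0"
  proof (rule ccontr)
    assume t0: "t \<noteq> 0"
    \<comment> \<open>Otherwise \<open>a\<close> would be the midpoint of \<open>ep A\<close> and
      this point.\<close>
    have "ep A + 2 *\<^sub>R t \<in> newton_polyhedron f" by (rule newton_polyhedron_add[OF A(1)]) (use A in simp)
    moreover have "a \<in> open_segment (ep A) (ep A + 2 *\<^sub>R t)"
      unfolding in_segment A(3) using t0 by (intro conjI exI[of _ "1/2"]) (auto simp: vec_eq_iff field_simps)
    ultimately show False using ae newton_polyhedron_ep[OF A(1)] unfolding extreme_point_of_def by blast
  qed
  then have "A \<in> minface (supp f) x" using at ep_in_tau_iff[OF x A(1)] A(3) by simp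
  then show ?thesis using that A \<open>t = 0\<close> by simp
qed

lemma newton_tau_up:
  fixes f :: "('a::zero, 'n::finite) multipoly"
  assumes x: "x \<in> dcone (supp f) P" and y: "y \<in> newton_tau f x" and l: "x $ l = 0" and s: "0 \<le> s"
  shows "y + s *\<^sub>R axis l 1 \<in> newton_tau f x"
proof -
  have "y + s *\<^sub>R axis l 1 \<in> newton_polyhedron f"
    by (rule newton_polyhedron_up) (use y s in \<open>auto simp: newton_tau_eq[OF x] axis_def\<close>)
  then show ?thesis using y l by (simp add: newton_tau_eq[OF x] inner_add_right)
qed

lemma B1_normal_simplex:
  fixes f :: "('a::zero, 3) multipoly"
  assumes v: "v \<in> prim_rays (supp f)" and P: "P \<in> minface (supp f) (ep v)"
    and B: "B1_simplex i (newton_tau f (ep v))"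
  shows "\<exists>E D C. B1_normal (supp f) i v E D C"
proof -
  let ?T = "newton_tau f (ep v)" and ?M = "minface (supp f) (ep v)"
  have x: "ep v \<in> dcone (supp f) P" using P by (simp add: dcone_def)
  obtain a b c where abc: "card {a, b, c} = 3" "\<not> affine_dependent {a, b, c}" "?T = convex hull {a, b, c}"
    "a $ i = 0" "b $ i = 0" "c $ i = 1" using B unfolding B1_simplex_def by blast
  have ext: "z extreme_point_of ?T" if "z \<in> {a, b, c}" for z
    unfolding abc(3) extreme_point_of_convex_hull_affine_independent[OF abc(2)] by (rule that)
  obtain A where A: "A \<in> ?M" "a = ep A" using extreme_vertex[OF x ext, of a] by blast
  obtain O' where O': "O' \<in> ?M" "b = ep O'" using extreme_vertex[OF x ext, of b] by blast
  obtain C where C: "C \<in> ?M" "c = ep C" using extreme_vertex[OF x ext, of c] by blast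
  have ne: "A \<noteq> O'" using abc(1) A O' by (auto simp: card_insert_if split: if_splits)
  \<comment> \<open>A vanishing coordinate would be a direction of recession, but a simplex is
    bounded.\<close>
  have pos: "0 < v $ l" for l
  proof (rule ccontr)
    assume "\<not> 0 < v $ l"
    then have l: "ep v $ l = 0" by simp
    define m where "m = max (a $ l) (max (b $ l) (c $ l))"
    have "convex hull {a, b, c} \<subseteq> {y. y $ l \<le> m}"
    proof (rule hull_minimal)
      show "convex {y :: real ^ 3. y $ l \<le> m}" using convex_halfspace_le[of "axis l 1 :: real ^ 3" m] by (simp only: inner_axis_1)
    qed (auto simp: m_def)
    moreover have "a \<in> ?T" using ext[of a] by (simp add: extreme_point_of_def)
    then have "a + (m - a $ l + 1) *\<^sub>R axis l 1 \<in> ?T" by (rule newton_tau_up[OF x _ l]) (simp add: m_def)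
    ultimately have "(a + (m - a $ l + 1) *\<^sub>R axis l 1) $ l \<le> m" unfolding abc(3) by blast
    then show False by (simp add: axis_def)
  qed
  have "\<omega> = C \<or> (\<exists>s. 0 \<le> s \<and> s \<le> 1 \<and> ep \<omega> = ep A + s *\<^sub>R (ep O' - ep A))" if w: "\<omega> \<in> ?M" for \<omega>
  proof -
    have "ep \<omega> \<in> convex hull {a, b, c}" using ep_in_tau_iff[OF x, of \<omega>] w abc(3) by (simp add: minface_def)
    then obtain t u r where t: "0 \<le> t" "0 \<le> u" "0 \<le> r" "t + u + r = 1" "ep \<omega> = t *\<^sub>R a + u *\<^sub>R b + r *\<^sub>R c"
      unfolding convex_hull_3 by blast
    \<comment> \<open>The barycentric coordinate of \<open>c\<close> is the height above the plane,
      which is an integer for an exponent and hence 0 or 1.\<close>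
    have ri: "real (\<omega> $ i) = r" using arg_cong[OF t(5), of "\<lambda>y. y $ i"] abc by simp
    have "r \<le> 1" using t by simp
    then consider "r = 0" | "r = 1" using ri by (metis nat_less_le of_nat_0 of_nat_1 of_nat_le_iff less_one)
    then show ?thesis
    proof cases
      case 1
      then have "t = 1 - u" using t by simp
      then have "ep \<omega> = ep A + u *\<^sub>R (ep O' - ep A)" using t(5) 1 A O' by (simp add: scaleR_left_diff_distrib scaleR_right_diff_distrib)
      then show ?thesis using t(1,2,4) 1 by (intro disjI2 exI[of _ u] conjI) linarith+
    next
      case 2
      then have "t = 0" "u = 0" using t by auto
      then have "ep \<omega> = ep C" using t(5) 2 C by simp
      then show ?thesis by (simp add: exponent_point_inject)
    qed
  qed
  moreover have "A $ i = 0" "O' $ i = 0" "C $ i = 1" using abc A O' C by auto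
  ultimately have "B1_normal (supp f) i v A O' C" unfolding B1_normal_def using A O' C ne pos by blast
  then show ?thesis by blast
qed

lemma B1_normal_noncompact:
  fixes f :: "('a::zero, 3) multipoly"
  assumes v: "v \<in> prim_rays (supp f)" and P: "P \<in> minface (supp f) (ep v)"
    and B: "B1_noncompact i (newton_tau f (ep v))"
  shows "\<exists>E D C. B1_normal (supp f) i v E D C"
proof -
  let ?T = "newton_tau f (ep v)" and ?M = "minface (supp f) (ep v)"
  have x: "ep v \<in> dcone (supp f) P" using P by (simp add: dcone_def)
  obtain j a b where j: "j \<noteq> i" "\<And>k. noncompact_for k ?T \<longleftrightarrow> k = j"
    and ab: "forget_coordinate j ` ?T = closed_segment a b" "a $ i = 0" "b $ i = 1"
    using B unfolding B1_noncompact_def by blast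
  have Mx: "\<omega> \<in> ?M \<Longrightarrow> ep v \<in> dcone (supp f) \<omega>" for \<omega> by (simp add: dcone_def)
  have PT: "ep \<omega> \<in> ?T" if "\<omega> \<in> ?M" for \<omega> using ep_in_tau_iff[OF x, of \<omega>] that by (simp add: minface_def)
  have fi: "forget_coordinate j y $ i = y $ i" for y using j(1) by (simp add: forget_coordinate_def)
  have vj: "v $ j = 0"
  proof -
    have "ep P + axis j 1 \<in> ?T" using j(2)[of j] PT[OF P] by (simp add: noncompact_for_def)
    then have "ep v \<bullet> axis j 1 = 0" by (simp add: newton_tau_eq[OF x] inner_add_right inner_commute)
    then show ?thesis by simp
  qed
  have vl: "0 < v $ l" if "l \<noteq> j" for l
  proof (rule ccontr)
    assume "\<not> 0 < v $ l"
    then have "noncompact_for l ?T"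
      unfolding noncompact_for_def using newton_tau_up[OF x, of _ l 1] by simp
    then show False using j(2) that by simp
  qed
  have range: "y $ i \<le> 1" if "y \<in> ?T" for y
  proof -
    have "forget_coordinate j y \<in> closed_segment a b" using that ab by blast
    then obtain u where "forget_coordinate j y = (1 - u) *\<^sub>R a + u *\<^sub>R b" "u \<le> 1" by (auto simp: in_segment)
    then show ?thesis using fi[of y] ab by simp
  qed
  have ends: "y $ i = 0 \<Longrightarrow> forget_coordinate j y = a" "y $ i = 1 \<Longrightarrow> forget_coordinate j y = b" if "y \<in> ?T" for y
  proof -
    have "forget_coordinate j y \<in> closed_segment a b" using that ab by blast
    then obtain u where u: "forget_coordinate j y = (1 - u) *\<^sub>R a + u *\<^sub>R b" by (auto simp: in_segment)
    then have "y $ i = u" using fi[of y] ab by simp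
    then show "y $ i = 0 \<Longrightarrow> forget_coordinate j y = a" "y $ i = 1 \<Longrightarrow> forget_coordinate j y = b" using u by simp_all
  qed
  have finM: "finite ?M" by (simp add: minface_def)
  have level: "\<omega> $ i = 0 \<or> \<omega> $ i = 1" if "\<omega> \<in> ?M" for \<omega> using range[OF PT[OF that]] by simp linarith
  \<comment> \<open>The ends of the projected segment come from points of the face that need not be
    exponents. If all exponents of the face had height 1, the inequality of
    \<open>newton_tau_lower\<close> would exclude height 0 for every point of it.\<close>
  have low: "\<exists>\<omega>\<in>?M. \<omega> $ i = 0"
  proof (rule ccontr)
    assume neg: "\<not> ?thesis"
    then have one: "\<omega> $ i = 1" if "\<omega> \<in> ?M" for \<omega> using level that by blast
    obtain y where y: "y \<in> ?T" "forget_coordinate j y = a" using ab(1) by (metis ends_in_segment(1) imageE)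
    have "ep P \<bullet> axis i 1 \<le> y \<bullet> axis i 1"

    proof (rule newton_tau_lower[OF x _ _ y(1)])
      show "ep P \<bullet> axis i 1 \<le> ep \<omega> \<bullet> axis i 1" if "\<omega> \<in> ?M" for \<omega> using one[OF that] one[OF P] by simp
    qed (simp add: axis_def)
    then show False using one[OF P] fi[of y] y ab by simp
  qed
  have high: "\<exists>\<omega>\<in>?M. \<omega> $ i = 1"
  proof (rule ccontr)
    assume neg: "\<not> ?thesis"
    then have zero: "\<omega> $ i = 0" if "\<omega> \<in> ?M" for \<omega> using level that by blast
    obtain y where y: "y \<in> ?T" "forget_coordinate j y = b" using ab(1) by (metis ends_in_segment(2) imageE)
    have "ep P \<bullet> - axis i 1 \<le> y \<bullet> - axis i 1"
    proof (rule newton_tau_lower[OF x _ _ y(1)])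
      show "ep P \<bullet> - axis i 1 \<le> ep \<omega> \<bullet> - axis i 1" if "\<omega> \<in> ?M" for \<omega> using zero that P by simp
      show "0 \<le> (- axis i 1 :: real ^ 3) $ l" if "ep v $ l = 0" for l
        using that vl[of l] j(1) by (cases "l = j") (auto simp: axis_def)
    qed
    then show False using zero[OF P] fi[of y] y ab by simp
  qed
  have pick: "\<exists>A\<in>?M. A $ i = n \<and> (\<forall>\<omega>\<in>?M. \<omega> $ i = n \<longrightarrow> A $ j \<le> \<omega> $ j)" if ex: "\<exists>\<omega>\<in>?M. \<omega> $ i = n" for n
  proof -
    obtain A where "is_arg_min (\<lambda>\<omega>. \<omega> $ j) (\<lambda>\<omega>. \<omega> \<in> {\<omega>\<in>?M. \<omega> $ i = n}) A"
      using ex_is_arg_min_if_finite[of "{\<omega>\<in>?M. \<omega> $ i = n}" "\<lambda>\<omega>. \<omega> $ j"] finM ex by fastforce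
    then show ?thesis by (auto simp: is_arg_min_linorder)
  qed
  \<comment> \<open>At each of the two heights the face projects to one point, so its exponents
    there lie on a half line in direction \<open>j\<close>; the lowest one is the vertex.\<close>
  obtain E where E: "E \<in> ?M" "E $ i = 0" "\<And>\<omega>. \<omega> \<in> ?M \<Longrightarrow> \<omega> $ i = 0 \<Longrightarrow> E $ j \<le> \<omega> $ j" using pick[OF low] by blast
  obtain C where C: "C \<in> ?M" "C $ i = 1" "\<And>\<omega>. \<omega> \<in> ?M \<Longrightarrow> \<omega> $ i = 1 \<Longrightarrow> C $ j \<le> \<omega> $ j" using pick[OF high] by blast
  have same: "ep \<omega> = ep A + (real (\<omega> $ j) - real (A $ j)) *\<^sub>R axis j 1"
    if "forget_coordinate j (ep \<omega>) = forget_coordinate j (ep A)" for \<omega> A :: "nat ^ 3"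
  proof -
    have "ep \<omega> $ l = ep A $ l" if "l \<noteq> j" for l
      using arg_cong[OF \<open>forget_coordinate j (ep \<omega>) = _\<close>, of "\<lambda>y. y $ l"] that by (simp add: forget_coordinate_def)
    then show ?thesis by (simp add: vec_eq_iff axis_def)
  qed
  have "\<exists>s\<ge>0. ep \<omega> = ep E + s *\<^sub>R axis j 1 \<or> ep \<omega> = ep C + s *\<^sub>R axis j 1" if w: "\<omega> \<in> ?M" for \<omega>
    using level[OF w]
  proof
    assume 0: "\<omega> $ i = 0"
    have "forget_coordinate j (ep \<omega>) = forget_coordinate j (ep E)"
      using ends(1)[OF PT[OF w]] ends(1)[OF PT[OF E(1)]] 0 E(2) by simp
    from same[OF this] show ?thesis using E(3)[OF w 0] by (intro exI[of _ "real (\<omega> $ j) - real (E $ j)"]) simp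
  next
    assume 0: "\<omega> $ i = 1"
    have "forget_coordinate j (ep \<omega>) = forget_coordinate j (ep C)"
      using ends(2)[OF PT[OF w]] ends(2)[OF PT[OF C(1)]] 0 C(2) by simp
    from same[OF this] show ?thesis using C(3)[OF w 0] by (intro exI[of _ "real (\<omega> $ j) - real (C $ j)"]) simp
  qed
  moreover have "E \<noteq> E + axis j 1" by (simp add: vec_eq_iff axis_def)
  moreover have "(E + axis j 1) $ i = 0" using E(2) j(1) by (simp add: axis_def)
  ultimately have "B1_normal (supp f) i v E (E + axis j 1) C"
    unfolding B1_normal_def using E(1,2) C(1,2) j(1) vj vl by blast
  then show ?thesis by blast
qed

lemma B1_normal_exists:
  fixes f :: "('a::zero, 3) multipoly"
  assumes "v \<in> prim_rays (supp f)" "P \<in> minface (supp f) (ep v)" "B1_facet f i (newton_tau f (ep v))"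
  shows "\<exists>E D C. B1_normal (supp f) i v E D C"
  using assms B1_normal_simplex B1_normal_noncompact unfolding B1_facet_def by blast

lemma ep_axis [simp]: "ep (axis j 1) = axis j 1" "ep (axis j (Suc 0)) = axis j 1"
  by (simp_all add: vec_eq_iff axis_def)

lemma Gcd_axis: "Gcd (range (\<lambda>l. axis i (1::nat) $ l)) = 1"
proof -
  have "Gcd (range (\<lambda>l. axis i (1::nat) $ l)) dvd axis i (1::nat) $ i" by (rule Gcd_dvd) (rule rangeI)
  then show ?thesis by simp
qed

text \<open>Only segments with both ends in \<open>K\<close> are tested. This is enough to exclude
  the inner exponents of the edge from \<open>E\<close> to \<open>D\<close>.\<close>

definition extremal :: "(nat ^ 3) set \<Rightarrow> nat ^ 3 \<Rightarrow> bool" where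
  "extremal K P \<longleftrightarrow> (\<forall>A\<in>K. \<forall>B\<in>K. \<forall>s. 0 < s \<longrightarrow> s < 1 \<longrightarrow> ep P = ep A + s *\<^sub>R (ep B - ep A) \<longrightarrow> A = B)"

text \<open>A point of maximal norm in a face is a vertex of it.\<close>

lemma extremal_exists:
  assumes K: "finite K" "K \<noteq> {}"
  obtains P where "P \<in> minface K x" "extremal K P"
proof -
  obtain P0 where "P0 \<in> minface K x" using minface_nonempty[OF K] .
  moreover have "finite (minface K x)" using K by (simp add: minface_def)
  ultimately obtain P where P: "P \<in> minface K x" "\<And>Q. Q \<in> minface K x \<Longrightarrow> ep Q \<bullet> ep Q \<le> ep P \<bullet> ep P"
    using ex_is_arg_min_if_finite[of "minface K x" "\<lambda>Q. - (ep Q \<bullet> ep Q)"] by (auto simp: is_arg_min_linorder)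
  have "A = B" if A: "A \<in> K" and B: "B \<in> K" and s: "0 < s" "s < 1" and e: "ep P = ep A + s *\<^sub>R (ep B - ep A)" for A B s
  proof -
    have low: "ep P \<bullet> x \<le> ep A \<bullet> x" "ep P \<bullet> x \<le> ep B \<bullet> x" using P(1) A B by (auto simp: minface_def)
    have "ep P \<bullet> x = (1 - s) * (ep A \<bullet> x) + s * (ep B \<bullet> x)" unfolding e by (simp add: inner_add_left inner_diff_left algebra_simps)
    then have sum: "(1 - s) * (ep A \<bullet> x - ep P \<bullet> x) + s * (ep B \<bullet> x - ep P \<bullet> x) = 0" by (simp add: algebra_simps)
    have nn: "0 \<le> (1 - s) * (ep A \<bullet> x - ep P \<bullet> x)" "0 \<le> s * (ep B \<bullet> x - ep P \<bullet> x)" using low s by auto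
    then have "(1 - s) * (ep A \<bullet> x - ep P \<bullet> x) = 0" "s * (ep B \<bullet> x - ep P \<bullet> x) = 0" using sum by linarith+
    then have AB: "A \<in> minface K x" "B \<in> minface K x" unfolding minface_eq[OF P(1)] using A B s by auto
    \<comment> \<open>Both ends belong to the face, so neither has larger norm than the inner point
      \<open>P\<close>; strict convexity of the squared norm leaves only
      \<open>d = 0\<close>.\<close>
    define d where "d = ep B - ep A"
    have Bd: "ep B = ep A + d" by (simp add: d_def)
    have 1: "ep A \<bullet> ep A \<le> ep A \<bullet> ep A + 2 * s * (ep A \<bullet> d) + s * (s * (d \<bullet> d))"
      using P(2)[OF AB(1)] unfolding e d_def[symmetric] by (simp add: inner_add_left inner_add_right inner_commute algebra_simps)
    have 2: "2 * (ep A \<bullet> d) + d \<bullet> d \<le> 2 * s * (ep A \<bullet> d) + s * (s * (d \<bullet> d))"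
      using P(2)[OF AB(2)] unfolding e Bd by (simp add: inner_add_left inner_add_right inner_commute algebra_simps)
    have "0 \<le> s * (2 * (ep A \<bullet> d) + s * (d \<bullet> d))" using 1 by (simp add: algebra_simps)
    then have 3: "0 \<le> 2 * (ep A \<bullet> d) + s * (d \<bullet> d)" using s by (simp add: zero_le_mult_iff)
    have "(1 - s) * (2 * (ep A \<bullet> d) + (1 + s) * (d \<bullet> d)) \<le> 0" using 2 by (simp add: algebra_simps)
    then have "2 * (ep A \<bullet> d) + (1 + s) * (d \<bullet> d) \<le> 0" using s by (simp add: mult_le_0_iff)
    with 3 have "d \<bullet> d \<le> 0" by (simp add: algebra_simps)
    then have "d = 0" by (metis inner_gt_zero_iff not_less)
    then show ?thesis by (simp add: d_def exponent_point_inject)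
  qed
  then show ?thesis using that P(1) unfolding extremal_def by blast
qed

lemma B1_normal_pos:
  assumes "B1_normal K i v E D C"
  shows "0 < v $ i" "\<exists>l. l \<noteq> i \<and> 0 < v $ l"
proof -
  show "0 < v $ i" using assms unfolding B1_normal_def by metis
  have ex: "\<exists>l::3. l \<noteq> a \<and> l \<noteq> b" for a b
  proof -
    have "(1::3) \<noteq> 2" "(1::3) \<noteq> 3" "(2::3) \<noteq> 3" by simp_all
    then show ?thesis by metis
  qed
  show "\<exists>l. l \<noteq> i \<and> 0 < v $ l"
  proof (cases "\<forall>l. 0 < v $ l")
    case True
    then show ?thesis using ex[of i i] by blast
  next
    case False
    then obtain j where "\<And>l. l \<noteq> j \<Longrightarrow> 0 < v $ l" using assms unfolding B1_normal_def by metis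
    then show ?thesis using ex[of i j] by blast
  qed
qed

lemma B1_normal_points:
  assumes "B1_normal K i v E D C"
  shows "E \<in> minface K (ep v)" "C \<in> minface K (ep v)" "E \<in> K" "C \<in> K" "E $ i = 0" "D $ i = 0" "C $ i = 1" "E \<noteq> D"
  using assms by (auto simp: B1_normal_def minface_def)

lemma B1_normal_cases:
  assumes B: "B1_normal K i v E D C"
  obtains (simplex) "D \<in> minface K (ep v)" "\<forall>l. 0 < v $ l"
      "\<And>\<omega>. \<omega> \<in> minface K (ep v) \<Longrightarrow> \<omega> = C \<or> (\<exists>s. 0 \<le> s \<and> s \<le> 1 \<and> ep \<omega> = ep E + s *\<^sub>R (ep D - ep E))"
  | (unbounded) j where "j \<noteq> i" "ep D - ep E = axis j 1" "v $ j = 0" "\<And>l. l \<noteq> j \<Longrightarrow> 0 < v $ l"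
      "\<And>\<omega>. \<omega> \<in> minface K (ep v) \<Longrightarrow> \<exists>s\<ge>0. ep \<omega> = ep E + s *\<^sub>R axis j 1 \<or> ep \<omega> = ep C + s *\<^sub>R axis j 1"
proof -
  from B consider "D \<in> minface K (ep v) \<and> (\<forall>l. 0 < v $ l) \<and>
        (\<forall>\<omega>\<in>minface K (ep v). \<omega> = C \<or> (\<exists>s. 0 \<le> s \<and> s \<le> 1 \<and> ep \<omega> = ep E + s *\<^sub>R (ep D - ep E)))"
   | j where "j \<noteq> i" "D = E + axis j 1" "v $ j = 0" "\<forall>l. l \<noteq> j \<longrightarrow> 0 < v $ l"
        "\<forall>\<omega>\<in>minface K (ep v). \<exists>s\<ge>0. ep \<omega> = ep E + s *\<^sub>R axis j 1 \<or> ep \<omega> = ep C + s *\<^sub>R axis j 1"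
    unfolding B1_normal_def by blast
  then show ?thesis
  proof cases
    case 1
    then show ?thesis by (intro simplex) blast+
  next
    case (2 j)
    have "ep D - ep E = axis j 1" using 2(2) by (simp add: exponent_point_add)
    from unbounded[OF 2(1) this 2(3)] 2(4,5) show ?thesis by blast
  qed
qed

lemma B1_normal_swap:
  assumes "B1_normal K i v E D C" "\<forall>l. 0 < v $ l"
  shows "B1_normal K i v D E C" "D \<in> minface K (ep v)"
proof -
  have no: "v $ j \<noteq> 0" for j using assms(2) by (metis less_irrefl)
  show D: "D \<in> minface K (ep v)" using assms(1)
  proof (cases rule: B1_normal_cases)
    case (unbounded j)
    then show ?thesis using no by blast
  qed
  have "\<omega> = C \<or> (\<exists>s. 0 \<le> s \<and> s \<le> 1 \<and> ep \<omega> = ep D + s *\<^sub>R (ep E - ep D))" if "\<omega> \<in> minface K (ep v)" for \<omega>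
    using assms(1)
  proof (cases rule: B1_normal_cases)
    case simplex
    from simplex(3)[OF that] show ?thesis
    proof
      assume "\<exists>s. 0 \<le> s \<and> s \<le> 1 \<and> ep \<omega> = ep E + s *\<^sub>R (ep D - ep E)"
      then obtain s where s: "0 \<le> s" "s \<le> 1" "ep \<omega> = ep E + s *\<^sub>R (ep D - ep E)" by blast
      have "ep \<omega> = ep D + (1 - s) *\<^sub>R (ep E - ep D)" unfolding s(3) by (simp add: vec_eq_iff algebra_simps)
      then show ?thesis using s by (intro disjI2 exI[of _ "1 - s"]) simp
    qed simp
  qed (use no in auto)
  then show "B1_normal K i v D E C" using assms B1_normal_points[OF assms(1)] D unfolding B1_normal_def by auto
qed

lemma minface_dcone: "P \<in> minface K (ep v) \<longleftrightarrow> ep v \<in> dcone K P"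
  by (simp add: dcone_def)

lemma B1_normal_orth:
  assumes B: "B1_normal K i v E D C"
  shows "(ep D - ep E) \<bullet> ep v = 0" "(ep C - ep E) \<bullet> ep v = 0"
proof -
  show "(ep C - ep E) \<bullet> ep v = 0"
    using minface_inner_eq[OF B1_normal_points(2)[OF B] B1_normal_points(1)[OF B]] by (simp add: inner_diff_left)
  show "(ep D - ep E) \<bullet> ep v = 0" using B
  proof (cases rule: B1_normal_cases)
    case simplex
    then show ?thesis using minface_inner_eq[OF simplex(1) B1_normal_points(1)[OF B]] by (simp add: inner_diff_left)
  next
    case (unbounded j)
    then show ?thesis by simp
  qed
qed

text \<open>The two edge vectors at \<open>E\<close> span the directions of the facet, so the
  equations defining the ray follow from these two.\<close>

lemma B1_normal_kernel:
  assumes B: "B1_normal K i v E D C" and v: "v \<in> prim_rays K"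
    and x: "(ep D - ep E) \<bullet> x = 0" "(ep C - ep E) \<bullet> x = 0"
  obtains t where "x = t *\<^sub>R ep v"
proof -
  have Cx: "ep C \<bullet> x = ep E \<bullet> x" using x(2) by (simp add: inner_diff_left)
  have base: "ep \<omega> \<bullet> x = ep E \<bullet> x" if "\<omega> \<in> minface K (ep v)" for \<omega>
    using B
  proof (cases rule: B1_normal_cases)
    case simplex
    from simplex(3)[OF that] show ?thesis
    proof
      assume "\<exists>s. 0 \<le> s \<and> s \<le> 1 \<and> ep \<omega> = ep E + s *\<^sub>R (ep D - ep E)"
      then obtain s where "ep \<omega> = ep E + s *\<^sub>R (ep D - ep E)" by blast
      then show ?thesis using x(1) by (simp add: inner_add_left)
    qed (use Cx in simp)
  next
    case (unbounded j)
    have "axis j 1 \<bullet> x = 0" using x(1) unfolding unbounded(2) .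
    moreover from unbounded(5)[OF that] obtain s where "ep \<omega> = ep E + s *\<^sub>R axis j 1 \<or> ep \<omega> = ep C + s *\<^sub>R axis j 1" by blast
    ultimately show ?thesis using Cx by (auto simp only: inner_add_left inner_scaleR_left mult_zero_right add_0_right)
  qed
  have zero: "x $ l = 0" if "v $ l = 0" for l
    using B
  proof (cases rule: B1_normal_cases)
    case simplex
    then show ?thesis using that by (metis less_irrefl)
  next
    case (unbounded j)
    then have "l = j" using that by (metis less_irrefl)
    then show ?thesis using x(1) unfolding unbounded(2) by simp
  qed
  obtain c where "x = c *\<^sub>R ep v"
  proof (rule is_rayD[of K "ep v" x])
    show "is_ray K (ep v)" using v by (simp add: prim_rays_def)
    show "ep \<omega> \<bullet> x = ep \<omega>' \<bullet> x" if "\<omega> \<in> minface K (ep v)" "\<omega>' \<in> minface K (ep v)" for \<omega> \<omega>'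
      unfolding base[OF that(1)] base[OF that(2)] ..
    show "x $ l = 0" if "ep v $ l = 0" for l using zero that by simp
  qed
  then show ?thesis using that by blast
qed

lemma B1_normal_base_nonneg:
  assumes B: "B1_normal K i v E D C" and x: "x \<in> dcone K E"
  shows "0 \<le> (ep D - ep E) \<bullet> x"
  using B
proof (cases rule: B1_normal_cases)
  case simplex
  then have "D \<in> K" by (simp add: minface_def)
  then show ?thesis using dconeD(3)[OF x] by (simp add: inner_diff_left)
next
  case (unbounded j)
  then show ?thesis using dconeD(2)[OF x] by simp
qed

lemma axis_dcone: "P \<in> K \<Longrightarrow> P $ i = 0 \<Longrightarrow> axis i 1 \<in> dcone K P"
  by (simp add: dcone_iff constr_def ball_Un inner_diff_left) (simp add: axis_def)

text \<open>The edge at height 0 lies in the facet \<open>x_i = 0\<close> of the polyhedron, hence in no third facet.\<close>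

lemma B1_normal_bottom:
  assumes B: "B1_normal K i v E D C" and v: "v \<in> prim_rays K" and w: "w \<in> prim_rays K" "w \<noteq> v" "w \<noteq> axis i 1"
    and E: "E \<in> minface K (ep w)" and o: "(ep D - ep E) \<bullet> ep w = 0"
  shows False
proof -
  note pts = B1_normal_points[OF B]
  define d where "d = (ep C - ep E) \<bullet> ep w"
  have we: "ep w \<in> dcone K E" using E by (simp add: minface_dcone)
  have d0: "0 \<le> d" unfolding d_def using dconeD(3)[OF we pts(4)] by (simp add: inner_diff_left)
  \<comment> \<open>Removing the right multiple of \<open>e_i\<close> from \<open>w\<close> makes
    both edge equations hold, so \<open>w = t v + d e_i\<close> inside the dual cone of
    \<open>E\<close>. Extremality of the ray \<open>w\<close> leaves only \<open>w = v\<close> or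
    \<open>w = e_i\<close>.\<close>
  have "(ep D - ep E) \<bullet> (ep w - d *\<^sub>R axis i 1) = 0" "(ep C - ep E) \<bullet> (ep w - d *\<^sub>R axis i 1) = 0"
    using o pts by (simp_all add: inner_diff_right d_def)
  from B1_normal_kernel[OF B v this] obtain t where t: "ep w - d *\<^sub>R axis i 1 = t *\<^sub>R ep v" .
  then have wt: "ep w = t *\<^sub>R ep v + d *\<^sub>R axis i 1" by (simp add: algebra_simps)
  obtain l where l: "l \<noteq> i" "0 < v $ l" using B1_normal_pos(2)[OF B] by blast
  have "real (w $ l) = t * real (v $ l)" using arg_cong[OF wt, of "\<lambda>y. y $ l"] l(1) by (simp add: axis_def)
  then have "0 \<le> t * real (v $ l)" by (metis of_nat_0_le_iff)
  then have t0: "0 \<le> t" using l by (simp add: zero_le_mult_iff)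
  show False
  proof (cases "t = 0")
    case True
    then have "ep w = d *\<^sub>R ep (axis i 1)" using wt by simp
    then have "w = axis i 1" using prim_parallel[of w "axis i 1" d] Gcd_axis[of i] w(1) by (simp add: prim_rays_def)
    then show False using w by simp
  next
    case False
    have "v \<in> rays K E" "w \<in> rays K E" using v w E pts by (auto simp: rays_def)
    then have "v = w" using ray_extreme_eq[of w K E v "d *\<^sub>R axis i 1" t] False t0 wt
        dcone_scale[OF axis_dcone[OF pts(3,5)] d0] by simp
    then show False using w by simp
  qed
qed

text \<open>The facets normal to \<open>v\<close> and \<open>w\<close> have two points in common; in the second alternative these are a
  vertex and its translate in a common direction of recession.\<close>

definition share :: "(nat ^ 3) set \<Rightarrow> nat ^ 3 \<Rightarrow> nat ^ 3 \<Rightarrow> bool" where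
  "share K v w \<longleftrightarrow> (\<exists>A B. A \<noteq> B \<and> {A, B} \<subseteq> minface K (ep v) \<inter> minface K (ep w)) \<or>
     (\<exists>A j. A \<in> minface K (ep v) \<inter> minface K (ep w) \<and> v $ j = 0 \<and> w $ j = 0)"

lemma share_commute: "share K v w \<longleftrightarrow> share K w v"
  by (simp add: share_def Int_commute conj_ac)

lemma minface_along:
  assumes "\<omega> \<in> minface K (ep w)" "P \<in> K" "0 \<le> s" "ep \<omega> = ep P + s *\<^sub>R axis j 1"
  shows "P \<in> minface K (ep w)" "s > 0 \<Longrightarrow> w $ j = 0"
proof -
  have e: "ep \<omega> \<bullet> ep w = ep P \<bullet> ep w + s * real (w $ j)" using assms(4) by (simp add: inner_add_left)
  have "ep \<omega> \<bullet> ep w \<le> ep P \<bullet> ep w" using assms(1,2) by (simp add: minface_def)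
  then have z: "s * real (w $ j) = 0" using e mult_nonneg_nonneg[OF assms(3), of "real (w $ j)"] by simp
  then show "P \<in> minface K (ep w)" unfolding minface_eq[OF assms(1)] using e assms(2) by simp
  show "w $ j = 0" if "s > 0" using z that by simp
qed

text \<open>If the common points did not involve the apex, the facets would share the edge at height
  0. That edge already separates the facet of \<open>v\<close> from the coordinate plane, so no
  further normal is orthogonal to it.\<close>

lemma share_apex:
  assumes B: "B1_normal K i v E D C" and v: "v \<in> prim_rays K" and w: "w \<in> prim_rays K" "w \<noteq> v" "w \<noteq> axis i 1"
    and sh: "share K v w"
  shows "C \<in> minface K (ep w)"
proof (rule ccontr)
  assume C: "C \<notin> minface K (ep w)"
  note pts = B1_normal_points[OF B]
  note bot = B1_normal_bottom[OF B v w]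
  show False using B
  proof (cases rule: B1_normal_cases)
    case simplex
    have "\<not> (\<exists>A j. A \<in> minface K (ep v) \<inter> minface K (ep w) \<and> v $ j = 0 \<and> w $ j = 0)"
      using simplex(2) by (metis less_irrefl)
    then obtain A A' where A: "A \<noteq> A'" "A \<in> minface K (ep v)" "A \<in> minface K (ep w)" "A' \<in> minface K (ep v)" "A' \<in> minface K (ep w)"
      using sh unfolding share_def by blast
    have "A \<noteq> C" "A' \<noteq> C" using A C by auto
    then obtain s s' where s: "ep A = ep E + s *\<^sub>R (ep D - ep E)" "ep A' = ep E + s' *\<^sub>R (ep D - ep E)"
      using simplex(3)[OF A(2)] simplex(3)[OF A(4)] by blast
    have "s \<noteq> s'" using s A(1) by (metis exponent_point_inject)
    moreover have "ep A \<bullet> ep w = ep A' \<bullet> ep w" by (rule minface_inner_eq[OF A(3,5)])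
    then have "s * ((ep D - ep E) \<bullet> ep w) = s' * ((ep D - ep E) \<bullet> ep w)" unfolding s by (simp only: inner_add_left inner_scaleR_left add_left_cancel)
    ultimately have o: "(ep D - ep E) \<bullet> ep w = 0" by simp
    then have "ep A \<bullet> ep w = ep E \<bullet> ep w" unfolding s(1) by (simp only: inner_add_left inner_scaleR_left mult_zero_right add_0_right)
    then have "E \<in> minface K (ep w)" unfolding minface_eq[OF A(3)] using pts(3) by simp
    then show False using bot o by blast
  next
    case (unbounded j)
    have low: "\<exists>s\<ge>0. ep A = ep E + s *\<^sub>R axis j 1" if A: "A \<in> minface K (ep v)" "A \<in> minface K (ep w)" for A
    proof -
      from unbounded(5)[OF A(1)] obtain s where s: "s \<ge> 0" "ep A = ep E + s *\<^sub>R axis j 1 \<or> ep A = ep C + s *\<^sub>R axis j 1" by blast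
      then show ?thesis using minface_along(1)[OF A(2) pts(4) s(1)] C by blast
    qed
    have "\<exists>A. A \<in> minface K (ep v) \<and> A \<in> minface K (ep w) \<and> w $ j = 0"
      using sh unfolding share_def
    proof
      assume "\<exists>A B. A \<noteq> B \<and> {A, B} \<subseteq> minface K (ep v) \<inter> minface K (ep w)"
      then obtain A A' where A: "A \<noteq> A'" "A \<in> minface K (ep v)" "A \<in> minface K (ep w)" "A' \<in> minface K (ep v)" "A' \<in> minface K (ep w)"
        by blast
      obtain s s' where s: "s \<ge> 0" "ep A = ep E + s *\<^sub>R axis j 1" "s' \<ge> 0" "ep A' = ep E + s' *\<^sub>R axis j 1"
        using low A by metis
      have "s \<noteq> s'" using s A(1) by (metis exponent_point_inject)
      then have "s > 0 \<or> s' > 0" using s by linarith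
      then have "w $ j = 0" using minface_along(2)[OF A(3) pts(3) s(1,2)] minface_along(2)[OF A(5) pts(3) s(3,4)] by blast
      then show ?thesis using A by blast
    next
      assume "\<exists>A j. A \<in> minface K (ep v) \<inter> minface K (ep w) \<and> v $ j = 0 \<and> w $ j = 0"
      then show ?thesis using unbounded(4) by (metis IntE less_irrefl)
    qed
    then obtain A where A: "A \<in> minface K (ep v)" "A \<in> minface K (ep w)" "w $ j = 0" by blast
    obtain s where "s \<ge> 0" "ep A = ep E + s *\<^sub>R axis j 1" using low A by metis
    then have "E \<in> minface K (ep w)" using minface_along(1)[OF A(2) pts(3)] by blast
    then show False using bot A(3) unfolding unbounded(2) by simp
  qed
qed

text \<open>\<open>R'\<close> consists of the generators with nonzero coefficient in one
  representation of \<open>x\<close>. The same \<open>R'\<close> serves all forms: a form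
  nonnegative on \<open>R\<close> that vanishes at \<open>x\<close> vanishes on every generator
  involved.\<close>

lemma ncone_face:
  assumes R: "finite R" and x: "x \<in> ncone R"
  obtains R' where "R' \<subseteq> R" "x \<in> ncone R'"
    "\<And>c r. (\<And>r. r \<in> R \<Longrightarrow> 0 \<le> c \<bullet> ep r) \<Longrightarrow> c \<bullet> x = 0 \<Longrightarrow> r \<in> R' \<Longrightarrow> c \<bullet> ep r = 0"
proof -
  obtain a where a: "\<forall>r\<in>R. 0 \<le> a r" "x = (\<Sum>r\<in>R. a r *\<^sub>R ep r)" using x unfolding ncone_def by blast
  define R' where "R' = {r\<in>R. a r \<noteq> 0}"
  have sub: "R' \<subseteq> R" and fin: "finite R'" using R by (auto simp: R'_def)
  have x': "x = (\<Sum>r\<in>R'. a r *\<^sub>R ep r)"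
    unfolding a(2) by (rule sum.mono_neutral_right[OF R sub]) (auto simp: R'_def)
  have "x \<in> ncone R'"
    unfolding x' by (rule ncone_sum[OF fin]) (use a(1) sub fin in \<open>auto intro!: ncone_scale ncone_mem\<close>)
  moreover have "c \<bullet> ep r = 0" if c: "\<And>r. r \<in> R \<Longrightarrow> 0 \<le> c \<bullet> ep r" "c \<bullet> x = 0" and r: "r \<in> R'" for c r
  proof -
    have nn: "0 \<le> a r * (c \<bullet> ep r)" if "r \<in> R'" for r
    proof (rule mult_nonneg_nonneg)
      show "0 \<le> a r" using a(1) sub that by blast
      show "0 \<le> c \<bullet> ep r" using c(1) sub that by blast
    qed
    have "(\<Sum>r\<in>R'. a r * (c \<bullet> ep r)) = 0" using c(2) unfolding x' by (simp add: inner_sum_right)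
    then have "\<forall>r\<in>R'. a r * (c \<bullet> ep r) = 0" by (subst (asm) sum_nonneg_eq_0_iff[OF fin nn])
    then show ?thesis using r by (simp add: R'_def)
  qed
  ultimately show ?thesis using that sub by blast
qed

lemma ncone_nonpos:
  assumes "x \<in> ncone R" "finite R" "linear N" "\<And>r. r \<in> R \<Longrightarrow> N (ep r) \<le> (0::real)"
  shows "N x \<le> 0"
  using assms(1,2)
proof (rule ncone_induct)
  show "N 0 \<le> 0" using assms(3) by (simp add: linear_0)
  show "N (x + y) \<le> 0" if "N x \<le> 0" "N y \<le> 0" for x y using that by (simp add: linear_add[OF assms(3)])
  show "N (t *\<^sub>R ep r) \<le> 0" if "r \<in> R" "0 \<le> t" for t r
    using that assms(4) by (simp add: linear_scale[OF assms(3)] mult_nonneg_nonpos)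
qed

lemma ncone_positive:
  assumes "x \<in> ncone R" "finite R" "0 < c \<bullet> x"
  obtains r where "r \<in> R" "0 < c \<bullet> ep r"
proof -
  have "\<exists>r\<in>R. 0 < c \<bullet> ep r"
  proof (rule ccontr)
    assume "\<not> ?thesis"
    then have "c \<bullet> x \<le> 0"
      by (intro ncone_nonpos[OF assms(1,2), of "(\<bullet>) c"]) (auto simp: not_less bounded_linear_inner_right bounded_linear.linear)
    then show False using assms(3) by simp
  qed
  then show ?thesis using that by blast
qed

text \<open>Produces a neighbouring normal. One point of the face \<open>f = 0\<close> of the dual
  cone on the positive side of \<open>c\<close> suffices to find a ray of that face on the same
  side.\<close>

lemma dcone_extract:
  fixes K :: "(nat ^ 3) set"
  assumes K: "finite K" and x: "x \<in> dcone K P" and c: "0 < c \<bullet> x"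
    and f: "\<And>y. y \<in> dcone K P \<Longrightarrow> 0 \<le> f \<bullet> y" "f \<bullet> x = 0"
  obtains r where "r \<in> rays K P" "0 < c \<bullet> ep r" "f \<bullet> ep r = 0"
proof -
  obtain R' where R': "R' \<subseteq> rays K P" "x \<in> ncone R'"
    "\<And>c r. (\<And>r. r \<in> rays K P \<Longrightarrow> 0 \<le> c \<bullet> ep r) \<Longrightarrow> c \<bullet> x = 0 \<Longrightarrow> r \<in> R' \<Longrightarrow> c \<bullet> ep r = 0"
    using ncone_face[OF finite_rays[OF K] dcone_generated[OF K x]] by blast
  obtain r where r: "r \<in> R'" "0 < c \<bullet> ep r"
    using ncone_positive[OF R'(2) finite_subset[OF R'(1) finite_rays[OF K]] c] by blast
  have "f \<bullet> ep r = 0" by (rule R'(3)[OF _ f(2) r(1)]) (use f(1) rays_dcone in blast)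
  then show ?thesis using that r R'(1) by blast
qed

text \<open>The normals orthogonal to the edge from \<open>E\<close> to \<open>C\<close> form a face
  of the dual cone of \<open>E\<close> that contains \<open>v\<close>; \<open>a\<close> is a ray of
  it on the side on which the edge vector towards \<open>D\<close> is positive.\<close>

lemma B1_normal_neighbour:
  assumes K: "finite K" and B: "B1_normal K i v E D C"
  obtains a where "a \<in> rays K E" "C \<in> minface K (ep a)" "0 < (ep D - ep E) \<bullet> ep a"
proof -
  note pts = B1_normal_points[OF B]
  define b c where "b = ep D - ep E" and "c = ep C - ep E"
  have bi: "b $ i = 0" "c $ i = 1" using pts by (simp_all add: b_def c_def)
  have b0: "b \<noteq> 0" using pts by (simp add: b_def exponent_point_inject)
  \<comment> \<open>A multiple of the part of \<open>b\<close> orthogonal to \<open>c\<close>: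
    moving \<open>v\<close> along it keeps \<open>E\<close> and \<open>C\<close> equally minimal and
    makes the form \<open>b\<close> positive.\<close>
  define d where "d = (c \<bullet> c) *\<^sub>R b - (b \<bullet> c) *\<^sub>R c"
  have cd: "c \<bullet> d = 0" by (simp add: d_def inner_diff_right inner_commute)
  have c0: "0 < c \<bullet> c" using bi by auto
  have d0: "d \<noteq> 0"
  proof
    assume "d = 0"
    then have "d $ i = 0" by simp
    then have "b \<bullet> c = 0" using bi by (simp add: d_def)
    then show False using \<open>d = 0\<close> b0 c0 by (simp add: d_def)
  qed
  have "d \<bullet> d = (c \<bullet> c) * (b \<bullet> d) - (b \<bullet> c) * (c \<bullet> d)" by (simp add: d_def inner_diff_left)
  then have "0 < (c \<bullet> c) * (b \<bullet> d)" using d0 by (metis cd diff_zero inner_gt_zero_iff mult_zero_right)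
  then have bd: "0 < b \<bullet> d" using c0 by (simp add: zero_less_mult_iff)
  have vE: "ep v \<in> dcone K E" using pts(1) by (simp add: minface_dcone)
  have Cd: "ep C \<bullet> d = ep E \<bullet> d" using cd by (simp add: c_def inner_diff_left)
  have g1: "ep E \<bullet> d \<le> ep \<omega> \<bullet> d" if w: "\<omega> \<in> minface K (ep v)" for \<omega>
    using B
  proof (cases rule: B1_normal_cases)
    case simplex
    from simplex(3)[OF w] show ?thesis
    proof
      assume "\<exists>s. 0 \<le> s \<and> s \<le> 1 \<and> ep \<omega> = ep E + s *\<^sub>R (ep D - ep E)"
      then obtain s where "0 \<le> s" "ep \<omega> = ep E + s *\<^sub>R b" by (auto simp: b_def)
      then show ?thesis using bd by (simp add: inner_add_left)
    qed (use Cd in simp)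
  next
    case (unbounded j)
    have "0 < axis j 1 \<bullet> d" using bd unfolding b_def unbounded(2) .
    moreover from unbounded(5)[OF w] obtain s where "s \<ge> 0" "ep \<omega> = ep E + s *\<^sub>R axis j 1 \<or> ep \<omega> = ep C + s *\<^sub>R axis j 1" by blast
    ultimately show ?thesis using Cd by (auto simp: inner_add_left)
  qed
  have g2: "0 \<le> d $ l" if "ep v $ l = 0" for l
    using B
  proof (cases rule: B1_normal_cases)
    case simplex
    then show ?thesis using that by (metis exponent_point_nth less_irrefl of_nat_eq_0_iff)
  next
    case (unbounded j)
    then have "l = j" using that by (metis exponent_point_nth less_irrefl of_nat_eq_0_iff)
    moreover have "0 < axis j 1 \<bullet> d" using bd unfolding b_def unbounded(2) .
    ultimately show ?thesis by simp
  qed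
  obtain e where e: "0 < e" "\<And>t. 0 \<le> t \<Longrightarrow> t \<le> e \<Longrightarrow> ep v + t *\<^sub>R d \<in> dcone K E"
    using dcone_perturb[OF K vE g1 g2] by blast
  have x: "ep v + e *\<^sub>R d \<in> dcone K E" using e by simp
  have cv: "b \<bullet> ep v = 0" "c \<bullet> ep v = 0" using B1_normal_orth[OF B] by (simp_all add: b_def c_def)
  have nn: "0 \<le> c \<bullet> y" if "y \<in> dcone K E" for y using dconeD(3)[OF that pts(4)] by (simp add: c_def inner_diff_left)
  obtain a where a: "a \<in> rays K E" "0 < b \<bullet> ep a" "c \<bullet> ep a = 0"
  proof (rule dcone_extract[OF K x _ nn])
    show "0 < b \<bullet> (ep v + e *\<^sub>R d)" using cv bd e by (simp add: inner_add_right)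
    show "c \<bullet> (ep v + e *\<^sub>R d) = 0" using cv cd by (simp add: inner_add_right)
  qed
  have "E \<in> minface K (ep a)" using a(1) by (simp add: rays_def)
  then have "C \<in> minface K (ep a)" using a(3) pts(4) unfolding minface_eq[OF \<open>E \<in> minface K (ep a)\<close>] by (simp add: c_def inner_diff_left)
  then show ?thesis using that a by (simp add: b_def)
qed

text \<open>A supporting form of the polyhedron at \<open>C\<close> whose edge is \<open>C D\<close>, or the ray from \<open>C\<close> in the
  direction of recession.\<close>

definition apex_form :: "nat ^ 3 \<Rightarrow> nat ^ 3 \<Rightarrow> nat ^ 3 \<Rightarrow> nat ^ 3 \<Rightarrow> real ^ 3" where
  "apex_form v E D C = (if \<forall>l. 0 < v $ l then ep D - ep C else ep D - ep E)"

lemma apex_form_nonneg: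
  assumes B: "B1_normal K i v E D C" and x: "x \<in> dcone K C"
  shows "0 \<le> apex_form v E D C \<bullet> x"
  using B
proof (cases rule: B1_normal_cases)
  case simplex
  then have "D \<in> K" by (simp add: minface_def)
  then show ?thesis using dconeD(3)[OF x] simplex(2) by (simp add: apex_form_def inner_diff_left)
next
  case (unbounded j)
  then have "(\<forall>l. 0 < v $ l) = False" by auto
  then have "apex_form v E D C = axis j 1" unfolding apex_form_def unbounded(2) by (simp only: if_False)
  then show ?thesis using dconeD(2)[OF x] by simp
qed

text \<open>The normal across the other edge at \<open>C\<close>. For a simplex this is the previous
  construction with \<open>E\<close> and \<open>D\<close> exchanged; for an unbounded facet it is
  found by moving \<open>v\<close> in direction \<open>- e_i\<close>, which prefers the points at
  height 1.\<close>

lemma B1_normal_apex_neighbour: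
  assumes K: "finite K" and B: "B1_normal K i v E D C"
  obtains b where "b \<in> rays K C" "(ep C - ep E) \<bullet> ep b < 0" "apex_form v E D C \<bullet> ep b = 0"
  using B
proof (cases rule: B1_normal_cases)
  case simplex
  obtain b where b: "b \<in> rays K D" "C \<in> minface K (ep b)" "0 < (ep E - ep D) \<bullet> ep b"
    using B1_normal_neighbour[OF K B1_normal_swap(1)[OF B simplex(2)]] by blast
  have e: "ep C \<bullet> ep b = ep D \<bullet> ep b" using minface_inner_eq[OF b(2), of D] b(1) by (simp add: rays_def)
  have "b \<in> rays K C" using b by (simp add: rays_def)
  then show ?thesis using that[of b] e b(3) simplex(2) by (simp add: apex_form_def inner_diff_left)
next
  case (unbounded j)
  note pts = B1_normal_points[OF B]
  have "(\<forall>l. 0 < v $ l) = False" using unbounded(3) by auto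
  then have af: "apex_form v E D C = axis j 1" unfolding apex_form_def unbounded(2) by (simp only: if_False)
  have vC: "ep v \<in> dcone K C" using pts(2) by (simp add: minface_dcone)
  have g1: "ep C \<bullet> - axis i 1 \<le> ep \<omega> \<bullet> - axis i 1" if w: "\<omega> \<in> minface K (ep v)" for \<omega>
  proof -
    from unbounded(5)[OF w] obtain s where "ep \<omega> = ep E + s *\<^sub>R axis j 1 \<or> ep \<omega> = ep C + s *\<^sub>R axis j 1" by blast
    then have "ep \<omega> $ i = ep E $ i + s * axis j 1 $ i \<or> ep \<omega> $ i = ep C $ i + s * axis j 1 $ i"
      by (elim disjE) (simp_all only: vector_add_component vector_scaleR_component real_scaleR_def simp_thms)
    then have "ep \<omega> $ i \<le> 1" using pts(5,7) unbounded(1) by (auto simp: axis_def)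
    then show ?thesis using pts(7) by simp
  qed
  have g2: "0 \<le> (- axis i 1 :: real ^ 3) $ l" if "ep v $ l = 0" for l
  proof -
    have "l = j" using that unbounded(4) by (metis exponent_point_nth less_irrefl of_nat_eq_0_iff)
    then show ?thesis using unbounded(1) by (simp add: axis_def)
  qed
  obtain e where e: "0 < e" "\<And>t. 0 \<le> t \<Longrightarrow> t \<le> e \<Longrightarrow> ep v + t *\<^sub>R - axis i 1 \<in> dcone K C"
    using dcone_perturb[OF K vC g1 g2] by blast
  have x: "ep v + e *\<^sub>R - axis i 1 \<in> dcone K C" using e by simp
  have "(ep E - ep C) \<bullet> ep v = 0" using B1_normal_orth(2)[OF B] by (simp add: inner_diff_left)
  then have 1: "0 < (ep E - ep C) \<bullet> (ep v + e *\<^sub>R - axis i 1)" using pts e(1) by (simp add: inner_diff_left inner_diff_right)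
  have 2: "axis j 1 \<bullet> (ep v + e *\<^sub>R - axis i 1) = 0" using unbounded(1,3) by (simp only: inner_axis_1) (simp add: axis_def)
  have 3: "\<And>y. y \<in> dcone K C \<Longrightarrow> 0 \<le> axis j 1 \<bullet> y" using dconeD(2) by simp
  obtain b where b: "b \<in> rays K C" "0 < (ep E - ep C) \<bullet> ep b" "axis j 1 \<bullet> ep b = 0"
    by (rule dcone_extract[OF K x 1 3 2])
  then show ?thesis using that[of b] unfolding af by (simp add: inner_diff_left)
qed

text \<open>Of three rays of a pointed cone in one plane, one lies between the two others.\<close>

lemma plane_rays:
  fixes K :: "(nat ^ 3) set"
  assumes r: "u \<in> rays K C" "v \<in> rays K C" "x \<in> rays K C" and ne: "u \<noteq> v" "u \<noteq> x" "v \<noteq> x"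
    and w: "w \<bullet> ep u = 0" "w \<bullet> ep v = 0" "w \<bullet> ep x = 0"
  shows "w = 0"
proof (rule ccontr)
  let ?R = "rays K C"
  assume w0: "w \<noteq> 0"
  have ray: "ep y \<noteq> 0" if "y \<in> ?R" for y using that by (auto simp: rays_def prim_rays_def is_ray_def)
  have dc: "ep y \<in> dcone K C" if "y \<in> ?R" for y by (rule rays_dcone[OF that])
  \<comment> \<open>All three rays are orthogonal to \<open>w\<close>, so \<open>n\<close> is a
    multiple of \<open>w\<close> and orthogonal to \<open>x\<close>; the identity of Lagrange then
    expands \<open>x\<close> explicitly in \<open>u\<close> and \<open>v\<close>.\<close>
  define n where "n = cross3 (ep u) (ep v)"
  have "n \<noteq> 0"
  proof
    assume "n = 0"
    then have "collinear {0, ep u, ep v}" by (simp add: n_def cross_eq_0)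
    then obtain t where "ep v = t *\<^sub>R ep u" using ray[OF r(1)] unfolding collinear_lemma by force
    then show False using prim_parallel[of v u t] r ne by (auto simp: rays_def prim_rays_def)
  qed
  have "cross3 w n = 0" unfolding n_def Lagrange using w by (simp add: inner_commute)
  then have "collinear {0, w, n}" by (simp add: cross_eq_0)
  then obtain c where c: "n = c *\<^sub>R w" using w0 unfolding collinear_lemma by force
  have nx: "n \<bullet> ep x = 0" using w(3) by (simp add: c)
  have "cross3 n (cross3 (ep x) n) = (n \<bullet> n) *\<^sub>R ep x" unfolding Lagrange using nx by simp
  moreover have "cross3 n (cross3 (ep x) n) = (ep x \<bullet> ep v) *\<^sub>R cross3 n (ep u) - (ep x \<bullet> ep u) *\<^sub>R cross3 n (ep v)"
    unfolding n_def Lagrange[of "ep x"] by (simp add: cross3_simps vec_eq_iff forall_3)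
  moreover have "cross3 n y = - (cross3 y n)" for y by (rule cross_skew)
  then have "cross3 n (ep u) = - ((ep u \<bullet> ep v) *\<^sub>R ep u - (ep u \<bullet> ep u) *\<^sub>R ep v)"
    "cross3 n (ep v) = - ((ep v \<bullet> ep v) *\<^sub>R ep u - (ep v \<bullet> ep u) *\<^sub>R ep v)"
    unfolding n_def Lagrange[symmetric] by metis+
  ultimately have "(n \<bullet> n) *\<^sub>R ep x = ((ep x \<bullet> ep u) * (ep v \<bullet> ep v) - (ep x \<bullet> ep v) * (ep u \<bullet> ep v)) *\<^sub>R ep u
      + ((ep x \<bullet> ep v) * (ep u \<bullet> ep u) - (ep x \<bullet> ep u) * (ep v \<bullet> ep u)) *\<^sub>R ep v"
    by (simp add: algebra_simps)
  then have "\<exists>A B. (n \<bullet> n) *\<^sub>R ep x = A *\<^sub>R ep u + B *\<^sub>R ep v" by blast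
  then obtain A B where AB: "(n \<bullet> n) *\<^sub>R ep x = A *\<^sub>R ep u + B *\<^sub>R ep v" by blast
  define a b where "a = A / (n \<bullet> n)" and "b = B / (n \<bullet> n)"
  have "ep x = (1 / (n \<bullet> n)) *\<^sub>R (A *\<^sub>R ep u + B *\<^sub>R ep v)" unfolding AB[symmetric] using \<open>n \<noteq> 0\<close> by simp
  then have x: "ep x = a *\<^sub>R ep u + b *\<^sub>R ep v" by (simp add: a_def b_def scaleR_add_right)
  have key: False if y: "y1 \<in> ?R" "y2 \<in> ?R" "y3 \<in> ?R" "y1 \<noteq> y2" "0 < s" "0 \<le> t" "ep y1 = s *\<^sub>R ep y2 + t *\<^sub>R ep y3" for y1 y2 y3 s t
    using ray_extreme_eq[OF y(1,2) dcone_scale[OF dc[OF y(3)] y(6)] y(5,7)] y(4) by simp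
  \<comment> \<open>A summand with negative coefficient is brought to the other side. This writes a
    ray as a nonnegative combination of the two others and reduces to the case
    \<open>key\<close>.\<close>
  have neg: False if y: "y1 \<in> ?R" "y2 \<in> ?R" "y3 \<in> ?R" "y1 \<noteq> y3" "s < 0" "ep y1 = s *\<^sub>R ep y2 + t *\<^sub>R ep y3" for y1 y2 y3 s t
  proof -
    have e: "t *\<^sub>R ep y3 = ep y1 + (- s) *\<^sub>R ep y2" unfolding y(6) by simp
    obtain l where l: "y1 $ l \<noteq> 0" using ray[OF y(1)] by (auto simp: vec_eq_iff)
    have "t * real (y3 $ l) = real (y1 $ l) + (- s) * real (y2 $ l)" using arg_cong[OF e, of "\<lambda>z. z $ l"] by simp
    moreover have "0 \<le> (- s) * real (y2 $ l)" using y(5) by (intro mult_nonneg_nonneg) auto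
    ultimately have "0 < t * real (y3 $ l)" using l by linarith
    then have t: "0 < t" by (metis of_nat_0_le_iff not_less zero_less_mult_iff)
    have "ep y3 = (1 / t) *\<^sub>R (t *\<^sub>R ep y3)" using t by simp
    also have "\<dots> = (1 / t) *\<^sub>R ep y1 + (- s / t) *\<^sub>R ep y2" unfolding e by (simp add: scaleR_add_right scaleR_diff_right)
    finally show False by (intro key[of y3 y1 y2 "1 / t" "- s / t"]) (use y t in \<open>auto intro: divide_nonpos_pos\<close>)
  qed
  consider "a < 0" | "b < 0" | "0 \<le> a" "0 \<le> b" by linarith
  then show False
  proof cases
    case 1
    then show False using neg[OF r(3,1,2) _ 1 x] ne by simp
  next
    case 2
    have "ep x = b *\<^sub>R ep v + a *\<^sub>R ep u" using x by simp
    then show False using neg[OF r(3,2,1) _ 2] ne by blast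
  next
    case 3
    then have "0 < a \<or> 0 < b" using x ray[OF r(3)] by force
    then show False
    proof
      assume "0 < a"
      then show False using key[OF r(3,1,2) _ _ 3(2) x] ne by simp
    next
      assume "0 < b"
      have "ep x = b *\<^sub>R ep v + a *\<^sub>R ep u" using x by simp
      then show False using key[OF r(3,2,1) _ \<open>0 < b\<close> 3(1)] ne by blast
    qed
  qed
qed

text \<open>Taking moduli, \<open>zeta_weight p C y s0 = 1\<close> becomes a linear equation in
  \<open>y\<close> with coefficients \<open>1 + C_l Re s0\<close>. The \<open>i\<close>-th
  coefficient is \<open>1 + Re s0\<close>, so the equation defines a plane, and a plane contains at
  most two rays of a pointed cone.\<close>

lemma bad_rays_le_2:
  fixes K :: "(nat ^ 3) set"
  assumes p: "2 \<le> p" and C: "C $ i = 1" and s0: "Re s0 \<noteq> -1"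
    and r: "u \<in> rays K C" "v \<in> rays K C" "x \<in> rays K C" and ne: "u \<noteq> v" "u \<noteq> x" "v \<noteq> x"
    and z: "zeta_weight p C u s0 = 1" "zeta_weight p C v s0 = 1" "zeta_weight p C x s0 = 1"
  shows False
proof -
  define w where "w = (\<chi> l. 1 + real (C $ l) * Re s0)"
  have "w \<bullet> ep y = 0" if "zeta_weight p C y s0 = 1" for y
  proof -
    have "norm (zeta_weight p C y s0) = 1" using that by simp
    then have "exp (Re (- complex_of_real (ln (real p)) * (of_nat (\<Sum>l\<in>UNIV. y $ l) + of_nat (dotn C y) * s0))) = 1"
      unfolding zeta_weight_def norm_exp_eq_Re by simp
    then have "ln (real p) * (real (\<Sum>l\<in>UNIV. y $ l) + real (dotn C y) * Re s0) = 0" by simp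
    then have "real (\<Sum>l\<in>UNIV. y $ l) + real (dotn C y) * Re s0 = 0" using p by simp
    moreover have "w \<bullet> ep y = real (\<Sum>l\<in>UNIV. y $ l) + real (dotn C y) * Re s0"
      by (simp add: w_def inner_vec_def sum_3 algebra_simps)
    ultimately show ?thesis by simp
  qed
  then have "w = 0" using plane_rays[OF r ne] z by blast
  then have "w $ i = 0" by simp
  then show False using C s0 by (simp add: w_def)
qed

text \<open>Brings adjacent facets for the same variable into the position assumed for a pair: the
  same apex and a common vertex at height 0.\<close>

lemma share_pair:
  assumes Bv: "B1_normal K i v E D C" and Bw: "B1_normal K i w E' D' C'" and v: "v \<in> prim_rays K" "v \<noteq> axis i 1"
    and w: "w \<in> prim_rays K" "w \<noteq> axis i 1" "w \<noteq> v" and sh: "share K v w"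
  obtains B D1 D2 where "B1_normal K i v B D1 C" "B1_normal K i w B D2 C"
proof -
  \<comment> \<open>Suppose both facets recede in direction \<open>j\<close>. Their vertices at
    height 0 are then compared by the one remaining coordinate, and minimality for \<open>v\<close>
    and for \<open>w\<close> makes these coordinates equal. So \<open>w\<close> annihilates both
    edge vectors of \<open>v\<close> and is parallel to it.\<close>
  have noz: "\<not> (v $ j = 0 \<and> w $ j = 0)" for j
  proof
    assume z: "v $ j = 0 \<and> w $ j = 0"
    note pv = B1_normal_points[OF Bv] and pw = B1_normal_points[OF Bw]
    have Cw: "C \<in> minface K (ep w)" by (rule share_apex[OF Bv v(1) w(1,3,2) sh])
    show False using Bv
    proof (cases rule: B1_normal_cases)
      case simplex
      then show False using z by (metis less_irrefl)
    next
      case (unbounded j')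
      have j: "j' = j" using unbounded(4)[of j] z by auto
      have ji: "j \<noteq> i" using unbounded(1) j by simp
      obtain l where l: "l \<noteq> i" "l \<noteq> j" "\<And>h. h = i \<or> h = j \<or> h = l"
      proof -
        have "\<exists>l. l \<noteq> i \<and> l \<noteq> j \<and> (\<forall>h. h = i \<or> h = j \<or> h = l)"
        proof -
          have "(1::3) \<noteq> 2" "(1::3) \<noteq> 3" "(2::3) \<noteq> 3" by simp_all
          then show ?thesis using ji exhaust_3 by metis
        qed
        then show ?thesis using that by blast
      qed
      have ev: "ep A \<bullet> ep u = real (A $ l) * real (u $ l)" if "A $ i = 0" "u $ j = 0" for A u :: "nat ^ 3"
      proof -
        have "ep A \<bullet> ep u = (\<Sum>h\<in>{l}. real (A $ h) * real (u $ h))"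
          unfolding inner_vec_def
        proof (rule sum.mono_neutral_cong_right)
          show "\<forall>h\<in>UNIV - {l}. ep A $ h \<bullet> ep u $ h = 0"
          proof
            fix h assume "h \<in> UNIV - {l}"
            then have "h = i \<or> h = j" using l(3)[of h] by blast
            then show "ep A $ h \<bullet> ep u $ h = 0" using that by auto
          qed
        qed auto
        then show ?thesis by simp
      qed
      have lp: "0 < v $ l" using unbounded(4) l(2) j by simp
      have lw: "0 < w $ l"
      proof (rule ccontr)
        assume "\<not> 0 < w $ l"
        then have "ep w = real (w $ i) *\<^sub>R ep (axis i 1)" using z l(3) by (auto simp: vec_eq_iff axis_def)
        then show False using prim_parallel[of w "axis i 1"] Gcd_axis[of i] w by (auto simp: prim_rays_def)
      qed
      have "ep E \<bullet> ep v \<le> ep E' \<bullet> ep v" "ep E' \<bullet> ep w \<le> ep E \<bullet> ep w" using pv pw by (auto simp: minface_def)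
      then have "real (E $ l) * real (v $ l) \<le> real (E' $ l) * real (v $ l)" "real (E' $ l) * real (w $ l) \<le> real (E $ l) * real (w $ l)"
        using ev z pv pw by simp_all
      then have "E $ l = E' $ l" using lp lw by simp
      then have "ep E \<bullet> ep w = ep E' \<bullet> ep w" using ev z pv pw by simp
      then have "(ep C - ep E) \<bullet> ep w = 0" using minface_inner_eq[OF Cw pw(1)] by (simp add: inner_diff_left)
      moreover have "(ep D - ep E) \<bullet> ep w = 0" unfolding unbounded(2) j using z by simp
      ultimately obtain t where "ep w = t *\<^sub>R ep v" using B1_normal_kernel[OF Bv v(1)] by blast
      then show False using prim_parallel[of w v t] v w by (auto simp: prim_rays_def)
    qed
  qed
  \<comment> \<open>Each apex is minimal on both facets, and apart from translates in a direction of
    recession a facet has only one point at height 1.\<close>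
  have lower: "C2 = C1" if lo: "B1_normal K i u1 E1 D1 C1" "B1_normal K i u2 E2 D2 C2" "C2 \<in> minface K (ep u1)" "C1 \<in> minface K (ep u2)"
      "\<And>j. \<not> (u1 $ j = 0 \<and> u2 $ j = 0)" for u1 u2 E1 E2 D1 D2 C1 C2
    using lo(1)
  proof (cases rule: B1_normal_cases)
    case simplex
    from simplex(3)[OF lo(3)] show ?thesis
    proof
      assume "\<exists>s. 0 \<le> s \<and> s \<le> 1 \<and> ep C2 = ep E1 + s *\<^sub>R (ep D1 - ep E1)"
      then obtain s where "ep C2 = ep E1 + s *\<^sub>R (ep D1 - ep E1)" by blast
      then have "ep C2 $ i = 0" using B1_normal_points(5,6)[OF lo(1)] by simp
      then show ?thesis using B1_normal_points(7)[OF lo(2)] by simp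
    qed
  next
    case (unbounded j)
    obtain s where s: "s \<ge> 0" "ep C2 = ep E1 + s *\<^sub>R axis j 1 \<or> ep C2 = ep C1 + s *\<^sub>R axis j 1" using unbounded(5)[OF lo(3)] by blast
    have "ep C2 \<noteq> ep E1 + s *\<^sub>R axis j 1"
    proof
      assume "ep C2 = ep E1 + s *\<^sub>R axis j 1"
      then have "ep C2 $ i = 0" using B1_normal_points(5)[OF lo(1)] unbounded(1) by (simp add: axis_def)
      then show False using B1_normal_points(7)[OF lo(2)] by simp
    qed
    then have e: "ep C2 = ep C1 + s *\<^sub>R axis j 1" using s by blast
    have "\<not> s > 0" using minface_along(2)[OF B1_normal_points(2)[OF lo(2)] B1_normal_points(4)[OF lo(1)] s(1) e] lo(5) unbounded(3) by blast
    then show ?thesis using s e by (simp add: exponent_point_inject)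
  qed
  have CC: "C' = C"
  proof (rule lower[OF Bv Bw _ _ noz])
    show "C \<in> minface K (ep w)" by (rule share_apex[OF Bv v(1) w(1,3,2) sh])
    show "C' \<in> minface K (ep v)" by (rule share_apex[OF Bw w(1) v(1) _ v(2)]) (use w sh share_commute in auto)
  qed
  obtain A where A: "A \<noteq> C" "A \<in> minface K (ep v)" "A \<in> minface K (ep w)"
  proof -
    obtain A B where "A \<noteq> B" "{A, B} \<subseteq> minface K (ep v) \<inter> minface K (ep w)"
      using sh noz unfolding share_def by metis
    then show ?thesis using that[of A] that[of B] by (cases "A = C") auto
  qed
  \<comment> \<open>A common point other than the apex is an end of the edge at height 0: an inner
    point would put the whole edge into the second facet, contrary to
    \<open>B1_normal_bottom\<close>.\<close>
  have base: "\<exists>D2. B1_normal K i u1 A D2 C" if B: "B1_normal K i u1 E1 D1 C" and u: "u1 \<in> prim_rays K" "u2 \<in> prim_rays K" "u2 \<noteq> u1" "u2 \<noteq> axis i 1"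
     "\<And>j. \<not> (u1 $ j = 0 \<and> u2 $ j = 0)" and A1: "A \<in> minface K (ep u1)" and A2: "A \<in> minface K (ep u2)" for u1 u2 E1 D1
    using B
  proof (cases rule: B1_normal_cases)
    case simplex
    obtain s where s: "0 \<le> s" "s \<le> 1" "ep A = ep E1 + s *\<^sub>R (ep D1 - ep E1)" using simplex(3)[OF A1] A(1) by blast
    consider "s = 0" | "s = 1" | "0 < s" "s < 1" using s by linarith
    then show ?thesis
    proof cases
      case 1
      then have "A = E1" using s(3) by (simp add: exponent_point_inject)
      then show ?thesis using B by blast
    next
      case 2
      then have "A = D1" using s(3) by (simp add: exponent_point_inject)
      then show ?thesis using B1_normal_swap(1)[OF B simplex(2)] by blast
    next
      case 3
      have "D1 \<in> K" using simplex(1) by (simp add: minface_def)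
      then have "ep A \<bullet> ep u2 \<le> ep E1 \<bullet> ep u2" "ep A \<bullet> ep u2 \<le> ep D1 \<bullet> ep u2" using A2 B1_normal_points(3)[OF B] by (simp_all add: minface_def)
      moreover have e: "ep A \<bullet> ep u2 = ep E1 \<bullet> ep u2 + s * ((ep D1 - ep E1) \<bullet> ep u2)" unfolding s(3) by (simp only: inner_add_left inner_scaleR_left)
      ultimately have "s * ((ep D1 - ep E1) \<bullet> ep u2) \<le> 0" "0 \<le> (1 - s) * ((ep D1 - ep E1) \<bullet> ep u2)"
        by (simp_all add: algebra_simps inner_diff_left)
      then have o: "(ep D1 - ep E1) \<bullet> ep u2 = 0" using 3 by (simp add: mult_le_0_iff zero_le_mult_iff)
      then have "E1 \<in> minface K (ep u2)" using e B1_normal_points(3)[OF B] unfolding minface_eq[OF A2] by simp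
      then show ?thesis using B1_normal_bottom[OF B u(1,2,3,4) _ o] by blast
    qed
  next
    case (unbounded j)
    obtain s where s: "s \<ge> 0" "ep A = ep E1 + s *\<^sub>R axis j 1 \<or> ep A = ep C + s *\<^sub>R axis j 1" using unbounded(5)[OF A1] by blast
    have "\<not> s > 0" using minface_along(2)[OF A2 B1_normal_points(3)[OF B] s(1)] minface_along(2)[OF A2 B1_normal_points(4)[OF B] s(1)] s(2) u(5) unbounded(3) by blast
    then have "A = E1" using s A(1) by (simp add: exponent_point_inject)
    then show ?thesis using B by blast
  qed
  obtain D1 where "B1_normal K i v A D1 C" using base[OF Bv v(1) w(1,3,2) noz A(2,3)] by blast
  moreover obtain D2 where "B1_normal K i w A D2 C" using base[OF Bw[unfolded CC] w(1) v(1) _ v(2) _ A(3,2)] w(3) noz by blast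
  ultimately show ?thesis using that by blast
qed

lemma inner_ep: "ep A \<bullet> ep k = real (dotn A k)"
  by (simp add: inner_vec_def)

lemma axis_prim_ray:
  fixes K :: "(nat ^ 'n::finite) set"
  shows "axis i 1 \<in> prim_rays K"
proof -
  have "\<exists>c. d = c *\<^sub>R axis i 1" if "\<forall>l. axis i 1 $ l = (0::real) \<longrightarrow> d $ l = 0" for d :: "real ^ 'n"
    using that by (intro exI[of _ "d $ i"]) (simp add: vec_eq_iff axis_def)
  then have "is_ray K (axis i 1)" unfolding is_ray_def by (auto simp: axis_eq_0_iff) (simp add: axis_def)
  then show ?thesis using Gcd_axis[of i] by (simp add: prim_rays_def)
qed

lemma axis_ray: "P \<in> K \<Longrightarrow> P $ i = 0 \<Longrightarrow> axis i 1 \<in> rays K P"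
  using axis_prim_ray[of i K] axis_dcone[of P K i] by (simp add: rays_def dcone_def)

section \<open>Clusters of contributing normals\<close>

text \<open>The positive coefficient \<open>t\<close> on a member of \<open>X\<close> removes the
  outer walls of the region, which then belong to the neighbouring cones.\<close>

definition cluster_points :: "(nat ^ 3) set \<Rightarrow> (nat ^ 3) set \<Rightarrow> (nat ^ 3) set" where
  "cluster_points X M = {k. (\<forall>l. 1 \<le> k $ l) \<and> (\<exists>v\<in>X. \<exists>t>0. ep k - t *\<^sub>R ep v \<in> ncone (X \<union> M))}"

text \<open>The zero set of \<open>N\<close> cuts the dual cone of \<open>P\<close> into a cone spanned by the normals in \<open>X\<close> and by rays from
  \<open>M\<close> in the cut, and a part that contains all other rays.\<close>

definition ear :: "(nat ^ 3) set \<Rightarrow> nat ^ 3 \<Rightarrow> (nat ^ 3) set \<Rightarrow> (nat ^ 3) set \<Rightarrow> real ^ 3 \<Rightarrow> bool" where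
  "ear K P X M N \<longleftrightarrow> (\<forall>v\<in>X. 0 < N \<bullet> ep v) \<and> (\<forall>n\<in>M. 0 \<le> N \<bullet> ep n) \<and>
     (\<exists>M'\<subseteq>M. M' \<subseteq> rays K P \<and> (\<forall>n\<in>M'. N \<bullet> ep n = 0) \<and>
        (\<forall>x\<in>dcone K P. 0 \<le> N \<bullet> x \<longrightarrow> x \<in> ncone ((X \<inter> rays K P) \<union> M')))"

lemma ear_cluster_points:
  assumes e: "ear K P X M N" and k: "k \<in> cluster_points X M" and f: "finite X" "finite M"
  shows "0 < N \<bullet> ep k"
proof -
  obtain v t where v: "v \<in> X" "0 < t" "ep k - t *\<^sub>R ep v \<in> ncone (X \<union> M)" using k by (auto simp: cluster_points_def)
  have "(- N) \<bullet> (ep k - t *\<^sub>R ep v) \<le> 0"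
    by (rule ncone_nonpos[OF v(3), of "(\<bullet>) (- N)"])
      (use e f in \<open>auto simp: ear_def bounded_linear_inner_right bounded_linear.linear less_imp_le\<close>)
  then have "t * (N \<bullet> ep v) \<le> N \<bullet> ep k" by (simp add: inner_diff_right)
  moreover have "0 < t * (N \<bullet> ep v)" using e v by (simp add: ear_def)
  ultimately show ?thesis by linarith
qed

text \<open>A ray with positive \<open>N\<close> would lie in the ear and, being extreme, would be
  one of its generators; but generators outside \<open>X\<close> have \<open>N = 0\<close>.\<close>

lemma ear_nonpos:
  assumes e: "ear K P X M N" and r: "r \<in> rays K P" "r \<notin> X" and f: "finite X" "finite M"
  shows "N \<bullet> ep r \<le> 0"
proof (rule ccontr)
  assume pos: "\<not> N \<bullet> ep r \<le> 0"
  obtain M' where M': "M' \<subseteq> M" "M' \<subseteq> rays K P" "\<forall>n\<in>M'. N \<bullet> ep n = 0"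
    "\<forall>x\<in>dcone K P. 0 \<le> N \<bullet> x \<longrightarrow> x \<in> ncone ((X \<inter> rays K P) \<union> M')" using e unfolding ear_def by blast
  have "ep r \<in> ncone ((X \<inter> rays K P) \<union> M')" using M'(4) rays_dcone[OF r(1)] pos by simp
  then have "r \<in> (X \<inter> rays K P) \<union> M'"
    by (rule ray_ncone_eq[OF r(1)]) (use f M' finite_subset[OF M'(1) f(2)] in auto)
  then show False using r(2) M'(3) pos by auto
qed

text \<open>The coefficient of \<open>e_i\<close> is at least 1 and can be lowered by one. The
  additional share of \<open>v\<close>, whose \<open>i\<close>-th coordinate is positive, forces
  \<open>k $ i > 1\<close>, so the coordinates stay positive.\<close>

lemma cluster_points_decrease:
  assumes k: "\<forall>l. 1 \<le> k $ l" and v: "v \<in> X" "0 < v $ i" and s: "0 < s" and \<alpha>: "1 \<le> \<alpha>"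
    and e: "ep k = s *\<^sub>R ep v + \<alpha> *\<^sub>R axis i 1 + y" and y: "y \<in> ncone (X \<union> M)" "\<And>l. 0 \<le> y $ l"
    and f: "finite X" "finite M" "axis i 1 \<in> M"
  shows "\<exists>k'\<in>cluster_points X M. k = k' + axis i 1"
proof
  define k' where "k' = (\<chi> l. k $ l - axis i 1 $ l)"
  have ki: "1 \<le> k' $ i"
  proof -
    have "real (k $ i) = s * real (v $ i) + \<alpha> + y $ i" using arg_cong[OF e, of "\<lambda>z. z $ i"] by simp
    moreover have "0 < s * real (v $ i)" using s v by simp
    ultimately have "1 < k $ i" using \<alpha> y(2)[of i] by linarith
    then show ?thesis by (simp add: k'_def)
  qed
  show kk: "k = k' + axis i 1" using k by (simp add: k'_def vec_eq_iff axis_def)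
  have "ep k = ep k' + axis i 1" using kk by (simp add: exponent_point_add)
  then have "ep k' - s *\<^sub>R ep v = (\<alpha> - 1) *\<^sub>R ep (axis i 1) + y" using e by (simp add: algebra_simps)
  also have "\<dots> \<in> ncone (X \<union> M)"
    by (rule ncone_add[OF ncone_scale[OF ncone_mem] y(1)]) (use f \<alpha> in auto)
  finally have "ep k' - s *\<^sub>R ep v \<in> ncone (X \<union> M)" .
  moreover have "\<forall>l. 1 \<le> k' $ l"
  proof
    fix l show "1 \<le> k' $ l" using ki k by (cases "l = i") (auto simp: k'_def axis_def)
  qed
  ultimately show "k' \<in> cluster_points X M" using v(1) s unfolding cluster_points_def by blast
qed

text \<open>A nonzero vector of the orthant is no combination of such vectors with nonpositive
  coefficients. All signs of the ear forms at neighbouring normals are obtained in this way.\<close>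

lemma coeff_pos:
  fixes x y :: "real ^ 'n::finite"
  assumes e: "x = r *\<^sub>R y + a *\<^sub>R m + b *\<^sub>R n" and ab: "a \<le> 0" "b \<le> 0"
    and nn: "\<And>l. 0 \<le> x $ l" "\<And>l. 0 \<le> y $ l" "\<And>l. 0 \<le> m $ l" "\<And>l. 0 \<le> n $ l" and x: "x \<noteq> 0"
  shows "0 < r"
proof (rule ccontr)
  assume "\<not> 0 < r"
  then have l0: "r \<le> 0" by simp
  have "x $ l = 0" for l
  proof -
    have "x $ l = r * y $ l + a * m $ l + b * n $ l" using arg_cong[OF e, of "\<lambda>z. z $ l"] by simp
    moreover have "r * y $ l \<le> 0" "a * m $ l \<le> 0" "b * n $ l \<le> 0" using l0 ab nn by (simp_all add: mult_nonpos_nonneg)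
    ultimately show ?thesis using nn(1)[of l] by linarith
  qed
  then show False using x by (simp add: vec_eq_iff)
qed

text \<open>The suitably scaled forms \<open>N\<close>, \<open>c\<close>, \<open>d\<close> are the
  dual coordinates of \<open>v\<close>, \<open>m\<close>, \<open>n\<close>. The first is built from
  the form \<open>v\<close> by cancelling its values at \<open>m\<close> and \<open>n\<close> with
  \<open>c\<close> and \<open>d\<close>.\<close>

lemma tri_coordinates:
  fixes v m n c d :: "real ^ 'n::finite"
  assumes c: "c \<bullet> v = 0" "0 < c \<bullet> m" "c \<bullet> n = 0" and d: "d \<bullet> v = 0" "d \<bullet> m = 0" "0 < d \<bullet> n"
    and ker: "\<And>x. c \<bullet> x = 0 \<Longrightarrow> d \<bullet> x = 0 \<Longrightarrow> \<exists>t. x = t *\<^sub>R v" and v0: "v \<noteq> 0"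
  obtains N where "N \<bullet> v = 1" "N \<bullet> m = 0" "N \<bullet> n = 0"
    "\<And>x. x = (N \<bullet> x) *\<^sub>R v + (c \<bullet> x / (c \<bullet> m)) *\<^sub>R m + (d \<bullet> x / (d \<bullet> n)) *\<^sub>R n"
proof -
  define N where "N = (1 / (v \<bullet> v)) *\<^sub>R (v - (m \<bullet> v / (c \<bullet> m)) *\<^sub>R c - (n \<bullet> v / (d \<bullet> n)) *\<^sub>R d)"
  have vv: "v \<bullet> v \<noteq> 0" using v0 by simp
  have dec: "x = (N \<bullet> x) *\<^sub>R v + (c \<bullet> x / (c \<bullet> m)) *\<^sub>R m + (d \<bullet> x / (d \<bullet> n)) *\<^sub>R n" for x
  proof -
    define y where "y = x - (c \<bullet> x / (c \<bullet> m)) *\<^sub>R m - (d \<bullet> x / (d \<bullet> n)) *\<^sub>R n"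
    have "c \<bullet> y = 0" "d \<bullet> y = 0" using c d by (simp_all add: y_def inner_diff_right)
    then obtain t where t: "y = t *\<^sub>R v" using ker by blast
    have "t * (v \<bullet> v) = v \<bullet> x - (c \<bullet> x / (c \<bullet> m)) * (v \<bullet> m) - (d \<bullet> x / (d \<bullet> n)) * (v \<bullet> n)"
      using arg_cong[OF t, of "\<lambda>z. v \<bullet> z"] by (simp add: y_def inner_diff_right)
    also have "\<dots> = (v \<bullet> v) * (N \<bullet> x)"
    proof -
      have "(v \<bullet> v) * (N \<bullet> x) = v \<bullet> x - (m \<bullet> v / (c \<bullet> m)) * (c \<bullet> x) - (n \<bullet> v / (d \<bullet> n)) * (d \<bullet> x)"
        using vv by (simp add: N_def inner_diff_left)
      then show ?thesis by (simp add: inner_commute[of v m] inner_commute[of v n] mult.commute)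
    qed
    finally have "t = N \<bullet> x" using vv by simp
    then show ?thesis using t by (simp add: y_def algebra_simps)
  qed
  have "N \<bullet> v = 1" "N \<bullet> m = 0" "N \<bullet> n = 0"
    using vv c d by (simp_all add: N_def inner_diff_left inner_commute[of m v] inner_commute[of n v])
  then show ?thesis using that dec by blast
qed

text \<open>The coefficient of \<open>e_i\<close> is the form \<open>ep C - ep E\<close> itself,
  without a denominator. At lattice points it is therefore an integer, and a positive one permits a
  step down by \<open>e_i\<close>.\<close>

lemma B1_normal_base_ear:
  assumes B: "B1_normal K i v E D C" and v: "v \<in> prim_rays K"
    and a: "a \<in> rays K E" "C \<in> minface K (ep a)" "0 < (ep D - ep E) \<bullet> ep a"
  obtains N where "N \<bullet> ep v = 1" "N \<bullet> axis i 1 = 0" "N \<bullet> ep a = 0"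
    "\<And>x. x = (N \<bullet> x) *\<^sub>R ep v + ((ep C - ep E) \<bullet> x) *\<^sub>R axis i 1 + ((ep D - ep E) \<bullet> x / ((ep D - ep E) \<bullet> ep a)) *\<^sub>R ep a"
proof -
  let ?u = "ep C - ep E" and ?h = "ep D - ep E"
  note pts = B1_normal_points[OF B]
  have ca: "?u \<bullet> ep a = 0"
    using minface_inner_eq[OF a(2), of E] a(1) by (simp add: rays_def inner_diff_left)
  have c1: "?u \<bullet> axis i 1 = 1" and d1: "?h \<bullet> axis i 1 = 0" using pts by simp_all
  have v0: "ep v \<noteq> 0" using v by (auto simp: prim_rays_def is_ray_def)
  have ker: "\<exists>t. x = t *\<^sub>R ep v" if "?u \<bullet> x = 0" "?h \<bullet> x = 0" for x
    using B1_normal_kernel[OF B v that(2,1)] by blast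
  obtain N where N: "N \<bullet> ep v = 1" "N \<bullet> axis i 1 = 0" "N \<bullet> ep a = 0"
    "\<And>x. x = (N \<bullet> x) *\<^sub>R ep v + (?u \<bullet> x / (?u \<bullet> axis i 1)) *\<^sub>R axis i 1
      + (?h \<bullet> x / (?h \<bullet> ep a)) *\<^sub>R ep a"
    using tri_coordinates[OF B1_normal_orth(2)[OF B] _ ca B1_normal_orth(1)[OF B] d1 a(3) ker v0] c1 by auto
  show ?thesis by (rule that[OF N(1-3)]) (rule N(4)[unfolded c1 div_by_1])
qed

lemma B1_normal_apex_ear:
  assumes B: "B1_normal K i v E D C" and v: "v \<in> prim_rays K"
    and a: "a \<in> rays K E" "C \<in> minface K (ep a)" "0 < (ep D - ep E) \<bullet> ep a"
    and b: "b \<in> rays K C" "(ep C - ep E) \<bullet> ep b < 0" "apex_form v E D C \<bullet> ep b = 0"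
  obtains N where "N \<bullet> ep v = 1" "N \<bullet> ep a = 0" "N \<bullet> ep b = 0" "0 < apex_form v E D C \<bullet> ep a"
    "\<And>x. x = (N \<bullet> x) *\<^sub>R ep v + (apex_form v E D C \<bullet> x / (apex_form v E D C \<bullet> ep a)) *\<^sub>R ep a
      + ((ep E - ep C) \<bullet> x / ((ep E - ep C) \<bullet> ep b)) *\<^sub>R ep b"
proof -
  let ?ap = "apex_form v E D C" and ?d = "ep E - ep C"
  have ca: "?d \<bullet> ep a = 0"
    using minface_inner_eq[OF a(2), of E] a(1) by (simp add: rays_def inner_diff_left)
  \<comment> \<open>This form of \<open>apex_form\<close> treats bounded and unbounded facets at
    once: modulo \<open>ep E - ep C\<close> it is the edge vector at height 0.\<close>
  have af: "?ap = (ep D - ep E) + (if \<forall>l. 0 < v $ l then 1 else 0) *\<^sub>R ?d"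
    unfolding apex_form_def by (cases "\<forall>l. 0 < v $ l") (simp_all only: if_True if_False, simp_all)
  have v0: "ep v \<noteq> 0" using v by (auto simp: prim_rays_def is_ray_def)
  have o: "?d \<bullet> ep v = 0" using B1_normal_orth(2)[OF B] by (simp add: inner_diff_left)
  have av: "?ap \<bullet> ep v = 0" unfolding af inner_add_left inner_scaleR_left o B1_normal_orth(1)[OF B] by simp
  have aa: "0 < ?ap \<bullet> ep a" unfolding af inner_add_left inner_scaleR_left ca using a(3) by simp
  have bb: "0 < ?d \<bullet> ep b" using b(2) by (simp add: inner_diff_left)
  have ker: "\<exists>t. x = t *\<^sub>R ep v" if x: "?ap \<bullet> x = 0" "?d \<bullet> x = 0" for x
  proof -
    have "(ep D - ep E) \<bullet> x = 0" using x(1) unfolding af inner_add_left inner_scaleR_left x(2) by simp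
    moreover have "(ep C - ep E) \<bullet> x = 0" using x(2) by (simp add: inner_diff_left)
    ultimately show ?thesis using B1_normal_kernel[OF B v] by blast
  qed
  show ?thesis
  proof (rule tri_coordinates[OF av aa b(3) o ca bb ker v0])
    fix N assume N: "N \<bullet> ep v = 1" "N \<bullet> ep a = 0" "N \<bullet> ep b = 0"
      "\<And>x. x = (N \<bullet> x) *\<^sub>R ep v + (?ap \<bullet> x / (?ap \<bullet> ep a)) *\<^sub>R ep a
      + (?d \<bullet> x / (?d \<bullet> ep b)) *\<^sub>R ep b"
    show thesis by (rule that[OF N(1-3) aa N(4)])
  qed
qed

text \<open>Positive coordinates of \<open>k\<close> exclude exponents beyond a vertex in the
  direction of recession, and extremality excludes those inside the edge at height 0.\<close>

lemma B1_normal_vertex: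
  assumes B: "B1_normal K i v E D C" and P: "P \<in> minface K (ep v)" "P \<in> minface K (ep k)" "extremal K P" and k: "\<forall>l. 0 < k $ l"
  shows "P = E \<or> P = C \<or> (P = D \<and> (\<forall>l. 0 < v $ l))"
  using B
proof (cases rule: B1_normal_cases)
  case simplex
  show ?thesis
  proof (cases "P = C")
    case False
    obtain s where s: "0 \<le> s" "s \<le> 1" "ep P = ep E + s *\<^sub>R (ep D - ep E)" using simplex(3)[OF P(1)] False by blast
    have "D \<in> K" using simplex(1) by (simp add: minface_def)
    then have "\<not> (0 < s \<and> s < 1)" using P(3) s(3) B1_normal_points(3,8)[OF B] unfolding extremal_def by blast
    then consider "s = 0" | "s = 1" using s by linarith
    then show ?thesis using s(3) simplex(2) by cases (simp_all add: exponent_point_inject)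
  qed simp
next
  case (unbounded j)
  obtain s where s: "s \<ge> 0" "ep P = ep E + s *\<^sub>R axis j 1 \<or> ep P = ep C + s *\<^sub>R axis j 1" using unbounded(5)[OF P(1)] by blast
  have "\<not> s > 0" using minface_along(2)[OF P(2) B1_normal_points(3)[OF B] s(1)] minface_along(2)[OF P(2) B1_normal_points(4)[OF B] s(1)] s(2) k
    by (metis less_irrefl)
  then show ?thesis using s by (auto simp: exponent_point_inject)
qed

lemma B1_normal_above:
  assumes B: "B1_normal K i v E D C" and w: "\<omega> \<in> minface K (ep v)" "1 \<le> \<omega> $ i"
  shows "\<exists>j s. 0 \<le> s \<and> ep \<omega> = ep C + s *\<^sub>R axis j 1"
  using B
proof (cases rule: B1_normal_cases)
  case simplex
  show ?thesis
  proof (cases "\<omega> = C")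
    case True
    then show ?thesis by (intro exI[of _ i] exI[of _ 0]) simp
  next
    case False
    then obtain s where "ep \<omega> = ep E + s *\<^sub>R (ep D - ep E)" using simplex(3)[OF w(1)] by blast
    then have "ep \<omega> $ i = 0" using B1_normal_points(5,6)[OF B] by simp
    then show ?thesis using w(2) by simp
  qed
next
  case (unbounded j)
  obtain s where s: "s \<ge> 0" "ep \<omega> = ep E + s *\<^sub>R axis j 1 \<or> ep \<omega> = ep C + s *\<^sub>R axis j 1" using unbounded(5)[OF w(1)] by blast
  have "ep \<omega> \<noteq> ep E + s *\<^sub>R axis j 1"
  proof
    assume "ep \<omega> = ep E + s *\<^sub>R axis j 1"
    then have "ep \<omega> $ i = 0" using B1_normal_points(5)[OF B] unbounded(1) by (simp add: axis_def)
    then show False using w(2) by simp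
  qed
  then show ?thesis using s by blast
qed

text \<open>The points of \<open>cone (X \<union> M)\<close> having a positive coefficient on \<open>X\<close> are covered by ears at the vertices in
  \<open>V\<close>.  By the last clause they form full half lines in direction \<open>e_i\<close>, each starting at a point at which
  \<open>C\<close> is minimal; there \<open>f\<close> may be replaced by the monomial \<open>C\<close>.\<close>

definition cluster :: "(nat ^ 3) set \<Rightarrow> (nat ^ 3) set \<Rightarrow> (nat ^ 3) set \<Rightarrow> 3 \<Rightarrow> nat ^ 3 \<Rightarrow> (nat ^ 3) set \<Rightarrow> bool" where
  "cluster K Bad X i C M \<longleftrightarrow> finite X \<and> X \<noteq> {} \<and> X \<subseteq> Bad \<and> X \<subseteq> rays K C \<and> C $ i = 1 \<and>
     finite M \<and> M \<inter> Bad = {} \<and> axis i 1 \<in> M \<and> M - {axis i 1} \<subseteq> rays K C \<and> (\<forall>v\<in>X. ep v \<in> ncone M) \<and>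
     (\<forall>v\<in>X. \<forall>\<omega>\<in>minface K (ep v). 1 \<le> \<omega> $ i \<longrightarrow> (\<exists>j s. 0 \<le> s \<and> ep \<omega> = ep C + s *\<^sub>R axis j 1)) \<and>
     (\<exists>V. (\<forall>P\<in>V. \<exists>N. ear K P X M N) \<and>
        (\<forall>v\<in>X. \<forall>P k. P \<in> minface K (ep v) \<longrightarrow> P \<in> minface K (ep k) \<longrightarrow> extremal K P \<longrightarrow> (\<forall>l. 0 < k $ l) \<longrightarrow> P \<in> V) \<and>
        (\<forall>k\<in>cluster_points X M. (\<exists>P\<in>V. P \<in> minface K (ep k)) \<and> (C \<in> minface K (ep k) \<or> (\<exists>k'\<in>cluster_points X M. k = k' + axis i 1))))"

text \<open>Integrality of the pairing; it supplies the condition \<open>1 \<le> \<alpha>\<close> of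
  \<open>cluster_points_decrease\<close>.\<close>

lemma diff_ep_ge_1:
  assumes "0 < (ep A - ep P) \<bullet> ep k"
  shows "1 \<le> (ep A - ep P) \<bullet> ep k"
proof -
  have "dotn P k < dotn A k" using assms unfolding inner_diff_left inner_ep by linarith
  then have "real (dotn P k) + 1 \<le> real (dotn A k)" by linarith
  then show ?thesis unfolding inner_diff_left inner_ep by linarith
qed

lemma apex_form_eq: "apex_form v E D C = (ep D - ep E) - (if \<forall>l. 0 < v $ l then 1 else 0) *\<^sub>R (ep C - ep E)"
  unfolding apex_form_def by (cases "\<forall>l. 0 < v $ l") (simp_all only: if_True if_False, simp_all)

lemma B1_normal_unbounded_nonneg:
  assumes B: "B1_normal K i v E D C" and n: "\<not> (\<forall>l. 0 < v $ l)" and x: "\<And>l. 0 \<le> x $ l"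
  shows "0 \<le> (ep D - ep E) \<bullet> x"
  using B
proof (cases rule: B1_normal_cases)
  case simplex
  then show ?thesis using n by blast
next
  case (unbounded j)
  show ?thesis unfolding unbounded(2) using x by simp
qed

lemma minface_of_ncone:
  assumes "ep k \<in> ncone R" "finite R" "R \<subseteq> rays K P" "P \<in> K"
  shows "P \<in> minface K (ep k)"
  using ncone_subset_dcone[OF assms(1,2,4)] assms(3) rays_dcone unfolding minface_dcone by blast

lemma ncone_3:
  assumes "x = a *\<^sub>R ep u + b *\<^sub>R ep v + c *\<^sub>R ep w" "0 \<le> a" "0 \<le> b" "0 \<le> c" "{u, v, w} \<subseteq> R" "finite R"
  shows "x \<in> ncone R"
  unfolding assms(1) by (intro ncone_add[OF ncone_add] ncone_scale ncone_mem) (use assms in auto)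

lemma apex_neighbour_base:
  assumes B: "B1_normal K i v E D C" and b: "b \<in> rays K C" "(ep C - ep E) \<bullet> ep b < 0" "apex_form v E D C \<bullet> ep b = 0"
    and s: "\<forall>l. 0 < v $ l"
  shows "b \<in> rays K D" "0 < (ep E - ep D) \<bullet> ep b"
proof -
  have D: "D \<in> K" using B1_normal_swap(2)[OF B s] by (simp add: minface_def)
  have C: "C \<in> minface K (ep b)" using b(1) by (simp add: rays_def)
  have e: "ep D \<bullet> ep b = ep C \<bullet> ep b" using b(3) s by (simp add: apex_form_def inner_diff_left)
  then have "D \<in> minface K (ep b)" using D unfolding minface_eq[OF C] by simp
  then show "b \<in> rays K D" using b(1) by (simp add: rays_def)
  show "0 < (ep E - ep D) \<bullet> ep b" using b(2) e by (simp add: inner_diff_left)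
qed

text \<open>
  The ears cover all cases of the signs of the coordinates of \<open>k\<close>: the third vertex of the facet is
  minimal when both coordinates relative to it are positive, and otherwise \<open>E\<close> or \<open>C\<close> is.
\<close>

lemma cluster_isolated:
  assumes K: "finite K" and B: "B1_normal K i v E D C" and Bad: "Bad \<subseteq> prim_rays K" "v \<in> Bad" "axis i 1 \<notin> Bad"
    and iso: "\<And>w. w \<in> Bad \<Longrightarrow> w \<noteq> v \<Longrightarrow> \<not> share K v w"
  shows "\<exists>C M. cluster K Bad {v} i C M"
proof -
  let ?h = "ep D - ep E" and ?u = "ep C - ep E" and ?d = "ep E - ep C" and ?ap = "apex_form v E D C" and ?w = "ep E - ep D" and ?z = "ep C - ep D"
  note pts = B1_normal_points[OF B]
  have v: "v \<in> prim_rays K" using Bad by blast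
  obtain a where a: "a \<in> rays K E" "C \<in> minface K (ep a)" "0 < ?h \<bullet> ep a" using B1_normal_neighbour[OF K B] .
  obtain b where b: "b \<in> rays K C" "?u \<bullet> ep b < 0" "?ap \<bullet> ep b = 0" using B1_normal_apex_neighbour[OF K B] .
  have pr: "a \<in> prim_rays K" "b \<in> prim_rays K" using a b by (auto simp: rays_def)
  have EC: "E \<noteq> C" using pts by auto
  have vE: "v \<in> rays K E" "v \<in> rays K C" using v pts by (auto simp: rays_def)
  have eE: "axis i 1 \<in> rays K E" by (rule axis_ray[OF pts(3,5)])
  have aC: "a \<in> rays K C" using a pr by (simp add: rays_def)
  let ?e = "axis i 1 :: nat ^ 3"
  define M where "M = {?e, a, b}"
  \<comment> \<open>The normal \<open>a\<close> shares the edge from \<open>E\<close> to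
    \<open>C\<close> with \<open>v\<close>. If it contributed, \<open>v\<close> would not be
    isolated; the same holds for \<open>b\<close> and the other edge at \<open>C\<close>.\<close>
  have a_good: "a \<notin> Bad"
  proof
    assume "a \<in> Bad"
    moreover have "a \<noteq> v" using a(3) B1_normal_orth(1)[OF B] by auto
    moreover have "share K v a" using pts(1,2) a EC unfolding share_def rays_def by blast
    ultimately show False using iso by blast
  qed
  have b_good: "b \<notin> Bad"
  proof
    assume bb: "b \<in> Bad"
    have bv: "b \<noteq> v" using b(2) B1_normal_orth(2)[OF B] by auto
    have Cb: "C \<in> minface K (ep b)" using b(1) by (simp add: rays_def)
    have "share K v b" using B
    proof (cases rule: B1_normal_cases)
      case simplex
      have "D \<in> minface K (ep b)" using apex_neighbour_base(1)[OF B b simplex(2)] by (simp add: rays_def)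
      moreover have "D \<noteq> C" using pts by auto
      ultimately show ?thesis using simplex(1) pts(2) Cb unfolding share_def by blast
    next
      case (unbounded j)
      have "?ap = axis j 1" using unbounded(3) unfolding apex_form_def unbounded(2) by (metis less_irrefl)
      then have "b $ j = 0" using b(3) by simp
      then show ?thesis using unbounded(3) pts(2) Cb unfolding share_def by blast
    qed
    then show False using iso bb bv by blast
  qed
  obtain N where N: "N \<bullet> ep v = 1" "N \<bullet> axis i 1 = 0" "N \<bullet> ep a = 0"
    "\<And>x. x = (N \<bullet> x) *\<^sub>R ep v + (?u \<bullet> x) *\<^sub>R axis i 1 + (?h \<bullet> x / (?h \<bullet> ep a)) *\<^sub>R ep a"
    by (rule B1_normal_base_ear[OF B v a], rule that)
  obtain L where L: "L \<bullet> ep v = 1" "L \<bullet> ep a = 0" "L \<bullet> ep b = 0" and da: "0 < ?ap \<bullet> ep a"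
    and L4: "\<And>x. x = (L \<bullet> x) *\<^sub>R ep v + (?ap \<bullet> x / (?ap \<bullet> ep a)) *\<^sub>R ep a
      + (?d \<bullet> x / (?d \<bullet> ep b)) *\<^sub>R ep b"
    by (rule B1_normal_apex_ear[OF B v a b], rule that)
  have eb: "0 < ?d \<bullet> ep b" using b(2) by (simp add: inner_diff_left)
  have nz: "ep u \<noteq> 0" if "u \<in> prim_rays K" for u using that by (auto simp: prim_rays_def is_ray_def)
  have ax: "0 \<le> (axis i 1 :: real ^ 3) $ l" for l by (simp add: axis_def)
  have bb: "?h \<bullet> ep b \<le> 0" using b(2,3) unfolding apex_form_eq inner_diff_left[of _ "_ *\<^sub>R _"] inner_scaleR_left by (auto split: if_splits)
  \<comment> \<open>At \<open>b\<close> the coefficients of \<open>e_i\<close> and \<open>a\<close>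
    are nonpositive, so that of \<open>v\<close> is positive. Hence \<open>v\<close> lies in the
    cone over \<open>a\<close>, \<open>b\<close>, \<open>e_i\<close>, as made explicit at the
    end.\<close>
  have Nb: "0 < N \<bullet> ep b"
    by (rule coeff_pos[OF N(4)[of "ep b"]]) (use b(2) bb a(3) ax nz[OF pr(2)] in \<open>auto intro: divide_nonpos_pos\<close>)
  have ae: "?ap \<bullet> axis i 1 \<le> 0" using pts by (simp add: apex_form_def)
  have Le: "0 < L \<bullet> axis i 1"
    by (rule coeff_pos[OF L4[of "axis i 1"]]) (use pts ae da eb ax in \<open>auto intro: divide_nonpos_pos simp: axis_eq_0_iff\<close>)
  have earE: "ear K E {v} M N"
    unfolding ear_def
  proof (intro conjI exI[of _ "{?e, a}"] ballI impI)
    fix x assume x: "x \<in> dcone K E" "0 \<le> N \<bullet> x"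
    have "0 \<le> ?u \<bullet> x" using dconeD(3)[OF x(1) pts(4)] by (simp add: inner_diff_left)
    moreover have "0 \<le> ?h \<bullet> x" by (rule B1_normal_base_nonneg[OF B x(1)])
    ultimately show "x \<in> ncone ({v} \<inter> rays K E \<union> {?e, a})"
      by (intro ncone_3[of x "N \<bullet> x" v "?u \<bullet> x" ?e "?h \<bullet> x / (?h \<bullet> ep a)" a])
        (use N(4)[of x] x a(3) vE in simp_all)
  qed (use N Nb eE a in \<open>auto simp: M_def\<close>)
  have earC: "ear K C {v} M L"
    unfolding ear_def
  proof (intro conjI exI[of _ "{a, b}"] ballI impI)
    fix x assume x: "x \<in> dcone K C" "0 \<le> L \<bullet> x"
    have "0 \<le> ?d \<bullet> x" using dconeD(3)[OF x(1) pts(3)] by (simp add: inner_diff_left)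
    moreover have "0 \<le> ?ap \<bullet> x" by (rule apex_form_nonneg[OF B x(1)])
    ultimately show "x \<in> ncone ({v} \<inter> rays K C \<union> {a, b})"
      by (intro ncone_3[of x "L \<bullet> x" v "?ap \<bullet> x / (?ap \<bullet> ep a)" a "?d \<bullet> x / (?d \<bullet> ep b)" b])
        (use L4[of x] x da eb vE in simp_all)
  qed (use L Le aC b in \<open>auto simp: M_def\<close>)
  \<comment> \<open>Only a bounded facet has a third vertex. Exchanging \<open>E\<close> and
    \<open>D\<close> exchanges the neighbours \<open>a\<close> and \<open>b\<close>, and the ear at
    \<open>D\<close> is the one at \<open>E\<close> in the new roles.\<close>
  have D_ear: "\<exists>N'. ear K D {v} M N' \<and> b \<in> rays K D \<and> D \<in> K \<and> axis i 1 \<in> rays K D \<and> v \<in> rays K D \<and> 0 < ?w \<bullet> ep b \<and>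
      (\<forall>x. x = (N' \<bullet> x) *\<^sub>R ep v + (?z \<bullet> x) *\<^sub>R axis i 1 + (?w \<bullet> x / (?w \<bullet> ep b)) *\<^sub>R ep b)"
    if s: "\<forall>l. 0 < v $ l"
  proof -
    note B' = B1_normal_swap(1)[OF B s]
    note bD = apex_neighbour_base[OF B b s]
    have Cb: "C \<in> minface K (ep b)" using b(1) by (simp add: rays_def)
    obtain N' where N': "N' \<bullet> ep v = 1" "N' \<bullet> axis i 1 = 0" "N' \<bullet> ep b = 0"
      "\<And>x. x = (N' \<bullet> x) *\<^sub>R ep v + (?z \<bullet> x) *\<^sub>R axis i 1 + (?w \<bullet> x / (?w \<bullet> ep b)) *\<^sub>R ep b"
      using B1_normal_base_ear[OF B' v bD(1) Cb bD(2)] by metis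
    note pts' = B1_normal_points[OF B']
    have e: "axis i 1 \<in> rays K D" by (rule axis_ray[OF pts'(3,5)])
    have Ca: "ep C \<bullet> ep a = ep E \<bullet> ep a" using minface_inner_eq[OF a(2), of E] a(1) by (simp add: rays_def)
    have Na: "0 < N' \<bullet> ep a"
      by (rule coeff_pos[OF N'(4)[of "ep a"]]) (use a(3) Ca bD(2) ax nz[OF pr(1)] in \<open>auto intro: divide_nonpos_pos simp: inner_diff_left\<close>)
    have vD: "v \<in> rays K D" using pts'(1) v by (simp add: rays_def)
    have "ear K D {v} M N'"
      unfolding ear_def
    proof (intro conjI exI[of _ "{?e, b}"] ballI impI)
      fix x assume x: "x \<in> dcone K D" "0 \<le> N' \<bullet> x"
      have "0 \<le> ?z \<bullet> x" using dconeD(3)[OF x(1) pts(4)] by (simp add: inner_diff_left)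
      moreover have "0 \<le> ?w \<bullet> x" by (rule B1_normal_base_nonneg[OF B' x(1)])
      ultimately show "x \<in> ncone ({v} \<inter> rays K D \<union> {?e, b})"
        by (intro ncone_3[of x "N' \<bullet> x" v "?z \<bullet> x" ?e "?w \<bullet> x / (?w \<bullet> ep b)" b])
          (use N'(4)[of x] x bD(2) vD in simp_all)
    qed (use N' Na e bD in \<open>auto simp: M_def\<close>)
    then show ?thesis using N'(4) bD e vD pts' by blast
  qed
  define V where "V = {E, C} \<union> {P. P = D \<and> (\<forall>l. 0 < v $ l)}"
  have fin: "finite {v}" "finite M" "axis i 1 \<in> M" by (auto simp: M_def)
  have V: "\<forall>P\<in>V. \<exists>N. ear K P {v} M N" using earE earC D_ear unfolding V_def by blast
  \<comment> \<open>At every cluster point either \<open>C\<close> is minimal or one can step down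
    by \<open>e_i\<close>; iterating leads to a starting point at which \<open>C\<close> is
    minimal.\<close>
  have walk: "(\<exists>P\<in>V. P \<in> minface K (ep k)) \<and> (C \<in> minface K (ep k) \<or> (\<exists>k'\<in>cluster_points {v} M. k = k' + axis i 1))" if k: "k \<in> cluster_points {v} M" for k
  proof -
    have k1: "\<forall>l. 1 \<le> k $ l" using k by (simp add: cluster_points_def)
    let ?b = "?h \<bullet> ep k" and ?g = "?u \<bullet> ep k"
    have sub: "ncone {u} \<subseteq> ncone ({v} \<union> M)" if "u \<in> M" for u using ncone_mono[of _ "{u}" "{v} \<union> M"] that fin by blast
    have dec: "\<exists>k'\<in>cluster_points {v} M. k = k' + axis i 1"
      if "ep k = s *\<^sub>R ep v + \<alpha> *\<^sub>R axis i 1 + c *\<^sub>R ep u" "0 < s" "1 \<le> \<alpha>" "0 \<le> c" "u \<in> M" for s \<alpha> c u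
    proof (rule cluster_points_decrease[OF k1 _ B1_normal_pos(1)[OF B] that(2,3,1) _ _ fin])
      have "c *\<^sub>R ep u \<in> ncone {u}" by (intro ncone_scale ncone_mem that) auto
      then show "c *\<^sub>R ep u \<in> ncone ({v} \<union> M)" using sub[OF that(5)] by blast
    qed (use that in auto)
    have caseD: ?thesis if s: "\<forall>l. 0 < v $ l" and lt: "?b < ?g" "?b < 0"
    proof -
      obtain N' where N': "ear K D {v} M N'" "b \<in> rays K D" "D \<in> K" "axis i 1 \<in> rays K D" "v \<in> rays K D" "0 < ?w \<bullet> ep b"
        "\<And>x. x = (N' \<bullet> x) *\<^sub>R ep v + (?z \<bullet> x) *\<^sub>R axis i 1 + (?w \<bullet> x / (?w \<bullet> ep b)) *\<^sub>R ep b"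
        using D_ear[OF s] by metis
      have pos: "0 < N' \<bullet> ep k" by (rule ear_cluster_points[OF N'(1) k fin(1,2)])
      have 1: "0 < ?z \<bullet> ep k" "0 \<le> ?w \<bullet> ep k / (?w \<bullet> ep b)"
        using lt N'(6) by (simp_all add: inner_diff_left)
      have "D \<in> minface K (ep k)"
        by (rule minface_of_ncone[OF ncone_3[of "ep k" "N' \<bullet> ep k" v "?z \<bullet> ep k" ?e _ b "{v, ?e, b}"]])
          (use N'(7)[of "ep k"] N'(2-5) pos 1 in auto)
      then show ?thesis using dec[OF N'(7)[of "ep k"] pos diff_ep_ge_1[OF 1(1)] 1(2)] s by (auto simp: V_def M_def)
    qed
    have nonD: "0 \<le> ?b" if "\<not> (\<forall>l. 0 < v $ l)" using B1_normal_unbounded_nonneg[OF B that] by simp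
    \<comment> \<open>According to which of the vertices is minimal at \<open>k\<close>: a third
      vertex \<open>D\<close> lying strictly below \<open>E\<close> and \<open>C\<close>, then
      \<open>E\<close>, then \<open>C\<close>.\<close>
    consider "\<forall>l. 0 < v $ l" "?b < ?g" "?b < 0" | "0 \<le> ?g" "0 \<le> ?b" | "?g < 0" "0 \<le> ?ap \<bullet> ep k"
    proof (cases "\<forall>l. 0 < v $ l")
      case True
      then have "?ap \<bullet> ep k = ?b - ?g" by (simp add: apex_form_def inner_diff_left)
      then have ap: "0 \<le> ?ap \<bullet> ep k" if "\<not> (?b < ?g \<and> ?b < 0)" "?g < 0" using that by linarith
      show ?thesis
      proof (cases "?b < ?g \<and> ?b < 0")
        case False
        then show ?thesis using that(2,3) ap by (cases "0 \<le> ?g") auto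
      qed (use that(1) True in blast)
    next
      case False
      then have "?ap \<bullet> ep k = ?b" by (simp only: apex_form_def if_False)
      then show ?thesis using that(2,3) nonD[OF False] by (cases "0 \<le> ?g") auto
    qed
    then show ?thesis
    proof cases
      case 1
      then show ?thesis by (rule caseD)
    next
      case 2
      have pos: "0 < N \<bullet> ep k" by (rule ear_cluster_points[OF earE k fin(1,2)])
      have q: "0 \<le> ?b / (?h \<bullet> ep a)" using 2 a(3) by simp
      have Ek: "E \<in> minface K (ep k)"
        by (rule minface_of_ncone[OF ncone_3[of "ep k" "N \<bullet> ep k" v ?g ?e _ a "{v, ?e, a}"]])
          (use N(4)[of "ep k"] vE eE a(1) pts pos q 2 in auto)
      show ?thesis
      proof (cases "?g = 0")
        case True
        then have "C \<in> minface K (ep k)" using pts(4) unfolding minface_eq[OF Ek] by (simp add: inner_diff_left)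
        then show ?thesis using Ek by (auto simp: V_def)
      next
        case False
        then have "0 < ?g" using 2 by simp
        then show ?thesis using dec[OF N(4)[of "ep k"] pos diff_ep_ge_1 q] Ek by (auto simp: V_def M_def)
      qed
    next
      case 3
      have pos: "0 < L \<bullet> ep k" by (rule ear_cluster_points[OF earC k fin(1,2)])
      have q: "0 \<le> ?ap \<bullet> ep k / (?ap \<bullet> ep a)" "0 \<le> ?d \<bullet> ep k / (?d \<bullet> ep b)"
        using 3 da eb by (simp_all add: inner_diff_left)
      have "C \<in> minface K (ep k)"
        by (rule minface_of_ncone[OF ncone_3[of "ep k" "L \<bullet> ep k" v _ a _ b "{v, a, b}", OF L4[of "ep k"] _ q]])
          (use vE aC b(1) pts(4) pos in auto)
      then show ?thesis by (auto simp: V_def)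
    qed
  qed
  \<comment> \<open>The expansion of \<open>b\<close> in \<open>v\<close>, \<open>e_i\<close>,
    \<open>a\<close> is solved for \<open>v\<close>; all coefficients are nonnegative because
    \<open>N\<close> is positive at \<open>b\<close> and the others are nonpositive.\<close>
  have vM: "ep v \<in> ncone M"
  proof (rule ncone_3[of "ep v" "1 / (N \<bullet> ep b)" b "- (?u \<bullet> ep b) / (N \<bullet> ep b)" ?e
        "- (?h \<bullet> ep b / (?h \<bullet> ep a)) / (N \<bullet> ep b)" a])
    have "(N \<bullet> ep b) *\<^sub>R ep v = ep b - (?u \<bullet> ep b) *\<^sub>R axis i 1 - (?h \<bullet> ep b / (?h \<bullet> ep a)) *\<^sub>R ep a"
      using N(4)[of "ep b"] by (simp add: algebra_simps)
    then have "ep v = (1 / (N \<bullet> ep b)) *\<^sub>R (ep b - (?u \<bullet> ep b) *\<^sub>R axis i 1 - (?h \<bullet> ep b / (?h \<bullet> ep a)) *\<^sub>R ep a)"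
      using Nb by (metis divide_self_if less_irrefl scaleR_one scaleR_scaleR times_divide_eq_left mult_1)
    also have "\<dots> = (1 / (N \<bullet> ep b)) *\<^sub>R ep b + (- (?u \<bullet> ep b) / (N \<bullet> ep b)) *\<^sub>R axis i 1
        + (- (?h \<bullet> ep b / (?h \<bullet> ep a)) / (N \<bullet> ep b)) *\<^sub>R ep a"
      by (simp add: scaleR_diff_right)
    finally show "ep v = (1 / (N \<bullet> ep b)) *\<^sub>R ep b + (- (?u \<bullet> ep b) / (N \<bullet> ep b)) *\<^sub>R ep ?e
        + (- (?h \<bullet> ep b / (?h \<bullet> ep a)) / (N \<bullet> ep b)) *\<^sub>R ep a"
      by (simp only: ep_axis)
    show "0 \<le> 1 / (N \<bullet> ep b)" "0 \<le> - (?u \<bullet> ep b) / (N \<bullet> ep b)"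
      "0 \<le> - (?h \<bullet> ep b / (?h \<bullet> ep a)) / (N \<bullet> ep b)"
      using Nb b(2) divide_nonpos_pos[OF bb a(3)] by (simp, intro divide_nonneg_pos, simp_all only: neg_0_le_iff_le less_imp_le, intro divide_nonneg_pos, simp_all only: neg_0_le_iff_le)
  qed (use fin in \<open>auto simp: M_def\<close>)
  have "cluster K Bad {v} i C M"
    unfolding cluster_def
  proof (intro conjI exI[of _ V] V)
    show "\<forall>v'\<in>{v}. \<forall>P k. P \<in> minface K (ep v') \<longrightarrow> P \<in> minface K (ep k) \<longrightarrow> extremal K P \<longrightarrow> (\<forall>l. 0 < k $ l) \<longrightarrow> P \<in> V"
      using B1_normal_vertex[OF B] by (auto simp: V_def)
    show "\<forall>v'\<in>{v}. \<forall>\<omega>\<in>minface K (ep v'). 1 \<le> \<omega> $ i \<longrightarrow> (\<exists>j s. 0 \<le> s \<and> ep \<omega> = ep C + s *\<^sub>R axis j 1)"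
      using B1_normal_above[OF B] by blast
    show "\<forall>k\<in>cluster_points {v} M. (\<exists>P\<in>V. P \<in> minface K (ep k)) \<and> (C \<in> minface K (ep k) \<or> (\<exists>k'\<in>cluster_points {v} M. k = k' + axis i 1))"
      using walk by blast
    show "M \<inter> Bad = {}" using a_good b_good Bad(3) by (auto simp: M_def)
  qed (use Bad vE pts vM fin aC b in \<open>auto simp: M_def\<close>)
  then show ?thesis by blast
qed

text \<open>
  A quadrilateral in coordinates relative to two adjacent vertices: a point on the inner side of all
  four edges lies in one of the triangles cut off by a diagonal.
\<close>

lemma quadrilateral_coordinates:
  fixes p q t :: real
  assumes a: "0 < pa" "qa \<le> 0" "ta < 0" and b: "pb \<le> 0" "0 < qb" "tb < 0"
    and x: "t \<le> 0" "q * ta - t * qa \<le> 0" "p * tb - t * pb \<le> 0"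
    and N: "0 \<le> (pa * qb - qa * pb) * t - (p * qb - q * pb) * ta - (q * pa - p * qa) * tb"
  obtains c d e g where "0 \<le> c" "0 \<le> d" "0 \<le> e" "0 \<le> g"
    "p = c * pa + d + g * pb" "q = c * qa + e + g * qb" "t = c * ta + g * tb"
proof (cases "0 \<le> p - (t / ta) * pa")
  case True
  \<comment> \<open>On this side of the diagonal the point lies in the triangle of the first two
    basis vectors and \<open>(pa, qa, ta)\<close>; the second corner gets coefficient 0.\<close>
  have "0 \<le> t / ta" using x(1) a(3) by (simp add: divide_nonpos_neg)
  moreover have "0 \<le> q - (t / ta) * qa" using x(2) a(3) by (simp add: field_simps)
  ultimately show ?thesis using True a(3) by (intro that[of "t / ta" "p - (t / ta) * pa" "q - (t / ta) * qa" 0]) auto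
next
  case False
  \<comment> \<open>Beyond the diagonal it lies in the triangle of the second basis vector and the
    two corners. The numbers \<open>c\<close> and \<open>g\<close> come from Cramer's rule for the
    first and third coordinates, with determinant \<open>w\<close>.\<close>
  define w where "w = pa * tb - pb * ta"
  have "pa * tb < 0" "0 \<le> pb * ta" using a b by (simp_all add: mult_pos_neg mult_nonpos_nonpos)
  then have w: "w < 0" by (simp add: w_def)
  define c where "c = (p * tb - t * pb) / w"
  define g where "g = (pa * t - p * ta) / w"
  define e where "e = q - c * qa - g * qb"
  have c0: "0 \<le> c" unfolding c_def using x(3) w by (simp add: divide_nonpos_neg)
  have "pa * t - p * ta \<le> 0" using False a(3) by (simp add: field_simps)
  then have g0: "0 \<le> g" unfolding g_def using w by (simp add: divide_nonpos_neg)
  have p: "p = c * pa + g * pb" and t: "t = c * ta + g * tb"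
    using w by (simp_all add: c_def g_def field_simps) (simp_all add: w_def algebra_simps)
  have q: "q = c * qa + e + g * qb" by (simp add: e_def)
  have "(pa * qb - qa * pb) * t - (p * qb - q * pb) * ta - (q * pa - p * qa) * tb = e * - w"
    unfolding p q t w_def by (simp add: algebra_simps)
  then have "0 \<le> e * - w" using N by simp
  then have "0 \<le> e" using w by (simp add: zero_le_mult_iff mult_le_0_iff)
  then show ?thesis using that[of c 0 e g] c0 g0 p q t by simp
qed

lemma sector_nonneg:
  fixes f g :: real
  assumes "\<not> (S \<and> f < g \<and> f < 0)" "\<not> S \<Longrightarrow> 0 \<le> f" "g < 0"
  shows "0 \<le> (if S then f - g else f)"
  using assms by auto

text \<open>The ear at a third vertex is that of an isolated facet. The two extra inequalities on
  \<open>ep D - ep B\<close> place the second contributing normal and its outer neighbour on the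
  positive side.\<close>

lemma pair_third_ear:
  assumes Bv: "B1_normal K i v B D C" and Bw: "B1_normal K i w B F C" and v: "v \<in> prim_rays K" and w: "w \<in> prim_rays K"
    and a: "a \<in> rays K C" "(ep C - ep B) \<bullet> ep a < 0" "apex_form v B D C \<bullet> ep a = 0"
    and b: "b \<in> rays K C" "(ep C - ep B) \<bullet> ep b < 0"
    and pos: "0 < (ep D - ep B) \<bullet> ep w" "0 < (ep D - ep B) \<bullet> ep b" and s: "\<forall>l. 0 < v $ l"
  obtains N where "ear K D {v, w} {axis i 1, a, b} N" "a \<in> rays K D" "v \<in> rays K D" "axis i 1 \<in> rays K D" "D \<in> K"
    "0 < (ep B - ep D) \<bullet> ep a"
    "\<And>x. x = (N \<bullet> x) *\<^sub>R ep v + ((ep C - ep D) \<bullet> x) *\<^sub>R axis i 1 + ((ep B - ep D) \<bullet> x / ((ep B - ep D) \<bullet> ep a)) *\<^sub>R ep a"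
proof -
  let ?h = "ep B - ep D" and ?u = "ep C - ep D"
  note B' = B1_normal_swap(1)[OF Bv s]
  note pts = B1_normal_points[OF B']
  note aD = apex_neighbour_base[OF Bv a s]
  have Ca: "C \<in> minface K (ep a)" using a(1) by (simp add: rays_def)
  obtain N where N: "N \<bullet> ep v = 1" "N \<bullet> axis i 1 = 0" "N \<bullet> ep a = 0"
    "\<And>x. x = (N \<bullet> x) *\<^sub>R ep v + (?u \<bullet> x) *\<^sub>R axis i 1 + (?h \<bullet> x / (?h \<bullet> ep a)) *\<^sub>R ep a"
    by (rule B1_normal_base_ear[OF B' v aD(1) Ca aD(2)], rule that)
  have e: "axis i 1 \<in> rays K D" by (rule axis_ray[OF pts(3,5)])
  have vD: "v \<in> rays K D" using pts(1) v by (simp add: rays_def)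
  have nz: "ep u \<noteq> 0" if "u \<in> prim_rays K" for u using that by (auto simp: prim_rays_def is_ray_def)
  have ax: "0 \<le> (axis i 1 :: real ^ 3) $ l" for l by (simp add: axis_def)
  have Cw: "ep C \<bullet> ep w = ep B \<bullet> ep w" using minface_inner_eq[OF B1_normal_points(2,1)[OF Bw]] .
  have Nw: "0 < N \<bullet> ep w"
    by (rule coeff_pos[OF N(4)[of "ep w"]]) (use pos(1) Cw aD(2) ax nz[OF w] in \<open>auto intro: divide_nonpos_pos simp: inner_diff_left\<close>)
  have "b \<in> prim_rays K" using b(1) by (simp add: rays_def)
  then have Nb: "0 < N \<bullet> ep b"
    by (intro coeff_pos[OF N(4)[of "ep b"]]) (use pos(2) b(2) aD(2) ax nz in \<open>auto intro: divide_nonpos_pos simp: inner_diff_left\<close>)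
  let ?e = "axis i 1 :: nat ^ 3"
  have "ear K D {v, w} {?e, a, b} N"
    unfolding ear_def
  proof (intro conjI exI[of _ "{?e, a}"] ballI impI)
    fix x assume x: "x \<in> dcone K D" "0 \<le> N \<bullet> x"
    have "0 \<le> ?u \<bullet> x" using dconeD(3)[OF x(1) pts(4)] by (simp add: inner_diff_left)
    moreover have "0 \<le> ?h \<bullet> x" by (rule B1_normal_base_nonneg[OF B' x(1)])
    ultimately show "x \<in> ncone ({v, w} \<inter> rays K D \<union> {?e, a})"
      by (intro ncone_3[of x "N \<bullet> x" v "?u \<bullet> x" ?e "?h \<bullet> x / (?h \<bullet> ep a)" a])
        (use N(4)[of x] x aD(2) vD in simp_all)
  qed (use N Nb Nw e aD in auto)
  then show ?thesis using that N(4) aD e vD pts by blast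
qed

lemma cluster_pair:
  assumes K: "finite K" and Bv: "B1_normal K i v B D C" and Bw: "B1_normal K i w B F C" and vw: "v \<noteq> w"
    and Bad: "Bad \<subseteq> prim_rays K" "v \<in> Bad" "w \<in> Bad" "axis i 1 \<notin> Bad"
    and third: "\<And>x. x \<in> Bad \<Longrightarrow> x \<in> rays K C \<Longrightarrow> x = v \<or> x = w"
  shows "\<exists>M. cluster K Bad {v, w} i C M"
proof -
  note pv = B1_normal_points[OF Bv] and pw = B1_normal_points[OF Bw]
  have vp: "v \<in> prim_rays K" and wp: "w \<in> prim_rays K" using Bad by auto
  have vr: "v \<in> rays K B" "v \<in> rays K C" "w \<in> rays K B" "w \<in> rays K C" using vp wp pv pw by (auto simp: rays_def)
  define g where "g = ep C - ep B"
  let ?f = "ep D - ep B" and ?h = "ep F - ep B"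
  have fv: "?f \<bullet> ep v = 0" "g \<bullet> ep v = 0" and hw: "?h \<bullet> ep w = 0" "g \<bullet> ep w = 0"
    using B1_normal_orth[OF Bv] B1_normal_orth[OF Bw] by (simp_all add: g_def)
  have nz: "ep u \<noteq> 0" if "u \<in> prim_rays K" for u using that by (auto simp: prim_rays_def is_ray_def)
  have par: "u = u'" if "u \<in> prim_rays K" "u' \<in> prim_rays K" "ep u = c *\<^sub>R ep u'" for u u' c
    using prim_parallel[of u u' c] that by (auto simp: prim_rays_def)
  have fw: "0 < ?f \<bullet> ep w"
  proof -
    have "?f \<bullet> ep w \<noteq> 0" using B1_normal_kernel[OF Bv vp, of "ep w"] hw(2) par[OF wp vp] vw unfolding g_def by metis
    moreover have "0 \<le> ?f \<bullet> ep w" using B1_normal_base_nonneg[OF Bv] rays_dcone[OF vr(3)] by blast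
    ultimately show ?thesis by simp
  qed
  have hv: "0 < ?h \<bullet> ep v"
  proof -
    have "?h \<bullet> ep v \<noteq> 0" using B1_normal_kernel[OF Bw wp, of "ep v"] fv(2) par[OF vp wp] vw unfolding g_def by metis
    moreover have "0 \<le> ?h \<bullet> ep v" using B1_normal_base_nonneg[OF Bw] rays_dcone[OF vr(1)] by blast
    ultimately show ?thesis by simp
  qed
  \<comment> \<open>Normalised so that \<open>p\<close>, \<open>q\<close>, \<open>g\<close> are the
    dual coordinates of the basis \<open>v\<close>, \<open>w\<close>, \<open>e_i\<close>.\<close>
  define p q where "p = (1 / (?h \<bullet> ep v)) *\<^sub>R ?h" and "q = (1 / (?f \<bullet> ep w)) *\<^sub>R ?f"
  have px: "p \<bullet> x = ?h \<bullet> x / (?h \<bullet> ep v)" and qx: "q \<bullet> x = ?f \<bullet> x / (?f \<bullet> ep w)" for x by (simp_all add: p_def q_def)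
  have pq: "p \<bullet> ep v = 1" "p \<bullet> ep w = 0" "p \<bullet> axis i 1 = 0" "q \<bullet> ep v = 0" "q \<bullet> ep w = 1" "q \<bullet> axis i 1 = 0" "g \<bullet> axis i 1 = 1"
    using fv hw fw hv pv pw by (simp_all add: px qx p_def q_def g_def)
  have dec: "x = (p \<bullet> x) *\<^sub>R ep v + (q \<bullet> x) *\<^sub>R ep w + (g \<bullet> x) *\<^sub>R axis i 1" for x
  proof -
    define y where "y = x - (p \<bullet> x) *\<^sub>R ep v - (q \<bullet> x) *\<^sub>R ep w - (g \<bullet> x) *\<^sub>R axis i 1"
    have y: "p \<bullet> y = 0" "q \<bullet> y = 0" "g \<bullet> y = 0" using pq fv hw by (simp_all add: y_def inner_diff_right)
    have "?f \<bullet> y = 0" using y(2) fw by (simp add: qx)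
    then obtain c where c: "y = c *\<^sub>R ep v" using B1_normal_kernel[OF Bv vp, of y] y(3) unfolding g_def by metis
    have "c = 0" using y(1) pq(1) by (simp add: c)
    then have "y = 0" using c by simp
    then show ?thesis by (simp add: y_def algebra_simps)
  qed
  obtain a where a: "a \<in> rays K C" "(ep C - ep B) \<bullet> ep a < 0" "apex_form v B D C \<bullet> ep a = 0" using B1_normal_apex_neighbour[OF K Bv] .
  obtain b where b: "b \<in> rays K C" "(ep C - ep B) \<bullet> ep b < 0" "apex_form w B F C \<bullet> ep b = 0" using B1_normal_apex_neighbour[OF K Bw] .
  have pr: "a \<in> prim_rays K" "b \<in> prim_rays K" using a b by (auto simp: rays_def)
  let ?pa = "p \<bullet> ep a" and ?qa = "q \<bullet> ep a" and ?ga = "g \<bullet> ep a" and ?pb = "p \<bullet> ep b" and ?qb = "q \<bullet> ep b" and ?gb = "g \<bullet> ep b"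
  have ag: "a \<notin> Bad" using third[of a] a fv(2) hw(2) unfolding g_def by auto
  have bg: "b \<notin> Bad" using third[of b] b fv(2) hw(2) unfolding g_def by auto
  have ga: "?ga < 0" and gb: "?gb < 0" using a b by (simp_all add: g_def)
  define r1 r2 :: real where "r1 = (if \<forall>l. 0 < v $ l then 1 else 0)" and "r2 = (if \<forall>l. 0 < w $ l then 1 else 0)"
  have r: "0 \<le> r1" "0 \<le> r2" by (simp_all add: r1_def r2_def)
  have av: "apex_form v B D C \<bullet> x = (?f \<bullet> ep w) * (q \<bullet> x) - r1 * (g \<bullet> x)" for x
    using fw by (simp only: apex_form_eq qx g_def inner_diff_left[of _ "_ *\<^sub>R _"] inner_scaleR_left r1_def) simp
  have aw: "apex_form w B F C \<bullet> x = (?h \<bullet> ep v) * (p \<bullet> x) - r2 * (g \<bullet> x)" for x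
    using hv by (simp only: apex_form_eq px g_def inner_diff_left[of _ "_ *\<^sub>R _"] inner_scaleR_left r2_def) simp
  have qa: "(?f \<bullet> ep w) * ?qa = r1 * ?ga" using a(3) av by simp
  have pb: "(?h \<bullet> ep v) * ?pb = r2 * ?gb" using b(3) aw by simp
  have qa0: "?qa \<le> 0"
  proof -
    have "(?f \<bullet> ep w) * ?qa \<le> 0" unfolding qa using r ga by (simp add: mult_nonneg_nonpos)
    then show ?thesis using fw by (simp add: mult_le_0_iff)
  qed
  have pb0: "?pb \<le> 0"
  proof -
    have "(?h \<bullet> ep v) * ?pb \<le> 0" unfolding pb using r gb by (simp add: mult_nonneg_nonpos)
    then show ?thesis using hv by (simp add: mult_le_0_iff)
  qed
  have ax: "0 \<le> (axis i 1 :: real ^ 3) $ l" for l by (simp add: axis_def)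
  have pa0: "0 < ?pa"
    by (rule coeff_pos[OF dec[of "ep a"]]) (use qa0 ga ax nz[OF pr(1)] in auto)
  have qb0: "0 < ?qb"
  proof (rule coeff_pos)
    show "ep b = ?qb *\<^sub>R ep w + ?pb *\<^sub>R ep v + ?gb *\<^sub>R axis i 1" using dec[of "ep b"] by (simp add: add.commute)
  qed (use pb0 gb ax nz[OF pr(2)] in auto)
  define dt where "dt = ?pa * ?qb - ?qa * ?pb"
  \<comment> \<open>In \<open>?qb *\<^sub>R ep a - ?qa *\<^sub>R ep b\<close> the coordinate of
    \<open>w\<close> cancels and that of \<open>e_i\<close> is nonpositive, while the vector is
    nonzero and lies in the orthant. Its coordinate \<open>dt\<close> along \<open>v\<close> is thus
    positive.\<close>
  have dt0: "0 < dt"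
  proof (rule coeff_pos[where x = "?qb *\<^sub>R ep a + (- ?qa) *\<^sub>R ep b" and y = "ep v"
        and a = 0 and m = 0 and b = "?qb * ?ga - ?qa * ?gb" and n = "axis i 1"])
    have "p \<bullet> (?qb *\<^sub>R ep a + (- ?qa) *\<^sub>R ep b) = dt"
      "q \<bullet> (?qb *\<^sub>R ep a + (- ?qa) *\<^sub>R ep b) = 0"
      "g \<bullet> (?qb *\<^sub>R ep a + (- ?qa) *\<^sub>R ep b) = ?qb * ?ga - ?qa * ?gb"
      by (simp_all add: inner_add_right inner_diff_right dt_def)
    then show "?qb *\<^sub>R ep a + (- ?qa) *\<^sub>R ep b
        = dt *\<^sub>R ep v + 0 *\<^sub>R 0 + (?qb * ?ga - ?qa * ?gb) *\<^sub>R axis i 1"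
      using dec[of "?qb *\<^sub>R ep a + (- ?qa) *\<^sub>R ep b"] by simp
    have "?qb * ?ga \<le> 0" "0 \<le> ?qa * ?gb"
      using qb0 ga qa0 gb by (simp_all add: mult_nonneg_nonpos mult_nonpos_nonpos)
    then show "?qb * ?ga - ?qa * ?gb \<le> 0" by linarith
    have nn: "0 \<le> - ?qa * real (b $ l)" "0 \<le> ?qb * real (a $ l)" for l using qb0 qa0 by (simp_all add: mult_nonpos_nonneg)
    show "0 \<le> (?qb *\<^sub>R ep a + (- ?qa) *\<^sub>R ep b) $ l" for l
      using nn[of l] by simp
    have "\<exists>l. 0 < a $ l" using nz[OF pr(1)] by (auto simp: vec_eq_iff)
    then obtain l where "0 < a $ l" ..
    then have "0 < ?qb * real (a $ l)" using qb0 by simp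
    then have "0 < (?qb *\<^sub>R ep a + (- ?qa) *\<^sub>R ep b) $ l" using nn(1)[of l] by simp
    then show "?qb *\<^sub>R ep a + (- ?qa) *\<^sub>R ep b \<noteq> 0" by (metis less_irrefl zero_index)
  qed (use ax in simp_all)
  let ?e = "axis i 1 :: nat ^ 3"
  define M where "M = {?e, a, b}"
  have fin: "finite {v, w}" "finite M" "axis i 1 \<in> M" by (auto simp: M_def)
  have eB: "?e \<in> rays K B" by (rule axis_ray[OF pv(3,5)])
  \<comment> \<open>The dual cone of \<open>B\<close> is the whole cone over \<open>v\<close>,
    \<open>w\<close>, \<open>e_i\<close>. The cutting form only has to vanish at \<open>e_i\<close>
    and be positive at \<open>v\<close> and \<open>w\<close>; the coefficients are chosen so that it
    takes the same value \<open>dt\<close> at \<open>a\<close> and \<open>b\<close>.\<close>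
  define NB where "NB = (?qb - ?qa) *\<^sub>R p + (?pa - ?pb) *\<^sub>R q"
  have NB: "NB \<bullet> x = (?qb - ?qa) * (p \<bullet> x) + (?pa - ?pb) * (q \<bullet> x)" for x
    by (simp add: NB_def inner_add_left)
  have NBab: "NB \<bullet> ep a = dt" "NB \<bullet> ep b = dt" unfolding NB dt_def by (simp_all add: algebra_simps)
  have NBe: "NB \<bullet> axis i 1 = 0" by (simp only: NB pq(3,6) mult_zero_right add_0_right)
  have baseB: "0 \<le> p \<bullet> x" "0 \<le> q \<bullet> x" "0 \<le> g \<bullet> x" if "x \<in> dcone K B" for x
    using B1_normal_base_nonneg[OF Bv that] B1_normal_base_nonneg[OF Bw that] dconeD(3)[OF that pv(4)] fw hv by (simp_all add: px qx g_def inner_diff_left)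
  have earB: "ear K B {v, w} M NB"
    unfolding ear_def
  proof (intro conjI exI[of _ "{?e}"] ballI impI)
    fix x assume x: "x \<in> dcone K B" "0 \<le> NB \<bullet> x"
    have "x = (p \<bullet> x) *\<^sub>R ep v + (q \<bullet> x) *\<^sub>R ep w + (g \<bullet> x) *\<^sub>R ep ?e" using dec[of x] by (simp only: ep_axis)
    then show "x \<in> ncone ({v, w} \<inter> rays K B \<union> {?e})"
      by (rule ncone_3) (use baseB[OF x(1)] vr in simp_all)
  next
    fix n assume "n \<in> M"
    then show "0 \<le> NB \<bullet> ep n" using NBab dt0 NBe by (auto simp: M_def)
  qed (use pq pa0 qa0 pb0 qb0 eB NBe in \<open>auto simp: NB[of "ep v"] NB[of "ep w"] M_def\<close>)
  \<comment> \<open>The equation of the plane through \<open>a\<close> and \<open>b\<close>, written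
    as a determinant and oriented so that \<open>v\<close>, \<open>w\<close>, \<open>e_i\<close> are
    on the positive side.\<close>
  define NC where "NC = dt *\<^sub>R g + (?qa * ?gb - ?qb * ?ga) *\<^sub>R p
    + (?pb * ?ga - ?pa * ?gb) *\<^sub>R q"
  have NC: "NC \<bullet> x = dt * (g \<bullet> x) + (?qa * ?gb - ?qb * ?ga) * (p \<bullet> x)
    + (?pb * ?ga - ?pa * ?gb) * (q \<bullet> x)" for x
    by (simp add: NC_def inner_add_left)
  have NCab: "NC \<bullet> ep a = 0" "NC \<bullet> ep b = 0" unfolding NC dt_def by (simp_all add: algebra_simps)
  have "0 \<le> ?qa * ?gb" "?qb * ?ga < 0" "0 \<le> ?pb * ?ga" "?pa * ?gb < 0"
    using qb0 ga qa0 gb pb0 pa0 by (simp_all add: mult_pos_neg mult_nonpos_nonpos)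
  then have NCvw: "0 < NC \<bullet> ep v" "0 < NC \<bullet> ep w" unfolding NC using pq fv hw by simp_all
  have NCe: "0 < NC \<bullet> axis i 1" unfolding NC using pq dt0 by simp
  \<comment> \<open>The four inequalities are the sides of the quadrilateral with corners
    \<open>v\<close>, \<open>w\<close>, \<open>b\<close>, \<open>a\<close>: the side through
    \<open>v\<close> and \<open>w\<close>, the two outer edges at \<open>C\<close>, and the plane
    through \<open>a\<close> and \<open>b\<close>.\<close>
  have quad: "x \<in> ncone ({v, w} \<union> {a, b})"
    if x: "g \<bullet> x \<le> 0" "0 \<le> apex_form v B D C \<bullet> x" "0 \<le> apex_form w B F C \<bullet> x" "0 \<le> NC \<bullet> x" for x
  proof -
    have "(?f \<bullet> ep w) * ((q \<bullet> x) * ?ga - (g \<bullet> x) * ?qa) = ?ga * (apex_form v B D C \<bullet> x)"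
      unfolding av using qa by (simp add: algebra_simps)
    also have "\<dots> \<le> 0" using ga x(2) by (simp add: mult_nonpos_nonneg)
    finally have 1: "(q \<bullet> x) * ?ga - (g \<bullet> x) * ?qa \<le> 0" using fw by (simp add: mult_le_0_iff)
    have "(?h \<bullet> ep v) * ((p \<bullet> x) * ?gb - (g \<bullet> x) * ?pb) = ?gb * (apex_form w B F C \<bullet> x)"
      unfolding aw using pb by (simp add: algebra_simps)
    also have "\<dots> \<le> 0" using gb x(3) by (simp add: mult_nonpos_nonneg)
    finally have 2: "(p \<bullet> x) * ?gb - (g \<bullet> x) * ?pb \<le> 0" using hv by (simp add: mult_le_0_iff)
    have "0 \<le> (?pa * ?qb - ?qa * ?pb) * (g \<bullet> x)
        - ((p \<bullet> x) * ?qb - (q \<bullet> x) * ?pb) * ?ga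
        - ((q \<bullet> x) * ?pa - (p \<bullet> x) * ?qa) * ?gb"
      using x(4) unfolding NC dt_def by (simp add: algebra_simps)
    then obtain c d e h where c: "0 \<le> c" "0 \<le> d" "0 \<le> e" "0 \<le> h"
      "p \<bullet> x = c * ?pa + d + h * ?pb" "q \<bullet> x = c * ?qa + e + h * ?qb"
      "g \<bullet> x = c * ?ga + h * ?gb"
      using quadrilateral_coordinates[OF pa0 qa0 ga pb0 qb0 gb x(1) 1 2] by metis
    have "x = (p \<bullet> x) *\<^sub>R ep v + (q \<bullet> x) *\<^sub>R ep w + (g \<bullet> x) *\<^sub>R axis i 1" by (rule dec)
    also have "\<dots> = c *\<^sub>R (?pa *\<^sub>R ep v + ?qa *\<^sub>R ep w + ?ga *\<^sub>R axis i 1)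
       + h *\<^sub>R (?pb *\<^sub>R ep v + ?qb *\<^sub>R ep w + ?gb *\<^sub>R axis i 1) + d *\<^sub>R ep v + e *\<^sub>R ep w"
      unfolding c(5-7) by (simp add: algebra_simps)
    also have "\<dots> = c *\<^sub>R ep a + h *\<^sub>R ep b + d *\<^sub>R ep v + e *\<^sub>R ep w" unfolding dec[symmetric] ..
    also have "\<dots> \<in> ncone ({v, w} \<union> {a, b})"
      by (rule ncone_add[OF ncone_add[OF ncone_add]]; rule ncone_scale[OF ncone_mem]) (use c in auto)
    finally show ?thesis .
  qed
  have earC: "ear K C {v, w} M NC"
    unfolding ear_def
  proof (intro conjI exI[of _ "{a, b}"] ballI impI)
    fix x assume x: "x \<in> dcone K C" "0 \<le> NC \<bullet> x"
    have "g \<bullet> x \<le> 0" using dconeD(3)[OF x(1) pv(3)] by (simp add: g_def inner_diff_left)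
    then have "x \<in> ncone ({v, w} \<union> {a, b})"
      using quad x(2) apex_form_nonneg[OF Bv x(1)] apex_form_nonneg[OF Bw x(1)] by blast
    moreover have "{v, w} \<inter> rays K C = {v, w}" using vr by blast
    ultimately show "x \<in> ncone ({v, w} \<inter> rays K C \<union> {a, b})" by simp
  qed (use NCab NCvw NCe a b in \<open>auto simp: M_def\<close>)
  have fb: "0 < ?f \<bullet> ep b" using qb0 fw by (simp add: qx zero_less_divide_iff)
  have ha: "0 < ?h \<bullet> ep a" using pa0 hv by (simp add: px zero_less_divide_iff)
  define V where "V = {B, C} \<union> {P. P = D \<and> (\<forall>l. 0 < v $ l)} \<union> {P. P = F \<and> (\<forall>l. 0 < w $ l)}"
  have V: "\<forall>P\<in>V. \<exists>N. ear K P {v, w} M N"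
  proof
    fix P assume "P \<in> V"
    then consider "P = B" | "P = C" | "P = D" "\<forall>l. 0 < v $ l" | "P = F" "\<forall>l. 0 < w $ l" unfolding V_def by blast
    then show "\<exists>N. ear K P {v, w} M N"
    proof cases
      case 3
      then show ?thesis using pair_third_ear[OF Bv Bw vp wp a b(1,2) fw fb] unfolding M_def by metis
    next
      case 4
      then show ?thesis using pair_third_ear[OF Bw Bv wp vp b a(1,2) hv ha] unfolding M_def insert_commute[of v w] insert_commute[of a b] by metis
    qed (use earB earC in blast)+
  qed
  have walk: "(\<exists>P\<in>V. P \<in> minface K (ep k)) \<and> (C \<in> minface K (ep k) \<or> (\<exists>k'\<in>cluster_points {v, w} M. k = k' + axis i 1))" if k: "k \<in> cluster_points {v, w} M" for k
  proof -
    have k1: "\<forall>l. 1 \<le> k $ l" using k by (simp add: cluster_points_def)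
    have dec': "\<exists>k'\<in>cluster_points {v, w} M. k = k' + axis i 1"
      if h: "ep k = s *\<^sub>R ep u + \<alpha> *\<^sub>R axis i 1 + c *\<^sub>R ep u'" "u \<in> {v, w}" "0 < s" "1 \<le> \<alpha>" "0 \<le> c" "u' \<in> {v, w} \<union> M" for s \<alpha> c u u'
    proof (rule cluster_points_decrease[OF k1 h(2) _ h(3,4,1) _ _ fin])
      show "c *\<^sub>R ep u' \<in> ncone ({v, w} \<union> M)" using h fin by (intro ncone_scale ncone_mem) auto
      show "0 < u $ i" using h(2) B1_normal_pos(1)[OF Bv] B1_normal_pos(1)[OF Bw] by auto
    qed (use h in auto)
    have caseD: "D' \<in> minface K (ep k) \<and> (\<exists>k'\<in>cluster_points {v, w} M. k = k' + axis i 1)"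
      if N': "ear K D' {v, w} M N'" "a' \<in> rays K D'" "u \<in> rays K D'" "axis i 1 \<in> rays K D'" "D' \<in> K" "0 < (ep B - ep D') \<bullet> ep a'"
        "\<And>x. x = (N' \<bullet> x) *\<^sub>R ep u + ((ep C - ep D') \<bullet> x) *\<^sub>R axis i 1 + ((ep B - ep D') \<bullet> x / ((ep B - ep D') \<bullet> ep a')) *\<^sub>R ep a'"
        and u: "u \<in> {v, w}" "a' \<in> M"
        and lt: "(ep D' - ep B) \<bullet> ep k < g \<bullet> ep k" "(ep D' - ep B) \<bullet> ep k < 0" for D' N' a' u
    proof -
      have pos: "0 < N' \<bullet> ep k" by (rule ear_cluster_points[OF N'(1) k fin(1,2)])
      have 1: "0 < (ep C - ep D') \<bullet> ep k" "0 \<le> (ep B - ep D') \<bullet> ep k / ((ep B - ep D') \<bullet> ep a')"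
        using lt N'(6) by (simp_all add: g_def inner_diff_left)
      have "D' \<in> minface K (ep k)"
        by (rule minface_of_ncone[OF ncone_3[of "ep k" "N' \<bullet> ep k" u "(ep C - ep D') \<bullet> ep k" ?e _ a' "{u, ?e, a'}"]])
          (use N'(7)[of "ep k"] N'(2-5) pos 1 in auto)
      then show ?thesis using dec'[OF N'(7)[of "ep k"] u(1) pos diff_ep_ge_1[OF 1(1)] 1(2)] u(2) by blast
    qed
    have nonD: "0 \<le> ?f \<bullet> ep k" if "\<not> (\<forall>l. 0 < v $ l)" using B1_normal_unbounded_nonneg[OF Bv that] by simp
    have nonF: "0 \<le> ?h \<bullet> ep k" if "\<not> (\<forall>l. 0 < w $ l)" using B1_normal_unbounded_nonneg[OF Bw that] by simp
    have apD: "apex_form v B D C \<bullet> ep k = (if \<forall>l. 0 < v $ l then ?f \<bullet> ep k - g \<bullet> ep k else ?f \<bullet> ep k)"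
      by (cases "\<forall>l. 0 < v $ l") (simp_all only: apex_form_eq g_def if_True if_False, simp_all add: inner_diff_left)
    have apF: "apex_form w B F C \<bullet> ep k = (if \<forall>l. 0 < w $ l then ?h \<bullet> ep k - g \<bullet> ep k else ?h \<bullet> ep k)"
      by (cases "\<forall>l. 0 < w $ l") (simp_all only: apex_form_eq g_def if_True if_False, simp_all add: inner_diff_left)
    show ?thesis
    proof (cases "(\<forall>l. 0 < v $ l) \<and> ?f \<bullet> ep k < g \<bullet> ep k \<and> ?f \<bullet> ep k < 0")
      case True
      then have s: "\<forall>l. 0 < v $ l" by blast
      from pair_third_ear[OF Bv Bw vp wp a b(1,2) fw fb s] obtain N' where
        "ear K D {v, w} {axis i 1, a, b} N'" "a \<in> rays K D" "v \<in> rays K D" "axis i 1 \<in> rays K D" "D \<in> K" "0 < (ep B - ep D) \<bullet> ep a"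
        "\<And>x. x = (N' \<bullet> x) *\<^sub>R ep v + ((ep C - ep D) \<bullet> x) *\<^sub>R axis i 1 + ((ep B - ep D) \<bullet> x / ((ep B - ep D) \<bullet> ep a)) *\<^sub>R ep a"
        by metis
      from caseD[OF this(1)[folded M_def] this(2-7)] True show ?thesis by (auto simp: M_def V_def)
    next
      case notD: False
      show ?thesis
      proof (cases "(\<forall>l. 0 < w $ l) \<and> ?h \<bullet> ep k < g \<bullet> ep k \<and> ?h \<bullet> ep k < 0")
        case True
        then have s: "\<forall>l. 0 < w $ l" by blast
        from pair_third_ear[OF Bw Bv wp vp b a(1,2) hv ha s] obtain N' where
          N': "ear K F {w, v} {axis i 1, b, a} N'" "b \<in> rays K F" "w \<in> rays K F" "axis i 1 \<in> rays K F" "F \<in> K" "0 < (ep B - ep F) \<bullet> ep b"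
          "\<And>x. x = (N' \<bullet> x) *\<^sub>R ep w + ((ep C - ep F) \<bullet> x) *\<^sub>R axis i 1 + ((ep B - ep F) \<bullet> x / ((ep B - ep F) \<bullet> ep b)) *\<^sub>R ep b"
          by metis
        have "ear K F {v, w} M N'" using N'(1) by (simp add: M_def insert_commute)
        from caseD[OF this N'(2-7)] True show ?thesis by (auto simp: M_def V_def)
      next
        case notF: False
        show ?thesis
        proof (cases "g \<bullet> ep k < 0")
          case True
          have "0 \<le> apex_form v B D C \<bullet> ep k"
            unfolding apD by (rule sector_nonneg[OF notD nonD True])
          moreover have "0 \<le> apex_form w B F C \<bullet> ep k"
            unfolding apF by (rule sector_nonneg[OF notF nonF True])
          moreover have "0 < NC \<bullet> ep k" by (rule ear_cluster_points[OF earC k fin(1,2)])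
          ultimately have "ep k \<in> ncone ({v, w} \<union> {a, b})" using quad True by simp
          then have "C \<in> minface K (ep k)" by (rule minface_of_ncone) (use vr a b pv in auto)
          then show ?thesis by (auto simp: V_def)
        next
          case False
          then have g0: "0 \<le> g \<bullet> ep k" by simp
          have "0 \<le> ?f \<bullet> ep k" using notD nonD g0 by (cases "\<forall>l. 0 < v $ l") (blast intro: linorder_not_less[THEN iffD1] order_less_le_trans)+
          moreover have "0 \<le> ?h \<bullet> ep k" using notF nonF g0 by (cases "\<forall>l. 0 < w $ l") (blast intro: linorder_not_less[THEN iffD1] order_less_le_trans)+
          ultimately have pk: "0 \<le> p \<bullet> ep k" "0 \<le> q \<bullet> ep k" using fw hv by (simp_all add: px qx)
          have Bk: "B \<in> minface K (ep k)"
            by (rule minface_of_ncone[OF ncone_3[of "ep k" "p \<bullet> ep k" v "q \<bullet> ep k" w "g \<bullet> ep k" ?e "{v, w, ?e}"]])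
              (use dec[of "ep k"] pk g0 vr eB pv in auto)
          have pos: "0 < NB \<bullet> ep k" by (rule ear_cluster_points[OF earB k fin(1,2)])
          show ?thesis
          proof (cases "g \<bullet> ep k = 0")
            case True
            then have "C \<in> minface K (ep k)" using pv(4) unfolding minface_eq[OF Bk] by (simp add: g_def inner_diff_left)
            then show ?thesis using Bk by (auto simp: V_def)
          next
            case False
            then have g1: "1 \<le> g \<bullet> ep k" using diff_ep_ge_1[of C B k] g0 by (simp add: g_def)
            \<comment> \<open>Positivity of \<open>NB\<close> gives a positive coefficient on
              \<open>v\<close> or on \<open>w\<close>; whichever is positive survives the step
              down.\<close>
            have "\<exists>k'\<in>cluster_points {v, w} M. k = k' + axis i 1"
            proof (cases "p \<bullet> ep k = 0")
              case True
              then have "0 < q \<bullet> ep k" using pos pk unfolding NB by (cases "q \<bullet> ep k = 0") auto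
              then show ?thesis using dec'[of "q \<bullet> ep k" w "g \<bullet> ep k" "p \<bullet> ep k" v] dec[of "ep k"] pk g1 by (simp add: add.commute add.left_commute)
            next
              case False
              then have "0 < p \<bullet> ep k" using pk by simp
              then show ?thesis using dec'[of "p \<bullet> ep k" v "g \<bullet> ep k" "q \<bullet> ep k" w] dec[of "ep k"] pk g1 by (simp add: add.commute add.left_commute)
            qed
            then show ?thesis using Bk by (auto simp: V_def)
          qed
        qed
      qed
    qed
  qed
  have comb: "ep u \<in> ncone M" if e: "dt *\<^sub>R ep u = c *\<^sub>R ep a + d *\<^sub>R ep b + h *\<^sub>R axis i 1" and nn: "0 \<le> c" "0 \<le> d" "0 \<le> h" for u c d h
  proof -
    have "c *\<^sub>R ep a + d *\<^sub>R ep b + h *\<^sub>R ep ?e \<in> ncone M" by (rule ncone_3[OF refl nn]) (use fin in \<open>auto simp: M_def\<close>)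
    then have "dt *\<^sub>R ep u \<in> ncone M" unfolding e by simp
    then have "(1 / dt) *\<^sub>R dt *\<^sub>R ep u \<in> ncone M" by (rule ncone_scale) (use dt0 in simp)
    then show ?thesis using dt0 by simp
  qed
  have vM: "ep v \<in> ncone M" "ep w \<in> ncone M"
  proof -
    have ea: "ep a = ?pa *\<^sub>R ep v + ?qa *\<^sub>R ep w + ?ga *\<^sub>R axis i 1" by (rule dec)
    have eb: "ep b = ?pb *\<^sub>R ep v + ?qb *\<^sub>R ep w + ?gb *\<^sub>R axis i 1" by (rule dec)
    have nn: "0 \<le> ?qa * ?gb" "?qb * ?ga \<le> 0" "0 \<le> ?pb * ?ga" "?pa * ?gb \<le> 0"
      using qb0 ga qa0 gb pb0 pa0 by (simp_all add: mult_nonneg_nonpos mult_nonpos_nonpos)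
    show "ep v \<in> ncone M"
    proof (rule comb[of v "?qb" "- ?qa" "?qa * ?gb - ?qb * ?ga"])
      have "?qb *\<^sub>R ep a - ?qa *\<^sub>R ep b = dt *\<^sub>R ep v + (?qb * ?ga - ?qa * ?gb) *\<^sub>R axis i 1"
        using dec[of "?qb *\<^sub>R ep a - ?qa *\<^sub>R ep b"] by (simp add: inner_diff_right dt_def algebra_simps)
      then show "dt *\<^sub>R ep v = ?qb *\<^sub>R ep a + (- ?qa) *\<^sub>R ep b + (?qa * ?gb - ?qb * ?ga) *\<^sub>R axis i 1"
        by (simp add: algebra_simps)
    qed (use qb0 qa0 nn in simp_all)
    show "ep w \<in> ncone M"
    proof (rule comb[of w "- ?pb" "?pa" "?pb * ?ga - ?pa * ?gb"])
      have "?pa *\<^sub>R ep b - ?pb *\<^sub>R ep a = dt *\<^sub>R ep w + (?pa * ?gb - ?pb * ?ga) *\<^sub>R axis i 1"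
        using dec[of "?pa *\<^sub>R ep b - ?pb *\<^sub>R ep a"] by (simp add: inner_diff_right dt_def algebra_simps)
      then show "dt *\<^sub>R ep w = (- ?pb) *\<^sub>R ep a + ?pa *\<^sub>R ep b + (?pb * ?ga - ?pa * ?gb) *\<^sub>R axis i 1"
        by (simp add: algebra_simps)
    qed (use pa0 pb0 nn in simp_all)
  qed
  have "cluster K Bad {v, w} i C M"
    unfolding cluster_def
  proof (intro conjI exI[of _ V] V)
    show "\<forall>v'\<in>{v, w}. \<forall>P k. P \<in> minface K (ep v') \<longrightarrow> P \<in> minface K (ep k) \<longrightarrow> extremal K P \<longrightarrow> (\<forall>l. 0 < k $ l) \<longrightarrow> P \<in> V"
      using B1_normal_vertex[OF Bv] B1_normal_vertex[OF Bw] unfolding V_def by blast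
    show "\<forall>v'\<in>{v, w}. \<forall>\<omega>\<in>minface K (ep v'). 1 \<le> \<omega> $ i \<longrightarrow> (\<exists>j s. 0 \<le> s \<and> ep \<omega> = ep C + s *\<^sub>R axis j 1)"
      using B1_normal_above[OF Bv] B1_normal_above[OF Bw] by blast
    show "\<forall>k\<in>cluster_points {v, w} M. (\<exists>P\<in>V. P \<in> minface K (ep k)) \<and> (C \<in> minface K (ep k) \<or> (\<exists>k'\<in>cluster_points {v, w} M. k = k' + axis i 1))"
      using walk by blast
    show "M \<inter> Bad = {}" using ag bg Bad(4) by (auto simp: M_def)
  qed (use Bad vr pv vM fin a b in \<open>auto simp: M_def\<close>)
  then show ?thesis by blast
qed

lemma clusterD:
  assumes "cluster K Bad X i C M"
  shows "finite X" "X \<noteq> {}" "X \<subseteq> Bad" "X \<subseteq> rays K C" "C $ i = 1" "finite M" "M \<inter> Bad = {}"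
    "axis i 1 \<in> M" "M - {axis i 1} \<subseteq> rays K C" "\<And>v. v \<in> X \<Longrightarrow> ep v \<in> ncone M"
    "\<And>v \<omega>. v \<in> X \<Longrightarrow> \<omega> \<in> minface K (ep v) \<Longrightarrow> 1 \<le> \<omega> $ i \<Longrightarrow> \<exists>j s. 0 \<le> s \<and> ep \<omega> = ep C + s *\<^sub>R axis j 1"
    "\<And>k. k \<in> cluster_points X M \<Longrightarrow> C \<in> minface K (ep k) \<or> (\<exists>k'\<in>cluster_points X M. k = k' + axis i 1)"
  using assms unfolding cluster_def by blast+

text \<open>Every contributing normal adjacent to \<open>v\<close> passes through the apex of
  \<open>v\<close>. As only two contributing normals can do so, adjacency is a partial matching, and
  its classes with one or two elements partition \<open>Bad\<close>.\<close>

lemma clusters_exist: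
  assumes K: "finite K" and Bad: "Bad \<subseteq> prim_rays K"
    and B1: "\<And>v. v \<in> Bad \<Longrightarrow> \<exists>i E D C. B1_normal K i v E D C"
    and pair: "\<And>v w. v \<in> Bad \<Longrightarrow> w \<in> Bad \<Longrightarrow> share K v w \<Longrightarrow>
       \<exists>i E D C E' D' C'. B1_normal K i v E D C \<and> B1_normal K i w E' D' C'"
    and plane: "\<And>C i u v x. C $ i = 1 \<Longrightarrow> {u, v, x} \<subseteq> Bad \<inter> rays K C \<Longrightarrow> u = v \<or> u = x \<or> v = x"
    and axis: "\<And>i \<omega>. \<omega> \<in> K \<Longrightarrow> \<omega> $ i = 0 \<Longrightarrow> axis i 1 \<notin> Bad"
  obtains \<X> where "finite \<X>" "\<Union>\<X> = Bad" "\<And>X Y. X \<in> \<X> \<Longrightarrow> Y \<in> \<X> \<Longrightarrow> X \<noteq> Y \<Longrightarrow> X \<inter> Y = {}"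
    "\<And>X. X \<in> \<X> \<Longrightarrow> \<exists>i C M. cluster K Bad X i C M"
proof -
  define cl where "cl v = insert v {w \<in> Bad. w \<noteq> v \<and> share K v w}" for v
  have unique: "u = w" if v: "v \<in> Bad" and u: "u \<in> Bad" "u \<noteq> v" "share K v u" and w: "w \<in> Bad" "w \<noteq> v" "share K v w" for u v w
  proof -
    obtain i E D C where B: "B1_normal K i v E D C" using B1[OF v] by blast
    note pts = B1_normal_points[OF B]
    have e: "axis i 1 \<notin> Bad" by (rule axis[OF pts(3,5)])
    have "C \<in> minface K (ep u)" "C \<in> minface K (ep w)"
      using share_apex[OF B] Bad v u w e by blast+
    then have "{v, u, w} \<subseteq> Bad \<inter> rays K C" using Bad v u w pts by (auto simp: rays_def)
    from plane[OF pts(7) this] show ?thesis using u w by blast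
  qed
  have two: "cl v = {v, w}" if "v \<in> Bad" "w \<in> Bad" "w \<noteq> v" "share K v w" for v w
    unfolding cl_def using unique[OF that(1)] that by blast
  have same: "cl x = cl v" if v: "v \<in> Bad" and x: "x \<in> cl v" for v x
  proof (cases "x = v")
    case False
    then have "x \<in> Bad" "share K v x" using x by (auto simp: cl_def)
    then show ?thesis using two[of v x] two[of x v] v False share_commute[of K v x] by (simp add: insert_commute)
  qed simp
  show ?thesis
  proof (rule that[of "cl ` Bad"])
    have "finite Bad" using finite_subset[OF Bad finite_prim_rays[OF K]] .
    then show "finite (cl ` Bad)" by simp
    show "\<Union> (cl ` Bad) = Bad" by (auto simp: cl_def)
    show "X \<inter> Y = {}" if XY: "X \<in> cl ` Bad" "Y \<in> cl ` Bad" "X \<noteq> Y" for X Y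
    proof (rule ccontr)
      assume "X \<inter> Y \<noteq> {}"
      then obtain x where "x \<in> X" "x \<in> Y" by blast
      then show False using XY same by (metis imageE)
    qed
    fix X assume "X \<in> cl ` Bad"
    then obtain v where v: "v \<in> Bad" "X = cl v" by blast
    show "\<exists>i C M. cluster K Bad X i C M"
    proof (cases "\<exists>w\<in>Bad. w \<noteq> v \<and> share K v w")
      case False
      obtain i E D C where B: "B1_normal K i v E D C" using B1[OF v(1)] by blast
      have "cl v = {v}" unfolding cl_def using False by blast
      moreover have "axis i 1 \<notin> Bad" by (rule axis[OF B1_normal_points(3,5)[OF B]])
      ultimately show ?thesis using cluster_isolated[OF K B Bad v(1)] False v(2) by metis
    next
      case True
      then obtain w where w: "w \<in> Bad" "w \<noteq> v" "share K v w" by blast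
      obtain i E D C E' D' C' where B: "B1_normal K i v E D C" "B1_normal K i w E' D' C'" using pair[OF v(1) w(1,3)] by blast
      have e: "axis i 1 \<notin> Bad" by (rule axis[OF B1_normal_points(3,5)[OF B(1)]])
      have pr: "v \<in> prim_rays K" "w \<in> prim_rays K" "v \<noteq> axis i 1" "w \<noteq> axis i 1" using Bad v w e by auto
      obtain G D1 D2 where G: "B1_normal K i v G D1 C" "B1_normal K i w G D2 C"
        using share_pair[OF B pr(1,3,2,4) w(2,3)] by metis
      have "\<exists>M. cluster K Bad {v, w} i C M"
      proof (rule cluster_pair[OF K G _ Bad v(1) w(1) e])
        show "v \<noteq> w" using w by simp
        fix x assume x: "x \<in> Bad" "x \<in> rays K C"
        have "v \<in> rays K C" "w \<in> rays K C" using pr B1_normal_points(2)[OF G(1)] B1_normal_points(2)[OF G(2)] by (auto simp: rays_def)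
        then have "{x, v, w} \<subseteq> Bad \<inter> rays K C" using x v(1) w(1) by blast
        from plane[OF B1_normal_points(7)[OF G(1)] this] show "x = v \<or> x = w" using w by blast
      qed
      then show ?thesis using two[OF v(1) w] v(2) by metis
    qed
  qed
qed

text \<open>Applies \<open>ncone_face\<close> to the forms comparing the exponents with
  \<open>P\<close>: the generators really involved in \<open>k\<close> are minimal on all of the
  minimal face of \<open>k\<close>, so adding them later does not change that face.\<close>

lemma minface_face:
  assumes R: "finite R" and k: "k \<in> ncone R" and P: "P \<in> minface K k" and dc: "\<And>r. r \<in> R \<Longrightarrow> ep r \<in> dcone K P"
  obtains R' where "R' \<subseteq> R" "k \<in> ncone R'" "\<And>r. r \<in> R' \<Longrightarrow> minface K k \<subseteq> minface K (ep r)"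
proof -
  obtain R' where R': "R' \<subseteq> R" "k \<in> ncone R'"
    "\<And>c r. (\<And>r. r \<in> R \<Longrightarrow> 0 \<le> c \<bullet> ep r) \<Longrightarrow> c \<bullet> k = 0 \<Longrightarrow> r \<in> R' \<Longrightarrow> c \<bullet> ep r = 0"
    using ncone_face[OF R k] by blast
  have "minface K k \<subseteq> minface K (ep r)" if r: "r \<in> R'" for r
  proof
    fix \<omega> assume w: "\<omega> \<in> minface K k"
    then have wK: "\<omega> \<in> K" by (simp add: minface_def)
    have "(ep \<omega> - ep P) \<bullet> ep r = 0"
    proof (rule R'(3)[OF _ _ r])
      show "0 \<le> (ep \<omega> - ep P) \<bullet> ep r'" if "r' \<in> R" for r'
        using dconeD(3)[OF dc[OF that] wK] by (simp add: inner_diff_left)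
      show "(ep \<omega> - ep P) \<bullet> k = 0" using minface_inner_eq[OF w P] by (simp add: inner_diff_left)
    qed
    moreover have "P \<in> minface K (ep r)" using dc[of r] r R'(1) by (auto simp: dcone_def)
    ultimately show "\<omega> \<in> minface K (ep r)" using wK by (simp add: minface_eq inner_diff_left)
  qed
  then show ?thesis using that R' by blast
qed

lemma ncone_cases:
  assumes x: "x \<in> ncone (R \<union> S)" and f: "finite R" "finite S"
  obtains "x \<in> ncone S" | v t where "v \<in> R" "0 < t" "x - t *\<^sub>R ep v \<in> ncone (R \<union> S)"
proof -
  obtain c where c: "\<forall>r\<in>R \<union> S. 0 \<le> c r" "x = (\<Sum>r\<in>R \<union> S. c r *\<^sub>R ep r)" using x unfolding ncone_def by blast
  have fin: "finite (R \<union> S)" using f by simp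
  show ?thesis
  proof (cases "\<exists>v\<in>R. 0 < c v")
    case True
    then obtain v where v: "v \<in> R" "0 < c v" by blast
    have "x = c v *\<^sub>R ep v + (\<Sum>r\<in>R \<union> S - {v}. c r *\<^sub>R ep r)"
      unfolding c(2) by (rule sum.remove[OF fin]) (use v in simp)
    moreover have "(\<Sum>r\<in>R \<union> S - {v}. c r *\<^sub>R ep r) \<in> ncone (R \<union> S)"
      by (rule ncone_sum) (use c(1) fin in \<open>auto intro!: ncone_scale ncone_mem\<close>)
    ultimately have "x - c v *\<^sub>R ep v \<in> ncone (R \<union> S)" by simp
    then show ?thesis using that(2) v by blast
  next
    case False
    have "c r = 0" if "r \<in> R" for r using False c(1) that by (metis UnI1 order_le_less)
    then have "x = (\<Sum>r\<in>S. c r *\<^sub>R ep r)" unfolding c(2) by (intro sum.mono_neutral_right[OF fin]) auto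
    also have "\<dots> \<in> ncone S" by (rule ncone_sum) (use c(1) f in \<open>auto intro!: ncone_scale ncone_mem\<close>)
    finally show ?thesis by (rule that(1))
  qed
qed

text \<open>Choosing a vertex \<open>P\<close> makes the contributing normals at \<open>P\<close> belong to ears at \<open>P\<close>, which can be cut off.\<close>

lemma good_cone_or_cluster:
  assumes K: "finite K" "K \<noteq> {}" and Bad: "Bad \<subseteq> prim_rays K" and U: "\<Union>\<X> = Bad"
    and cl: "\<And>X. X \<in> \<X> \<Longrightarrow> cluster K Bad X (i X) (C X) (M X)"
    and k: "\<forall>l. 1 \<le> k $ l" and no: "\<And>X. X \<in> \<X> \<Longrightarrow> k \<notin> cluster_points X (M X)"
  shows "ep k \<in> ncone {g \<in> prim_rays K - Bad. minface K (ep k) \<subseteq> minface K (ep g)}"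
proof -
  obtain P where P: "P \<in> minface K (ep k)" "extremal K P" using extremal_exists[OF K] .
  have kd: "ep k \<in> dcone K P" using P(1) by (simp add: minface_dcone)
  have PK: "P \<in> K" by (rule dconeD(1)[OF kd])
  let ?R = "rays K P" and ?G = "rays K P - Bad"
  have fR: "finite ?R" by (rule finite_rays[OF K(1)])
  have "ep k \<in> ncone ?G"
  proof (rule ncone_eliminate[OF fR _ dcone_generated[OF K(1) kd]])
    fix v assume "v \<in> ?R - ?G"
    then have v: "v \<in> Bad" "v \<in> rays K P" by auto
    then obtain X where X: "X \<in> \<X>" "v \<in> X" using U by blast
    note c = cl[OF X(1), unfolded cluster_def]
    have fin: "finite X" "finite (M X)" and dis: "M X \<inter> Bad = {}" using c by blast+
    have "\<forall>l. 0 < k $ l" using k by (metis Suc_le_eq One_nat_def)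
    moreover obtain V where "\<forall>P\<in>V. \<exists>N. ear K P X (M X) N"
      "\<forall>v\<in>X. \<forall>P k. P \<in> minface K (ep v) \<longrightarrow> P \<in> minface K (ep k) \<longrightarrow> extremal K P \<longrightarrow> (\<forall>l. 0 < k $ l) \<longrightarrow> P \<in> V"
      using c by blast
    moreover have "P \<in> minface K (ep v)" using v(2) by (simp add: rays_def)
    ultimately obtain N where N: "ear K P X (M X) N" using X(2) P by blast
    obtain M' where M': "M' \<subseteq> M X" "M' \<subseteq> rays K P" "\<forall>n\<in>M'. N \<bullet> ep n = 0"
      "\<forall>x\<in>dcone K P. 0 \<le> N \<bullet> x \<longrightarrow> x \<in> ncone ((X \<inter> rays K P) \<union> M')" and NX: "\<forall>v\<in>X. 0 < N \<bullet> ep v"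
      using N unfolding ear_def by blast
    have fM': "finite M'" using finite_subset[OF M'(1) fin(2)] .
    let ?X = "X \<inter> rays K P"
    have fX: "finite ?X" using fin by simp
    \<comment> \<open>On the positive side \<open>k\<close> would lie in the ear. A positive
      coefficient on \<open>X\<close> then makes it a cluster point, and otherwise it is in the
      wall, where \<open>N\<close> vanishes.\<close>
    have Nk: "N \<bullet> ep k \<le> 0"
    proof (rule ccontr)
      assume pos: "\<not> N \<bullet> ep k \<le> 0"
      then have "ep k \<in> ncone (?X \<union> M')" using M'(4) kd by simp
      then show False
      proof (rule ncone_cases[OF _ fX fM'])
        assume "ep k \<in> ncone M'"
        then have "N \<bullet> ep k \<le> 0"
          by (rule ncone_nonpos) (use M'(3) fM' bounded_linear.linear[OF bounded_linear_inner_right] in auto)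
        then show False using pos by simp
      next
        fix v t assume vt: "v \<in> ?X" "t > 0" "ep k - t *\<^sub>R ep v \<in> ncone (?X \<union> M')"
        have "ep k - t *\<^sub>R ep v \<in> ncone (X \<union> M X)"
          by (rule ncone_mono[OF vt(3)]) (use fin M' in auto)
        then have "k \<in> cluster_points X (M X)" using k vt unfolding cluster_points_def by blast
        then show False using no X(1) by blast
      qed
    qed
    \<comment> \<open>A positive part on \<open>X\<close> would make \<open>N\<close> positive, so
      the wall is generated by \<open>M'\<close>, which consists of normals that do not
      contribute.\<close>
    have "w \<in> ncone ?G" if w: "w \<in> ncone ?R" "N \<bullet> w = 0" for w
    proof -
      have "w \<in> dcone K P" using ncone_subset_dcone[OF w(1) fR PK] rays_dcone by blast
      then have "w \<in> ncone (?X \<union> M')" using M'(4) w(2) by simp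
      then have "w \<in> ncone M'"
      proof (rule ncone_cases[OF _ fX fM'])
        fix v t assume vt: "v \<in> ?X" "t > 0" "w - t *\<^sub>R ep v \<in> ncone (?X \<union> M')"
        have "(- N) \<bullet> (w - t *\<^sub>R ep v) \<le> 0"
          by (rule ncone_nonpos[OF vt(3), of "(\<bullet>) (- N)"])
            (use M'(3) NX fin fM' in \<open>auto simp: less_imp_le bounded_linear_inner_right bounded_linear.linear\<close>)
        moreover have "0 < t * (N \<bullet> ep v)" using vt NX by simp
        ultimately show ?thesis using w(2) by (simp add: inner_diff_right)
      qed
      then show ?thesis by (rule ncone_mono) (use M' dis fR in auto)
    qed
    then show "\<exists>N. linear N \<and> 0 < N (ep v) \<and> N (ep k) \<le> (0::real) \<and> (\<forall>w\<in>ncone ?R. N w = 0 \<longrightarrow> w \<in> ncone ?G)"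
      using Nk NX X(2) bounded_linear.linear[OF bounded_linear_inner_right[of N]] by (intro exI[of _ "(\<bullet>) N"]) blast
  qed auto
  moreover have "finite ?G" using fR by simp
  moreover have "ep r \<in> dcone K P" if "r \<in> ?G" for r using that rays_dcone by blast
  ultimately obtain R' where R': "R' \<subseteq> ?G" "ep k \<in> ncone R'" "\<And>r. r \<in> R' \<Longrightarrow> minface K (ep k) \<subseteq> minface K (ep r)"
    using minface_face[OF _ _ P(1)] by metis
  show ?thesis
    by (rule ncone_mono[OF R'(2)]) (use R'(1,3) finite_prim_rays[OF K(1)] in \<open>auto simp: rays_def\<close>)
qed

text \<open>At a vertex minimal for \<open>k\<close> an ear form separates: it is positive on
  cluster points and nonpositive on the rays of that vertex outside \<open>X\<close>.\<close>

lemma cluster_disjoint_good: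
  assumes K: "finite K" and cl: "cluster K Bad X i C M" and k: "k \<in> cluster_points X M"
  shows "ep k \<notin> ncone {g \<in> prim_rays K - Bad. minface K (ep k) \<subseteq> minface K (ep g)}"
proof
  let ?G = "{g \<in> prim_rays K - Bad. minface K (ep k) \<subseteq> minface K (ep g)}"
  assume g: "ep k \<in> ncone ?G"
  obtain P N where P: "P \<in> minface K (ep k)" and N: "ear K P X M N"
    using cl k unfolding cluster_def by metis
  have fin: "finite X" "finite M" "X \<subseteq> Bad" using cl unfolding cluster_def by blast+
  have "N \<bullet> ep k \<le> 0"
  proof (rule ncone_nonpos[OF g, of "(\<bullet>) N"])
    show "N \<bullet> ep r \<le> 0" if "r \<in> ?G" for r
      by (rule ear_nonpos[OF N _ _ fin(1,2)]) (use that P fin(3) in \<open>auto simp: rays_def\<close>)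
  qed (use finite_prim_rays[OF K] bounded_linear.linear[OF bounded_linear_inner_right] in auto)
  then show False using ear_cluster_points[OF N k fin(1,2)] by simp
qed

text \<open>A common point would be generated by rays of the second cluster that have its whole
  minimal face in theirs. These rays belong to the vertex \<open>P\<close> of the first cluster and
  avoid \<open>X\<close>, so the first ear form would be nonpositive there.\<close>

lemma clusters_disjoint:
  assumes K: "finite K" and cl: "cluster K Bad X i C M" "cluster K Bad Y j C' M'" and XY: "X \<inter> Y = {}"
  shows "cluster_points X M \<inter> cluster_points Y M' = {}"
proof (rule ccontr)
  assume "cluster_points X M \<inter> cluster_points Y M' \<noteq> {}"
  then obtain k where k: "k \<in> cluster_points X M" "k \<in> cluster_points Y M'" by blast
  obtain P N where P: "P \<in> minface K (ep k)" and N: "ear K P X M N"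
    using cl(1) k(1) unfolding cluster_def by metis
  obtain Q L where Q: "Q \<in> minface K (ep k)" and L: "ear K Q Y M' L"
    using cl(2) k(2) unfolding cluster_def by metis
  have fin: "finite X" "finite M" "X \<subseteq> Bad" and fin': "finite Y" "finite M'" "Y \<subseteq> Bad" "M' \<inter> Bad = {}"
    using clusterD(1,6,3)[OF cl(1)] clusterD(1,6,3,7)[OF cl(2)] by simp_all
  obtain M1 where M1: "M1 \<subseteq> M'" "M1 \<subseteq> rays K Q"
    "\<forall>x\<in>dcone K Q. 0 \<le> L \<bullet> x \<longrightarrow> x \<in> ncone ((Y \<inter> rays K Q) \<union> M1)" using L unfolding ear_def by blast
  let ?R = "(Y \<inter> rays K Q) \<union> M1"
  have fR: "finite ?R" using fin' finite_subset[OF M1(1)] by simp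
  have "0 < L \<bullet> ep k" by (rule ear_cluster_points[OF L k(2) fin'(1,2)])
  then have "ep k \<in> ncone ?R" using M1(3) Q by (simp add: minface_dcone)
  moreover have "ep r \<in> dcone K Q" if "r \<in> ?R" for r using that M1(2) rays_dcone by blast
  ultimately obtain R' where R': "R' \<subseteq> ?R" "ep k \<in> ncone R'" "\<And>r. r \<in> R' \<Longrightarrow> minface K (ep k) \<subseteq> minface K (ep r)"
    using minface_face[OF fR _ Q] by metis
  have "N \<bullet> ep k \<le> 0"
  proof (rule ncone_nonpos[OF R'(2), of "(\<bullet>) N"])
    show "N \<bullet> ep r \<le> 0" if "r \<in> R'" for r
    proof (rule ear_nonpos[OF N _ _ fin(1,2)])
      show "r \<in> rays K P" using that R'(1,3) M1(2) P by (auto simp: rays_def)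
      show "r \<notin> X" using that R'(1) M1(1) fin(3) fin'(4) XY by blast
    qed
  qed (use finite_subset[OF R'(1) fR] bounded_linear.linear[OF bounded_linear_inner_right] in auto)
  then show False using ear_cluster_points[OF N k(1) fin(1,2)] by simp
qed

section \<open>Reduction modulo p\<close>

lemma padic_residue_add:
  fixes x y :: "'p::prime_card padic"
  assumes "x \<in> padic_integers" "y \<in> padic_integers"
  shows "padic_residue (x + y) = padic_residue x + padic_residue y"
proof -
  obtain m n where m: "padic_norm (x - of_int m) < 1" and n: "padic_norm (y - of_int n) < 1"
    using assms padic_integers_residue_ex by metis
  have "padic_norm ((x - of_int m) + (y - of_int n)) < 1" by (rule padic_norm_add_less[OF m n])
  then have "padic_norm ((x + y) - of_int (m + n)) < 1" by (simp add: algebra_simps)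
  from padic_residueI[OF this] show ?thesis using padic_residueI[OF m] padic_residueI[OF n] by simp
qed

lemma padic_residue_mult:
  fixes x y :: "'p::prime_card padic"
  assumes "x \<in> padic_integers" "y \<in> padic_integers"
  shows "padic_residue (x * y) = padic_residue x * padic_residue y"
proof -
  obtain m n where m: "padic_norm (x - of_int m) < 1" and n: "padic_norm (y - of_int n) < 1"
    using assms padic_integers_residue_ex by metis
  have "padic_norm ((x - of_int m) * y + of_int m * (y - of_int n)) < 1"
  proof (rule padic_norm_add_less)
    show "padic_norm ((x - of_int m) * y) < 1"
      using m assms(2) padic_norm_nonneg[of y] padic_norm_nonneg[of "x - of_int m"]
      unfolding padic_norm_mult padic_integers_def by (metis mem_Collect_eq mult_left_le order_le_less_trans)
    show "padic_norm (of_int m * (y - of_int n)) < 1"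
      using n padic_norm_of_int_le[of m, where 'p='p] padic_norm_nonneg[of "y - of_int n"]
      unfolding padic_norm_mult by (metis mult_left_le mult.commute order_le_less_trans)
  qed
  then have "padic_norm (x * y - of_int (m * n)) < 1" by (simp add: algebra_simps)
  from padic_residueI[OF this] show ?thesis using padic_residueI[OF m] padic_residueI[OF n] by simp
qed

lemma padic_residue_of_int: "padic_residue (of_int m :: 'p::prime_card padic) = of_int m"
  by (rule padic_residueI) simp

lemma padic_residue_simps [simp]: "padic_residue (0 :: 'p::prime_card padic) = 0" "padic_residue (1 :: 'p padic) = 1"
    "padic_residue (of_nat n :: 'p padic) = of_nat n"
  using padic_residue_of_int[of 0, where 'p='p] padic_residue_of_int[of 1, where 'p='p] padic_residue_of_int[of "int n", where 'p='p] by simp_all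

lemma padic_residue_eq_0_iff:
  fixes x :: "'p::prime_card padic"
  assumes "x \<in> padic_integers"
  shows "padic_residue x = 0 \<longleftrightarrow> padic_norm x < 1"
proof
  assume "padic_norm x < 1"
  then have "padic_norm (x - of_int 0) < 1" by simp
  from padic_residueI[OF this] show "padic_residue x = 0" by simp
next
  assume 0: "padic_residue x = 0"
  obtain m where m: "padic_norm (x - of_int m) < 1" using assms padic_integers_residue_ex by metis
  then have "of_int m = (0 :: 'p mod_ring)" using padic_residueI[OF m] 0 by simp
  then have "int CARD('p) dvd m" unfolding of_int_of_int_mod_ring by transfer (simp add: dvd_eq_mod_eq_0)
  then have "padic_norm (of_int m :: 'p padic) < 1" by (simp only: padic_norm_of_int_less_1)
  from padic_norm_add_less[OF m this] show "padic_norm x < 1" by simp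
qed

lemma padic_integers_closed:
  "0 \<in> (padic_integers :: 'p::prime_card padic set)" "1 \<in> (padic_integers :: 'p::prime_card padic set)"
  "of_nat n \<in> (padic_integers :: 'p::prime_card padic set)"
  "x \<in> padic_integers \<Longrightarrow> y \<in> padic_integers \<Longrightarrow> x * (y :: 'p padic) \<in> padic_integers"
  "x \<in> padic_integers \<Longrightarrow> y \<in> padic_integers \<Longrightarrow> x + (y :: 'p padic) \<in> padic_integers"
  using padic_norm_of_nat_le[of n, where 'p='p]
  by (auto simp: padic_integers_def padic_norm_mult padic_norm_nonneg mult_le_one padic_norm_add_le)

lemma padic_residue_prod:
  assumes "\<And>i. i \<in> A \<Longrightarrow> c i \<in> (padic_integers :: 'p::prime_card padic set)"
  shows "padic_residue (prod c A) = (\<Prod>i\<in>A. padic_residue (c i)) \<and> prod c A \<in> padic_integers"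
  using assms by (induction A rule: infinite_finite_induct) (auto simp: padic_residue_mult padic_integers_closed)

lemma padic_residue_sum:
  assumes "\<And>i. i \<in> A \<Longrightarrow> c i \<in> (padic_integers :: 'p::prime_card padic set)"
  shows "padic_residue (sum c A) = (\<Sum>i\<in>A. padic_residue (c i)) \<and> sum c A \<in> padic_integers"
  using assms by (induction A rule: infinite_finite_induct) (auto simp: padic_residue_add padic_integers_closed)

lemma padic_residue_power:
  assumes "x \<in> (padic_integers :: 'p::prime_card padic set)"
  shows "padic_residue (x ^ n) = padic_residue x ^ n \<and> x ^ n \<in> padic_integers"
  using assms by (induction n) (auto simp: padic_residue_mult padic_integers_closed)

lemma padic_residue_mono:
  fixes u :: "'p::prime_card padic ^ 'n::finite"
  assumes "\<And>i. u $ i \<in> padic_integers"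
  shows "padic_residue (mono_eval \<omega> u) = mono_eval \<omega> (\<chi> i. padic_residue (u $ i)) \<and> mono_eval \<omega> u \<in> padic_integers"
  unfolding mono_eval_def using padic_residue_prod[of UNIV "\<lambda>i. u $ i ^ (\<omega> $ i)"] padic_residue_power[OF assms] by simp

text \<open>Multiplication by the coordinate undoes the shift of exponents. On the torus the factor
  is nonzero, so \<open>theta\<close> can replace the derivatives in the non-degeneracy
  condition.\<close>

lemma eval_pderiv:
  fixes f :: "('a::comm_ring_1, 'n::finite) multipoly"
  shows "x $ i * multipoly_eval (multipoly_pderiv i f) x = theta i f x"
proof -
  let ?e = "axis i 1 :: nat ^ 'n"
  define A where "A = {\<omega>. \<omega> + ?e \<in> supp f}"
  have inj: "inj_on (\<lambda>\<omega>. \<omega> + ?e) A" by (simp add: inj_on_def)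
  have fin: "finite A" unfolding A_def
    using finite_vimageI[of "supp f" "\<lambda>\<omega>. \<omega> + ?e"] by (simp add: vimage_def inj_def)
  have lk: "Poly_Mapping.lookup (multipoly_pderiv i f) \<omega> = of_nat (\<omega> $ i + 1) * Poly_Mapping.lookup f (\<omega> + ?e)" for \<omega>
    by (simp add: multipoly_pderiv.rep_eq)
  have sub: "supp (multipoly_pderiv i f) \<subseteq> A"
    by (auto simp: A_def in_keys_iff lk)
  have me: "mono_eval (\<omega> + ?e) x = x $ i * mono_eval \<omega> x" for \<omega>
  proof -
    have "mono_eval (\<omega> + ?e) x = (\<Prod>l\<in>UNIV. x $ l ^ (\<omega> $ l)) * (\<Prod>l\<in>UNIV. x $ l ^ (?e $ l))"
      by (simp add: mono_eval_def power_add prod.distrib)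
    also have "(\<Prod>l\<in>UNIV. x $ l ^ (?e $ l)) = (\<Prod>l\<in>{i}. x $ l ^ (?e $ l))"
      by (rule prod.mono_neutral_right) (auto simp: axis_def)
    finally show ?thesis by (simp add: mono_eval_def mult.commute)
  qed
  have "x $ i * multipoly_eval (multipoly_pderiv i f) x = x $ i * (\<Sum>\<omega>\<in>A. Poly_Mapping.lookup (multipoly_pderiv i f) \<omega> * mono_eval \<omega> x)"
    unfolding multipoly_eval_mono by (subst sum.mono_neutral_left[OF fin sub]) (auto simp: in_keys_iff)
  also have "\<dots> = (\<Sum>\<omega>\<in>A. Poly_Mapping.lookup f (\<omega> + ?e) * of_nat ((\<omega> + ?e) $ i) * mono_eval (\<omega> + ?e) x)"
    unfolding sum_distrib_left by (rule sum.cong) (simp_all add: lk me me[unfolded One_nat_def] algebra_simps)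
  also have "\<dots> = (\<Sum>\<omega>\<in>(\<lambda>\<omega>. \<omega> + ?e) ` A. Poly_Mapping.lookup f \<omega> * of_nat (\<omega> $ i) * mono_eval \<omega> x)"
    by (rule sum.reindex_cong[OF inj refl, symmetric]) simp
  also have "\<dots> = theta i f x"
    unfolding theta_def
  proof (rule sum.mono_neutral_left)
    show "\<forall>\<omega>\<in>supp f - (\<lambda>\<omega>. \<omega> + ?e) ` A. Poly_Mapping.lookup f \<omega> * of_nat (\<omega> $ i) * mono_eval \<omega> x = 0"
    proof
      fix \<omega> assume w: "\<omega> \<in> supp f - (\<lambda>\<omega>. \<omega> + ?e) ` A"
      have "\<omega> $ i = 0"
      proof (rule ccontr)
        assume "\<omega> $ i \<noteq> 0"
        then have e: "\<omega> = (\<chi> l. \<omega> $ l - ?e $ l) + ?e" by (auto simp: vec_eq_iff axis_def)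
        moreover have "(\<chi> l. \<omega> $ l - ?e $ l) \<in> A" using w e by (simp add: A_def)
        ultimately show False using w by blast
      qed
      then show "Poly_Mapping.lookup f \<omega> * of_nat (\<omega> $ i) * mono_eval \<omega> x = 0" by simp
    qed
  qed (auto simp: A_def)
  finally show ?thesis .
qed

text \<open>Strict positivity of \<open>x\<close> makes the face compact, so that the definition of
  non-degeneracy applies to it.\<close>

lemma nondegenerate_face:
  fixes f :: "('p::prime_card padic, 'n::finite) multipoly" and u :: "'p mod_ring ^ 'n"
  assumes nd: "nondegenerate f" and x: "x \<in> dcone (supp f) P" "\<And>i. 0 < x $ i" and u: "\<And>i. u $ i \<noteq> 0"
    and z: "(\<Sum>\<omega>\<in>minface (supp f) x. padic_residue (Poly_Mapping.lookup f \<omega>) * mono_eval \<omega> u) = 0"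
  shows "\<exists>i. (\<Sum>\<omega>\<in>minface (supp f) x. padic_residue (Poly_Mapping.lookup f \<omega>) * of_nat (\<omega> $ i) * mono_eval \<omega> u) \<noteq> 0"
proof -
  define g where "g = Poly_Mapping.map padic_residue (face_poly f (newton_tau f x))"
  have x0: "x \<noteq> 0" using x(2) by (metis less_irrefl zero_index)
  have lk: "Poly_Mapping.lookup g \<omega> = (if \<omega> \<in> minface (supp f) x then padic_residue (Poly_Mapping.lookup f \<omega>) else 0)" for \<omega>
  proof (cases "\<omega> \<in> supp f")
    case True
    then show ?thesis using ep_in_tau_iff[OF x(1) True]
      by (simp add: g_def Poly_Mapping.map.rep_eq face_poly.rep_eq when_def in_keys_iff)
  next
    case False
    then have "\<omega> \<notin> minface (supp f) x" by (simp add: minface_def)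
    then show ?thesis using False by (simp add: g_def Poly_Mapping.map.rep_eq face_poly.rep_eq when_def in_keys_iff)
  qed
  have sub: "supp g \<subseteq> minface (supp f) x" by (auto simp: in_keys_iff lk split: if_splits)
  have fin: "finite (minface (supp f) x)" by (simp add: minface_def)
  have "multipoly_eval g u = (\<Sum>\<omega>\<in>minface (supp f) x. Poly_Mapping.lookup g \<omega> * mono_eval \<omega> u)"
    unfolding multipoly_eval_mono by (rule sum.mono_neutral_left[OF fin sub]) (auto simp: in_keys_iff)
  also have "\<dots> = 0" using z by (simp add: lk)
  finally have "multipoly_eval g u = 0" .
  moreover have "newton_face f (newton_tau f x)" "compact (newton_tau f x)"
    using newton_face_tau[OF x(1) x0] compact_newton_tau[OF x] by blast+
  ultimately obtain i where i: "multipoly_eval (multipoly_pderiv i g) u \<noteq> 0"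
    using nd u unfolding nondegenerate_def Let_def g_def by blast
  have "theta i g u = (\<Sum>\<omega>\<in>minface (supp f) x. Poly_Mapping.lookup g \<omega> * of_nat (\<omega> $ i) * mono_eval \<omega> u)"
    unfolding theta_def by (rule sum.mono_neutral_left[OF fin sub]) (auto simp: in_keys_iff)
  moreover have "theta i g u \<noteq> 0" unfolding eval_pderiv[symmetric] using i u[of i] by simp
  ultimately show ?thesis by (intro exI[of _ i]) (simp add: lk)
qed

text \<open>Up to the next level, \<open>y\<close> is p^m times the sum of the coefficients on the
  minimal face, where m is \<open>dotn P k\<close>; whether \<open>y\<close> drops below level m is
  decided by the residue of that sum.\<close>

lemma leading_part:
  fixes c :: "nat ^ 'n::finite \<Rightarrow> 'p::prime_card padic"
  assumes K: "finite K" and P: "P \<in> K" and min: "\<And>\<omega>. \<omega> \<in> K \<Longrightarrow> dotn P k \<le> dotn \<omega> k" and c: "\<And>\<omega>. c \<omega> \<in> padic_integers"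
    and \<phi>: "\<phi> = {\<omega>\<in>K. dotn \<omega> k = dotn P k}"
  defines "y \<equiv> \<Sum>\<omega>\<in>K. c \<omega> * padic_p ^ dotn \<omega> k"
  shows "padic_norm y \<le> pinv TYPE('p) ^ dotn P k"
    "padic_norm y < pinv TYPE('p) ^ dotn P k \<longleftrightarrow> (\<Sum>\<omega>\<in>\<phi>. padic_residue (c \<omega>)) = 0"
proof -
  let ?q = "pinv TYPE('p)"
  let ?m = "dotn P k"
  define S where "S = sum c \<phi>"
  have S: "padic_residue S = (\<Sum>\<omega>\<in>\<phi>. padic_residue (c \<omega>))" "S \<in> padic_integers"
    unfolding S_def using padic_residue_sum[of \<phi> c] c by auto
  have nS: "padic_norm (padic_p ^ ?m * S) = ?q ^ ?m * padic_norm S"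
    by (simp only: padic_norm_mult padic_norm_p_power)
  have split: "y = padic_p ^ ?m * S + (\<Sum>\<omega>\<in>K - \<phi>. c \<omega> * padic_p ^ dotn \<omega> k)"
  proof -
    have "y = (\<Sum>\<omega>\<in>\<phi>. c \<omega> * padic_p ^ dotn \<omega> k) + (\<Sum>\<omega>\<in>K - \<phi>. c \<omega> * padic_p ^ dotn \<omega> k)"
      unfolding y_def by (subst add.commute, rule sum.subset_diff) (use K \<phi> in auto)
    also have "(\<Sum>\<omega>\<in>\<phi>. c \<omega> * padic_p ^ dotn \<omega> k) = padic_p ^ ?m * S"
      unfolding S_def sum_distrib_left by (rule sum.cong) (auto simp: \<phi> mult.commute)
    finally show ?thesis .
  qed
  have rest: "padic_norm (\<Sum>\<omega>\<in>K - \<phi>. c \<omega> * padic_p ^ dotn \<omega> k) \<le> ?q ^ Suc ?m"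
  proof (rule padic_norm_sum_le)
    fix \<omega> assume "\<omega> \<in> K - \<phi>"
    then have "Suc ?m \<le> dotn \<omega> k" using min[of \<omega>] by (auto simp: \<phi>)
    then have "?q ^ dotn \<omega> k \<le> ?q ^ Suc ?m" by (simp only: pinv_power_le_iff)
    moreover have "padic_norm (c \<omega> * padic_p ^ dotn \<omega> k) = padic_norm (c \<omega>) * ?q ^ dotn \<omega> k"
      by (simp only: padic_norm_mult padic_norm_p_power)
    moreover have "padic_norm (c \<omega>) * ?q ^ dotn \<omega> k \<le> 1 * ?q ^ dotn \<omega> k"
      by (rule mult_right_mono) (use c[of \<omega>] in \<open>simp_all add: padic_integers_def\<close>)
    ultimately show "padic_norm (c \<omega> * padic_p ^ dotn \<omega> k) \<le> ?q ^ Suc ?m" by linarith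
  qed simp
  have lt: "?q ^ Suc ?m < ?q ^ ?m" by (simp only: pinv_power_less_iff)
  have q0: "0 < ?q ^ ?m" by (rule pinv_power_pos)
  have "padic_norm S \<le> 1" using S(2) by (simp add: padic_integers_def)
  then have "?q ^ ?m * padic_norm S \<le> ?q ^ ?m * 1" by (rule mult_left_mono) (use q0 in simp)
  then show "padic_norm y \<le> ?q ^ ?m" unfolding split
    by (intro padic_norm_add_le) (use nS rest lt in linarith)+
  have "padic_norm y < ?q ^ ?m \<longleftrightarrow> padic_norm (padic_p ^ ?m * S) < ?q ^ ?m"
  proof
    assume "padic_norm y < ?q ^ ?m"
    moreover have "padic_norm (- (\<Sum>\<omega>\<in>K - \<phi>. c \<omega> * padic_p ^ dotn \<omega> k)) < ?q ^ ?m"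
      unfolding padic_norm_minus using rest lt by linarith
    ultimately have "padic_norm (y + - (\<Sum>\<omega>\<in>K - \<phi>. c \<omega> * padic_p ^ dotn \<omega> k)) < ?q ^ ?m" by (rule padic_norm_add_less)
    moreover have "y + - (\<Sum>\<omega>\<in>K - \<phi>. c \<omega> * padic_p ^ dotn \<omega> k) = padic_p ^ ?m * S" by (simp add: split)
    ultimately show "padic_norm (padic_p ^ ?m * S) < ?q ^ ?m" by (simp only:)
  next
    assume "padic_norm (padic_p ^ ?m * S) < ?q ^ ?m"
    then show "padic_norm y < ?q ^ ?m" unfolding split by (rule padic_norm_add_less) (use rest lt in linarith)
  qed
  also have "\<dots> \<longleftrightarrow> padic_norm S < 1" unfolding nS using q0 by simp
  also have "\<dots> \<longleftrightarrow> (\<Sum>\<omega>\<in>\<phi>. padic_residue (c \<omega>)) = 0" using padic_residue_eq_0_iff[OF S(2)] S(1) by simp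
  finally show "padic_norm y < ?q ^ ?m \<longleftrightarrow> (\<Sum>\<omega>\<in>\<phi>. padic_residue (c \<omega>)) = 0" .
qed

lemma dotn_minface:
  assumes "P \<in> minface K (ep k)"
  shows "P \<in> K" "\<And>\<omega>. \<omega> \<in> K \<Longrightarrow> dotn P k \<le> dotn \<omega> k" "minface K (ep k) = {\<omega>\<in>K. dotn \<omega> k = dotn P k}"
proof -
  have e: "ep \<omega> \<bullet> ep k = real (dotn \<omega> k)" for \<omega> by (simp add: inner_vec_def)
  show "P \<in> K" "\<And>\<omega>. \<omega> \<in> K \<Longrightarrow> dotn P k \<le> dotn \<omega> k" using assms by (auto simp only: minface_def e of_nat_le_iff mem_Collect_eq)
  show "minface K (ep k) = {\<omega>\<in>K. dotn \<omega> k = dotn P k}" unfolding minface_eq[OF assms] by (simp only: e of_nat_eq_iff)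
qed

text \<open>The point is written as p^k u with units u, and the leading parts of \<open>f\<close>
  and of all \<open>theta i f\<close> are compared at the reduction of u, which lies in the
  torus.\<close>

lemma nondegenerate_shell:
  fixes f :: "('p::prime_card padic, 'n::finite) multipoly"
  assumes int: "\<And>\<omega>. Poly_Mapping.lookup f \<omega> \<in> padic_integers" and nd: "nondegenerate f"
    and k: "\<And>i. 0 < k $ i" and P: "P \<in> minface (supp f) (ep k)"
    and x: "x \<in> shell k" "padic_norm (multipoly_eval f x) < pinv TYPE('p) ^ dotn P k"
  shows "\<exists>i. padic_norm (theta i f x) = pinv TYPE('p) ^ dotn P k"
proof -
  obtain u :: "'p padic ^ 'n" where u: "u \<in> shell 0" "x = padic_scale k u" using x(1) unfolding shell_eq_scale[of k] by blast
  have u1: "padic_norm (u $ i) = 1" for i using u(1) by (simp add: shell_def)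
  then have ui: "u $ i \<in> padic_integers" for i by (simp add: padic_integers_def)
  define v where "v = (\<chi> i. padic_residue (u $ i))"
  have v0: "v $ i \<noteq> 0" for i using padic_residue_eq_0_iff[OF ui[of i]] u1[of i] by (simp add: v_def)
  have mono: "padic_residue (mono_eval \<omega> u) = mono_eval \<omega> v" "mono_eval \<omega> u \<in> padic_integers" for \<omega>
    using padic_residue_mono[of u \<omega>] ui unfolding v_def by blast+
  note dm = dotn_minface[OF P]
  have ev: "multipoly_eval f x = (\<Sum>\<omega>\<in>supp f. (Poly_Mapping.lookup f \<omega> * mono_eval \<omega> u) * padic_p ^ dotn \<omega> k)"
    unfolding multipoly_eval_mono u(2) mono_eval_scale by (simp add: mult_ac)
  have th: "theta i f x = (\<Sum>\<omega>\<in>supp f. (Poly_Mapping.lookup f \<omega> * of_nat (\<omega> $ i) * mono_eval \<omega> u) * padic_p ^ dotn \<omega> k)" for i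
    unfolding theta_def u(2) mono_eval_scale by (simp add: mult_ac)
  have c1: "Poly_Mapping.lookup f \<omega> * mono_eval \<omega> u \<in> padic_integers" for \<omega> using int mono by (simp add: padic_integers_closed)
  have c2: "Poly_Mapping.lookup f \<omega> * of_nat (\<omega> $ i) * mono_eval \<omega> u \<in> padic_integers" for \<omega> i using int mono by (simp add: padic_integers_closed)
  have "(\<Sum>\<omega>\<in>minface (supp f) (ep k). padic_residue (Poly_Mapping.lookup f \<omega> * mono_eval \<omega> u)) = 0"
    using leading_part(2)[where c = "\<lambda>\<omega>. Poly_Mapping.lookup f \<omega> * mono_eval \<omega> u", OF finite_keys dm(1,2) c1 dm(3)] x(2)
    unfolding ev by blast
  then have "(\<Sum>\<omega>\<in>minface (supp f) (ep k). padic_residue (Poly_Mapping.lookup f \<omega>) * mono_eval \<omega> v) = 0"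
    using int mono by (simp add: padic_residue_mult)
  then obtain i where "(\<Sum>\<omega>\<in>minface (supp f) (ep k). padic_residue (Poly_Mapping.lookup f \<omega>) * of_nat (\<omega> $ i) * mono_eval \<omega> v) \<noteq> 0"
    using nondegenerate_face[OF nd _ _ v0, of "ep k" P] P k by (auto simp: dcone_def)
  then have "(\<Sum>\<omega>\<in>minface (supp f) (ep k). padic_residue (Poly_Mapping.lookup f \<omega> * of_nat (\<omega> $ i) * mono_eval \<omega> u)) \<noteq> 0"
    using int mono by (simp add: padic_residue_mult padic_integers_closed)
  then have "\<not> padic_norm (theta i f x) < pinv TYPE('p) ^ dotn P k"
    using leading_part(2)[where c = "\<lambda>\<omega>. Poly_Mapping.lookup f \<omega> * of_nat (\<omega> $ i) * mono_eval \<omega> u", OF finite_keys dm(1,2) c2 dm(3)]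
    unfolding th by blast
  moreover have "padic_norm (theta i f x) \<le> pinv TYPE('p) ^ dotn P k"
    using leading_part(1)[where c = "\<lambda>\<omega>. Poly_Mapping.lookup f \<omega> * of_nat (\<omega> $ i) * mono_eval \<omega> u", OF finite_keys dm(1,2) c2 dm(3)]
    unfolding th by blast
  ultimately show ?thesis by (intro exI[of _ i]) linarith
qed

text \<open>On a face consisting of one monomial, a coefficient divisible by p would make every
  point of the torus a common zero; the vector of ones serves.\<close>

lemma nondegenerate_unit:
  fixes f :: "('p::prime_card padic, 'n::finite) multipoly"
  assumes int: "\<And>\<omega>. Poly_Mapping.lookup f \<omega> \<in> padic_integers" and nd: "nondegenerate f"
    and x: "\<And>i. 0 < x $ i" and C: "minface (supp f) x = {C}"
  shows "padic_norm (Poly_Mapping.lookup f C) = 1"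
proof (rule ccontr)
  assume "padic_norm (Poly_Mapping.lookup f C) \<noteq> 1"
  then have "padic_norm (Poly_Mapping.lookup f C) < 1" using int[of C] by (simp add: padic_integers_def)
  then have z: "padic_residue (Poly_Mapping.lookup f C) = 0" using padic_residue_eq_0_iff[OF int] by blast
  have "x \<in> dcone (supp f) C" using x C by (auto simp: dcone_def less_imp_le)
  from nondegenerate_face[OF nd this x, of "\<chi> i. 1"] show False by (simp add: C z)
qed

section \<open>Regrouping the zeta function\<close>

lemma infsum_finite_UN:
  fixes F :: "'a \<Rightarrow> complex"
  assumes "finite A" "\<And>a b. a \<in> A \<Longrightarrow> b \<in> A \<Longrightarrow> a \<noteq> b \<Longrightarrow> S a \<inter> S b = {}" "F summable_on (\<Union>a\<in>A. S a)"
  shows "infsum F (\<Union>a\<in>A. S a) = (\<Sum>a\<in>A. infsum F (S a))"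
  using assms
proof (induction A rule: finite_induct)
  case (insert a A)
  have sm: "F summable_on S a" "F summable_on (\<Union>a\<in>A. S a)"
    by (rule summable_on_subset_banach[OF insert.prems(2)]; blast)+
  have "S a \<inter> (\<Union>a\<in>A. S a) = {}" using insert.prems(1) insert.hyps(2) by blast
  then have "infsum F (S a \<union> (\<Union>a\<in>A. S a)) = infsum F (S a) + infsum F (\<Union>a\<in>A. S a)"
    by (rule infsum_Un_disjoint[OF sm])
  then show ?case using insert.IH[OF _ sm(2)] insert.prems(1) insert.hyps by simp
qed simp

lemma regular_at_UN:
  assumes A: "finite A" "\<And>a b. a \<in> A \<Longrightarrow> b \<in> A \<Longrightarrow> a \<noteq> b \<Longrightarrow> S a \<inter> S b = {}"
    and F: "\<And>s. Re s > 0 \<Longrightarrow> (\<lambda>k. F k s) summable_on (\<Union>a\<in>A. S a)"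
    and r: "\<And>a. a \<in> A \<Longrightarrow> regular_at s0 (\<lambda>s. infsum (\<lambda>k. F k s) (S a))"
  shows "regular_at s0 (\<lambda>s. infsum (\<lambda>k. F k s) (\<Union>a\<in>A. S a))"
proof (rule regular_at_cong)
  show "infsum (\<lambda>k. F k s) (\<Union>a\<in>A. S a) = (\<Sum>a\<in>A. infsum (\<lambda>k. F k s) (S a))" if "Re s > 0" for s
    by (rule infsum_finite_UN[OF A F[OF that]])
qed (rule regular_at_sum[OF A(1) r])

lemma minface_add:
  assumes "\<phi> = minface K x" "\<phi> \<subseteq> minface K y" "\<phi> \<noteq> {}"
  shows "minface K (x + y) = \<phi>"
proof -
  obtain P where P: "P \<in> minface K x" "P \<in> minface K y" using assms by blast
  then have PK: "P \<in> K" and low: "\<And>\<omega>. \<omega> \<in> K \<Longrightarrow> ep P \<bullet> x \<le> ep \<omega> \<bullet> x" "\<And>\<omega>. \<omega> \<in> K \<Longrightarrow> ep P \<bullet> y \<le> ep \<omega> \<bullet> y"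
    by (auto simp: minface_def)
  then have Pxy: "P \<in> minface K (x + y)" by (auto simp: minface_def inner_add_right intro: add_mono)
  show ?thesis
  proof (intro equalityI subsetI)
    fix \<omega> assume w: "\<omega> \<in> minface K (x + y)"
    then have wK: "\<omega> \<in> K" by (simp add: minface_def)
    have "ep \<omega> \<bullet> (x + y) = ep P \<bullet> (x + y)" by (rule minface_inner_eq[OF w Pxy])
    then have "ep \<omega> \<bullet> x = ep P \<bullet> x" using low[OF wK] unfolding inner_add_right by linarith
    then show "\<omega> \<in> \<phi>" using wK unfolding assms(1) minface_eq[OF P(1)] by simp
  next
    fix \<omega> assume "\<omega> \<in> \<phi>"
    then have "\<omega> \<in> minface K x" "\<omega> \<in> minface K y" using assms by auto
    then have "\<omega> \<in> K" "ep \<omega> \<bullet> x = ep P \<bullet> x" "ep \<omega> \<bullet> y = ep P \<bullet> y"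
      using minface_inner_eq P by (simp add: minface_def, blast+)
    then show "\<omega> \<in> minface K (x + y)" unfolding minface_eq[OF Pxy] by (simp add: inner_add_right)
  qed
qed

lemma zeta_weight_minface:
  assumes "P \<in> minface K (ep v)" "Q \<in> minface K (ep v)"
  shows "zeta_weight p P v s = zeta_weight p Q v s"
proof -
  have "dotn Q v = dotn P v" using dotn_minface(3)[OF assms(1)] assms(2) by simp
  then show ?thesis unfolding zeta_weight_def by simp
qed

lemma zeta_weight_axis: "zeta_weight p P (axis i 1) s = exp (- of_real (ln (real p)) * (1 + of_nat (P $ i) * s))"
proof -
  have "(\<Sum>l\<in>UNIV. axis i 1 $ l) = (1 :: nat)" by (simp add: axis_def)
  moreover have "dotn P (axis i 1) = P $ i" by (simp add: axis_def if_distrib[of "\<lambda>x. _ * x"] cong: if_cong)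
  ultimately show ?thesis unfolding zeta_weight_def by simp
qed

text \<open>Two cases occur: at height 0 the weight is 1/p, and at height 1 it is p^(-1-s0), which
  is excluded by the assumption on \<open>Re s0\<close>.\<close>

lemma zeta_weight_axis_neq_1:
  assumes p: "2 \<le> p" and P: "Re s0 * real (P $ i) \<noteq> -1"
  shows "zeta_weight p P (axis i 1) s0 \<noteq> 1"
proof
  assume "zeta_weight p P (axis i 1) s0 = 1"
  then have "norm (zeta_weight p P (axis i 1) s0) = 1" by simp
  then have "ln (real p) * (1 + real (P $ i) * Re s0) = 0" unfolding zeta_weight_axis norm_exp_eq_Re by simp
  then show False using p P by (simp add: mult.commute add_eq_0_iff)
qed

context haar_poly
begin

text \<open>Fixing the minimal face \<open>\<phi>\<close> makes the local factor constant on the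
  cell, and generators minimal on all of \<open>\<phi>\<close> leave the cell stable.\<close>

lemma good_cell_regular:
  assumes nd: "nondegenerate f" and s0: "Re s0 \<noteq> -1" and P: "P \<in> \<phi>" and G: "finite G"
    and g: "\<And>g. g \<in> G \<Longrightarrow> \<phi> \<subseteq> minface (supp f) (ep g) \<and> zeta_weight CARD('p) P g s0 \<noteq> 1"
  defines "T \<equiv> {k. (\<forall>l. 1 \<le> k $ l) \<and> minface (supp f) (ep k) = \<phi> \<and> ep k \<in> ncone G}"
  shows "regular_at s0 (\<lambda>s. infsum (\<lambda>k. ser (shell k) s) T)"
proof (rule regular_at_cong)
  fix s :: complex assume s: "Re s > 0"
  have "ser (shell k) s = zeta_weight CARD('p) P k s * local_factor (face_measure \<phi>) s" if k: "k \<in> T" for k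
  proof -
    have Pk: "P \<in> minface (supp f) (ep k)" and pos: "\<And>l. 0 < k $ l" using k P by (auto simp: T_def Suc_le_eq)
    note dm = dotn_minface[OF Pk]
    have "ser (shell k) s = zeta_weight CARD('p) P k s *
        local_factor (face_measure {\<omega>\<in>supp f. dotn \<omega> k = dotn P k}) s"
      by (rule ser_shell[OF dm(1,2) nondegenerate_shell[OF integral nd pos Pk] s])
    also have "{\<omega>\<in>supp f. dotn \<omega> k = dotn P k} = \<phi>" using dm(3) k by (simp add: T_def)
    finally show ?thesis .
  qed
  then have "infsum (\<lambda>k. ser (shell k) s) T = infsum (\<lambda>k. zeta_weight CARD('p) P k s * local_factor (face_measure \<phi>) s) T"
    by (rule infsum_cong)
  also have "\<dots> = infsum (\<lambda>k. zeta_weight CARD('p) P k s) T * local_factor (face_measure \<phi>) s"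
    by (rule infsum_cmult_left')
  finally show "infsum (\<lambda>k. ser (shell k) s) T = infsum (\<lambda>k. zeta_weight CARD('p) P k s) T * local_factor (face_measure \<phi>) s" .
next
  have "k + r \<in> T" if k: "k \<in> T" and r: "r \<in> G" for k r
  proof -
    have "minface (supp f) (ep k + ep r) = \<phi>"
      by (rule minface_add) (use k g[OF r] P in \<open>auto simp: T_def\<close>)
    moreover have "ep k + ep r \<in> ncone G" using k ncone_mem[OF G r] by (intro ncone_add) (auto simp: T_def)
    ultimately show ?thesis using k by (auto simp: T_def exponent_point_add trans_le_add1)
  qed
  then have "regular_at s0 (\<lambda>s. infsum (\<lambda>k. zeta_weight CARD('p) P k s) T)"
    by (intro regular_at_cone_series[OF card_ge_2 G]) (use g in \<open>auto simp: T_def\<close>)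
  then show "regular_at s0 (\<lambda>s. infsum (\<lambda>k. zeta_weight CARD('p) P k s) T * local_factor (face_measure \<phi>) s)"
    by (intro regular_at_mult local_factor_regular s0)
qed

end

locale haar_poly_3 = haar_poly \<mu> f
  for \<mu> :: "('p::prime_card padic ^ 3) measure" and f :: "('p padic, 3) multipoly"
begin

lemma cluster_regular:
  assumes nd: "nondegenerate f" and s0: "Re s0 \<noteq> -1" and cl: "cluster (supp f) Bad X i C M"
    and good: "\<And>r. r \<in> rays (supp f) C \<Longrightarrow> r \<notin> Bad \<Longrightarrow> zeta_weight CARD('p) C r s0 \<noteq> 1"
    and sm: "\<And>s. Re s > 0 \<Longrightarrow> (\<lambda>k. ser (shell k) s) summable_on cluster_points X M"
  shows "regular_at s0 (\<lambda>s. infsum (\<lambda>k. ser (shell k) s) (cluster_points X M))"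
proof (cases "cluster_points X M = {}")
  case True
  then show ?thesis by (simp add: regular_at_holomorphic)
next
  case False
  let ?w = "zeta_weight CARD('p) C"
  let ?K = "supp f" and ?S = "cluster_points X M" and ?e = "axis i 1 :: nat ^ 3"
  note c = clusterD[OF cl]
  have CK: "C \<in> ?K" using c(2,4) by (auto simp: rays_def minface_def)
  have closed: "k + r \<in> ?S" if k: "k \<in> ?S" and r: "r \<in> M" for k r
  proof -
    obtain v t where v: "\<forall>l. 1 \<le> k $ l" "v \<in> X" "t > 0" "ep k - t *\<^sub>R ep v \<in> ncone (X \<union> M)" using k by (auto simp: cluster_points_def)
    have "(ep k - t *\<^sub>R ep v) + ep r \<in> ncone (X \<union> M)" by (rule ncone_add[OF v(4) ncone_mem]) (use c r in auto)
    moreover have "(ep k - t *\<^sub>R ep v) + ep r = ep (k + r) - t *\<^sub>R ep v" by (simp add: exponent_point_add)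
    moreover have "\<forall>l. 1 \<le> (k + r) $ l" using v(1) by (simp add: trans_le_add1)
    ultimately show ?thesis using v(2,3) unfolding cluster_points_def by auto
  qed
  have closed': "k + t *s ?e \<in> ?S" if "k \<in> ?S" for k t
  proof (induction t)
    case 0
    then show ?case using that by (simp add: vec_eq_iff)
  next
    case (Suc t)
    have "k + Suc t *s ?e = (k + t *s ?e) + ?e" by (simp add: vec_eq_iff)
    then show ?case using closed[OF Suc c(8)] by simp
  qed
  have inM: "ep k \<in> ncone M" if k: "k \<in> ?S" for k
  proof -
    obtain v t where v: "v \<in> X" "t > 0" "ep k - t *\<^sub>R ep v \<in> ncone (X \<union> M)" using k by (auto simp: cluster_points_def)
    have "x \<in> ncone M" if "x \<in> ncone (X \<union> M)" for x
      using that
    proof (rule ncone_induct)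
      show "finite (X \<union> M)" using c by simp
      show "t *\<^sub>R ep r \<in> ncone M" if "r \<in> X \<union> M" "0 \<le> t" for t r
        by (rule ncone_scale[OF _ that(2)]) (use that(1) c(10) ncone_mem[OF c(6)] in blast)
    qed (auto intro: ncone_zero ncone_add)
    then have "(ep k - t *\<^sub>R ep v) + t *\<^sub>R ep v \<in> ncone M" using v c(10) by (intro ncone_add ncone_scale) auto
    then show ?thesis by simp
  qed
  \<comment> \<open>Equality would force \<open>\<omega>\<close> into the facet of some
    \<open>v\<close> in \<open>X\<close>, hence to be a proper translate of \<open>C\<close> along
    an axis; since \<open>k\<close> has positive coordinates such a translate is strictly
    larger.\<close>
  have dom: "dotn C k < dotn \<omega> k" if k: "k \<in> ?S" and w: "\<omega> \<in> ?K" "1 \<le> \<omega> $ i" "\<omega> \<noteq> C" for k \<omega>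
  proof (rule ccontr)
    assume "\<not> dotn C k < dotn \<omega> k"
    then have le: "(ep \<omega> - ep C) \<bullet> ep k \<le> 0" unfolding inner_diff_left inner_ep by linarith
    obtain v t where v: "v \<in> X" "t > 0" "ep k - t *\<^sub>R ep v \<in> ncone (X \<union> M)" "\<forall>l. 1 \<le> k $ l" using k by (auto simp: cluster_points_def)
    have ray: "0 \<le> (ep \<omega> - ep C) \<bullet> ep r" if "r \<in> rays ?K C" for r
      using dconeD(3)[OF rays_dcone[OF that] w(1)] by (simp add: inner_diff_left)
    have nn: "0 \<le> (ep \<omega> - ep C) \<bullet> ep r" if "r \<in> X \<union> M" for r
    proof (cases "r = ?e")
      case True
      then show ?thesis using w(2) c(5) by simp
    next
      case False
      then show ?thesis using ray that c(4,9) by blast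
    qed
    have "(- (ep \<omega> - ep C)) \<bullet> (ep k - t *\<^sub>R ep v) \<le> 0"
    proof (rule ncone_nonpos[OF v(3), of "(\<bullet>) (- (ep \<omega> - ep C))"])
      show "(- (ep \<omega> - ep C)) \<bullet> ep r \<le> 0" if "r \<in> X \<union> M" for r
        using nn[OF that] by (simp only: inner_minus_left neg_le_0_iff_le)
    qed (use c(1,6) bounded_linear.linear[OF bounded_linear_inner_right] in auto)
    then have "t * ((ep \<omega> - ep C) \<bullet> ep v) \<le> 0" using le by (simp add: inner_diff_right inner_minus_left del: minus_diff_eq)
    then have "(ep \<omega> - ep C) \<bullet> ep v = 0" using v(2) nn[of v] v(1) by (simp add: mult_le_0_iff)
    then have "\<omega> \<in> minface ?K (ep v)"
      using w(1) minface_eq[of C ?K "ep v"] v(1) c(4) by (auto simp: rays_def inner_diff_left)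
    then obtain j s where s: "0 \<le> s" "ep \<omega> = ep C + s *\<^sub>R axis j 1" using c(11)[OF v(1) _ w(2)] by blast
    have "s \<noteq> 0" using s w(3) by (auto simp: exponent_point_inject)
    then have "0 < s * real (k $ j)" using s v(4) by (simp add: Suc_le_eq)
    then show False using le unfolding s(2) by simp
  qed
  \<comment> \<open>The starting points of the half lines in direction \<open>e_i\<close>. At them
    \<open>C\<close> is minimal, although it need not be further along the half line.\<close>
  define B where "B = {k\<in>?S. \<not> (\<exists>k'\<in>?S. k = k' + ?e)}"
  have BC: "C \<in> minface ?K (ep k)" if "k \<in> B" for k using c(12) that by (auto simp: B_def)
  have base: "\<exists>k0\<in>B. \<exists>t. k = k0 + t *s ?e" if "k \<in> ?S" for k
    using that
  proof (induction "k $ i" arbitrary: k rule: less_induct)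
    case less
    show ?case
    proof (cases "k \<in> B")
      case True
      then show ?thesis by (intro bexI[of _ k] exI[of _ 0]) (simp_all add: vec_eq_iff)
    next
      case False
      then obtain k' where k': "k' \<in> ?S" "k = k' + ?e" using less.prems by (auto simp: B_def)
      then obtain k0 t where "k0 \<in> B" "k' = k0 + t *s ?e" using less.hyps[of k'] by (auto simp: axis_def)
      then show ?thesis using k'(2) by (intro bexI[of _ k0] exI[of _ "Suc t"]) (simp_all add: vec_eq_iff)
    qed
  qed
  have inj: "inj_on (\<lambda>(k0, t). k0 + t *s ?e) (B \<times> UNIV)"
  proof -
    have no: False if k: "k0 \<in> B" "k1 \<in> B" "k0 + t *s ?e = k1 + u *s ?e" "t < u" for k0 k1 t u
    proof -
      have "k0 = (k1 + (u - t - 1) *s ?e) + ?e"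
      proof -
        have "k0 $ l = ((k1 + (u - t - 1) *s ?e) + ?e) $ l" for l
          using arg_cong[OF k(3), of "\<lambda>z. z $ l"] k(4) by (cases "l = i") (auto simp: axis_def)
        then show ?thesis by (rule vec_eq_iff[THEN iffD2, OF allI])
      qed
      moreover have "k1 + (u - t - 1) *s ?e \<in> ?S" using closed' k(2) by (simp add: B_def)
      ultimately show False using k(1) unfolding B_def by blast
    qed
    show ?thesis
    proof (rule inj_onI, clarify)
      fix k0 t k1 u assume k: "k0 \<in> B" "k1 \<in> B" "k0 + t *s ?e = k1 + u *s ?e"
      have "t = u" using no[OF k] no[OF k(2,1) k(3)[symmetric]] by (metis linorder_less_linear)
      then show "k0 = k1 \<and> t = u" using k(3) by simp
    qed
  qed
  have img: "(\<lambda>(k0, t). k0 + t *s ?e) ` (B \<times> UNIV) = ?S"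
  proof (intro equalityI subsetI)
    fix k assume "k \<in> ?S"
    then show "k \<in> (\<lambda>(k0, t). k0 + t *s ?e) ` (B \<times> UNIV)" using base[of k] by force
  qed (use closed' B_def in auto)
  have fib: "infsum F ?S = infsum (\<lambda>k0. infsum (\<lambda>t. F (k0 + t *s ?e)) UNIV) B" if F: "F summable_on ?S" for F :: "nat ^ 3 \<Rightarrow> complex"
  proof -
    have "infsum F ?S = infsum (F \<circ> (\<lambda>(k0, t). k0 + t *s ?e)) (B \<times> UNIV)"
      unfolding img[symmetric] by (rule infsum_reindex[OF inj])
    also have "\<dots> = infsum (\<lambda>(k0, t). F (k0 + t *s ?e)) (B \<times> UNIV)" by (rule infsum_cong) auto
    also have "\<dots> = infsum (\<lambda>k0. infsum (\<lambda>t. F (k0 + t *s ?e)) UNIV) B"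
    proof (rule infsum_Sigma'_banach[symmetric])
      have "(F \<circ> (\<lambda>(k0, t). k0 + t *s ?e)) summable_on (B \<times> UNIV)"
        using F unfolding img[symmetric] by (simp only: summable_on_reindex[OF inj])
      then show "(\<lambda>(k0, t). F (k0 + t *s ?e)) summable_on (SIGMA k0:B. UNIV)" by (simp add: o_def case_prod_unfold)
    qed
    finally show ?thesis .
  qed
  have unit: "padic_norm (Poly_Mapping.lookup f C) = 1"
  proof -
    obtain k where k: "k \<in> B" using False base by blast
    then have kS: "k \<in> ?S" and k1: "\<And>l. 1 \<le> k $ l" by (auto simp: B_def cluster_points_def)
    define b where "b = (\<Sum>\<omega>\<in>?K. \<omega> $ i)"
    have wb: "\<omega> $ i \<le> b" if "\<omega> \<in> ?K" for \<omega> unfolding b_def by (rule member_le_sum) (use that in auto)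
    \<comment> \<open>Lowering the \<open>i\<close>-th coordinate by \<open>e\<close> breaks the
      ties with exponents of height 0 in favour of \<open>C\<close>. The bound \<open>b\<close> on
      the heights keeps the loss for the others below 1, the integral gap by which \<open>C\<close>
      dominates them.\<close>
    define e where "e = 1 / (2 + real b)"
    define x where "x = ep k - e *\<^sub>R axis i 1"
    have e: "0 < e" "e < 1" by (auto simp: e_def)
    show ?thesis
    proof (rule nondegenerate_unit[OF integral nd, of x])
      have k1': "1 \<le> real (k $ l)" for l using k1[of l] by linarith
      show "0 < x $ l" for l using k1'[of l] e by (auto simp: x_def axis_def)
      have lt: "0 < (ep \<omega> - ep C) \<bullet> x" if w: "\<omega> \<in> ?K" "\<omega> \<noteq> C" for \<omega>
      proof -
        have xx: "(ep \<omega> - ep C) \<bullet> x = (ep \<omega> - ep C) \<bullet> ep k - e * (real (\<omega> $ i) - 1)"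
          using c(5) by (simp add: x_def inner_diff_right)
        show ?thesis
        proof (cases "\<omega> $ i = 0")
          case True
          have "0 \<le> (ep \<omega> - ep C) \<bullet> ep k" using BC[OF k] w(1) by (simp add: minface_def inner_diff_left)
          then show ?thesis unfolding xx True using e by simp
        next
          case False
          then have "dotn C k < dotn \<omega> k" using dom[OF kS w(1) _ w(2)] by simp
          then have "1 \<le> (ep \<omega> - ep C) \<bullet> ep k" unfolding inner_diff_left inner_ep by linarith
          moreover have "e * (real (\<omega> $ i) - 1) < 1" using wb[OF w(1)] by (simp add: e_def field_simps)
          ultimately show ?thesis unfolding xx by linarith
        qed
      qed
      then have "ep C \<bullet> x < ep \<omega> \<bullet> x" if "\<omega> \<in> ?K" "\<omega> \<noteq> C" for \<omega> using that by (force simp: inner_diff_left)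
      then show "minface ?K x = {C}" using CK unfolding minface_def
        by (intro equalityI subsetI) (force simp: not_le order_less_imp_le)+
    qed
  qed
  \<comment> \<open>The two summands differ at single points; they are exchanged only after
    summation along each half line.\<close>
  have eq: "infsum (\<lambda>k. ser (shell k) s) ?S = of_real kappa * infsum (\<lambda>k. ?w k s) ?S" if s: "Re s > 0" for s
  proof -
    have zs: "(\<lambda>k. ?w k s) summable_on ?S"
      by (rule abs_summable_summable) (rule norm_zeta_weight_summable[OF card_ge_2], use s in simp)
    have "infsum (\<lambda>k. ser (shell k) s) ?S = infsum (\<lambda>k0. infsum (\<lambda>t. ser (shell (k0 + t *s ?e)) s) UNIV) B"
      by (rule fib[OF sm[OF s]])
    also have "\<dots> = infsum (\<lambda>k0. infsum (\<lambda>t. of_real kappa * ?w (k0 + t *s ?e) s) UNIV) B"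
    proof (rule infsum_cong)
      fix k0 assume k0: "k0 \<in> B"
      then have "k0 \<in> ?S" by (simp add: B_def)
      then show "infsum (\<lambda>t. ser (shell (k0 + t *s ?e)) s) UNIV = infsum (\<lambda>t. of_real kappa * ?w (k0 + t *s ?e) s) UNIV"
        by (intro infsum_ser_fibre[OF CK c(5) unit _ _ s] dom dotn_minface(2)[OF BC[OF k0]])
    qed
    also have "\<dots> = infsum (\<lambda>k. of_real kappa * ?w k s) ?S"
      by (rule fib[symmetric]) (rule summable_on_cmult_right[OF zs])
    also have "\<dots> = of_real kappa * infsum (\<lambda>k. ?w k s) ?S" by (rule infsum_cmult_right')
    finally show ?thesis .
  qed
  have "?w r s0 \<noteq> 1" if "r \<in> M" for r
  proof (cases "r = ?e")
    case True
    then show ?thesis using zeta_weight_axis_neq_1[OF card_ge_2[where 'p='p], of s0 C i] c(5) s0 by simp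
  next
    case False
    then show ?thesis using good that c(7,9) by blast
  qed
  then have "regular_at s0 (\<lambda>s. infsum (\<lambda>k. ?w k s) ?S)"
    by (intro regular_at_cone_series[OF card_ge_2 c(6)]) (use closed inM in auto)
  then have "regular_at s0 (\<lambda>s. of_real kappa * infsum (\<lambda>k. ?w k s) ?S)"
    by (rule regular_at_mult[OF regular_at_holomorphic[OF holomorphic_on_const]])
  then show ?thesis by (rule regular_at_cong[rotated]) (rule eq)
qed

end

lemma bad_contributes:
  fixes f :: "('p::prime_card padic, 'n::finite) multipoly"
  assumes v: "v \<in> prim_rays (supp f)" and P: "P \<in> minface (supp f) (ep v)" and z: "zeta_weight CARD('p) P v s0 = 1"
  shows "contributes f (newton_tau f (ep v)) s0"
proof -
  have ray: "is_ray (supp f) (ep v)" and gcd: "Gcd (range (\<lambda>i. v $ i)) = 1" using v by (auto simp: prim_rays_def)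
  have d: "ep v \<in> dcone (supp f) P" using P by (simp add: dcone_def)
  have "v \<noteq> 0"
  proof
    assume "v = 0"
    then have "ep v = 0" by (simp add: vec_eq_iff)
    then show False using ray by (simp add: is_ray_def)
  qed
  then have "primitive_normal (newton_tau f (ep v)) v"
    unfolding primitive_normal_def using gcd by (auto simp: newton_tau_eq[OF d] inner_diff_right)
  moreover have "newton_m f (ep v) = real (dotn P v)" unfolding newton_m_eq[OF d] by (simp add: inner_vec_def)
  moreover have "newton_sigma (ep v) = real (\<Sum>i\<in>UNIV. v $ i)" by (simp add: newton_sigma_def)
  moreover have "of_nat CARD('p) powr (of_real (real (\<Sum>i\<in>UNIV. v $ i)) + of_real (real (dotn P v)) * s0) = 1"
  proof -
    have "Ln (of_nat CARD('p)) = complex_of_real (ln (real CARD('p)))"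
      using Ln_of_real[of "real CARD('p)"] by (simp add: zero_less_card_finite)
    then have "of_nat CARD('p) powr (of_real (real (\<Sum>i\<in>UNIV. v $ i)) + of_real (real (dotn P v)) * s0)
        = inverse (zeta_weight CARD('p) P v s0)"
      by (simp add: powr_def zeta_weight_def exp_minus[symmetric] mult.commute)
    then show ?thesis using z by simp
  qed
  ultimately show ?thesis unfolding contributes_def using ray_facet[OF ray P] by (metis (no_types))
qed

text \<open>In the second alternative of \<open>share\<close> the translate of the common vertex by
  a unit step in the common direction of recession is the other point.\<close>

lemma share_two_points:
  fixes f :: "('a::zero, 3) multipoly"
  assumes sh: "share (supp f) v w"
  shows "\<not> (\<exists>x. newton_tau f (ep v) \<inter> newton_tau f (ep w) \<subseteq> {x})"
proof -
  have T: "ep A \<in> newton_tau f (ep u) \<and> ep u \<in> dcone (supp f) A" if "A \<in> minface (supp f) (ep u)" for A u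
  proof -
    have "ep u \<in> dcone (supp f) A" using that by (simp add: dcone_def)
    then show ?thesis using ep_in_tau_iff[of "ep u" f A A] that by (simp add: minface_def)
  qed
  have "\<exists>a b. a \<noteq> b \<and> {a, b} \<subseteq> newton_tau f (ep v) \<inter> newton_tau f (ep w)"
    using sh unfolding share_def
  proof
    assume "\<exists>A B. A \<noteq> B \<and> {A, B} \<subseteq> minface (supp f) (ep v) \<inter> minface (supp f) (ep w)"
    then obtain A B where "A \<noteq> B" "{A, B} \<subseteq> minface (supp f) (ep v) \<inter> minface (supp f) (ep w)" by blast
    then show ?thesis using T by (intro exI[of _ "ep A"] exI[of _ "ep B"]) (auto simp: exponent_point_inject)
  next
    assume "\<exists>A j. A \<in> minface (supp f) (ep v) \<inter> minface (supp f) (ep w) \<and> v $ j = 0 \<and> w $ j = 0"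
    then obtain A j where A: "A \<in> minface (supp f) (ep v)" "A \<in> minface (supp f) (ep w)" "v $ j = 0" "w $ j = 0" by blast
    have up: "ep A + 1 *\<^sub>R axis j 1 \<in> newton_tau f (ep u)" if "A \<in> minface (supp f) (ep u)" "u $ j = 0" for u
      by (rule newton_tau_up[of "ep u" f A]) (use T[OF that(1)] that(2) in auto)
    have "ep A + 1 *\<^sub>R axis j 1 \<in> newton_tau f (ep v) \<inter> newton_tau f (ep w)" using up A by blast
    moreover have "ep A \<noteq> ep A + 1 *\<^sub>R axis j 1" by (simp add: axis_eq_0_iff)
    ultimately show ?thesis using T[OF A(1)] T[OF A(2)] by blast
  qed
  then show ?thesis by blast
qed

theorem theorem0p40:
  fixes f :: "('p::prime_card padic, 3) multipoly"
    and \<mu> :: "('p padic ^ 3) measure"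
    and Z :: "complex \<Rightarrow> complex"
    and s0 :: complex
  assumes "\<And>\<omega>. Poly_Mapping.lookup f \<omega> \<in> padic_integers"
    and "f \<noteq> 0"
    and "multipoly_eval f 0 = 0"
    and "nondegenerate f"
    and "haar_measure_normalized \<mu>"
    and "igusa_zeta_continuation \<mu> f Z"
    and "candidate_pole f s0"
    and "Re s0 \<noteq> -1"
    and "\<And>\<tau>. contributes f \<tau> s0 \<Longrightarrow> \<exists>i. B1_facet f i \<tau>"
    and "\<And>\<tau> \<tau>'. contributes f \<tau> s0 \<Longrightarrow> contributes f \<tau>' s0 \<Longrightarrow>
           (\<exists>i. B1_facet f i \<tau> \<and> B1_facet f i \<tau>') \<or> (\<exists>x. \<tau> \<inter> \<tau>' \<subseteq> {x})"
  shows "\<not> is_pole Z s0"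
proof -
  interpret haar_poly_3 \<mu> f by unfold_locales (use assms(1,5) in auto)
  note nd = assms(4) and s0 = assms(8) and p2 = card_ge_2[where 'p='p]
  define K where "K = supp f"
  have K: "finite K" "K \<noteq> {}" using assms(2) by (simp_all add: K_def)
  \<comment> \<open>The choice of \<open>P\<close> is immaterial, since all exponents of the minimal
    face pair equally with \<open>v\<close>.\<close>
  define Bad where "Bad = {v \<in> prim_rays K. \<exists>P\<in>minface K (ep v). zeta_weight CARD('p) P v s0 = 1}"
  have Bad: "Bad \<subseteq> prim_rays K" by (auto simp: Bad_def)
  have con: "contributes f (newton_tau f (ep v)) s0" if "v \<in> Bad" for v
    using bad_contributes that unfolding Bad_def K_def by blast
  have B1_normal: "\<exists>E D C. B1_normal K i v E D C" if v: "v \<in> Bad" and "B1_facet f i (newton_tau f (ep v))" for v i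
    using B1_normal_exists[of v f _ i] that unfolding Bad_def K_def by blast
  have wt: "zeta_weight CARD('p) C u s0 = 1 \<longleftrightarrow> u \<in> Bad" if "u \<in> rays K C" for u C
  proof -
    have C: "u \<in> prim_rays K" "C \<in> minface K (ep u)" using that by (auto simp: rays_def)
    show ?thesis
    proof
      assume "u \<in> Bad"
      then obtain P where "P \<in> minface K (ep u)" "zeta_weight CARD('p) P u s0 = 1" by (auto simp: Bad_def)
      then show "zeta_weight CARD('p) C u s0 = 1" using zeta_weight_minface[OF C(2)] by metis
    qed (use C in \<open>auto simp: Bad_def\<close>)
  qed
  obtain \<X> where X: "finite \<X>" "\<Union>\<X> = Bad" "\<And>X Y. X \<in> \<X> \<Longrightarrow> Y \<in> \<X> \<Longrightarrow> X \<noteq> Y \<Longrightarrow> X \<inter> Y = {}"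
    "\<And>X. X \<in> \<X> \<Longrightarrow> \<exists>i C M. cluster K Bad X i C M"
  proof (rule clusters_exist[OF K(1) Bad])
    show "\<exists>i E D C. B1_normal K i v E D C" if "v \<in> Bad" for v using assms(9)[OF con[OF that]] B1_normal[OF that] by blast
    show "\<exists>i E D C E' D' C'. B1_normal K i v E D C \<and> B1_normal K i w E' D' C'" if vw: "v \<in> Bad" "w \<in> Bad" "share K v w" for v w
    proof -
      obtain i where "B1_facet f i (newton_tau f (ep v))" "B1_facet f i (newton_tau f (ep w))"
        using assms(10)[OF con[OF vw(1)] con[OF vw(2)]] share_two_points[of f v w] vw(3) unfolding K_def by blast
      then have "\<exists>E D C. B1_normal K i v E D C" "\<exists>E D C. B1_normal K i w E D C" using B1_normal vw(1,2) by blast+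
      then show ?thesis by blast
    qed
    show "u = v \<or> u = x \<or> v = x" if C: "C $ i = 1" and uvx: "{u, v, x} \<subseteq> Bad \<inter> rays K C" for C i u v x
      using bad_rays_le_2[OF p2 C s0, of u K v x] uvx wt by auto
    \<comment> \<open>A coordinate facet that contains an exponent of height 0 has m = 0, and its
      weight is 1/p independently of \<open>s0\<close>.\<close>
    show "axis i 1 \<notin> Bad" if w: "\<omega> \<in> K" "\<omega> $ i = 0" for i \<omega>
    proof -
      have "axis i 1 \<in> rays K \<omega>" by (rule axis_ray[OF w])
      moreover have "zeta_weight CARD('p) \<omega> (axis i 1) s0 \<noteq> 1" by (rule zeta_weight_axis_neq_1[OF p2]) (use w in simp)
      ultimately show ?thesis using wt by blast
    qed
  qed blast
  obtain i C M where cl: "\<And>X. X \<in> \<X> \<Longrightarrow> cluster K Bad X (i X) (C X) (M X)" using X(4) by metis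
  define G where "G \<phi> = {g \<in> prim_rays K - Bad. \<phi> \<subseteq> minface K (ep g)}" for \<phi>
  \<comment> \<open>Sorting the remaining points by their minimal face makes these cells disjoint by
    construction; together with the cluster regions they partition the positive lattice
    points.\<close>
  define T where "T \<phi> = {k. (\<forall>l. 1 \<le> k $ l) \<and> minface K (ep k) = \<phi> \<and> ep k \<in> ncone (G \<phi>)}" for \<phi>
  define S where "S X = cluster_points X (M X)" for X
  let ?U = "{k :: nat ^ 3. \<forall>i. 1 \<le> k $ i}"
  have SU: "(\<Union>X\<in>\<X>. S X) \<subseteq> ?U" and TU: "(\<Union>\<phi>\<in>Pow K. T \<phi>) \<subseteq> ?U" by (auto simp: S_def T_def cluster_points_def)
  have U: "?U = (\<Union>\<phi>\<in>Pow K. T \<phi>) \<union> (\<Union>X\<in>\<X>. S X)"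
  proof (intro equalityI subsetI)
    fix k :: "nat ^ 3" assume k: "k \<in> ?U"
    show "k \<in> (\<Union>\<phi>\<in>Pow K. T \<phi>) \<union> (\<Union>X\<in>\<X>. S X)"
    proof (cases "k \<in> (\<Union>X\<in>\<X>. S X)")
      case False
      have "ep k \<in> ncone (G (minface K (ep k)))"
        unfolding G_def by (rule good_cone_or_cluster[OF K Bad X(2) cl]) (use k False in \<open>auto simp: S_def\<close>)
      then have "k \<in> T (minface K (ep k))" using k by (simp add: T_def)
      moreover have "minface K (ep k) \<in> Pow K" by (auto simp: minface_def)
      ultimately show ?thesis by blast
    qed simp
  qed (use SU TU in blast)
  have disj: "(\<Union>\<phi>\<in>Pow K. T \<phi>) \<inter> (\<Union>X\<in>\<X>. S X) = {}"
  proof -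
    have "k \<notin> T \<phi>" if "X \<in> \<X>" "k \<in> S X" for X k \<phi>
      using cluster_disjoint_good[OF K(1) cl[OF that(1)], of k] that(2) by (auto simp: S_def T_def G_def)
    then show ?thesis by blast
  qed
  have sm: "(\<lambda>k. ser (shell k) s) summable_on A" if "Re s > 0" "A \<subseteq> ?U" for s A
    by (rule summable_on_subset_banach[OF igusa_zeta_eq_infsum(2)[OF that(1)] that(2)])
  have regT: "regular_at s0 (\<lambda>s. infsum (\<lambda>k. ser (shell k) s) (\<Union>\<phi>\<in>Pow K. T \<phi>))"
  proof (rule regular_at_UN)
    show "finite (Pow K)" using K by simp
    show "T \<phi> \<inter> T \<psi> = {}" if "\<phi> \<noteq> \<psi>" for \<phi> \<psi> using that by (auto simp: T_def)
    show "(\<lambda>k. ser (shell k) s) summable_on (\<Union>\<phi>\<in>Pow K. T \<phi>)" if "Re s > 0" for s by (rule sm[OF that TU])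
    show "regular_at s0 (\<lambda>s. infsum (\<lambda>k. ser (shell k) s) (T \<phi>))" if "\<phi> \<in> Pow K" for \<phi>
    proof (cases "\<phi> = {}")
      case True
      have "T \<phi> = {}" using minface_nonempty[OF K] True unfolding T_def by blast
      then show ?thesis by (simp add: regular_at_holomorphic)
    next
      case False
      then obtain P where P: "P \<in> \<phi>" by blast
      have "regular_at s0 (\<lambda>s. infsum (\<lambda>k. ser (shell k) s)
          {k. (\<forall>l. 1 \<le> k $ l) \<and> minface (supp f) (ep k) = \<phi> \<and> ep k \<in> ncone (G \<phi>)})"
      proof (rule good_cell_regular[OF nd s0 P])
        show "finite (G \<phi>)" using finite_prim_rays[OF K(1)] by (simp add: G_def)
        show "\<phi> \<subseteq> minface (supp f) (ep g) \<and> zeta_weight CARD('p) P g s0 \<noteq> 1" if g: "g \<in> G \<phi>" for g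
          using g P wt[of g P] by (auto simp: G_def K_def rays_def)
      qed
      then show ?thesis by (simp add: T_def K_def)
    qed
  qed
  have regS: "regular_at s0 (\<lambda>s. infsum (\<lambda>k. ser (shell k) s) (\<Union>X\<in>\<X>. S X))"
  proof (rule regular_at_UN[OF X(1)])
    show "S X \<inter> S Y = {}" if XY: "X \<in> \<X>" "Y \<in> \<X>" "X \<noteq> Y" for X Y
      unfolding S_def by (rule clusters_disjoint[OF K(1) cl[OF XY(1)] cl[OF XY(2)] X(3)[OF XY]])
    show "(\<lambda>k. ser (shell k) s) summable_on (\<Union>X\<in>\<X>. S X)" if "Re s > 0" for s by (rule sm[OF that SU])
    show "regular_at s0 (\<lambda>s. infsum (\<lambda>k. ser (shell k) s) (S X))" if XX: "X \<in> \<X>" for X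
      unfolding S_def
    proof (rule cluster_regular[OF nd s0 cl[OF XX, unfolded K_def]])
      show "zeta_weight CARD('p) (C X) r s0 \<noteq> 1" if "r \<in> rays (supp f) (C X)" "r \<notin> Bad" for r
        using wt[of r "C X"] that by (simp add: K_def)
      show "(\<lambda>k. ser (shell k) s) summable_on cluster_points X (M X)" if "Re s > 0" for s
        by (rule sm[OF that]) (auto simp: cluster_points_def)
    qed
  qed
  have reg: "regular_at s0 (\<lambda>s. infsum (\<lambda>k. ser (shell k) s) (\<Union>\<phi>\<in>Pow K. T \<phi>) + infsum (\<lambda>k. ser (shell k) s) (\<Union>X\<in>\<X>. S X))"
    by (rule regular_at_add[OF regT regS])
  have Z: "Z meromorphic_on UNIV" "\<And>s. Re s > 0 \<Longrightarrow> Z s = igusa_zeta \<mu> f s"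
    using assms(6) by (auto simp: igusa_zeta_continuation_def)
  show ?thesis
  proof (rule regular_at_imp_not_pole[OF Z(1) reg])
    fix s :: complex assume s: "Re s > 0"
    have "Z s = infsum (\<lambda>k. ser (shell k) s) ?U" using Z(2)[OF s] igusa_zeta_eq_infsum(1)[OF s] by simp
    also have "\<dots> = infsum (\<lambda>k. ser (shell k) s) (\<Union>\<phi>\<in>Pow K. T \<phi>) + infsum (\<lambda>k. ser (shell k) s) (\<Union>X\<in>\<X>. S X)"
      unfolding U by (rule infsum_Un_disjoint[OF sm[OF s TU] sm[OF s SU] disj])
    finally show "Z s = infsum (\<lambda>k. ser (shell k) s) (\<Union>\<phi>\<in>Pow K. T \<phi>) + infsum (\<lambda>k. ser (shell k) s) (\<Union>X\<in>\<X>. S X)" .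
  qed
qed

end
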